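(* For $n\ge2$, the algebra $ZUR(n)$ is isomorphic to $U_q(\widehat{\mathfrak{gl}}(n))$.
   Context: **The algebra $U_q(\widehat{\mathfrak{gl}}(n))$.** Let $q$ be a formal variable and $E_{ij}$ the matrix units of $\mathrm{End}(\mathbb{C}^n)$. Set $$R(z)=\sum_{i}E_{ii}\otimes E_{ii}+\sum_{i\ne j}\frac{z-1}{q^{-1}z-q}E_{ii}\otimes E_{jj}+\sum_{i>j}\frac{q^{-1}-q}{zq^{-1}-q}E_{ij}\otimes E_{ji}+\sum_{i<j}\frac{z(q^{-1}-q)}{zq^{-1}-q}E_{ij}\otimes E_{ji}.$$ $U_q(\widehat{\mathfrak{gl}}(n))$ is the associative unital algebra over $\mathbb{C}(q)$ generated by an invertible central element $q^{c/2}$ and by elements $l^{\pm}_{ij}[\pm m]$ ($m\ge 1$, $1\le i,j\le n$), $l^+_{ij}[0]$ and $l^-_{ji}[0]$ ($1\le j\le i\le n$). Put $l^+_{ij}[0]=l^-_{ji}[0]=0$ for $1\le i<j\le n$, $l^{\pm}_{ij}(z)=\sum_{m\ge0}l^{\pm}_{ij}[\pm m]z^{\pm m}$, $L^{\pm}(z)=(l^{\pm}_{ij}(z))_{i,j=1}^n$. With $z_{\pm}=zq^{\pm c/2}$ (similarly $w_\pm$) and $L_1=L\otimes 1$, $L_2=1\otimes L$, the defining relations are $l^+_{ii}[0]l^-_{ii}[0]=l^-_{ii}[0]l^+_{ii}[0]=1$ and $$R(z/w)L^{\pm}_1(z)L^{\pm}_2(w)=L^{\pm}_2(w)L^{\pm}_1(z)R(z/w),$$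 $$R(z_-/w_+)L^+_1(z)L^-_2(w)=L^-_2(w)L^+_1(z)R(z_+/w_-),$$ where in the last relation the $R$-matrices are expanded in powers of $z/w$ (in the first one may expand in $z/w$ or in $w/z$). **The algebra $ZUR(n)$.** Let $V'=\mathbb{C}^{n-1}$ be the span of $e_1,\dots,e_{n-1}$ and let $\bar R(z)$ be the restriction of $R(z)$ to $V'\otimes V'$. $ZUR(n)$ is the associative unital algebra over $\mathbb{C}(q)$ generated by an invertible central element $q^{c/2}$ and by the coefficients of: a row $E(z)=(E_a(z))_{a=1}^{n-1}$ (associated with $V'^*$) and a column $F(z)=(F_a(z))_{a=1}^{n-1}$ (associated with $V'$), formal Laurent series in $z$ infinite in both directions; $(n-1)\times(n-1)$ matrices $K^{\pm}(z)=\sum_{m\ge0}K^{\pm}[\pm m]z^{\pm m}$ (associated with $V'\otimes V'^*$); and scalar series $k^{\pm}(z)=\sum_{m\ge0}k^{\pm}[\pm m]z^{\pm m}$. Here $K^+[0]$ is lower triangular, $K^-[0]$ is upper triangular, $K^+_{ii}[0]K^-_{ii}[0]=K^-_{ii}[0]K^+_{ii}[0]=1$ and $k^+[0]k^-[0]=k^-[0]k^+[0]=1$ (so $K^\pm(z)$, $k^\pm(z)$ are invertible). The defining commutation relations are (upper signs together, lower signs together): $$\bar R(z/w)K_1^{\pm}(z)K_2^{\pm}(w)=K_2^{\pm}(w)K_1^{\pm}(z)\bar R(z/w),$$ $$\bar R(z_-/w_+)K_1^+(z)K_2^-(w)=K_2^-(w)K_1^+(z)\bar R(z_+/w_-),$$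 $$k^{\pm}(z)k^{\pm}(w)=k^{\pm}(w)k^{\pm}(z),\qquad k^+(z)k^-(w)=k^-(w)k^+(z),\qquad K^{\pm}(z)k^{\pm}(w)=k^{\pm}(w)K^{\pm}(z),$$ $$\frac{z_{\mp}q^{-1}-w_{\pm}q}{z_{\mp}-w_{\pm}}\,k^{\mp}(w)K^{\pm}(z)=K^{\pm}(z)k^{\mp}(w)\,\frac{z_{\pm}q^{-1}-w_{\mp}q}{z_{\pm}-w_{\mp}},$$ $$K_1^{\pm}(z)E_2(w)=\frac{zq^{\mp\frac c2-1}-wq}{zq^{\mp\frac c2}-w}\,E_2(w)\,\bar R(zq^{\mp\frac c2}/w)\,K_1^{\pm}(z),$$ $$K_1^{\pm}(z)\,\bar R(zq^{\pm\frac c2}/w)\,F_2(w)=\frac{zq^{\pm\frac c2}-w}{zq^{\pm\frac c2-1}-wq}\,F_2(w)K_1^{\pm}(z),$$ $$k^{\pm}(z)E(w)=\frac{zq^{\mp\frac c2+1}-wq^{-1}}{zq^{\mp\frac c2}-w}\,E(w)k^{\pm}(z),\qquad k^{\pm}(z)F(w)=\frac{zq^{\pm\frac c2}-w}{zq^{\pm\frac c2+1}-wq^{-1}}\,F(w)k^{\pm}(z),$$ $$(z-wq^2)\,E_1(z)E_2(w)\bar R(z/w)=(zq^2-w)\,E_2(w)E_1(z),$$ $$(zq^2-w)\,F_1(z)F_2(w)=(z-wq^2)\,\bar R(z/w)F_2(w)F_1(z),$$ $$E_2(z)F_1(w)-F_1(w)E_2(z)=(q-q^{-1})\Big(\delta\big(\tfrac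 wz q^{c}\big)k^-(wq^{\frac c2})K^-(wq^{\frac c2})^{-1}-\delta\big(\tfrac wz q^{-c}\big)k^+(wq^{-\frac c2})K^+(wq^{-\frac c2})^{-1}\Big).$$ Conventions: $\delta(x)=\sum_{m\in\mathbb{Z}}x^m$. Subscripts $1,2$ indicate the tensor factor of $V'\otimes V'$ on which a matrix, row ($E$) or column ($F$) acts, the order of algebra elements being as written; e.g. $E_1(z)E_2(w)$ is the row with $(a,b)$ entry $E_a(z)E_b(w)$, $E_2(w)E_1(z)$ is the row with $(a,b)$ entry $E_b(w)E_a(z)$, $F_1(z)F_2(w)$ and $F_2(w)F_1(z)$ are the columns with $(a,b)$ entries $F_a(z)F_b(w)$ and $F_b(w)F_a(z)$, and in the last relation the $(a,b)$ matrix entry of $E_2(z)F_1(w)-F_1(w)E_2(z)$ is $E_b(z)F_a(w)-F_a(w)E_b(z)$. Products of $k^\pm$ with $K^\pm,E,F$ are entrywise. Rational functions in a relation between $K^+(z)$ or $k^+(z)$ and $E(w)$, $F(w)$, or between $K^+(z)$ and $K^-(w)$ or $k^-(w)$, are expanded in powers of $z/w$; in relations between $K^-(z)$ or $k^-(z)$ and $E(w),F(w)$, or between $K^-(z)$ and $k^+(w)$, in powers of $w/z$. $(z-wq^2)\bar R(z/w)$ is polynomial in $z,w$. *)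

theory Defs
  imports
    "HOL-Library.Poly_Mapping"
    "HOL-Computational_Algebra.Polynomial_Factorial"
    "HOL-Computational_Algebra.Formal_Laurent_Series"
    "HOL-Algebra.QuotRing"
    "HOL-Algebra.Module"
begin

section \<open>Algebras over \<open>\<complex>(q)\<close> given by generators and relations\<close>

type_synonym Cq = "complex poly fract"

definition qv :: Cq where
  "qv = to_fract [:0, 1:]"

datatype 'g fword = FWord (letters: "'g list")

instantiation fword :: (type) monoid_add
begin

definition zero_fword :: "'a fword" where
  "zero_fword = FWord []"

definition plus_fword :: "'a fword \<Rightarrow> 'a fword \<Rightarrow> 'a fword" where
  "plus_fword u v = FWord (letters u @ letters v)"

instance
  by standard (simp_all add: zero_fword_def plus_fword_def)

end

text \<open>Words are written additively, so that the convolution product of \<^typ>\<open>'a \<Rightarrow>\<^sub>0 'b\<close> makes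
  the following type the free associative unital algebra on the type \<^typ>\<open>'g\<close>.\<close>

type_synonym 'g falg = "'g fword \<Rightarrow>\<^sub>0 Cq"

definition scal :: "Cq \<Rightarrow> 'g falg" where
  "scal c = Poly_Mapping.single 0 c"

definition gen :: "'g \<Rightarrow> 'g falg" where
  "gen g = Poly_Mapping.single (FWord [g]) 1"

text \<open>The free algebra on a subset \<open>X\<close> of the type of generators.\<close>

definition free_algebra :: "'g set \<Rightarrow> 'g falg ring" where
  "free_algebra X =
    \<lparr>carrier = {p. Poly_Mapping.keys p \<subseteq> FWord ` lists X}, mult = (*), one = 1, zero = 0, add = (+)\<rparr>"

text \<open>\<open>presented_algebra X E\<close> is the algebra with generators \<open>X\<close> and relations \<open>u = v\<close> for
  \<open>(u, v) \<in> E\<close>.\<close>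

definition presented_algebra ::
  "'g set \<Rightarrow> ('g falg \<times> 'g falg) set \<Rightarrow> (Cq, 'g falg set) module" where
  "presented_algebra X E =
    (let F = free_algebra X; I = Idl\<^bsub>F\<^esub> {u - v |u v. (u, v) \<in> E}; A = F Quot I
     in \<lparr>carrier = carrier A, mult = mult A, one = one A, zero = zero A, add = add A,
         smult = (\<lambda>c. mult A (I +>\<^bsub>F\<^esub> scal c))\<rparr>)"

definition algebra_isomorphic :: "('k, 'a) module \<Rightarrow> ('k, 'b) module \<Rightarrow> bool" where
  "algebra_isomorphic A B \<longleftrightarrow>
    (\<exists>h \<in> ring_iso A B. \<forall>c. \<forall>x \<in> carrier A. h (c \<odot>\<^bsub>A\<^esub> x) = c \<odot>\<^bsub>B\<^esub> h x)"


section \<open>Formal series and expansions of rational functions\<close>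

text \<open>A series \<open>\<Sum>S a b z\<^sup>a w\<^sup>b\<close> in two variables is represented by its coefficients
  \<open>S :: int \<Rightarrow> int \<Rightarrow> _\<close>.  A rational function of \<open>x\<close> over \<open>\<complex>(q)\<close> is represented by a function
  \<open>f\<close> on the field of formal Laurent series over \<open>\<complex>(q)\<close>: its expansion in powers of \<open>x\<close> is its
  value at the indeterminate \<open>X\<close>, its expansion in powers of \<open>x\<^sup>-\<^sup>1\<close> is its value at \<open>X\<^sup>-\<^sup>1\<close>,
  reread with \<open>X = x\<^sup>-\<^sup>1\<close>.\<close>

datatype expansion = ZW \<comment> \<open>powers of \<open>z/w\<close>\<close> | WZ \<comment> \<open>powers of \<open>w/z\<close>\<close>

primrec excoeff :: "expansion \<Rightarrow> (Cq fls \<Rightarrow> Cq fls) \<Rightarrow> int \<Rightarrow> Cq" where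
  "excoeff ZW f k = fls_nth (f fls_X) k"
| "excoeff WZ f k = fls_nth (f (inverse fls_X)) (- k)"

abbreviation qL :: "Cq fls" where
  "qL \<equiv> fls_const qv"

text \<open>Integer powers of an element \<open>u\<close> with designated inverse \<open>u'\<close>.\<close>

definition ipow :: "'a::monoid_mult \<Rightarrow> 'a \<Rightarrow> int \<Rightarrow> 'a" where
  "ipow u u' k = (if 0 \<le> k then u ^ nat k else u' ^ nat (- k))"

text \<open>\<open>rmul C d j f S\<close> is the product of \<open>f(x)\<close> and \<open>S(z, w)\<close>, where
  \<open>x = z w\<^sup>-\<^sup>1 q\<^sup>j\<^sup>c\<^sup>/\<^sup>2\<close>, \<open>C k = q\<^sup>k\<^sup>c\<^sup>/\<^sup>2\<close>, and \<open>f\<close> is expanded in the direction \<open>d\<close>.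
  Only finitely many terms of the sum are nonzero for the series to which this is applied below.\<close>

definition rmul :: "(int \<Rightarrow> 'g falg) \<Rightarrow> expansion \<Rightarrow> int \<Rightarrow> (Cq fls \<Rightarrow> Cq fls) \<Rightarrow>
    (int \<Rightarrow> int \<Rightarrow> 'g falg) \<Rightarrow> int \<Rightarrow> int \<Rightarrow> 'g falg" where
  "rmul C d j f S a b = (\<Sum>k. scal (excoeff d f k) * C (j * k) * S (a - k) (b + k))"

text \<open>\<open>A(z) B(w)\<close> and \<open>B(w) A(z)\<close>\<close>

definition prod_zw :: "(int \<Rightarrow> 'a::times) \<Rightarrow> (int \<Rightarrow> 'a) \<Rightarrow> int \<Rightarrow> int \<Rightarrow> 'a" where
  "prod_zw A B a b = A a * B b"

definition prod_wz :: "(int \<Rightarrow> 'a::times) \<Rightarrow> (int \<Rightarrow> 'a) \<Rightarrow> int \<Rightarrow> int \<Rightarrow> 'a" where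
  "prod_wz B A a b = B b * A a"

text \<open>\<open>Rmat q i j k l x\<close> is the coefficient of \<open>E\<^sub>i\<^sub>j \<otimes> E\<^sub>k\<^sub>l\<close> in \<open>R(x)\<close>, that is, the matrix entry
  with row index \<open>(i, k)\<close> and column index \<open>(j, l)\<close>.  It does not depend on the size of the
  matrix, so it also describes the restriction of \<open>R(x)\<close> to \<open>V' \<otimes> V'\<close>.\<close>

definition Rmat :: "'f::field \<Rightarrow> nat \<Rightarrow> nat \<Rightarrow> nat \<Rightarrow> nat \<Rightarrow> 'f \<Rightarrow> 'f" where
  "Rmat q i j k l x =
    (if i = j \<and> k = l then (if i = k then 1 else (x - 1) / (inverse q * x - q))
     else if i = l \<and> j = k then
       (if i > j then (inverse q - q) / (x * inverse q - q)
        else x * (inverse q - q) / (x * inverse q - q))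
     else 0)"

datatype pmsign = Plus | Minus

primrec sg :: "pmsign \<Rightarrow> int" where
  "sg Plus = 1"
| "sg Minus = -1"

primrec opp :: "pmsign \<Rightarrow> pmsign" where
  "opp Plus = Minus"
| "opp Minus = Plus"

text \<open>The direction of expansion in relations involving \<open>K\<^sup>\<plusminus>(z)\<close> or \<open>k\<^sup>\<plusminus>(z)\<close>.\<close>

primrec dir :: "pmsign \<Rightarrow> expansion" where
  "dir Plus = ZW"
| "dir Minus = WZ"

text \<open>The zero modes of \<open>L\<^sup>+\<close>, \<open>K\<^sup>+\<close> are lower triangular, those of \<open>L\<^sup>-\<close>, \<open>K\<^sup>-\<close> upper triangular.\<close>

definition mode_ok :: "pmsign \<Rightarrow> nat \<Rightarrow> nat \<Rightarrow> nat \<Rightarrow> bool" where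
  "mode_ok s i j m \<longleftrightarrow> m > 0 \<or> (case s of Plus \<Rightarrow> j \<le> i | Minus \<Rightarrow> i \<le> j)"

text \<open>The series \<open>\<Sum>c m z\<^sup>\<plusminus>\<^sup>m\<close> over \<open>m \<ge> 0\<close>.\<close>

definition half_series :: "pmsign \<Rightarrow> (nat \<Rightarrow> 'a::zero) \<Rightarrow> int \<Rightarrow> 'a" where
  "half_series s c t = (if 0 \<le> sg s * t then c (nat (sg s * t)) else 0)"


section \<open>The algebra \<open>U\<^sub>q\<close>\<close>

datatype ugen = UC | UCinv | UL pmsign nat nat nat
  \<comment> \<open>\<open>q\<^sup>c\<^sup>/\<^sup>2\<close>, \<open>q\<^sup>-\<^sup>c\<^sup>/\<^sup>2\<close>, and \<open>l\<^sup>\<plusminus>\<^sub>i\<^sub>j[\<plusminus>m]\<close> as \<open>UL \<plusminus> i j m\<close>\<close>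

definition U_gens :: "nat \<Rightarrow> ugen set" where
  "U_gens n = {UC, UCinv} \<union> {UL s i j m |s i j m. i \<in> {1..n} \<and> j \<in> {1..n} \<and> mode_ok s i j m}"

definition uC :: "int \<Rightarrow> ugen falg" where
  "uC = ipow (gen UC) (gen UCinv)"

definition lcoef :: "pmsign \<Rightarrow> nat \<Rightarrow> nat \<Rightarrow> nat \<Rightarrow> ugen falg" where
  "lcoef s i j m = (if mode_ok s i j m then gen (UL s i j m) else 0)"

definition lser :: "pmsign \<Rightarrow> nat \<Rightarrow> nat \<Rightarrow> int \<Rightarrow> ugen falg" where
  "lser s i j = half_series s (lcoef s i j)"

text \<open>In the matrix relations, \<open>(i, k)\<close> is the row index and \<open>(j, l)\<close> the column index.\<close>

inductive_set U_rels :: "nat \<Rightarrow> (ugen falg \<times> ugen falg) set" for n :: nat where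
  inv1: "(gen UC * gen UCinv, 1) \<in> U_rels n"
| inv2: "(gen UCinv * gen UC, 1) \<in> U_rels n"
| central: "g \<in> U_gens n \<Longrightarrow> (gen UC * gen g, gen g * gen UC) \<in> U_rels n"
| diag: "i \<in> {1..n} \<Longrightarrow> (lcoef s i i 0 * lcoef (opp s) i i 0, 1) \<in> U_rels n"
| RLL: "\<lbrakk>i \<in> {1..n}; j \<in> {1..n}; k \<in> {1..n}; l \<in> {1..n}\<rbrakk> \<Longrightarrow>
    ((\<Sum>a = 1..n. \<Sum>b = 1..n.
        rmul uC ZW 0 (Rmat qL i a k b) (prod_zw (lser s a j) (lser s b l)) r t),
     (\<Sum>a = 1..n. \<Sum>b = 1..n.
        rmul uC ZW 0 (Rmat qL a j b l) (prod_wz (lser s k b) (lser s i a)) r t)) \<in> U_rels n"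
| RLL': "\<lbrakk>i \<in> {1..n}; j \<in> {1..n}; k \<in> {1..n}; l \<in> {1..n}\<rbrakk> \<Longrightarrow>
    ((\<Sum>a = 1..n. \<Sum>b = 1..n.
        rmul uC ZW (-2) (Rmat qL i a k b) (prod_zw (lser Plus a j) (lser Minus b l)) r t),
     (\<Sum>a = 1..n. \<Sum>b = 1..n.
        rmul uC ZW 2 (Rmat qL a j b l) (prod_wz (lser Minus k b) (lser Plus i a)) r t)) \<in> U_rels n"

definition Uq_gl_hat :: "nat \<Rightarrow> (Cq, ugen falg set) module" where
  "Uq_gl_hat n = presented_algebra (U_gens n) (U_rels n)"


section \<open>Inverse of a matrix series with triangular constant term\<close>

text \<open>Matrices have index set \<open>{1..N}\<close>.  If \<open>T\<close> is triangular and \<open>D i\<close> is inverse to \<open>T i i\<close>, then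
  \<open>T = diag(T i i) (1 - M)\<close> with \<open>M\<close> strictly triangular, so the inverse of \<open>T\<close> is
  \<open>(\<Sum>r<N. M\<^sup>r) diag(D i)\<close>.  The inverse of a matrix power series \<open>\<Sum>T m u\<^sup>m\<close> is determined
  recursively from the inverse of \<open>T 0\<close> (see \<open>ser_inv_right\<close> below).\<close>

definition mat_id :: "nat \<Rightarrow> nat \<Rightarrow> 'a::ring_1" where
  "mat_id i j = (if i = j then 1 else 0)"

definition mat_mult ::
  "nat \<Rightarrow> (nat \<Rightarrow> nat \<Rightarrow> 'a::ring_1) \<Rightarrow> (nat \<Rightarrow> nat \<Rightarrow> 'a) \<Rightarrow> nat \<Rightarrow> nat \<Rightarrow> 'a" where
  "mat_mult N A B i j = (\<Sum>a = 1..N. A i a * B a j)"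

primrec mat_pow :: "nat \<Rightarrow> (nat \<Rightarrow> nat \<Rightarrow> 'a::ring_1) \<Rightarrow> nat \<Rightarrow> nat \<Rightarrow> nat \<Rightarrow> 'a" where
  "mat_pow N A 0 = mat_id"
| "mat_pow N A (Suc r) = mat_mult N A (mat_pow N A r)"

definition tri_inv ::
  "nat \<Rightarrow> (nat \<Rightarrow> 'a::ring_1) \<Rightarrow> (nat \<Rightarrow> nat \<Rightarrow> 'a) \<Rightarrow> nat \<Rightarrow> nat \<Rightarrow> 'a" where
  "tri_inv N D T i j =
    (\<Sum>r<N. mat_pow N (\<lambda>a b. if a = b then 0 else - (D a * T a b)) r i j) * D j"

fun ser_inv ::
  "nat \<Rightarrow> (nat \<Rightarrow> 'a::ring_1) \<Rightarrow> (nat \<Rightarrow> nat \<Rightarrow> nat \<Rightarrow> 'a) \<Rightarrow> nat \<Rightarrow> nat \<Rightarrow> nat \<Rightarrow> 'a" where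
  "ser_inv N D T 0 = tri_inv N D (T 0)"
| "ser_inv N D T (Suc m) =
    (\<lambda>i j. - mat_mult N (tri_inv N D (T 0))
        (\<lambda>a b. \<Sum>r\<le>m. mat_mult N (T (Suc r)) (ser_inv N D T (m - r)) a b) i j)"

lemma mat_mult_assoc: "mat_mult N (mat_mult N A B) C i j = mat_mult N A (mat_mult N B C) i j"
  unfolding mat_mult_def by (simp add: sum_distrib_left sum_distrib_right mult.assoc) (rule sum.swap)

lemma mat_pow_lower:
  assumes "\<And>i j. i \<in> {1..N} \<Longrightarrow> j \<in> {1..N} \<Longrightarrow> i \<le> j \<Longrightarrow> A i j = 0"
  shows "i \<in> {1..N} \<Longrightarrow> j \<in> {1..N} \<Longrightarrow> i < j + r \<Longrightarrow> mat_pow N A r i j = (0::'a::ring_1)"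
proof (induct r arbitrary: i j)
  case (Suc r)
  show ?case unfolding mat_pow.simps mat_mult_def
  proof (rule sum.neutral, rule ballI)
    fix a assume a: "a \<in> {1..N}"
    show "A i a * mat_pow N A r a j = 0"
      by (cases "i \<le> a") (use assms[of i a] Suc a in auto)
  qed
qed (auto simp: mat_id_def)

lemma mat_pow_upper:
  assumes "\<And>i j. i \<in> {1..N} \<Longrightarrow> j \<in> {1..N} \<Longrightarrow> j \<le> i \<Longrightarrow> A i j = 0"
  shows "i \<in> {1..N} \<Longrightarrow> j \<in> {1..N} \<Longrightarrow> j < i + r \<Longrightarrow> mat_pow N A r i j = (0::'a::ring_1)"
proof (induct r arbitrary: i j)
  case (Suc r)
  show ?case unfolding mat_pow.simps mat_mult_def
  proof (rule sum.neutral, rule ballI)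
    fix a assume a: "a \<in> {1..N}"
    show "A i a * mat_pow N A r a j = 0"
      by (cases "a \<le> i") (use assms[of i a] Suc a in auto)
  qed
qed (auto simp: mat_id_def)

lemma tri_inv_right:
  fixes T :: "nat \<Rightarrow> nat \<Rightarrow> 'a::ring_1"
  assumes D: "\<And>i. i \<in> {1..N} \<Longrightarrow> T i i * D i = 1 \<and> D i * T i i = 1"
    and tri: "(\<forall>i\<in>{1..N}. \<forall>j\<in>{1..N}. i < j \<longrightarrow> T i j = 0) \<or> (\<forall>i\<in>{1..N}. \<forall>j\<in>{1..N}. j < i \<longrightarrow> T i j = 0)"
    and ij: "i \<in> {1..N}" "j \<in> {1..N}"
  shows "mat_mult N T (tri_inv N D T) i j = mat_id i j"
proof -
  define M where "M = (\<lambda>a b. if a = b then 0 else - (D a * T a b))"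
  have nil: "mat_pow N M N i j = 0"
    using tri
  proof
    assume "\<forall>i\<in>{1..N}. \<forall>j\<in>{1..N}. i < j \<longrightarrow> T i j = 0"
    then show ?thesis by (intro mat_pow_lower) (use ij in \<open>auto simp: M_def\<close>)
  next
    assume "\<forall>i\<in>{1..N}. \<forall>j\<in>{1..N}. j < i \<longrightarrow> T i j = 0"
    then show ?thesis by (intro mat_pow_upper) (use ij in \<open>auto simp: M_def\<close>)
  qed
  define S where "S a b = (\<Sum>r<N. mat_pow N M r a b)" for a b
  have T: "T i a = T i i * ((if i = a then 1 else 0) - M i a)" for a
    using D[OF ij(1)] by (auto simp: M_def simp flip: mult.assoc)
  have "(\<Sum>a=1..N. T i a * S a j) = T i i * (S i j - (\<Sum>a=1..N. M i a * S a j))"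
  proof -
    have "(\<Sum>a=1..N. T i a * S a j) = T i i * (\<Sum>a=1..N. mat_id i a * S a j - M i a * S a j)"
      unfolding sum_distrib_left
      by (intro sum.cong refl, subst T) (simp only: mat_id_def mult.assoc left_diff_distrib)
    also have "(\<Sum>a=1..N. mat_id i a * S a j) = S i j"
      using ij by (simp add: mat_id_def if_distrib[of "\<lambda>x. x * _"] cong: if_cong)
    then have "(\<Sum>a=1..N. mat_id i a * S a j - M i a * S a j) = S i j - (\<Sum>a=1..N. M i a * S a j)"
      by (simp only: sum_subtractf)
    finally show ?thesis .
  qed
  also have "(\<Sum>a=1..N. M i a * S a j) = (\<Sum>r<N. mat_pow N M (Suc r) i j)"
    unfolding S_def mat_pow.simps mat_mult_def by (simp add: sum_distrib_left) (rule sum.swap)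
  also have "S i j - \<dots> = (\<Sum>r<N. mat_pow N M r i j - mat_pow N M (Suc r) i j)"
    by (simp add: S_def sum_subtractf)
  also have "\<dots> = mat_id i j"
    by (subst sum_lessThan_telescope') (use nil in \<open>simp add: mat_id_def\<close>)
  finally have "(\<Sum>a=1..N. T i a * S a j) = T i i * mat_id i j" .
  then have "(\<Sum>a=1..N. T i a * S a j) * D j = mat_id i j"
    using D ij by (auto simp: mat_id_def)
  then show ?thesis
    unfolding mat_mult_def tri_inv_def M_def[symmetric] S_def[symmetric] by (simp add: sum_distrib_right mult.assoc)
qed

lemma ser_inv_right:
  fixes T :: "nat \<Rightarrow> nat \<Rightarrow> nat \<Rightarrow> 'a::ring_1"
  assumes D: "\<And>i. i \<in> {1..N} \<Longrightarrow> T 0 i i * D i = 1 \<and> D i * T 0 i i = 1"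
    and tri: "(\<forall>i\<in>{1..N}. \<forall>j\<in>{1..N}. i < j \<longrightarrow> T 0 i j = 0) \<or> (\<forall>i\<in>{1..N}. \<forall>j\<in>{1..N}. j < i \<longrightarrow> T 0 i j = 0)"
    and ij: "i \<in> {1..N}" "j \<in> {1..N}"
  shows "(\<Sum>r\<le>m. mat_mult N (T r) (ser_inv N D T (m - r)) i j) = (if m = 0 then mat_id i j else 0)"
proof (cases m)
  case 0 then show ?thesis using tri_inv_right[OF D tri ij] by simp
next
  case (Suc k)
  define W where "W = (\<lambda>a b. \<Sum>r\<le>k. mat_mult N (T (Suc r)) (ser_inv N D T (k - r)) a b)"
  have "mat_mult N (T 0) (ser_inv N D T m) i j = - mat_mult N (T 0) (mat_mult N (tri_inv N D (T 0)) W) i j"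
    by (simp add: Suc W_def mat_mult_def sum_negf)
  also have "\<dots> = - mat_mult N (mat_mult N (T 0) (tri_inv N D (T 0))) W i j" by (simp add: mat_mult_assoc)
  also have "\<dots> = - mat_mult N mat_id W i j"
    unfolding mat_mult_def[of N _ W] by (intro arg_cong[where f=uminus] sum.cong arg_cong2[where f="(*)"] tri_inv_right[OF D tri ij(1)]) auto
  also have "mat_mult N mat_id W i j = W i j" using ij by (simp add: mat_mult_def mat_id_def if_distrib[of "\<lambda>x. x * _"] cong: if_cong)
  finally show ?thesis unfolding Suc by (subst sum.atMost_Suc_shift) (simp add: W_def Suc)
qed


section \<open>The algebra \<open>ZUR\<close>\<close>

datatype zgen = ZC | ZCinv | ZE nat int | ZF nat int | ZK pmsign nat nat nat | Zk pmsign nat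
  \<comment> \<open>\<open>q\<^sup>c\<^sup>/\<^sup>2\<close>, \<open>q\<^sup>-\<^sup>c\<^sup>/\<^sup>2\<close>, the coefficients of \<open>z\<^sup>m\<close> in \<open>E\<^sub>a(z)\<close> and \<open>F\<^sub>a(z)\<close>,
      \<open>K\<^sup>\<plusminus>\<^sub>i\<^sub>j[\<plusminus>m]\<close>, and \<open>k\<^sup>\<plusminus>[\<plusminus>m]\<close>\<close>

definition Z_gens :: "nat \<Rightarrow> zgen set" where
  "Z_gens n = {ZC, ZCinv}
    \<union> {ZE a m |a m. a \<in> {1..n-1}} \<union> {ZF a m |a m. a \<in> {1..n-1}}
    \<union> {ZK s i j m |s i j m. i \<in> {1..n-1} \<and> j \<in> {1..n-1} \<and> mode_ok s i j m}
    \<union> {Zk s m |s m. True}"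

definition zC :: "int \<Rightarrow> zgen falg" where
  "zC = ipow (gen ZC) (gen ZCinv)"

definition Eser :: "nat \<Rightarrow> int \<Rightarrow> zgen falg" where
  "Eser a m = gen (ZE a m)"

definition Fser :: "nat \<Rightarrow> int \<Rightarrow> zgen falg" where
  "Fser a m = gen (ZF a m)"

definition Kcoef :: "pmsign \<Rightarrow> nat \<Rightarrow> nat \<Rightarrow> nat \<Rightarrow> zgen falg" where
  "Kcoef s i j m = (if mode_ok s i j m then gen (ZK s i j m) else 0)"

definition Kser :: "pmsign \<Rightarrow> nat \<Rightarrow> nat \<Rightarrow> int \<Rightarrow> zgen falg" where
  "Kser s i j = half_series s (Kcoef s i j)"

definition kcoef :: "pmsign \<Rightarrow> nat \<Rightarrow> zgen falg" where
  "kcoef s m = gen (Zk s m)"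

definition kser :: "pmsign \<Rightarrow> int \<Rightarrow> zgen falg" where
  "kser s = half_series s (kcoef s)"

text \<open>The \<open>(i, j)\<close> entry of \<open>K\<^sup>\<plusminus>(u)\<^sup>-\<^sup>1\<close> (coefficient of \<open>u\<^sup>\<plusminus>\<^sup>m\<close>) and of \<open>k\<^sup>\<plusminus>(u) K\<^sup>\<plusminus>(u)\<^sup>-\<^sup>1\<close>.\<close>

definition Kinv :: "nat \<Rightarrow> pmsign \<Rightarrow> nat \<Rightarrow> nat \<Rightarrow> nat \<Rightarrow> zgen falg" where
  "Kinv n s m = ser_inv (n - 1) (\<lambda>i. Kcoef (opp s) i i 0) (\<lambda>m i j. Kcoef s i j m) m"

definition kKinv :: "nat \<Rightarrow> pmsign \<Rightarrow> nat \<Rightarrow> nat \<Rightarrow> int \<Rightarrow> zgen falg" where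
  "kKinv n s i j = half_series s (\<lambda>m. \<Sum>r\<le>m. kcoef s r * Kinv n s (m - r) i j)"

text \<open>Coefficient of \<open>z\<^sup>r w\<^sup>t\<close> in \<open>\<delta>(w z\<^sup>-\<^sup>1 q\<^sup>h\<^sup>c) H(w q\<^sup>h\<^sup>c\<^sup>/\<^sup>2)\<close>.\<close>

definition delta_term :: "int \<Rightarrow> (int \<Rightarrow> zgen falg) \<Rightarrow> int \<Rightarrow> int \<Rightarrow> zgen falg" where
  "delta_term h H r t = zC (2 * h * (- r)) * zC (h * (r + t)) * H (r + t)"

text \<open>Each rational coefficient is a function of \<open>x = z w\<^sup>-\<^sup>1 q\<^sup>j\<^sup>c\<^sup>/\<^sup>2\<close>, with \<open>j\<close> the third argument
  of \<^const>\<open>rmul\<close>.  For example \<open>(z\<^sub>- q\<^sup>-\<^sup>1 - w\<^sub>+ q) / (z\<^sub>- - w\<^sub>+) = (x q\<^sup>-\<^sup>1 - q) / (x - 1)\<close> with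
  \<open>j = -2\<close>.  The quadratic relations \<open>EE\<close>, \<open>FF\<close> are divided by \<open>w\<close>, which turns the coefficients
  \<open>z - w q\<^sup>2\<close> and \<open>z q\<^sup>2 - w\<close> into \<open>x - q\<^sup>2\<close> and \<open>x q\<^sup>2 - 1\<close>; their products with the
  entries of \<open>R\<close> are polynomials in \<open>x\<close>.\<close>

inductive_set Z_rels :: "nat \<Rightarrow> (zgen falg \<times> zgen falg) set" for n :: nat where
  inv1: "(gen ZC * gen ZCinv, 1) \<in> Z_rels n"
| inv2: "(gen ZCinv * gen ZC, 1) \<in> Z_rels n"
| central: "g \<in> Z_gens n \<Longrightarrow> (gen ZC * gen g, gen g * gen ZC) \<in> Z_rels n"
| diagK: "i \<in> {1..n-1} \<Longrightarrow> (Kcoef s i i 0 * Kcoef (opp s) i i 0, 1) \<in> Z_rels n"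
| diagk: "(kcoef s 0 * kcoef (opp s) 0, 1) \<in> Z_rels n"
| RKK: "\<lbrakk>i \<in> {1..n-1}; j \<in> {1..n-1}; k \<in> {1..n-1}; l \<in> {1..n-1}\<rbrakk> \<Longrightarrow>
    ((\<Sum>a = 1..n-1. \<Sum>b = 1..n-1.
        rmul zC ZW 0 (Rmat qL i a k b) (prod_zw (Kser s a j) (Kser s b l)) r t),
     (\<Sum>a = 1..n-1. \<Sum>b = 1..n-1.
        rmul zC ZW 0 (Rmat qL a j b l) (prod_wz (Kser s k b) (Kser s i a)) r t)) \<in> Z_rels n"
| RKK': "\<lbrakk>i \<in> {1..n-1}; j \<in> {1..n-1}; k \<in> {1..n-1}; l \<in> {1..n-1}\<rbrakk> \<Longrightarrow>
    ((\<Sum>a = 1..n-1. \<Sum>b = 1..n-1.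
        rmul zC ZW (-2) (Rmat qL i a k b) (prod_zw (Kser Plus a j) (Kser Minus b l)) r t),
     (\<Sum>a = 1..n-1. \<Sum>b = 1..n-1.
        rmul zC ZW 2 (Rmat qL a j b l) (prod_wz (Kser Minus k b) (Kser Plus i a)) r t)) \<in> Z_rels n"
| kk: "(prod_zw (kser s) (kser s) r t, prod_wz (kser s) (kser s) r t) \<in> Z_rels n"
| kk': "(prod_zw (kser Plus) (kser Minus) r t, prod_wz (kser Minus) (kser Plus) r t) \<in> Z_rels n"
| Kk: "\<lbrakk>i \<in> {1..n-1}; j \<in> {1..n-1}\<rbrakk> \<Longrightarrow>
    (prod_zw (Kser s i j) (kser s) r t, prod_wz (kser s) (Kser s i j) r t) \<in> Z_rels n"
| Kk': "\<lbrakk>i \<in> {1..n-1}; j \<in> {1..n-1}\<rbrakk> \<Longrightarrow>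
    (rmul zC (dir s) (- 2 * sg s) (\<lambda>x. (x * inverse qL - qL) / (x - 1))
        (prod_wz (kser (opp s)) (Kser s i j)) r t,
     rmul zC (dir s) (2 * sg s) (\<lambda>x. (x * inverse qL - qL) / (x - 1))
        (prod_zw (Kser s i j) (kser (opp s))) r t) \<in> Z_rels n"
| KE: "\<lbrakk>i \<in> {1..n-1}; j \<in> {1..n-1}; b \<in> {1..n-1}\<rbrakk> \<Longrightarrow>
    (prod_zw (Kser s i j) (Eser b) r t,
     (\<Sum>a = 1..n-1. \<Sum>d = 1..n-1.
        rmul zC (dir s) (- sg s) (\<lambda>x. (x * inverse qL - qL) / (x - 1) * Rmat qL i a d b x)
          (prod_wz (Eser d) (Kser s a j)) r t)) \<in> Z_rels n"
| KF: "\<lbrakk>i \<in> {1..n-1}; j \<in> {1..n-1}; k \<in> {1..n-1}\<rbrakk> \<Longrightarrow>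
    ((\<Sum>a = 1..n-1. \<Sum>d = 1..n-1.
        rmul zC (dir s) (sg s) (Rmat qL a j k d) (prod_zw (Kser s i a) (Fser d)) r t),
     rmul zC (dir s) (sg s) (\<lambda>x. (x - 1) / (x * inverse qL - qL))
        (prod_wz (Fser k) (Kser s i j)) r t) \<in> Z_rels n"
| kE: "a \<in> {1..n-1} \<Longrightarrow>
    (prod_zw (kser s) (Eser a) r t,
     rmul zC (dir s) (- sg s) (\<lambda>x. (x * qL - inverse qL) / (x - 1))
        (prod_wz (Eser a) (kser s)) r t) \<in> Z_rels n"
| kF: "a \<in> {1..n-1} \<Longrightarrow>
    (prod_zw (kser s) (Fser a) r t,
     rmul zC (dir s) (sg s) (\<lambda>x. (x - 1) / (x * qL - inverse qL))
        (prod_wz (Fser a) (kser s)) r t) \<in> Z_rels n"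
| EE: "\<lbrakk>a \<in> {1..n-1}; b \<in> {1..n-1}\<rbrakk> \<Longrightarrow>
    ((\<Sum>c = 1..n-1. \<Sum>d = 1..n-1.
        rmul zC ZW 0 (\<lambda>x. (x - qL ^ 2) * Rmat qL c a d b x) (prod_zw (Eser c) (Eser d)) r t),
     rmul zC ZW 0 (\<lambda>x. x * qL ^ 2 - 1) (prod_wz (Eser b) (Eser a)) r t) \<in> Z_rels n"
| FF: "\<lbrakk>a \<in> {1..n-1}; b \<in> {1..n-1}\<rbrakk> \<Longrightarrow>
    (rmul zC ZW 0 (\<lambda>x. x * qL ^ 2 - 1) (prod_zw (Fser a) (Fser b)) r t,
     (\<Sum>c = 1..n-1. \<Sum>d = 1..n-1.
        rmul zC ZW 0 (\<lambda>x. (x - qL ^ 2) * Rmat qL a c b d x) (prod_wz (Fser d) (Fser c)) r t))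
      \<in> Z_rels n"
| EF: "\<lbrakk>a \<in> {1..n-1}; b \<in> {1..n-1}\<rbrakk> \<Longrightarrow>
    (prod_zw (Eser b) (Fser a) r t - prod_wz (Fser a) (Eser b) r t,
     scal (qv - inverse qv) *
       (delta_term 1 (kKinv n Minus a b) r t - delta_term (-1) (kKinv n Plus a b) r t)) \<in> Z_rels n"

definition ZUR :: "nat \<Rightarrow> (Cq, zgen falg set) module" where
  "ZUR n = presented_algebra (Z_gens n) (Z_rels n)"

end

theory Submission imports Defs begin

text \<open>Write \<open>L\<^sup>\<plusminus>(z)\<close> in block form with respect to the last index and take its Gauss decomposition: the corner
  \<open>K\<^sup>\<plusminus>(z)\<close>, the last row \<open>e\<^sup>\<plusminus>(z) K\<^sup>\<plusminus>(z)\<close>, the last column \<open>K\<^sup>\<plusminus>(z) f\<^sup>\<plusminus>(z)\<close> and the last diagonal entry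
  \<open>k\<^sup>\<plusminus>(z) + e\<^sup>\<plusminus>(z) K\<^sup>\<plusminus>(z) f\<^sup>\<plusminus>(z)\<close>. For every pair of signs the RLL relation is equivalent to relations between these
  factors, by cancelling the invertible matrices \<open>K\<^sup>\<plusminus>\<close> and using that the R-matrix is unitary. The relations for
  the half currents \<open>e\<^sup>\<plusminus>\<close>, \<open>f\<^sup>\<plusminus>\<close> contain inhomogeneous terms, products at one spectral parameter; these are exactly
  the terms that arise when the homogeneous relations of the full currents \<open>E = e\<^sup>+ - e\<^sup>-\<close>, \<open>F = f\<^sup>+ - f\<^sup>-\<close>
  are cut into halves: once denominators are cleared, a homogeneous relation \<open>x H\<^sub>1 + H\<^sub>0 = 0\<close> between two-sided
  series says that its positive and negative parts equal opposite series supported on a line. In the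
  quadratic relations of \<open>E\<close> and of \<open>F\<close> the boundary term is identified by the q-commutation of the half
  currents, which follows from divisibility by \<open>q\<^sup>-\<^sup>1 x - q\<close>. Since a half current is determined by the full
  current, the two presentations define mutually inverse homomorphisms.\<close>

section \<open>RLL relations for Gauss decomposed matrices\<close>

text \<open>For one ordered pair of signs, the relations between the factors do not give back all
  entries of the RLL relation: they cover \<open>K\<close> with a current of the second factor, but
  not \<open>K'\<close> with a current of the first. The missing entries come from the relation with
  the factors exchanged, which unitarity makes equivalent, so each pair is treated together with its
  exchange. To compare rational functions without expanding them, the relations are read in iterated
  Laurent series, where linear polynomials in \<open>z/w\<close> with central unit coefficients are
  invertible; denominators are cleared there and coefficients are compared afterwards. The
  q-commutation of half currents is needed for both directions of the translation of the quadratic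
  relations, and each side supplies it separately: the RLL relation for equal signs through the root
  \<open>x = q^2\<close> of the denominator, the current relations through an antisymmetry on lines
  of constant degree. Since power series and Laurent series are formed over types, each presented
  algebra becomes a type of class \<open>cqalg\<close>; this requires \<open>0 \<noteq> 1\<close>,
  which a one-dimensional representation provides.\<close>

lemma sum_delta_mult:
  fixes g :: "nat \<Rightarrow> 'r::ring_1"
  assumes "finite A" "i \<in> A"
  shows "(\<Sum>a\<in>A. (if i = a then 1 else 0) * g a) = g i" "(\<Sum>a\<in>A. (if a = i then 1 else 0) * g a) = g i"
    "(\<Sum>a\<in>A. g a * (if i = a then 1 else 0)) = g i" "(\<Sum>a\<in>A. g a * (if a = i then 1 else 0)) = g i"
proof -
  have "(if b then 1 else 0) * x = (if b then x else 0)" "x * (if b then 1 else 0) = (if b then x else 0)" for b and x :: 'r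
    by auto
  then show "(\<Sum>a\<in>A. (if i = a then 1 else 0) * g a) = g i" "(\<Sum>a\<in>A. (if a = i then 1 else 0) * g a) = g i"
    "(\<Sum>a\<in>A. g a * (if i = a then 1 else 0)) = g i" "(\<Sum>a\<in>A. g a * (if a = i then 1 else 0)) = g i"
    using assms by simp_all
qed

lemma matrix_cancel_left:
  fixes K Ki :: "nat \<Rightarrow> nat \<Rightarrow> 'r::ring_1"
  assumes inv: "\<And>i j. i \<in> A \<Longrightarrow> j \<in> A \<Longrightarrow> (\<Sum>a\<in>A. Ki i a * K a j) = (if i = j then 1 else 0)"
    and "finite A" and z: "\<And>i. i \<in> A \<Longrightarrow> (\<Sum>a\<in>A. K i a * y a) = 0" and b: "b \<in> A"
  shows "y b = 0"
proof -
  have "y b = (\<Sum>a\<in>A. (\<Sum>i\<in>A. Ki b i * K i a) * y a)"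
    using b \<open>finite A\<close> by (simp add: inv sum_delta_mult cong: sum.cong)
  also have "\<dots> = (\<Sum>i\<in>A. Ki b i * (\<Sum>a\<in>A. K i a * y a))"
    by (simp add: sum_distrib_left sum_distrib_right mult.assoc) (rule sum.swap)
  finally show ?thesis by (simp add: z)
qed

lemma matrix_cancel_right:
  fixes K Ki :: "nat \<Rightarrow> nat \<Rightarrow> 'r::ring_1"
  assumes inv: "\<And>i j. i \<in> A \<Longrightarrow> j \<in> A \<Longrightarrow> (\<Sum>a\<in>A. K i a * Ki a j) = (if i = j then 1 else 0)"
    and "finite A" and z: "\<And>j. j \<in> A \<Longrightarrow> (\<Sum>a\<in>A. y a * K a j) = 0" and b: "b \<in> A"
  shows "y b = 0"
proof -
  have "y b = (\<Sum>a\<in>A. y a * (\<Sum>i\<in>A. K a i * Ki i b))"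
    using b \<open>finite A\<close> by (simp add: inv sum_delta_mult cong: sum.cong)
  also have "\<dots> = (\<Sum>i\<in>A. (\<Sum>a\<in>A. y a * K a i) * Ki i b)"
    by (simp add: sum_distrib_left sum_distrib_right mult.assoc) (rule sum.swap)
  finally show ?thesis by (simp add: z)
qed

text \<open>Two Gauss decomposed matrices over a ring, with \<open>N + 1\<close> as the last index; \<open>a\<close>, \<open>b\<close>, \<open>c\<close> stand
  for the entries \<open>(x - 1) / (q\<^sup>-\<^sup>1 x - q)\<close>, \<open>(q\<^sup>-\<^sup>1 - q) / (q\<^sup>-\<^sup>1 x - q)\<close>,
  \<open>x (q\<^sup>-\<^sup>1 - q) / (q\<^sup>-\<^sup>1 x - q)\<close> of the left and right R-matrix, primes for the second spectral parameter.\<close>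

locale rpair =
  fixes N :: nat and al bl cl ar br cr :: "'r::ring_1"
    and K Ki :: "nat \<Rightarrow> nat \<Rightarrow> 'r" and k :: 'r and e f :: "nat \<Rightarrow> 'r"
    and K' Ki' :: "nat \<Rightarrow> nat \<Rightarrow> 'r" and k' :: 'r and e' f' :: "nat \<Rightarrow> 'r"
  assumes cen: "c \<in> {al, bl, cl, ar, br, cr} \<Longrightarrow> y * c = c * y"
    and al_cancel: "al * y = 0 \<Longrightarrow> y = 0" and ar_cancel: "ar * y = 0 \<Longrightarrow> y = 0"
    and KKi: "i \<in> {1..N} \<Longrightarrow> j \<in> {1..N} \<Longrightarrow> (\<Sum>a=1..N. K i a * Ki a j) = (if i = j then 1 else 0)"
    and KiK: "i \<in> {1..N} \<Longrightarrow> j \<in> {1..N} \<Longrightarrow> (\<Sum>a=1..N. Ki i a * K a j) = (if i = j then 1 else 0)"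
    and KKi': "i \<in> {1..N} \<Longrightarrow> j \<in> {1..N} \<Longrightarrow> (\<Sum>a=1..N. K' i a * Ki' a j) = (if i = j then 1 else 0)"
    and KiK': "i \<in> {1..N} \<Longrightarrow> j \<in> {1..N} \<Longrightarrow> (\<Sum>a=1..N. Ki' i a * K' a j) = (if i = j then 1 else 0)"
begin

definition L :: "nat \<Rightarrow> nat \<Rightarrow> 'r" where
  "L i j = (if i \<le> N then if j \<le> N then K i j else (\<Sum>a=1..N. K i a * f a)
     else if j \<le> N then (\<Sum>a=1..N. e a * K a j) else k + (\<Sum>a=1..N. \<Sum>b=1..N. e a * K a b * f b))"

definition L' :: "nat \<Rightarrow> nat \<Rightarrow> 'r" where
  "L' i j = (if i \<le> N then if j \<le> N then K' i j else (\<Sum>a=1..N. K' i a * f' a)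
     else if j \<le> N then (\<Sum>a=1..N. e' a * K' a j) else k' + (\<Sum>a=1..N. \<Sum>b=1..N. e' a * K' a b * f' b))"

definition rl :: "nat \<Rightarrow> nat \<Rightarrow> 'r" where "rl i j = (if i = j then 1 else al)"
definition rr :: "nat \<Rightarrow> nat \<Rightarrow> 'r" where "rr i j = (if i = j then 1 else ar)"
definition pl :: "nat \<Rightarrow> nat \<Rightarrow> 'r" where "pl i j = (if i = j then 0 else if i > j then bl else cl)"
definition pr :: "nat \<Rightarrow> nat \<Rightarrow> 'r" where "pr i j = (if i = j then 0 else if i > j then br else cr)"

text \<open>The entry with row \<open>(i, m)\<close> and column \<open>(j, l)\<close> of
  \<open>R L_1 L'_2 - L'_2 L_1 R'\<close>. Rows and columns of an R-matrix have at most two nonzero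
  entries, hence four terms. The two R-matrices are kept independent, since in the mixed relation
  their arguments differ by a power of \<open>q^c\<close>.\<close>

definition X :: "nat \<Rightarrow> nat \<Rightarrow> nat \<Rightarrow> nat \<Rightarrow> 'r" where
  "X i m j l = rl i m * (L i j * L' m l) + pl i m * (L m j * L' i l)
     - rr j l * (L' m l * L i j) - pr l j * (L' m j * L i l)"

lemma cen_simps:
  "y * al = al * y" "y * bl = bl * y" "y * cl = cl * y" "y * ar = ar * y" "y * br = br * y" "y * cr = cr * y"
  "y * rl i j = rl i j * y" "y * rr i j = rr i j * y" "y * pl i j = pl i j * y" "y * pr i j = pr i j * y"
  by (simp_all add: cen rl_def rr_def pl_def pr_def)

lemma lc0:
  "y * (al * w) = al * (y * w)" "y * (bl * w) = bl * (y * w)" "y * (cl * w) = cl * (y * w)"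
  "y * (ar * w) = ar * (y * w)" "y * (br * w) = br * (y * w)" "y * (cr * w) = cr * (y * w)"
  "y * (rl i j * w) = rl i j * (y * w)" "y * (rr i j * w) = rr i j * (y * w)"
  "y * (pl i j * w) = pl i j * (y * w)" "y * (pr i j * w) = pr i j * (y * w)"
  by (simp_all add: cen_simps[of y] flip: mult.assoc)

text \<open>Chosen so that rewriting terminates: coefficients pass the matrix entries, but two
  coefficients pass each other in one order only.\<close>

lemmas lc = lc0[of "L i j" for i j] lc0[of "L' i j" for i j] lc0[of "K i j" for i j] lc0[of "K' i j" for i j]
  lc0[of "Ki i j" for i j] lc0[of "Ki' i j" for i j] lc0[of k] lc0[of k'] lc0[of "e i" for i] lc0[of "e' i" for i]
  lc0[of "f i" for i] lc0[of "f' i" for i]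
  lc0(1)[of ar] lc0(1)[of bl] lc0(1)[of br] lc0(1)[of cl] lc0(1)[of cr] lc0(4)[of bl] lc0(4)[of br] lc0(4)[of cr] lc0(2)[of br]

text \<open>What remains of the last column and the last row of \<open>L\<close> in \<open>S\<close>
  and \<open>Sm\<close>: these are \<open>K\<close> times \<open>G\<close> and \<open>Gm\<close>
  times \<open>K\<close> (\<open>S_eq\<close>, \<open>Sm_eq\<close>).\<close>

definition G :: "nat \<Rightarrow> 'r" where "G c = f c - cr * f' c"
definition Gm :: "nat \<Rightarrow> 'r" where "Gm c = e c - bl * e' c"

abbreviation "n \<equiv> Suc N"

section \<open>Splitting off the last row and the last column\<close>

lemma L'_col: "i \<in> {1..n} \<Longrightarrow> L' i n = (\<Sum>a=1..N. L' i a * f' a) + (if i = n then k' else 0)"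
  by (auto simp: L'_def sum_distrib_right mult.assoc le_Suc_eq intro: sum.swap)
lemma L_row: "j \<in> {1..n} \<Longrightarrow> L n j = (\<Sum>a=1..N. e a * L a j) + (if j = n then k else 0)"
  by (auto simp: L_def sum_distrib_left mult.assoc le_Suc_eq)
lemma L'_row: "j \<in> {1..n} \<Longrightarrow> L' n j = (\<Sum>a=1..N. e' a * L' a j) + (if j = n then k' else 0)"
  by (auto simp: L'_def sum_distrib_left mult.assoc le_Suc_eq)

text \<open>For \<open>i \<le> N\<close> the defect of the relation between \<open>K\<close> and
  \<open>f'\<close>, before \<open>L'\<close> on its left is cancelled; for \<open>i = n\<close> it
  carries the commutator of \<open>e\<close> and \<open>f'\<close>.\<close>

definition Q :: "nat \<Rightarrow> nat \<Rightarrow> nat \<Rightarrow> 'r" where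
  "Q l i j = ar * (f' l * L i j) - rr j l * (L i j * f' l)
     + (if l = j then br * L i n - (\<Sum>c=1..N. pr c j * (L i c * f' c)) else 0)"

definition S :: "nat \<Rightarrow> 'r" where "S i = L i n - cr * (\<Sum>c=1..N. L i c * f' c)"
definition T :: "nat \<Rightarrow> nat \<Rightarrow> 'r" where "T l i = f' l * S i - ar * (L i n * f' l)"

text \<open>Up to \<open>k'\<close>, column \<open>n\<close> of \<open>L'\<close> is the combination
  of the other columns with coefficients \<open>f'\<close>. Inserting this into
  \<open>X i m j n\<close> reproduces the terms \<open>X i m j l * f' l\<close>, except that in the
  products \<open>L' L\<close> the factor \<open>f'\<close> stands to the left of \<open>L\<close>;
  moving it to the right produces \<open>Q\<close>.\<close>

lemma X_col:
  assumes "j \<in> {1..N}" "i \<in> {1..n}" "m \<in> {1..n}"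
  shows "X i m j n = (\<Sum>l=1..N. X i m j l * f' l) + rl i m * (L i j * (if m = n then k' else 0))
    + pl i m * (L m j * (if i = n then k' else 0)) - ar * ((if m = n then k' else 0) * L i j)
    - (\<Sum>l=1..N. L' m l * Q l i j)"
proof -
  define A where "A i = (\<Sum>l=1..N. L' i l * f' l)" for i
  define W where "W = (\<Sum>l=1..N. rr j l * (L' m l * (L i j * f' l)))"
  define V where "V = L' m j * (\<Sum>l=1..N. pr l j * (L i l * f' l))"
  have 1: "(\<Sum>l=1..N. X i m j l * f' l) = rl i m * (L i j * A m) + pl i m * (L m j * A i) - W - V"
    unfolding X_def A_def W_def V_def
    by (simp add: sum.distrib sum_subtractf algebra_simps sum_distrib_left lc)
  have 2: "(\<Sum>l=1..N. L' m l * Q l i j) = ar * (A m * L i j) - W + br * (L' m j * L i n) - V"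
  proof -
    have "(\<Sum>l=1..N. L' m l * Q l i j) = (\<Sum>l=1..N. L' m l * (ar * (f' l * L i j)))
       - (\<Sum>l=1..N. L' m l * (rr j l * (L i j * f' l)))
       + (\<Sum>l=1..N. if l = j then L' m l * (br * L i n - (\<Sum>c=1..N. pr c j * (L i c * f' c))) else 0)"
      unfolding Q_def sum.distrib[symmetric] sum_subtractf[symmetric]
      by (intro sum.cong refl) (simp add: algebra_simps)
    also have "\<dots> = ar * (A m * L i j) - W + (br * (L' m j * L i n) - V)"
      using assms(1) by (simp add: A_def W_def V_def lc sum_distrib_left sum_distrib_right mult.assoc right_diff_distrib)
    finally show ?thesis by simp
  qed
  have r: "rr j n = ar" "pr n j = br" using assms by (auto simp: rr_def pr_def)
  have a: "L' m n = A m + (if m = n then k' else 0)" "L' i n = A i + (if i = n then k' else 0)"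
    using L'_col assms by (simp_all add: A_def)
  show ?thesis unfolding 1 2 unfolding X_def r a by (simp add: algebra_simps)
qed

lemma X_col_last:
  assumes "i \<in> {1..n}" "m \<in> {1..n}"
  shows "X i m n n = (\<Sum>l=1..N. X i m n l * f' l) + rl i m * (L i n * (if m = n then k' else 0))
    + pl i m * (L m n * (if i = n then k' else 0)) - (if m = n then k' else 0) * S i
    - (\<Sum>l=1..N. L' m l * T l i)"
proof -
  define A where "A i = (\<Sum>l=1..N. L' i l * f' l)" for i
  define B where "B = (\<Sum>l=1..N. L i l * f' l)"
  define W where "W = (\<Sum>l=1..N. L' m l * (L i n * f' l))"
  have r: "rr n l = ar" "pr l n = cr" if "l \<in> {1..N}" for l using that by (auto simp: rr_def pr_def)
  have "(\<Sum>l=1..N. X i m n l * f' l) = (\<Sum>l=1..N. rl i m * (L i n * (L' m l * f' l)) + pl i m * (L m n * (L' i l * f' l))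
     - ar * (L' m l * (L i n * f' l)) - cr * (L' m n * (L i l * f' l)))"
    unfolding X_def by (intro sum.cong refl) (simp add: algebra_simps lc r)
  also have "\<dots> = rl i m * (L i n * A m) + pl i m * (L m n * A i) - ar * W - cr * (L' m n * B)"
    unfolding A_def W_def B_def
    by (simp add: sum.distrib sum_subtractf sum_distrib_left)
  finally have 1: "(\<Sum>l=1..N. X i m n l * f' l) = rl i m * (L i n * A m) + pl i m * (L m n * A i) - ar * W - cr * (L' m n * B)" .
  have 2: "(\<Sum>l=1..N. L' m l * T l i) = A m * S i - ar * W"
    unfolding T_def A_def W_def
    by (simp add: right_diff_distrib sum_subtractf sum_distrib_right sum_distrib_left lc mult.assoc)
  have 3: "S i = L i n - cr * B" by (simp add: S_def B_def)
  have r: "rr n n = 1" "pr n n = 0" by (auto simp: rr_def pr_def)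
  have a: "L' m n = A m + (if m = n then k' else 0)" "L' i n = A i + (if i = n then k' else 0)"
    using L'_col assms by (simp_all add: A_def)
  show ?thesis unfolding 1 2 unfolding 3 X_def r a by (simp add: algebra_simps lc lc0[of "A m"] lc0[of "A n"])
qed

lemmas lc_G = lc0[of "G i" for i] lc0[of "Gm i" for i] lc0[of "S i" for i]

definition Qm :: "nat \<Rightarrow> nat \<Rightarrow> nat \<Rightarrow> 'r" where
  "Qm m i j = al * (L i j * e' m) - rl i m * (e' m * L i j)
     + (if m = i then cl * L n j - (\<Sum>c=1..N. pl i c * (e' c * L c j)) else 0)"
definition Sm :: "nat \<Rightarrow> 'r" where "Sm j = L n j - bl * (\<Sum>c=1..N. e' c * L c j)"
definition Tm :: "nat \<Rightarrow> nat \<Rightarrow> 'r" where "Tm m j = Sm j * e' m - al * (e' m * L n j)"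

text \<open>The mirror image of \<open>X_col\<close>: the last row of \<open>L'\<close> is a
  combination of the other rows, with coefficients \<open>e'\<close> on the left.\<close>

lemma X_row:
  assumes "i \<in> {1..N}" "j \<in> {1..N}" "l \<in> {1..N}"
  shows "X i n j l = (\<Sum>m=1..N. e' m * X i m j l) + (\<Sum>m=1..N. Qm m i j * L' m l)"
proof -
  define A where "A l = (\<Sum>m=1..N. e' m * L' m l)" for l
  define W where "W = (\<Sum>m=1..N. rl i m * (e' m * (L i j * L' m l)))"
  define V where "V = (\<Sum>m=1..N. pl i m * (e' m * L m j)) * L' i l"
  have 1: "(\<Sum>m=1..N. e' m * X i m j l) = W + V - rr j l * (A l * L i j) - pr l j * (A j * L i l)"
    unfolding X_def A_def W_def V_def
    by (simp add: sum.distrib sum_subtractf right_diff_distrib distrib_left sum_distrib_left sum_distrib_right lc mult.assoc)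
  have 2: "(\<Sum>m=1..N. Qm m i j * L' m l) = al * (L i j * A l) - W + cl * (L n j * L' i l) - V"
  proof -
    have "(\<Sum>m=1..N. Qm m i j * L' m l) = (\<Sum>m=1..N. al * (L i j * e' m) * L' m l)
       - (\<Sum>m=1..N. (rl i m * (e' m * L i j)) * L' m l)
       + (\<Sum>m=1..N. if m = i then (cl * L n j - (\<Sum>c=1..N. pl i c * (e' c * L c j))) * L' m l else 0)"
      unfolding Qm_def sum.distrib[symmetric] sum_subtractf[symmetric]
      by (intro sum.cong refl) (simp add: algebra_simps)
    also have "\<dots> = al * (L i j * A l) - W + (cl * (L n j * L' i l) - V)"
      using assms(1) by (simp add: A_def W_def V_def lc sum_distrib_left sum_distrib_right mult.assoc left_diff_distrib)
    finally show ?thesis by simp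
  qed
  have r: "rl i n = al" "pl i n = cl" using assms by (auto simp: rl_def pl_def)
  have a: "L' n l = A l" "L' n j = A j" using assms by (simp_all add: L'_row A_def)
  show ?thesis unfolding 1 2 unfolding X_def r a 
    by (simp add: algebra_simps)
qed

lemma X_row_last:
  assumes "j \<in> {1..N}" "l \<in> {1..N}"
  shows "X n n j l = (\<Sum>m=1..N. e' m * X n m j l) + (\<Sum>m=1..N. Tm m j * L' m l)"
proof -
  define A where "A l = (\<Sum>m=1..N. e' m * L' m l)" for l
  define B where "B = (\<Sum>m=1..N. e' m * L m j)"
  define W where "W = (\<Sum>m=1..N. e' m * (L n j * L' m l))"
  have r: "rl n m = al" "pl n m = bl" if "m \<in> {1..N}" for m using that by (auto simp: rl_def pl_def)
  have a: "L' n l = A l" "L' n j = A j" using assms by (simp_all add: L'_row A_def)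
  have "(\<Sum>m=1..N. e' m * X n m j l) = (\<Sum>m=1..N. al * (e' m * (L n j * L' m l)) + bl * (e' m * (L m j * A l))
     - rr j l * (e' m * (L' m l * L n j)) - pr l j * (e' m * (L' m j * L n l)))"
    unfolding X_def a by (intro sum.cong refl) (simp add: algebra_simps lc r)
  also have "\<dots> = al * W + bl * (B * A l) - rr j l * (A l * L n j) - pr l j * (A j * L n l)"
    unfolding W_def B_def A_def[of l] A_def[of j]
    by (simp add: sum.distrib sum_subtractf mult.assoc flip: sum_distrib_left sum_distrib_right)
       (simp add: mult.assoc sum_distrib_right)
  finally have 1: "(\<Sum>m=1..N. e' m * X n m j l) = al * W + bl * (B * A l) - rr j l * (A l * L n j) - pr l j * (A j * L n l)" .
  have 2: "(\<Sum>m=1..N. Tm m j * L' m l) = Sm j * A l - al * W"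
    unfolding Tm_def A_def W_def
    by (simp add: left_diff_distrib sum_subtractf sum_distrib_left mult.assoc)
  have 3: "Sm j = L n j - bl * B" by (simp add: Sm_def B_def)
  have r: "rl n n = 1" "pl n n = 0" by (auto simp: rl_def pl_def)
  show ?thesis unfolding 1 2 unfolding 3 X_def r a
    by (simp add: algebra_simps lc)
qed

section \<open>Relations between the Gauss factors\<close>

definition "rel_KK \<longleftrightarrow> (\<forall>i\<in>{1..N}. \<forall>m\<in>{1..N}. \<forall>j\<in>{1..N}. \<forall>l\<in>{1..N}. X i m j l = 0)"
definition "rel_KF \<longleftrightarrow> (\<forall>l\<in>{1..N}. \<forall>i\<in>{1..N}. \<forall>j\<in>{1..N}. Q l i j = 0)"
definition "rel_KE \<longleftrightarrow> (\<forall>m\<in>{1..N}. \<forall>i\<in>{1..N}. \<forall>j\<in>{1..N}. Qm m i j = 0)"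
definition "rel_FF \<longleftrightarrow> (\<forall>c\<in>{1..N}. \<forall>l\<in>{1..N}. rr c l * (f' l * G c) + pr c l * (f' c * G l)
   - br * (f c * G l) - ar * (ar * (f c * f' l)) = 0)"
definition "rel_EE \<longleftrightarrow> (\<forall>i\<in>{1..N}. \<forall>m\<in>{1..N}. rl i m * (Gm i * e' m) + pl m i * (Gm m * e' i)
   - cl * (Gm m * e i) - al * (al * (e' m * e i)) = 0)"
definition "rel_Kk \<longleftrightarrow> (\<forall>i\<in>{1..N}. \<forall>j\<in>{1..N}. al * (K i j * k') = ar * (k' * K i j))"
definition "rel_kF \<longleftrightarrow> (\<forall>i\<in>{1..N}. ar * (f i * k') + cr * (k' * f' i) = k' * f i)"
definition "rel_kE \<longleftrightarrow> (\<forall>i\<in>{1..N}. e i * k' = al * (k' * e i) + bl * (e' i * k'))"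
definition "rel_kk \<longleftrightarrow> k * k' = k' * k"
definition "rel_EF \<longleftrightarrow> (\<forall>i\<in>{1..N}. \<forall>l\<in>{1..N}. al * (ar * (e i * f' l - f' l * e i)) =
   al * (br * (k * Ki l i)) - ar * (bl * (Ki' l i * k')))"

lemma K_cancel: "(\<And>i. i \<in> {1..N} \<Longrightarrow> (\<Sum>a=1..N. K i a * y a) = 0) \<Longrightarrow> b \<in> {1..N} \<Longrightarrow> y b = 0"
  by (rule matrix_cancel_left[of "{1..N}" Ki K]) (use KiK in auto)
lemma K'_cancel: "(\<And>i. i \<in> {1..N} \<Longrightarrow> (\<Sum>a=1..N. K' i a * y a) = 0) \<Longrightarrow> b \<in> {1..N} \<Longrightarrow> y b = 0"
  by (rule matrix_cancel_left[of "{1..N}" Ki' K']) (use KiK' in auto)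
lemma K_cancel_right: "(\<And>j. j \<in> {1..N} \<Longrightarrow> (\<Sum>a=1..N. y a * K a j) = 0) \<Longrightarrow> b \<in> {1..N} \<Longrightarrow> y b = 0"
  by (rule matrix_cancel_right[of "{1..N}" K Ki]) (use KKi in auto)
lemma K'_cancel_right: "(\<And>j. j \<in> {1..N} \<Longrightarrow> (\<Sum>a=1..N. y a * K' a j) = 0) \<Longrightarrow> b \<in> {1..N} \<Longrightarrow> y b = 0"
  by (rule matrix_cancel_right[of "{1..N}" K' Ki']) (use KKi' in auto)

lemma L_K: "i \<in> {1..N} \<Longrightarrow> j \<in> {1..N} \<Longrightarrow> L i j = K i j" "i \<in> {1..N} \<Longrightarrow> j \<in> {1..N} \<Longrightarrow> L' i j = K' i j"
  by (simp_all add: L_def L'_def)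

lemma L_n: "i \<in> {1..N} \<Longrightarrow> L i n = (\<Sum>a=1..N. K i a * f a)" "j \<in> {1..N} \<Longrightarrow> L n j = (\<Sum>a=1..N. e a * K a j)"
   "i \<in> {1..N} \<Longrightarrow> L' i n = (\<Sum>a=1..N. K' i a * f' a)" "j \<in> {1..N} \<Longrightarrow> L' n j = (\<Sum>a=1..N. e' a * K' a j)"
  by (simp_all add: L_def L'_def)

text \<open>In \<open>X_col\<close> the terms with \<open>k'\<close> are absent for
  \<open>i, m \<le> N\<close>, and the terms \<open>X i m j l * f' l\<close> vanish by
  \<open>rel_KK\<close>; only \<open>K' Q\<close> is left, and \<open>K'\<close> can be
  cancelled.\<close>

lemma rel_KF_iff:
  assumes "rel_KK"
  shows "(\<forall>i\<in>{1..N}. \<forall>m\<in>{1..N}. \<forall>j\<in>{1..N}. X i m j n = 0) \<longleftrightarrow> rel_KF"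
proof -
  have *: "X i m j n = - (\<Sum>l=1..N. K' m l * Q l i j)" if "i \<in> {1..N}" "m \<in> {1..N}" "j \<in> {1..N}" for i m j
    using X_col[of j i m] that assms by (auto simp: rel_KK_def L_K)
  show ?thesis
  proof
    assume 0: "\<forall>i\<in>{1..N}. \<forall>m\<in>{1..N}. \<forall>j\<in>{1..N}. X i m j n = 0"
    show rel_KF unfolding rel_KF_def
    proof (intro ballI)
      fix l i j assume a: "l \<in> {1..N}" "i \<in> {1..N}" "j \<in> {1..N}"
      show "Q l i j = 0"
        by (rule K'_cancel[of "\<lambda>l. Q l i j"]) (use * 0 a in auto)
    qed
  next
    assume rel_KF then show "\<forall>i\<in>{1..N}. \<forall>m\<in>{1..N}. \<forall>j\<in>{1..N}. X i m j n = 0"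
      using * by (simp add: rel_KF_def)
  qed
qed

lemma rel_KE_iff:
  assumes "rel_KK"
  shows "(\<forall>i\<in>{1..N}. \<forall>j\<in>{1..N}. \<forall>l\<in>{1..N}. X i n j l = 0) \<longleftrightarrow> rel_KE"
proof -
  have *: "X i n j l = (\<Sum>m=1..N. Qm m i j * K' m l)" if "i \<in> {1..N}" "l \<in> {1..N}" "j \<in> {1..N}" for i l j
    using X_row[of i j l] that assms by (auto simp: rel_KK_def L_K)
  show ?thesis
  proof
    assume 0: "\<forall>i\<in>{1..N}. \<forall>j\<in>{1..N}. \<forall>l\<in>{1..N}. X i n j l = 0"
    show rel_KE unfolding rel_KE_def
    proof (intro ballI)
      fix m i j assume a: "m \<in> {1..N}" "i \<in> {1..N}" "j \<in> {1..N}"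
      show "Qm m i j = 0"
        by (rule K'_cancel_right[of "\<lambda>m. Qm m i j"]) (use * 0 a in auto)
    qed
  next
    assume rel_KE then show "\<forall>i\<in>{1..N}. \<forall>j\<in>{1..N}. \<forall>l\<in>{1..N}. X i n j l = 0"
      using * by (simp add: rel_KE_def)
  qed
qed

lemma S_eq: "i \<in> {1..N} \<Longrightarrow> S i = (\<Sum>c=1..N. K i c * G c)"
  by (simp add: S_def G_def L_n L_K right_diff_distrib sum_subtractf lc flip: sum_distrib_left)
lemma Sm_eq: "j \<in> {1..N} \<Longrightarrow> Sm j = (\<Sum>c=1..N. Gm c * K c j)"
  by (simp add: Sm_def Gm_def L_n L_K left_diff_distrib sum_subtractf lc mult.assoc flip: sum_distrib_left)

text \<open>\<open>Q = 0\<close> moves \<open>f'\<close> past \<open>K\<close> at the price of a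
  factor \<open>ar\<close>; this is why \<open>T\<close> is multiplied by \<open>ar\<close>.
  Afterwards \<open>K\<close> is a common left factor.\<close>

lemma ar_T:
  assumes rel_KF "i \<in> {1..N}" "l \<in> {1..N}"
  shows "ar * T l i = (\<Sum>c=1..N. K i c * (rr c l * (f' l * G c) + pr c l * (f' c * G l)
   - br * (f c * G l) - ar * (ar * (f c * f' l))))"
proof -
  have Q: "ar * (f' l * K i c) = rr c l * (K i c * f' l) - (if l = c then br * L i n - (\<Sum>d=1..N. pr d c * (K i d * f' d)) else 0)"
    if "c \<in> {1..N}" for c
  proof -
    have "Q l i c = 0" using assms that by (auto simp: rel_KF_def)
    then show ?thesis using assms that unfolding Q_def by (cases "l = c") (simp_all add: L_K algebra_simps)
  qed
  have "ar * (f' l * S i) = (\<Sum>c=1..N. (ar * (f' l * K i c)) * G c)"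
    using assms by (simp add: S_eq sum_distrib_left mult.assoc)
  also have "\<dots> = (\<Sum>c=1..N. rr c l * (K i c * f' l) * G c - (if l = c then (br * L i n - (\<Sum>d=1..N. pr d c * (K i d * f' d))) * G c else 0))"
    by (intro sum.cong refl) (subst Q, auto simp: left_diff_distrib)
  also have "\<dots> = (\<Sum>c=1..N. rr c l * (K i c * f' l) * G c) - (br * L i n - (\<Sum>d=1..N. pr d l * (K i d * f' d))) * G l"
    using assms by (simp add: sum_subtractf)
  finally have 1: "ar * (f' l * S i) = \<dots>" .
  show ?thesis unfolding T_def right_diff_distrib 1 using assms
    by (simp add: L_n sum.distrib sum_subtractf sum_distrib_left sum_distrib_right lc mult.assoc algebra_simps)
qed

lemma rel_FF_iff:
  assumes "\<And>i m l. i \<in> {1..N} \<Longrightarrow> m \<in> {1..N} \<Longrightarrow> l \<in> {1..N} \<Longrightarrow> X i m n l = 0" and rel_KF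
  shows "(\<forall>i\<in>{1..N}. \<forall>m\<in>{1..N}. X i m n n = 0) \<longleftrightarrow> rel_FF" and "rel_FF \<Longrightarrow> i \<in> {1..N} \<Longrightarrow> l \<in> {1..N} \<Longrightarrow> T l i = 0"
proof -
  have *: "X i m n n = - (\<Sum>l=1..N. K' m l * T l i)" if "i \<in> {1..N}" "m \<in> {1..N}" for i m
    using X_col_last[of i m] that assms by (auto simp: L_K)
  show T: "T l i = 0" if rel_FF "i \<in> {1..N}" "l \<in> {1..N}" for i l
  proof (rule ar_cancel)
    show "ar * T l i = 0" using that unfolding rel_FF_def by (subst ar_T[OF assms(2)]) auto
  qed
  show "(\<forall>i\<in>{1..N}. \<forall>m\<in>{1..N}. X i m n n = 0) \<longleftrightarrow> rel_FF"
  proof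
    assume 0: "\<forall>i\<in>{1..N}. \<forall>m\<in>{1..N}. X i m n n = 0"
    have T: "T l i = 0" if "i \<in> {1..N}" "l \<in> {1..N}" for l i
      by (rule K'_cancel[of "\<lambda>l. T l i"]) (use * 0 that in auto)
    show rel_FF unfolding rel_FF_def
    proof (intro ballI)
      fix c l assume a: "c \<in> {1..N}" "l \<in> {1..N}"
      show "rr c l * (f' l * G c) + pr c l * (f' c * G l) - br * (f c * G l) - ar * (ar * (f c * f' l)) = 0"
        by (rule K_cancel[of "\<lambda>c. rr c l * (f' l * G c) + pr c l * (f' c * G l) - br * (f c * G l) - ar * (ar * (f c * f' l))"])
           (use a in \<open>simp_all only: ar_T[OF assms(2), symmetric] T mult_zero_right\<close>)
    qed
  next
    assume rel_FF then show "\<forall>i\<in>{1..N}. \<forall>m\<in>{1..N}. X i m n n = 0"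
      using * T by simp
  qed
qed

lemma al_Tm:
  assumes rel_KE "j \<in> {1..N}" "m \<in> {1..N}"
  shows "al * Tm m j = (\<Sum>i=1..N. (rl i m * (Gm i * e' m) + pl m i * (Gm m * e' i)
   - cl * (Gm m * e i) - al * (al * (e' m * e i))) * K i j)"
proof -
  have Q: "al * (K i j * e' m) = rl i m * (e' m * K i j) - (if m = i then cl * L n j - (\<Sum>c=1..N. pl i c * (e' c * K c j)) else 0)"
    if "i \<in> {1..N}" for i
  proof -
    have "Qm m i j = 0" using assms that by (auto simp: rel_KE_def)
    then show ?thesis using assms that unfolding Qm_def by (cases "m = i") (simp_all add: L_K algebra_simps)
  qed
  have "al * (Sm j * e' m) = (\<Sum>i=1..N. Gm i * (al * (K i j * e' m)))"
    using assms by (simp add: Sm_eq sum_distrib_left sum_distrib_right mult.assoc lc lc_G)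
  also have "\<dots> = (\<Sum>i=1..N. Gm i * (rl i m * (e' m * K i j)) - (if m = i then Gm i * (cl * L n j - (\<Sum>c=1..N. pl i c * (e' c * K c j))) else 0))"
    by (intro sum.cong refl) (subst Q, auto simp: right_diff_distrib)
  also have "\<dots> = (\<Sum>i=1..N. Gm i * (rl i m * (e' m * K i j))) - Gm m * (cl * L n j - (\<Sum>c=1..N. pl m c * (e' c * K c j)))"
    using assms by (simp add: sum_subtractf)
  finally have 1: "al * (Sm j * e' m) = \<dots>" .
  show ?thesis unfolding Tm_def right_diff_distrib 1 using assms
    by (simp add: L_n sum.distrib sum_subtractf sum_distrib_left sum_distrib_right lc lc_G mult.assoc algebra_simps)
qed

lemma rel_EE_iff:
  assumes "\<And>j m l. j \<in> {1..N} \<Longrightarrow> m \<in> {1..N} \<Longrightarrow> l \<in> {1..N} \<Longrightarrow> X n m j l = 0" and rel_KE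
  shows "(\<forall>j\<in>{1..N}. \<forall>l\<in>{1..N}. X n n j l = 0) \<longleftrightarrow> rel_EE"
proof -
  have *: "X n n j l = (\<Sum>m=1..N. Tm m j * K' m l)" if "j \<in> {1..N}" "l \<in> {1..N}" for j l
    using X_row_last[of j l] that assms by (auto simp: L_K)
  show ?thesis
  proof
    assume 0: "\<forall>j\<in>{1..N}. \<forall>l\<in>{1..N}. X n n j l = 0"
    have T: "Tm m j = 0" if "j \<in> {1..N}" "m \<in> {1..N}" for m j
      by (rule K'_cancel_right[of "\<lambda>m. Tm m j"]) (use * 0 that in auto)
    show rel_EE unfolding rel_EE_def
    proof (intro ballI)
      fix i m assume a: "i \<in> {1..N}" "m \<in> {1..N}"
      show "rl i m * (Gm i * e' m) + pl m i * (Gm m * e' i) - cl * (Gm m * e i) - al * (al * (e' m * e i)) = 0"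
        by (rule K_cancel_right[of "\<lambda>i. rl i m * (Gm i * e' m) + pl m i * (Gm m * e' i) - cl * (Gm m * e i) - al * (al * (e' m * e i))"])
           (use a in \<open>simp_all only: al_Tm[OF assms(2), symmetric] T mult_zero_right\<close>)
    qed
  next
    assume r: rel_EE
    have T: "Tm m j = 0" if "j \<in> {1..N}" "m \<in> {1..N}" for m j
    proof (rule al_cancel)
      show "al * Tm m j = 0" using that r unfolding rel_EE_def by (subst al_Tm[OF assms(2)]) auto
    qed
    then show "\<forall>j\<in>{1..N}. \<forall>l\<in>{1..N}. X n n j l = 0"
      using * by simp
  qed
qed

lemma rel_Kk_iff:
  assumes "\<And>i j l. i \<in> {1..N} \<Longrightarrow> j \<in> {1..N} \<Longrightarrow> l \<in> {1..N} \<Longrightarrow> X i n j l = 0" and rel_KF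
  shows "(\<forall>i\<in>{1..N}. \<forall>j\<in>{1..N}. X i n j n = 0) \<longleftrightarrow> rel_Kk"
proof -
  have *: "X i n j n = al * (K i j * k') - ar * (k' * K i j)" if "i \<in> {1..N}" "j \<in> {1..N}" for i j
    using X_col[of j i n] that assms by (auto simp: L_K rel_KF_def rl_def)
  show ?thesis unfolding rel_Kk_def by (intro ball_cong refl) (simp add: *)
qed

text \<open>Row \<open>n\<close> of \<open>L\<close> is \<open>e\<close> times the other rows plus
  \<open>k\<close>. Subtracting \<open>e i * Q l i j = 0\<close> leaves the commutators of
  \<open>e\<close> with \<open>f'\<close> and the contribution of \<open>k\<close>.\<close>

lemma Q_n:
  assumes rel_KF "j \<in> {1..N}" "l \<in> {1..N}"
  shows "Q l n j = (\<Sum>i=1..N. ar * ((f' l * e i - e i * f' l) * K i j)) + (if l = j then br * k else 0)"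
proof -
  have "0 = (\<Sum>i=1..N. e i * Q l i j)" using assms by (simp add: rel_KF_def)
  also have "\<dots> = (\<Sum>i=1..N. ar * (e i * (f' l * K i j))) - rr j l * (\<Sum>i=1..N. e i * (K i j * f' l))
    + (if l = j then br * (\<Sum>i=1..N. e i * L i n) - (\<Sum>i=1..N. e i * (\<Sum>c=1..N. pr c j * (K i c * f' c))) else 0)"
    unfolding Q_def using assms
    by (simp add: distrib_left right_diff_distrib sum.distrib sum_subtractf lc L_K sum_distrib_left)
  also have "(\<Sum>i=1..N. e i * (\<Sum>c=1..N. pr c j * (K i c * f' c))) = (\<Sum>c=1..N. pr c j * (L n c * f' c))"
    by (simp add: sum_distrib_left sum_distrib_right lc L_n mult.assoc) (rule sum.swap)
  also have "(\<Sum>i=1..N. e i * L i n) = L n n - k" using L_row[of n] by simp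
  also have "(\<Sum>i=1..N. e i * (K i j * f' l)) = L n j * f' l" using assms by (simp add: L_n sum_distrib_right mult.assoc)
  finally have "(\<Sum>i=1..N. ar * (e i * (f' l * K i j))) = rr j l * (L n j * f' l) 
    - (if l = j then br * (L n n - k) - (\<Sum>c=1..N. pr c j * (L n c * f' c)) else 0)" by (simp add: algebra_simps)
  moreover have "(\<Sum>i=1..N. ar * (f' l * (e i * K i j))) = ar * (f' l * L n j)"
    using assms by (simp add: L_n sum_distrib_left)
  ultimately show ?thesis unfolding Q_def
    by (simp add: left_diff_distrib right_diff_distrib sum_subtractf mult.assoc)
qed

lemma rel_EF_iff:
  assumes "\<And>j m l. j \<in> {1..N} \<Longrightarrow> m \<in> {1..N} \<Longrightarrow> l \<in> {1..N} \<Longrightarrow> X n m j l = 0" and rel_KF rel_Kk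
  shows "(\<forall>m\<in>{1..N}. \<forall>j\<in>{1..N}. X n m j n = 0) \<longleftrightarrow> rel_EF"
proof -
  \<comment> \<open>For \<open>i = n\<close>, \<open>X_col\<close> contains a term with
    \<open>K m j * k'\<close> that lacks the left factor \<open>K'\<close>. Inserting
    \<open>K' Ki' = 1\<close> provides it, so that \<open>K'\<close> can be cancelled from
    everything.\<close>
  define Z where "Z l j = Q l n j - bl * (\<Sum>m=1..N. Ki' l m * K m j * k')" for l j
  have X: "X n m j n = - (\<Sum>l=1..N. K' m l * Z l j)" if "m \<in> {1..N}" "j \<in> {1..N}" for m j
  proof -
    have "(\<Sum>l=1..N. K' m l * (bl * (\<Sum>a=1..N. Ki' l a * K a j * k'))) = bl * (\<Sum>a=1..N. (\<Sum>l=1..N. K' m l * Ki' l a) * (K a j * k'))"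
      by (simp add: sum_distrib_left sum_distrib_right lc mult.assoc) (rule sum.swap)
    also have "(\<Sum>a=1..N. (\<Sum>l=1..N. K' m l * Ki' l a) * (K a j * k')) = (\<Sum>a=1..N. (if m = a then 1 else 0) * (K a j * k'))"
      by (intro sum.cong refl) (simp only: KKi' that)
    also have "\<dots> = K m j * k'" using that by (simp add: sum_delta_mult)
    finally show ?thesis using X_col[of j n m] that assms(1)
      by (auto simp: Z_def right_diff_distrib sum_subtractf L_K pl_def)
  qed
  \<comment> \<open>\<open>rel_Kk\<close> brings \<open>k'\<close> to the left of \<open>K\<close>;
    then \<open>K\<close> is a right factor of all terms and can be cancelled as well.\<close>
  have Z: "al * Z l j = (\<Sum>i=1..N. - (al * (ar * (e i * f' l - f' l * e i)) - (al * (br * (k * Ki l i)) - ar * (bl * (Ki' l i * k')))) * K i j)"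
    if "l \<in> {1..N}" "j \<in> {1..N}" for l j
  proof -
    have 1: "al * (bl * (\<Sum>m=1..N. Ki' l m * K m j * k')) = (\<Sum>m=1..N. ar * (bl * (Ki' l m * k')) * K m j)"
      unfolding sum_distrib_left
    proof (intro sum.cong refl)
      fix m assume "m \<in> {1..N}"
      then have "al * (K m j * k') = ar * (k' * K m j)" using assms(3) that by (simp add: rel_Kk_def)
      then have "bl * (Ki' l m * (al * (K m j * k'))) = bl * (Ki' l m * (ar * (k' * K m j)))" by simp
      then show "al * (bl * (Ki' l m * K m j * k')) = ar * (bl * (Ki' l m * k')) * K m j"
        by (simp add: lc mult.assoc)
    qed
    have 2: "al * (if l = j then br * k else 0) = (\<Sum>i=1..N. al * (br * (k * Ki l i)) * K i j)"
      using KiK[of l j] that by (simp add: mult.assoc flip: sum_distrib_left)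
    show ?thesis
      unfolding Z_def right_diff_distrib 1 Q_n[OF assms(2) that(2,1)] distrib_left 2
      by (simp add: sum_distrib_left sum.distrib sum_subtractf sum_negf algebra_simps lc)
  qed
  show ?thesis
  proof
    assume 0: "\<forall>m\<in>{1..N}. \<forall>j\<in>{1..N}. X n m j n = 0"
    have Z0: "Z l j = 0" if "l \<in> {1..N}" "j \<in> {1..N}" for l j
      by (rule K'_cancel[of "\<lambda>l. Z l j"]) (use X 0 that in auto)
    show rel_EF unfolding rel_EF_def
    proof (intro ballI)
      fix i l assume a: "i \<in> {1..N}" "l \<in> {1..N}"
      have "- (al * (ar * (e i * f' l - f' l * e i)) - (al * (br * (k * Ki l i)) - ar * (bl * (Ki' l i * k')))) = 0"
        by (rule K_cancel_right[of "\<lambda>i. - (al * (ar * (e i * f' l - f' l * e i)) - (al * (br * (k * Ki l i)) - ar * (bl * (Ki' l i * k'))))"])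
          (use a Z Z0 in auto)
      then show "al * (ar * (e i * f' l - f' l * e i)) = al * (br * (k * Ki l i)) - ar * (bl * (Ki' l i * k'))" by simp
    qed
  next
    assume r: rel_EF
    have "Z l j = 0" if "l \<in> {1..N}" "j \<in> {1..N}" for l j
      by (rule al_cancel) (use Z[OF that] r that in \<open>simp add: rel_EF_def\<close>)
    then show "\<forall>m\<in>{1..N}. \<forall>j\<in>{1..N}. X n m j n = 0" by (simp add: X)
  qed
qed

lemma K_G_k':
  assumes rel_Kk "i \<in> {1..N}"
  shows "al * (\<Sum>c=1..N. K i c * (k' * G c)) = ar * (k' * (\<Sum>c=1..N. K i c * G c))"
  unfolding sum_distrib_left
proof (intro sum.cong refl)
  fix c assume "c \<in> {1..N}"
  then have "al * (K i c * k') * G c = ar * (k' * K i c) * G c" using assms by (simp add: rel_Kk_def)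
  then show "al * (K i c * (k' * G c)) = ar * (k' * (K i c * G c))" by (simp add: mult.assoc)
qed

text \<open>\<open>T = 0\<close> removes \<open>L'\<close> from \<open>X_col_last\<close> and leaves
  \<open>k'\<close> on the two sides of the last column of \<open>L\<close>. \<open>K\<close> is
  taken out on the left with \<open>K_G_k'\<close>, at the price of the factors \<open>ar\<close>
  and \<open>al\<close>.\<close>

lemma rel_kF_iff:
  assumes "\<And>i l. i \<in> {1..N} \<Longrightarrow> l \<in> {1..N} \<Longrightarrow> X i n n l = 0" and T: "\<And>i l. i \<in> {1..N} \<Longrightarrow> l \<in> {1..N} \<Longrightarrow> T l i = 0" and rel_Kk
  shows "(\<forall>i\<in>{1..N}. X i n n n = 0) \<longleftrightarrow> rel_kF"
proof -
  have X: "ar * X i n n n = al * (\<Sum>c=1..N. K i c * (ar * (f c * k') + cr * (k' * f' c) - k' * f c))" if "i \<in> {1..N}" for i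
  proof -
    have "ar * X i n n n = al * (ar * (L i n * k')) - ar * (k' * S i)"
      using X_col_last[of i n] that assms by (auto simp: rl_def right_diff_distrib lc)
    also have "ar * (k' * S i) = al * (\<Sum>c=1..N. K i c * (k' * G c))"
      using K_G_k'[OF assms(3) that] that by (simp add: S_eq)
    finally show ?thesis using that
      by (simp add: G_def L_n algebra_simps sum.distrib sum_subtractf sum_distrib_left sum_distrib_right lc mult.assoc)
  qed
  show ?thesis
  proof
    assume 0: "\<forall>i\<in>{1..N}. X i n n n = 0"
    have "(\<Sum>c=1..N. K i c * (ar * (f c * k') + cr * (k' * f' c) - k' * f c)) = 0" if "i \<in> {1..N}" for i
      by (rule al_cancel) (use X[OF that] 0 that in simp)
    then have "ar * (f c * k') + cr * (k' * f' c) - k' * f c = 0" if "c \<in> {1..N}" for c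
      using K_cancel[of "\<lambda>c. ar * (f c * k') + cr * (k' * f' c) - k' * f c" c] that by simp
    then show rel_kF by (simp add: rel_kF_def)
  next
    assume rel_kF
    then have "ar * X i n n n = 0" if "i \<in> {1..N}" for i by (simp add: X[OF that] rel_kF_def)
    then show "\<forall>i\<in>{1..N}. X i n n n = 0" using ar_cancel by blast
  qed
qed

text \<open>\<open>Q l n j\<close> enters \<open>X n n j n\<close> multiplied by row
  \<open>n\<close> of \<open>L'\<close>, which is \<open>e' K'\<close>; the product
  \<open>K' Q\<close> is already known from the entries \<open>X n m j n = 0\<close>.\<close>

lemma L'_n_Q:
  assumes "\<And>j m l. j \<in> {1..N} \<Longrightarrow> m \<in> {1..N} \<Longrightarrow> l \<in> {1..N} \<Longrightarrow> X n m j l = 0"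
    and "\<And>m j. m \<in> {1..N} \<Longrightarrow> j \<in> {1..N} \<Longrightarrow> X n m j n = 0" and j: "j \<in> {1..N}"
  shows "(\<Sum>l=1..N. L' n l * Q l n j) = bl * (\<Sum>m=1..N. e' m * (K m j * k'))"
proof -
  have *: "(\<Sum>l=1..N. K' m l * Q l n j) = bl * (K m j * k')" if "m \<in> {1..N}" for m
    using X_col[of j n m] that j assms by (auto simp: L_K pl_def)
  have "(\<Sum>l=1..N. L' n l * Q l n j) = (\<Sum>m=1..N. e' m * (\<Sum>l=1..N. K' m l * Q l n j))"
    by (simp add: L_n sum_distrib_left sum_distrib_right mult.assoc) (rule sum.swap)
  also have "\<dots> = (\<Sum>m=1..N. bl * (e' m * (K m j * k')))" by (intro sum.cong refl) (simp only: * lc)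
  finally show ?thesis by (simp add: sum_distrib_left)
qed

lemma rel_kE_iff:
  assumes "\<And>j m l. j \<in> {1..N} \<Longrightarrow> m \<in> {1..N} \<Longrightarrow> l \<in> {1..N} \<Longrightarrow> X n m j l = 0"
    and "\<And>m j. m \<in> {1..N} \<Longrightarrow> j \<in> {1..N} \<Longrightarrow> X n m j n = 0"
    and "\<And>j l. j \<in> {1..N} \<Longrightarrow> l \<in> {1..N} \<Longrightarrow> X n n j l = 0" and rel_Kk
  shows "(\<forall>j\<in>{1..N}. X n n j n = 0) \<longleftrightarrow> rel_kE"
proof -
  have X: "al * X n n j n = ar * (\<Sum>i=1..N. (e i * k' - al * (k' * e i) - bl * (e' i * k')) * K i j)" if j: "j \<in> {1..N}" for j
  proof -
    have "X n n j n = L n j * k' - ar * (k' * L n j) - bl * (\<Sum>m=1..N. e' m * (K m j * k'))"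
      using X_col[of j n n] j assms(3) L'_n_Q[OF assms(1,2) j] by (auto simp: rl_def pl_def)
    also have "\<dots> = (\<Sum>i=1..N. Gm i * (K i j * k')) - ar * (k' * L n j)"
      using j by (simp add: Gm_def L_n sum_distrib_left sum_distrib_right sum_subtractf left_diff_distrib mult.assoc)
    finally have "al * X n n j n = (\<Sum>i=1..N. Gm i * (al * (K i j * k'))) - ar * (al * (k' * L n j))"
      by (simp add: right_diff_distrib sum_distrib_left lc lc_G)
    also have "(\<Sum>i=1..N. Gm i * (al * (K i j * k'))) = (\<Sum>i=1..N. Gm i * (ar * (k' * K i j)))"
      using assms(4) j by (simp add: rel_Kk_def)
    finally show ?thesis using j
      by (simp add: Gm_def L_n algebra_simps sum.distrib sum_subtractf sum_distrib_left sum_distrib_right lc mult.assoc)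
  qed
  show ?thesis
  proof
    assume 0: "\<forall>j\<in>{1..N}. X n n j n = 0"
    have "(\<Sum>i=1..N. (e i * k' - al * (k' * e i) - bl * (e' i * k')) * K i j) = 0" if "j \<in> {1..N}" for j
      by (rule ar_cancel) (use X[OF that] 0 that in simp)
    then have "e i * k' - al * (k' * e i) - bl * (e' i * k') = 0" if "i \<in> {1..N}" for i
      using K_cancel_right[of "\<lambda>i. e i * k' - al * (k' * e i) - bl * (e' i * k')" i] that by simp
    then show rel_kE by (simp add: rel_kE_def algebra_simps)
  next
    assume rel_kE
    then have "al * X n n j n = 0" if "j \<in> {1..N}" for j by (simp add: X[OF that] rel_kE_def)
    then show "\<forall>j\<in>{1..N}. X n n j n = 0" using al_cancel by blast
  qed
qed

text \<open>Besides the commutator of \<open>k\<close> and \<open>k'\<close>, the corner entry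
  contains a sum in which \<open>k'\<close> stands to the right or to the left of
  \<open>e K f\<close>. Moving \<open>k'\<close> through the three factors with
  \<open>rel_kE\<close>, \<open>rel_Kk\<close> and \<open>rel_kF\<close> makes each term of this sum
  vanish.\<close>

lemma rel_kk_iff:
  assumes Xl: "\<And>l. l \<in> {1..N} \<Longrightarrow> X n n n l = 0"
    and Xm: "\<And>m l. m \<in> {1..N} \<Longrightarrow> l \<in> {1..N} \<Longrightarrow> X n m n l = 0"
    and Xn: "\<And>m. m \<in> {1..N} \<Longrightarrow> X n m n n = 0" and Kk: rel_Kk and kF: rel_kF and kE: rel_kE
  shows "X n n n n = 0 \<longleftrightarrow> rel_kk"
proof -
  have *: "(\<Sum>l=1..N. K' m l * T l n) = bl * (L m n * k')" if "m \<in> {1..N}" for m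
    using X_col_last[of n m] that Xm Xn by (auto simp: L_K pl_def)
  have "(\<Sum>l=1..N. L' n l * T l n) = (\<Sum>m=1..N. e' m * (\<Sum>l=1..N. K' m l * T l n))"
    by (simp add: L_n sum_distrib_left sum_distrib_right mult.assoc) (rule sum.swap)
  also have "\<dots> = (\<Sum>m=1..N. bl * (e' m * (L m n * k')))" by (intro sum.cong refl) (simp only: * lc)
  finally have 1: "(\<Sum>l=1..N. L' n l * T l n) = bl * (\<Sum>m=1..N. e' m * (L m n * k'))" by (simp add: sum_distrib_left)
  have Lnn: "L n n = (\<Sum>m=1..N. e m * L m n) + k" using L_row[of n] by simp
  have Sn: "S n = (\<Sum>m=1..N. e m * S m) + k"
  proof -
    have "(\<Sum>c=1..N. L n c * f' c) = (\<Sum>m=1..N. e m * (\<Sum>c=1..N. K m c * f' c))"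
      by (simp add: L_n sum_distrib_left sum_distrib_right mult.assoc) (rule sum.swap)
    then show ?thesis unfolding S_def Lnn
      by (simp add: L_K right_diff_distrib sum_subtractf lc sum_distrib_left)
  qed
  have X: "X n n n n = (k * k' - k' * k) + (\<Sum>m=1..N. Gm m * (L m n * k') - k' * (e m * S m))"
    using X_col_last[of n n] Xl 1 unfolding Sn Lnn
    by (simp add: rl_def pl_def Gm_def algebra_simps sum.distrib sum_subtractf sum_distrib_left sum_distrib_right)
  have "ar * (al * (Gm m * (L m n * k') - k' * (e m * S m))) = 0" if m: "m \<in> {1..N}" for m
  proof -
    have "Gm m * k' = al * (k' * e m)" using kE m by (simp add: rel_kE_def Gm_def algebra_simps)
    then have e: "Gm m * (k' * y) = al * (k' * (e m * y))" for y by (simp flip: mult.assoc)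
    have "ar * (L m n * k') = (\<Sum>c=1..N. K m c * (ar * (f c * k')))"
      using m by (simp add: L_n sum_distrib_left sum_distrib_right lc mult.assoc)
    also have "\<dots> = (\<Sum>c=1..N. K m c * (k' * G c))"
    proof (intro sum.cong refl)
      fix c assume "c \<in> {1..N}"
      then have "ar * (f c * k') = k' * G c" using kF by (auto simp: rel_kF_def G_def algebra_simps lc eq_diff_eq)
      then show "K m c * (ar * (f c * k')) = K m c * (k' * G c)" by simp
    qed
    finally have "al * (ar * (L m n * k')) = ar * (k' * S m)"
      using K_G_k'[OF Kk m] m by (simp add: S_eq)
    then have "Gm m * (al * (ar * (L m n * k'))) = Gm m * (ar * (k' * S m))" by simp
    then show ?thesis by (simp add: right_diff_distrib lc lc_G e)
  qed
  then have "Gm m * (L m n * k') - k' * (e m * S m) = 0" if "m \<in> {1..N}" for m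
    using that al_cancel ar_cancel by blast
  then have "X n n n n = k * k' - k' * k" unfolding X by simp
  then show ?thesis by (simp add: rel_kk_def)
qed

definition "rels \<longleftrightarrow> rel_KK \<and> rel_KF \<and> rel_KE \<and> rel_FF \<and> rel_EE \<and> rel_Kk \<and> rel_kF \<and> rel_kE \<and> rel_kk \<and> rel_EF"

lemma X_rels:
  assumes X: "\<And>i m j l. i \<in> {1..n} \<Longrightarrow> m \<in> {1..n} \<Longrightarrow> j \<in> {1..n} \<Longrightarrow> l \<in> {1..n} \<Longrightarrow> X i m j l = 0"
  shows rels
proof -
  have X1: "X i m j l = 0" if "i = n \<or> i \<in> {1..N}" "m = n \<or> m \<in> {1..N}" "j = n \<or> j \<in> {1..N}" "l = n \<or> l \<in> {1..N}" for i m j l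
    by (rule X) (use that in auto)
  have KK: rel_KK unfolding rel_KK_def using X1 by blast
  have KF: rel_KF using X1 rel_KF_iff[OF KK] by blast
  have KE: rel_KE using X1 rel_KE_iff[OF KK] by blast
  have FF: rel_FF using X1 rel_FF_iff(1)[OF _ KF] by blast
  have EE: rel_EE using X1 rel_EE_iff[OF _ KE] by blast
  have Kk: rel_Kk using X1 rel_Kk_iff[OF _ KF] by blast
  have EF: rel_EF using X1 rel_EF_iff[OF _ KF Kk] by blast
  have kF: rel_kF using X1 rel_kF_iff[OF _ rel_FF_iff(2)[OF _ KF FF] Kk] by blast
  have kE: rel_kE using X1 rel_kE_iff[OF _ _ _ Kk] by blast
  have kk: rel_kk using X1 rel_kk_iff[OF _ _ _ Kk kF kE] by blast
  show ?thesis unfolding rels_def using KK KF KE FF EE Kk EF kF kE kk by blast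
qed

end

section \<open>Exchange of the two factors and unitarity\<close>

locale rpair2 = P: rpair N al bl cl ar br cr K Ki k e f K' Ki' k' e' f' + W: rpair N al' bl' cl' ar' br' cr' K' Ki' k' e' f' K Ki k e f
  for N :: nat and al bl cl ar br cr al' bl' cl' ar' br' cr' :: "'r::ring_1"
    and K Ki :: "nat \<Rightarrow> nat \<Rightarrow> 'r" and k :: 'r and e f :: "nat \<Rightarrow> 'r"
    and K' Ki' :: "nat \<Rightarrow> nat \<Rightarrow> 'r" and k' :: 'r and e' f' :: "nat \<Rightarrow> 'r" +
  assumes ul: "al' * al + cl' * cl = 1" "al' * al + bl' * bl = 1" "al' * bl + cl' * al = 0" "al' * cl + bl' * al = 0"
    and ur: "ar' * ar + cr' * cr = 1" "ar' * ar + br' * br = 1" "ar' * br + cr' * ar = 0" "ar' * cr + br' * ar = 0"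
begin

abbreviation "n \<equiv> Suc N"

lemma sym: "rpair2 N al' bl' cl' ar' br' cr' al bl cl ar br cr K' Ki' K Ki"
  using ul ur by unfold_locales (simp_all add: add.commute
    W.cen_simps(1)[of al] W.cen_simps(1)[of bl] W.cen_simps(1)[of cl] W.cen_simps(2)[of al] W.cen_simps(2)[of bl]
    W.cen_simps(3)[of al] W.cen_simps(3)[of cl] W.cen_simps(4)[of ar] W.cen_simps(4)[of br] W.cen_simps(4)[of cr]
    W.cen_simps(5)[of ar] W.cen_simps(5)[of br] W.cen_simps(6)[of ar] W.cen_simps(6)[of cr])

lemma unitary_scalars:
  fixes a b c a' b' c' y1 y2 :: 'r
  assumes "a' * a + c' * c = 1" "a' * a + b' * b = 1" "a' * b + c' * a = 0" "a' * c + b' * a = 0"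
  shows "a' * (a * y1 + b * y2) + c' * (a * y2 + c * y1) = y1" "a' * (a * y1 + c * y2) + b' * (a * y2 + b * y1) = y1"
proof -
  have "a' * (a * y1 + b * y2) + c' * (a * y2 + c * y1) = (a' * a + c' * c) * y1 + (a' * b + c' * a) * y2"
    by (simp add: algebra_simps)
  then show "a' * (a * y1 + b * y2) + c' * (a * y2 + c * y1) = y1" by (simp add: assms)
  have "a' * (a * y1 + c * y2) + b' * (a * y2 + b * y1) = (a' * a + b' * b) * y1 + (a' * c + b' * a) * y2"
    by (simp add: algebra_simps)
  then show "a' * (a * y1 + c * y2) + b' * (a * y2 + b * y1) = y1" by (simp add: assms)
qed

lemma unitary:
  "W.rl i m * (P.rl i m * y1 + P.pl i m * y2) + W.pl m i * (P.rl m i * y2 + P.pl m i * y1) = y1"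
  "W.rl i m * (P.rl i m * y1 + P.pl m i * y2) + W.pl i m * (P.rl m i * y2 + P.pl i m * y1) = y1"
  "W.rr i m * (P.rr i m * y1 + P.pr i m * y2) + W.pr m i * (P.rr m i * y2 + P.pr m i * y1) = y1"
  "W.rr i m * (P.rr i m * y1 + P.pr m i * y2) + W.pr i m * (P.rr m i * y2 + P.pr i m * y1) = y1"
  unfolding P.rl_def W.rl_def P.pl_def W.pl_def P.rr_def W.rr_def P.pr_def W.pr_def
  using unitary_scalars[OF ul, of y1 y2] unitary_scalars[OF ur, of y1 y2]
  by (cases i m rule: linorder_cases; simp)+

lemma W_L: "W.L = P.L'" "W.L' = P.L"
  by (simp_all add: fun_eq_iff W.L_def P.L_def W.L'_def P.L'_def)

text \<open>By unitarity the inverses of the two R-matrices are the flipped R-matrices of the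
  exchanged pair. Multiplying \<open>R L_1 L'_2 - L'_2 L_1 R'\<close> by both inverses therefore
  exchanges the two products and changes the sign.\<close>

lemma X_swap:
  "W.X m i l j = - (W.rl i m * (W.rr j l * P.X i m j l + W.pr j l * P.X i m l j)
     + W.pl m i * (W.rr j l * P.X m i j l + W.pr j l * P.X m i l j))"
proof -
  define M where "M i m j l = P.L i j * P.L' m l" for i m j l
  define U where "U i m j l = P.L' m l * P.L i j" for i m j l
  define R where "R i m j l = P.rl i m * M i m j l + P.pl i m * M m i j l" for i m j l
  define V where "V i m j l = P.rr j l * U i m j l + P.pr l j * U i m l j" for i m j l
  have X: "P.X i m j l = R i m j l - V i m j l" for i m j l
    by (simp add: P.X_def R_def V_def M_def U_def)
  have c: "W.rl a b * (W.rr c d * y) = W.rr c d * (W.rl a b * y)" "W.pl a b * (W.rr c d * y) = W.rr c d * (W.pl a b * y)"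
     "W.rl a b * (W.pr c d * y) = W.pr c d * (W.rl a b * y)" "W.pl a b * (W.pr c d * y) = W.pr c d * (W.pl a b * y)" for a b c d y
    by (rule W.lc0)+
  have R: "W.rl i m * R i m j l + W.pl m i * R m i j l = M i m j l" for j l
    unfolding R_def by (rule unitary(1))
  have V: "W.rr j l * V i m j l + W.pr j l * V i m l j = U i m j l" for i m
    unfolding V_def by (rule unitary(4))
  have "W.rl i m * (W.rr j l * P.X i m j l + W.pr j l * P.X i m l j)
     + W.pl m i * (W.rr j l * P.X m i j l + W.pr j l * P.X m i l j)
    = W.rr j l * (W.rl i m * R i m j l + W.pl m i * R m i j l) + W.pr j l * (W.rl i m * R i m l j + W.pl m i * R m i l j)
      - W.rl i m * (W.rr j l * V i m j l + W.pr j l * V i m l j) - W.pl m i * (W.rr j l * V m i j l + W.pr j l * V m i l j)"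
    by (simp only: X distrib_left right_diff_distrib c) (simp only: algebra_simps)
  also have "\<dots> = W.rr j l * M i m j l + W.pr j l * M i m l j - W.rl i m * U i m j l - W.pl m i * U m i j l"
    unfolding R V ..
  also have "\<dots> = - W.X m i l j"
    by (auto simp add: W.X_def W_L M_def U_def W.rl_def W.rr_def)
  finally show ?thesis by simp
qed

text \<open>These entries pair a current of the first factor with the second one, and the relations
  of \<open>P\<close> alone do not reach them. By \<open>X_swap\<close> two such entries with
  \<open>i\<close> and \<open>m\<close> interchanged satisfy a homogeneous system whose matrix is an
  R-matrix, which unitarity inverts.\<close>

lemma col_swap:
  assumes "P.X i m l n = 0" "P.X m i l n = 0" "W.X m i l n = 0" "W.X i m l n = 0" "l \<in> {1..N}"
  shows "P.X i m n l = 0"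
proof -
  interpret sy: rpair2 N al' bl' cl' ar' br' cr' al bl cl ar br cr K' Ki' k' e' f' K Ki k e f by (rule sym)
  have r: "W.rr n l = ar'" using assms(5) by (simp add: W.rr_def)
  have z: "W.rl i m * P.X i m n l + W.pl m i * P.X m i n l = 0"
    if "W.X m i l n = 0" "P.X i m l n = 0" "P.X m i l n = 0" for i m
  proof (rule W.ar_cancel)
    have "W.X m i l n = - (ar' * (W.rl i m * P.X i m n l + W.pl m i * P.X m i n l))"
      unfolding X_swap[of m i l n] by (simp add: that r distrib_left W.lc0(4)[of "W.rl i m"] W.lc0(4)[of "W.pl m i"])
    then show "ar' * (W.rl i m * P.X i m n l + W.pl m i * P.X m i n l) = 0" using that by simp
  qed
  show ?thesis
    using sy.unitary(2)[of i m "P.X i m n l" "P.X m i n l"] z[of m i] z[of i m] assms by simp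
qed

lemma row_swap:
  assumes "P.X m n j l = 0" "P.X m n l j = 0" "W.X m n l j = 0" "W.X m n j l = 0" "m \<in> {1..N}"
  shows "P.X n m j l = 0"
proof -
  interpret sy: rpair2 N al' bl' cl' ar' br' cr' al bl cl ar br cr K' Ki' k' e' f' K Ki k e f by (rule sym)
  have r: "W.rl n m = al'" using assms(5) by (simp add: W.rl_def)
  have z: "W.rr j l * P.X n m j l + W.pr j l * P.X n m l j = 0"
    if "W.X m n l j = 0" "P.X m n j l = 0" "P.X m n l j = 0" for j l
    by (rule W.al_cancel) (use X_swap[of m n l j] that in \<open>simp add: r\<close>)
  show ?thesis
    using sy.unitary(3)[of j l "P.X n m j l" "P.X n m l j"] z[of j l] z[of l j] assms by simp
qed

context
  assumes Prels: "P.rels" and Wrels: "W.rels"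
begin

lemma X_KK: "i \<in> {1..N} \<Longrightarrow> m \<in> {1..N} \<Longrightarrow> j \<in> {1..N} \<Longrightarrow> l \<in> {1..N} \<Longrightarrow> P.X i m j l = 0"
  "i \<in> {1..N} \<Longrightarrow> m \<in> {1..N} \<Longrightarrow> j \<in> {1..N} \<Longrightarrow> l \<in> {1..N} \<Longrightarrow> W.X i m j l = 0"
  using Prels Wrels unfolding P.rels_def W.rels_def P.rel_KK_def W.rel_KK_def by auto
lemma X_KF: "i \<in> {1..N} \<Longrightarrow> m \<in> {1..N} \<Longrightarrow> j \<in> {1..N} \<Longrightarrow> P.X i m j n = 0"
  "i \<in> {1..N} \<Longrightarrow> m \<in> {1..N} \<Longrightarrow> j \<in> {1..N} \<Longrightarrow> W.X i m j n = 0"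
  using Prels Wrels unfolding P.rels_def W.rels_def using P.rel_KF_iff W.rel_KF_iff by auto
lemma X_KE: "i \<in> {1..N} \<Longrightarrow> j \<in> {1..N} \<Longrightarrow> l \<in> {1..N} \<Longrightarrow> P.X i n j l = 0"
  "i \<in> {1..N} \<Longrightarrow> j \<in> {1..N} \<Longrightarrow> l \<in> {1..N} \<Longrightarrow> W.X i n j l = 0"
  using Prels Wrels unfolding P.rels_def W.rels_def using P.rel_KE_iff W.rel_KE_iff by auto
lemma X_FK: "i \<in> {1..N} \<Longrightarrow> m \<in> {1..N} \<Longrightarrow> l \<in> {1..N} \<Longrightarrow> P.X i m n l = 0"
  by (rule col_swap) (simp_all add: X_KF)
lemma X_EK: "m \<in> {1..N} \<Longrightarrow> j \<in> {1..N} \<Longrightarrow> l \<in> {1..N} \<Longrightarrow> P.X n m j l = 0"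
  by (rule row_swap) (simp_all add: X_KE)
lemma X_FF: "i \<in> {1..N} \<Longrightarrow> m \<in> {1..N} \<Longrightarrow> P.X i m n n = 0"
  using P.rel_FF_iff(1)[OF X_FK] Prels unfolding P.rels_def by blast
lemma X_EE: "j \<in> {1..N} \<Longrightarrow> l \<in> {1..N} \<Longrightarrow> P.X n n j l = 0"
  using P.rel_EE_iff[OF X_EK] Prels unfolding P.rels_def by blast
lemma X_Kk: "i \<in> {1..N} \<Longrightarrow> j \<in> {1..N} \<Longrightarrow> P.X i n j n = 0"
  using P.rel_Kk_iff[OF X_KE(1)] Prels unfolding P.rels_def by blast
lemma X_EF: "m \<in> {1..N} \<Longrightarrow> j \<in> {1..N} \<Longrightarrow> P.X n m j n = 0"
  using P.rel_EF_iff[OF X_EK] Prels unfolding P.rels_def by blast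
lemma X_kE: "j \<in> {1..N} \<Longrightarrow> P.X n n j n = 0"
  using P.rel_kE_iff[OF X_EK X_EF X_EE] Prels unfolding P.rels_def by blast

end

text \<open>A second context, because its lemmas use those of the first one also for the exchanged
  pair \<open>sy\<close>.\<close>

context
  assumes Prels: "P.rels" and Wrels: "W.rels"
begin

interpretation sy: rpair2 N al' bl' cl' ar' br' cr' al bl cl ar br cr K' Ki' k' e' f' K Ki k e f by (rule sym)

lemma X_kK: "i \<in> {1..N} \<Longrightarrow> l \<in> {1..N} \<Longrightarrow> P.X i n n l = 0"
  by (rule col_swap) (simp_all add: X_Kk X_EF sy.X_Kk sy.X_EF Prels Wrels)
lemma X_FE: "m \<in> {1..N} \<Longrightarrow> l \<in> {1..N} \<Longrightarrow> P.X n m n l = 0"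
  by (rule col_swap) (simp_all add: X_Kk X_EF sy.X_Kk sy.X_EF Prels Wrels)
lemma X_Ek: "l \<in> {1..N} \<Longrightarrow> P.X n n n l = 0"
  by (rule col_swap) (simp_all add: X_kE sy.X_kE Prels Wrels)
lemma X_kF: "i \<in> {1..N} \<Longrightarrow> P.X i n n n = 0"
  using P.rel_kF_iff[OF X_kK P.rel_FF_iff(2)[OF X_FK[OF Prels Wrels]]] Prels unfolding P.rels_def by blast

end

lemma X_Fk: assumes "P.rels" "W.rels" "m \<in> {1..N}" shows "P.X n m n n = 0"
proof -
  interpret sy: rpair2 N al' bl' cl' ar' br' cr' al bl cl ar br cr K' Ki' k' e' f' K Ki k e f by (rule sym)
  show ?thesis by (rule row_swap) (use assms X_kF sy.X_kF in simp_all)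
qed

lemma X_kk: assumes "P.rels" "W.rels" shows "P.X n n n n = 0"
  using P.rel_kk_iff[OF X_Ek[OF assms] X_FE[OF assms] X_Fk[OF assms]] assms(1) unfolding P.rels_def by blast

theorem X_iff_rels:
  "(\<forall>i\<in>{1..n}. \<forall>m\<in>{1..n}. \<forall>j\<in>{1..n}. \<forall>l\<in>{1..n}. P.X i m j l = 0) \<longleftrightarrow> P.rels \<and> W.rels"
proof
  assume X: "\<forall>i\<in>{1..n}. \<forall>m\<in>{1..n}. \<forall>j\<in>{1..n}. \<forall>l\<in>{1..n}. P.X i m j l = 0"
  have "W.X i m j l = 0" if "i \<in> {1..n}" "m \<in> {1..n}" "j \<in> {1..n}" "l \<in> {1..n}" for i m j l
    using X that by (simp add: X_swap[of i m j l])
  then show "P.rels \<and> W.rels" using X P.X_rels W.X_rels by blast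
next
  assume "P.rels \<and> W.rels"
  then have r: "P.rels" "W.rels" by auto
  have n: "{1..n} = insert n {1..N}" by auto
  show "\<forall>i\<in>{1..n}. \<forall>m\<in>{1..n}. \<forall>j\<in>{1..n}. \<forall>l\<in>{1..n}. P.X i m j l = 0"
    unfolding n using r by (simp add: X_KK X_KF X_KE X_FK X_EK X_FF X_EE X_Kk X_EF X_kE X_kK X_FE X_Ek X_kF X_Fk X_kk)
qed

end

section \<open>Algebras over \<open>\<complex>(q)\<close> and series in two variables\<close>

class cqalg = ring_1 +
  fixes sc :: "Cq \<Rightarrow> 'a"
  assumes sc_add: "sc (c + d) = sc c + sc d" and sc_mult: "sc (c * d) = sc c * sc d"
    and sc_one: "sc 1 = 1" and sc_central: "sc c * y = y * sc c"
begin

lemma sc_zero [simp]: "sc 0 = 0" using sc_add[of 0 0] by simp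
lemma sc_uminus: "sc (- c) = - sc c" using sc_add[of c "- c"] by (simp add: eq_neg_iff_add_eq_0 add.commute)
lemma sc_diff: "sc (c - d) = sc c - sc d" using sc_add[of c "- d"] by (simp add: sc_uminus)

lemma sc_cancel: "sc c * y = 0 \<Longrightarrow> c \<noteq> 0 \<Longrightarrow> y = 0"
proof -
  assume a: "sc c * y = 0" "c \<noteq> 0"
  have "y = sc (inverse c) * (sc c * y)" using a(2) by (simp add: sc_one flip: sc_mult mult.assoc)
  then show "y = 0" by (simp add: a)
qed

end

section \<open>Central elements and units\<close>

definition cen :: "'r::ring_1 \<Rightarrow> bool" where "cen c \<longleftrightarrow> (\<forall>y. c * y = y * c)"

lemma cen_commute: "cen c \<Longrightarrow> c * y = y * c" by (simp add: cen_def)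
lemma cen_left_commute: "cen c \<Longrightarrow> c * (y * z) = y * (c * z)"
  unfolding cen_def by (metis mult.assoc)
lemmas cen_ac = cen_commute cen_left_commute mult.assoc

lemma cen_intros: "cen 0" "cen 1" "cen a \<Longrightarrow> cen b \<Longrightarrow> cen (a + b)" "cen a \<Longrightarrow> cen b \<Longrightarrow> cen (a - b)"
    "cen a \<Longrightarrow> cen (- a)"
  by (simp_all add: cen_def algebra_simps)
lemma cen_mult: "cen a \<Longrightarrow> cen b \<Longrightarrow> cen (a * b)"
  unfolding cen_def by (metis mult.assoc)
lemma cen_sc: "cen (sc c)" by (simp add: cen_def sc_central)
lemma cen_inverse: assumes "cen a" "a * b = 1" "b * a = 1" shows "cen b"
  unfolding cen_def
proof
  fix y
  have "b * y = b * y * (a * b)" using assms by simp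
  also have "\<dots> = b * (a * y) * b" using assms(1) by (simp add: cen_def mult.assoc)
  also have "\<dots> = y * b" using assms(3) by (simp flip: mult.assoc)
  finally show "b * y = y * b" .
qed

definition uinv :: "'r::ring_1 \<Rightarrow> 'r" where "uinv a = (SOME b. a * b = 1 \<and> b * a = 1)"
definition unit :: "'r::ring_1 \<Rightarrow> bool" where "unit a \<longleftrightarrow> (\<exists>b. a * b = 1 \<and> b * a = 1)"

lemma uinv: "unit a \<Longrightarrow> a * uinv a = 1" "unit a \<Longrightarrow> uinv a * a = 1"
  unfolding unit_def uinv_def by (metis (mono_tags, lifting) someI)+
lemma unit_cancel: "unit a \<Longrightarrow> a * y = 0 \<Longrightarrow> y = 0"
  unfolding unit_def by (metis mult.assoc mult_1_left mult_zero_right)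
lemma unit_mult: "unit a \<Longrightarrow> unit b \<Longrightarrow> unit (a * b)"
proof -
  assume "unit a" "unit b"
  then obtain a' b' where "a * a' = 1" "a' * a = 1" "b * b' = 1" "b' * b = 1" unfolding unit_def by blast
  then have "a * b * (b' * a') = 1" "b' * a' * (a * b) = 1" by (metis mult.assoc mult_1_left)+
  then show ?thesis unfolding unit_def by blast
qed
lemma cen_uinv: "unit a \<Longrightarrow> cen a \<Longrightarrow> cen (uinv a)" using cen_inverse uinv by blast
lemma unit_uinv: "unit a \<Longrightarrow> unit (uinv a)" using uinv unfolding unit_def by blast
lemma unit_eq_iff: assumes "unit a" shows "y = z \<longleftrightarrow> a * y = a * z"
proof
  assume "a * y = a * z"
  then have "a * (y - z) = 0" by (simp add: right_diff_distrib)
  then show "y = z" using unit_cancel[OF assms, of "y - z"] by simp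
qed simp

text \<open>\<open>u = (q\<^sup>-\<^sup>1 y - q)\<^sup>-\<^sup>1\<close> and \<open>u' = (q\<^sup>-\<^sup>1 y\<^sup>-\<^sup>1 - q)\<^sup>-\<^sup>1\<close>: the R-matrix is unitary, \<open>R(y) R\<^sub>2\<^sub>1(y\<^sup>-\<^sup>1) = 1\<close>.\<close>

lemma R_unitary:
  fixes y yi p q u u' :: "'r::ring_1"
  assumes c: "cen y" "cen yi" "cen p" "cen q" "cen u" "cen u'"
    and y: "y * yi = 1" and pq: "p * q = 1" and u: "u * (p * y - q) = 1" and u': "u' * (p * yi - q) = 1"
  shows "u' * (yi - 1) * (u * (y - 1)) + u' * (p - q) * yi * (u * (p - q) * y) = 1"
    "u' * (yi - 1) * (u * (y - 1)) + u' * (p - q) * (u * (p - q)) = 1"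
    "u' * (yi - 1) * (u * (p - q)) + u' * (p - q) * yi * (u * (y - 1)) = 0"
    "u' * (yi - 1) * (u * (p - q) * y) + u' * (p - q) * (u * (y - 1)) = 0"
proof -
  have r: "y * (yi * z) = z" "p * (q * z) = z" for z using y pq by (simp_all flip: mult.assoc)
  have "1 = u' * (p * yi - q) * (u * (p * y - q))" using u u' by simp
  also have "\<dots> = u' * (u * ((p * yi - q) * (p * y - q)))" using c by (simp add: cen_ac cen_intros cen_mult)
  \<comment> \<open>This identity, in which \<open>p * q = 1\<close> enters, yields the first two
    equations; the other two rest on \<open>y * yi = 1\<close>.\<close>
  also have "(p * yi - q) * (p * y - q) = (yi - 1) * (y - 1) + (p - q) * (p - q)"
    using c y pq by (simp add: algebra_simps cen_ac r)
  finally have 1: "u' * (u * ((yi - 1) * (y - 1) + (p - q) * (p - q))) = 1" by simp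
  have "u' * (yi - 1) * (u * (y - 1)) + u' * (p - q) * (u * (p - q)) = u' * (u * ((yi - 1) * (y - 1) + (p - q) * (p - q)))"
    using c by (simp add: algebra_simps cen_ac)
  then show "u' * (yi - 1) * (u * (y - 1)) + u' * (p - q) * (u * (p - q)) = 1"
    using 1 by simp
  then show "u' * (yi - 1) * (u * (y - 1)) + u' * (p - q) * yi * (u * (p - q) * y) = 1"
    using c y by (simp add: algebra_simps cen_ac r)
  show "u' * (yi - 1) * (u * (p - q)) + u' * (p - q) * yi * (u * (y - 1)) = 0"
    using c y by (simp add: algebra_simps cen_ac r)
  show "u' * (yi - 1) * (u * (p - q) * y) + u' * (p - q) * (u * (y - 1)) = 0"
    using c y by (simp add: algebra_simps cen_ac r)
qed

section \<open>One-sided series and rings that contain them\<close>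

definition hs :: "pmsign \<Rightarrow> 'a::zero fps \<Rightarrow> int \<Rightarrow> 'a" where "hs s c = half_series s (fps_nth c)"

lemma hs_sum: "hs s (sum g A) a = (\<Sum>i\<in>A. hs s (g i :: 'a::ring_1 fps) a)" by (simp add: hs_def half_series_def fps_sum_nth)
lemma hs_one: "hs s 1 a = (if a = 0 then 1 else (0::'a::ring_1))" by (cases s) (auto simp: hs_def half_series_def)
lemma hs_zero: "hs s 0 a = (0::'a::ring_1)" by (simp add: hs_def half_series_def)
lemma hs_neg: "sg s * a < 0 \<Longrightarrow> hs s c a = 0" by (simp add: hs_def half_series_def)
lemma hs_ext: "(\<And>a. hs s c a = hs s d a) \<Longrightarrow> c = d"
proof (rule fps_ext)
  fix m assume "\<And>a. hs s c a = hs s d a"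
  from this[of "sg s * int m"] show "c $ m = d $ m" by (cases s) (auto simp: hs_def half_series_def)
qed

text \<open>A ring containing \<open>A[[z\<^sup>\<plusminus>\<^sup>1]]\<close> and \<open>A[[w\<^sup>\<plusminus>\<^sup>1]]\<close> (signs \<open>s\<close>, \<open>s'\<close>) and \<open>x = z/w\<close>, whose elements are
  determined by their coefficients \<open>cf\<close>.\<close>

locale realization =
  fixes s s' :: pmsign and E1 E2 :: "'a::cqalg fps \<Rightarrow> 'r::ring_1" and co :: "'a \<Rightarrow> 'r" and x xi :: 'r
    and cf :: "'r \<Rightarrow> int \<Rightarrow> int \<Rightarrow> 'a"
  assumes E1_add: "E1 (c + d) = E1 c + E1 d" and E1_mult: "E1 (c * d) = E1 c * E1 d" and E1_one: "E1 1 = 1"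
    and E2_add: "E2 (c + d) = E2 c + E2 d" and E2_mult: "E2 (c * d) = E2 c * E2 d" and E2_one: "E2 1 = 1"
    and co_add: "co (a + b) = co a + co b" and co_mult: "co (a * b) = co a * co b" and co_one: "co 1 = 1"
    and co_cen: "cen a \<Longrightarrow> cen (co a)" and x_cen: "cen x" and x_xi: "x * xi = 1"
    and unit_lin: "cen a \<Longrightarrow> cen b \<Longrightarrow> a * a' = 1 \<Longrightarrow> b * b' = 1 \<Longrightarrow> unit (co a * x + co b)"
    and cf_add: "cf (S + T) i j = cf S i j + cf T i j"
    and cf_co: "cf (co a * S) i j = a * cf S i j"
    and cf_x: "cf (x * S) i j = cf S (i - 1) (j + 1)"
    and cf_E1E2: "cf (E1 c * E2 d) i j = hs s c i * hs s' d j"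
    and cf_E2E1: "cf (E2 d * E1 c) i j = hs s' d j * hs s c i"
    and cf_ext: "(\<And>i j. cf S i j = cf T i j) \<Longrightarrow> S = T"
begin

lemma xi_x: "xi * x = 1" and xi_cen: "cen xi"
proof -
  show "xi * x = 1" using x_xi x_cen by (simp add: cen_def)
  then show "cen xi" using cen_inverse[OF x_cen x_xi] by simp
qed

lemma E1_zero [simp]: "E1 0 = 0" using E1_add[of 0 0] by simp
lemma E2_zero [simp]: "E2 0 = 0" using E2_add[of 0 0] by simp
lemma co_zero [simp]: "co 0 = 0" using co_add[of 0 0] by simp
lemma co_uminus: "co (- a) = - co a" using co_add[of a "- a"] by (simp add: eq_neg_iff_add_eq_0 add.commute)
lemma co_diff: "co (a - b) = co a - co b" using co_add[of a "- b"] by (simp add: co_uminus)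
lemma cf_zero [simp]: "cf 0 i j = 0" using cf_add[of 0 0 i j] by simp
lemma cf_uminus: "cf (- S) i j = - cf S i j" using cf_add[of S "- S" i j] by (simp add: eq_neg_iff_add_eq_0 add.commute)
lemma cf_diff: "cf (S - T) i j = cf S i j - cf T i j" using cf_add[of S "- T" i j] by (simp add: cf_uminus)
lemma cf_sum: "cf (sum g A) i j = (\<Sum>a\<in>A. cf (g a) i j)"
  by (induction A rule: infinite_finite_induct) (auto simp: cf_add)
lemma E1_sum: "E1 (sum g A) = (\<Sum>a\<in>A. E1 (g a))"
  by (induction A rule: infinite_finite_induct) (auto simp: E1_add)
lemma E2_sum: "E2 (sum g A) = (\<Sum>a\<in>A. E2 (g a))"
  by (induction A rule: infinite_finite_induct) (auto simp: E2_add)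
lemma cf_E1: "cf (E1 c) i j = (if j = 0 then hs s c i else 0)"
  using cf_E1E2[of c 1 i j] by (simp add: E2_one hs_one)
lemma cf_E2: "cf (E2 c) i j = (if i = 0 then hs s' c j else 0)"
  using cf_E1E2[of 1 c i j] by (simp add: E1_one hs_one)
lemma cf_eq_iff: "S = T \<longleftrightarrow> (\<forall>i j. cf S i j = cf T i j)" using cf_ext by blast

lemma swapped: "realization s' s E2 E1 co xi x (\<lambda>S i j. cf S j i)"
proof
  fix a b a' b' :: 'a assume *: "cen a" "cen b" "a * a' = 1" "b * b' = 1"
  have xx: "x * (xi * y) = y" for y using x_xi by (simp flip: mult.assoc)
  have "co a * xi + co b = xi * (co b * x + co a)"
    using * co_cen xi_cen x_cen xi_x x_xi by (simp add: distrib_left cen_ac xx)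
  moreover have "unit xi" unfolding unit_def using x_xi xi_x by blast
  ultimately show "unit (co a * xi + co b)" using unit_lin[of b a b' a'] * unit_mult by simp
next
  fix S i j show "cf (xi * S) j i = cf S (j + 1) (i - 1)"
    using cf_x[of "xi * S" "j + 1" "i - 1"] x_xi by (simp flip: mult.assoc)
next
  fix S T assume "\<And>i j. cf S j i = cf T j i" then show "S = T" using cf_ext by blast
qed (use xi_cen xi_x E1_add E1_mult E1_one E2_add E2_mult E2_one co_add co_mult co_one co_cen cf_add cf_co cf_E1E2 cf_E2E1 in auto)

end

subsection \<open>Iterated Laurent series\<close>

text \<open>The inverse is a geometric series. Both products are computed because the coefficients
  need not commute.\<close>

lemma unit_fls_linear:
  fixes u v :: "'b::ring_1"
  assumes u: "u * u' = 1" "u' * u = 1"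
  shows "unit (fls_const u + fls_const v * fls_X_intpow 1)"
proof -
  define y where "y = Abs_fps (\<lambda>m. (- (u' * v)) ^ m * u')"
  define p where "p = fps_const u + fps_const v * fps_X"
  have "p * y = 1" 
  proof (rule fps_ext)
    fix m show "(p * y) $ m = 1 $ m"
    proof (cases m)
      case (Suc l)
      have "u * ((- (u' * v)) ^ Suc l * u') = - (v * ((- (u' * v)) ^ l * u'))"
        using u by (simp flip: mult.assoc)
      then show ?thesis by (simp add: p_def y_def Suc algebra_simps del: power_Suc)
    qed (simp add: p_def y_def u)
  qed
  moreover have "y * p = 1" 
  proof (rule fps_ext)
    fix m show "(y * p) $ m = 1 $ m"
    proof (cases m)
      case (Suc l)
      have "(- (u' * v)) ^ Suc l * u' * u = - ((- (u' * v)) ^ l * u' * v)"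
        using u by (simp add: mult.assoc power_Suc2 del: power_Suc)
      moreover have "y * (fps_const v * fps_X) = (y * fps_const v) * fps_X" by (simp add: mult.assoc)
      ultimately show ?thesis by (simp add: p_def y_def Suc distrib_left del: power_Suc)
    qed (simp add: p_def y_def u distrib_left)
  qed
  moreover have "fps_to_fls p = fls_const u + fls_const v * fls_X_intpow 1"
    by (rule fls_eqI) (auto simp: p_def)
  ultimately show ?thesis
    unfolding unit_def by (metis fls_times_fps_to_fls fps_to_fls_eq_1_iff)
qed

text \<open>The inner variable is \<open>Z = z^(sg s)\<close>, the outer one
  \<open>W = w^(sg s')\<close>; in terms of them \<open>z/w\<close> is
  \<open>Z^(sg s) W^(- sg s')\<close>. Thus all four pairs of signs use the same type, and the signs
  enter only through exponents.\<close>

definition zser :: "'a::ring_1 fps \<Rightarrow> 'a fls fls" where "zser c = fls_const (fps_to_fls c)"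
definition wser :: "'a::ring_1 fps \<Rightarrow> 'a fls fls" where "wser c = fps_to_fls (Abs_fps (\<lambda>m. fls_const (c $ m)))"
definition xser :: "pmsign \<Rightarrow> pmsign \<Rightarrow> int \<Rightarrow> 'a::ring_1 fls fls" where
  "xser s s' p = fls_const (fls_X_intpow (sg s * p)) * fls_X_intpow (- sg s' * p)"

lemma fls_const_cen: "cen y \<Longrightarrow> cen (fls_const (y :: 'b::ring_1))"
  unfolding cen_def by (auto intro: fls_eqI)

lemma sg_mult [simp]: "sg s * sg s = 1" "sg s * (sg s * a) = a" by (cases s; simp)+

lemma realization_fls:
  "realization s s' zser wser (\<lambda>a. fls_const (fls_const a)) (xser s s' 1) (xser s s' (- 1))
    (\<lambda>S i j. fls_nth (fls_nth S (sg s' * j)) (sg s * i) :: 'a::cqalg)"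
proof
  have X_cen: "cen (fls_X_intpow i :: 'b::ring_1 fls)" for i
    unfolding cen_def using fls_X_intpow_times_comm by blast
  have wadd: "fls_const (a + b) = fls_const a + fls_const (b::'a)" for a b by (rule fls_eqI) simp
  show xc: "cen (xser s s' 1 :: 'a fls fls)"
    unfolding xser_def by (intro cen_mult fls_const_cen X_cen)
  have xx: "xser s s' p * xser s s' r = (xser s s' (p + r) :: 'a fls fls)" for p r
  proof -
    have "xser s s' p * xser s s' r = fls_const (fls_X_intpow (sg s * p) * fls_X_intpow (sg s * r))
        * (fls_X_intpow (- sg s' * p) * fls_X_intpow (- sg s' * r)) "
      unfolding xser_def by (simp only: fls_const_mult_const[symmetric] mult.assoc cen_left_commute[OF X_cen, of "- sg s' * p" "fls_const (fls_X_intpow (sg s * r))"])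
    then show ?thesis
      by (simp only: xser_def fls_X_intpow_times_fls_X_intpow distrib_left mult_minus_left minus_add_distrib)
  qed
  show "xser s s' 1 * xser s s' (- 1) = (1 :: 'a fls fls)"
    unfolding xx by (simp add: xser_def)
  fix c d :: "'a fps" and S T :: "'a fls fls" and a b a' b' :: 'a and i j
  show "zser (c + d) = zser c + zser d" by (simp add: zser_def fls_plus_const)
  show "zser (c * d) = zser c * zser d" by (simp add: zser_def fls_times_fps_to_fls)
  show "zser 1 = (1 :: 'a fls fls)" by (simp add: zser_def)
  show "wser (c + d) = wser c + wser d"
    unfolding wser_def fps_to_fls_plus[symmetric] by (intro arg_cong[where f = fps_to_fls] fps_ext) (simp add: wadd)
  have sum: "fls_const (sum g A) = (\<Sum>i\<in>A. fls_const (g i :: 'a))" for g and A :: "nat set"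
    by (induction A rule: infinite_finite_induct) (simp_all add: wadd)
  show "wser (c * d) = wser c * wser d"
    unfolding wser_def fls_times_fps_to_fls[symmetric]
    by (intro arg_cong[where f = fps_to_fls] fps_ext) (simp add: fps_mult_nth sum)
  show "wser 1 = (1 :: 'a fls fls)"
  proof -
    have "Abs_fps (\<lambda>m. fls_const ((1 :: 'a fps) $ m)) = 1" by (rule fps_ext) auto
    then show ?thesis by (simp add: wser_def)
  qed
  show "fls_const (fls_const (a + b)) = fls_const (fls_const a) + fls_const (fls_const b)"
    by (simp add: fls_plus_const)
  show "fls_const (fls_const (a * b)) = fls_const (fls_const a) * fls_const (fls_const b)" by simp
  show "fls_const (fls_const (1 :: 'a)) = 1" by simp
  show "cen (fls_const (fls_const a))" if "cen a" by (intro fls_const_cen that)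
  show "unit (fls_const (fls_const a) * xser s s' 1 + fls_const (fls_const b))"
    if h: "cen a" "cen b" "a * a' = 1" "b * b' = 1"
  proof -
    have h': "a' * a = 1" "b' * b = 1" using h by (auto simp: cen_def)
    define t where "t = (fls_X_intpow (sg s) :: 'a fls)"
    define t' where "t' = (fls_X_intpow (- sg s) :: 'a fls)"
    have t: "t * t' = 1" "t' * t = 1" unfolding t_def t'_def fls_X_intpow_times_fls_X_intpow by simp_all
    have tc: "cen t" unfolding t_def by (rule X_cen)
    show ?thesis
    \<comment> \<open>For \<open>s' = Minus\<close> the variable \<open>x\<close> contains the first
      power of the outer variable, and the constant coefficient is the one to invert. For
      \<open>s' = Plus\<close> it contains the inverse power, which is factored out first.\<close>
    proof (cases s')
      case Minus
      have eq: "fls_const (fls_const a) * xser s s' 1 + fls_const (fls_const b)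
        = fls_const (fls_const b) + fls_const (fls_const a * t) * fls_X_intpow 1"
        by (simp add: xser_def Minus t_def mult.assoc add.commute flip: fls_const_mult_const)
      show ?thesis unfolding eq by (rule unit_fls_linear[of _ "fls_const b'"]) (simp_all add: h h')
    next
      case Plus
      have XX: "fls_X_intpow 1 * fls_X_intpow (- 1) = (1 :: 'a fls fls)"
        by (simp only: fls_X_intpow_times_fls_X_intpow, simp)
      then have XX: "fls_X_intpow 1 * fls_shift 1 1 = (1 :: 'a fls fls)" by simp
      have "(fls_const a * t) * (t' * fls_const a') = 1" "(t' * fls_const a') * (fls_const a * t) = 1"
        using t h h' by (simp_all add: mult.assoc) (simp_all flip: mult.assoc)
      then have "unit (fls_const (fls_const a * t) + fls_const (fls_const b) * fls_X_intpow 1)"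
        by (rule unit_fls_linear)
      moreover have "unit (fls_X_intpow (- 1) :: 'a fls fls)"
        unfolding unit_def
        by (intro exI[of _ "fls_X_intpow 1"]) (simp only: fls_X_intpow_times_fls_X_intpow, simp)
      ultimately have "unit ((fls_const (fls_const a * t) + fls_const (fls_const b) * fls_X_intpow 1) * fls_X_intpow (- 1))"
        by (rule unit_mult)
      moreover have "(fls_const (fls_const a * t) + fls_const (fls_const b) * fls_X_intpow 1) * fls_X_intpow (- 1)
        = fls_const (fls_const a) * xser s s' 1 + fls_const (fls_const b)"
        by (simp add: xser_def Plus t_def mult.assoc distrib_right XX flip: fls_const_mult_const)
      ultimately show ?thesis by simp
    qed
  qed
  show "fls_nth (fls_nth (S + T) (sg s' * j)) (sg s * i) = fls_nth (fls_nth S (sg s' * j)) (sg s * i) + fls_nth (fls_nth T (sg s' * j)) (sg s * i)"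
    by simp
  show "fls_nth (fls_nth (fls_const (fls_const a) * S) (sg s' * j)) (sg s * i) = a * fls_nth (fls_nth S (sg s' * j)) (sg s * i)"
    by simp
  show "fls_nth (fls_nth (xser s s' 1 * S) (sg s' * j)) (sg s * i) = fls_nth (fls_nth S (sg s' * (j + 1))) (sg s * (i - 1))"
    using fls_X_intpow_times_conv_shift(1)[of "- sg s'" S]
    by (simp add: xser_def mult.assoc fls_X_intpow_times_conv_shift algebra_simps)
  show "fls_nth (fls_nth (zser c * wser d) (sg s' * j)) (sg s * i) = hs s c i * hs s' d j"
    by (simp add: zser_def wser_def hs_def half_series_def)
  show "fls_nth (fls_nth (wser d * zser c) (sg s' * j)) (sg s * i) = hs s' d j * hs s c i"
    by (simp add: zser_def wser_def hs_def half_series_def)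
  show "S = T" if h: "\<And>i j. fls_nth (fls_nth S (sg s' * j)) (sg s * i) = fls_nth (fls_nth T (sg s' * j)) (sg s * i)"
  proof (intro fls_eqI)
    fix i j show "fls_nth (fls_nth S i) j = fls_nth (fls_nth T i) j"
      using h[of "sg s' * i" "sg s * j"] by simp
  qed
qed

abbreviation qi :: Cq where "qi \<equiv> inverse qv"
abbreviation dq :: Cq where "dq \<equiv> qi - qv"

lemma qv_nonzero: "qv \<noteq> 0" by (simp add: qv_def)
lemma dq_nonzero: "dq \<noteq> 0"
proof
  assume "dq = 0"
  then have "qv * qv = 1" using qv_nonzero by (simp add: field_simps)
  then have "to_fract ([:0, 1:] * [:0, 1:]) = (to_fract 1 :: Cq)" by (simp add: qv_def flip: to_fract_mult)
  then have "[:0, 1:] * [:0, 1:] = (1 :: complex poly)" by (simp only: to_fract_eq_iff)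
  then show False by (simp add: one_pCons)
qed
text \<open>Needed where a quantity is equal to its own negative, or a sum to that of its reflection
  (\<open>qfull_iff\<close>, \<open>qB_eq\<close>).\<close>

lemma two_nonzero: "(2 :: Cq) \<noteq> 0"
proof
  assume "(2 :: Cq) = 0"
  moreover have "(2 :: Cq) = to_fract (1 + 1)" unfolding to_fract_add to_fract_1 by simp
  ultimately have "to_fract (1 + 1) = (to_fract 0 :: Cq)" by simp
  then have "(1 + 1 :: complex poly) = 0" by (simp only: to_fract_eq_iff)
  then show False by (simp add: one_pCons)
qed

subsection \<open>Multiplication by rational functions of \<open>z/w\<close>\<close>

text \<open>The counterpart of \<open>rmul\<close> in an arbitrary algebra; \<open>ev_rmul\<close>
  compares the two.\<close>

definition rm :: "(int \<Rightarrow> 'a::cqalg) \<Rightarrow> expansion \<Rightarrow> int \<Rightarrow> (Cq fls \<Rightarrow> Cq fls) \<Rightarrow> (int \<Rightarrow> int \<Rightarrow> 'a) \<Rightarrow> int \<Rightarrow> int \<Rightarrow> 'a" where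
  "rm C d j f S a b = Sum_any (\<lambda>k. sc (excoeff d f k) * C (j * k) * S (a - k) (b + k))"

text \<open>Multiplication by the linear polynomial \<open>c1 \<kappa> z/w + c0\<close>.\<close>

definition lin :: "Cq \<Rightarrow> Cq \<Rightarrow> 'a::cqalg \<Rightarrow> (int \<Rightarrow> int \<Rightarrow> 'a) \<Rightarrow> int \<Rightarrow> int \<Rightarrow> 'a" where
  "lin c1 c0 \<kappa> S a b = sc c1 * \<kappa> * S (a - 1) (b + 1) + sc c0 * S a b"

primrec dsg :: "expansion \<Rightarrow> int" where "dsg ZW = 1" | "dsg WZ = -1"

text \<open>An expansion in the direction \<open>d\<close> takes its terms from far away on a line
  of constant total degree; \<open>S\<close> vanishes there, so the product is a finite sum.\<close>

definition bd :: "expansion \<Rightarrow> (int \<Rightarrow> int \<Rightarrow> 'a::zero) \<Rightarrow> bool" where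
  "bd d S \<longleftrightarrow> (\<forall>a b. \<exists>K\<ge>0. \<forall>k\<ge>K. S (a - dsg d * k) (b + dsg d * k) = 0)"

text \<open>This encodes \<open>f = (c1 x + c0) / (p1 x + p0)\<close>, at the two arguments at which
  \<open>excoeff\<close> evaluates \<open>f\<close>.\<close>

definition clears :: "Cq \<Rightarrow> Cq \<Rightarrow> Cq \<Rightarrow> Cq \<Rightarrow> (Cq fls \<Rightarrow> Cq fls) \<Rightarrow> bool" where
  "clears p1 p0 c1 c0 f \<longleftrightarrow> (\<forall>x\<in>{fls_X, inverse fls_X}.
     (fls_const p1 * x + fls_const p0) * f x = fls_const c1 * x + fls_const c0)"

lemma excoeff_rec:
  assumes "clears p1 p0 c1 c0 f"
  shows "p1 * excoeff d f (k - 1) + p0 * excoeff d f k = (if k = 1 then c1 else 0) + (if k = 0 then c0 else 0)"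
proof (cases d)
  case ZW
  have "fls_nth (fls_const p1 * (fls_X * f fls_X) + fls_const p0 * f fls_X) k = fls_nth (fls_const c1 * fls_X + fls_const c0) k"
    using assms by (simp add: clears_def distrib_right mult.assoc)
  then show ?thesis by (simp add: ZW fls_X_times_conv_shift(1))
next
  case WZ
  have "fls_nth (fls_const p1 * (inverse fls_X * f (inverse fls_X)) + fls_const p0 * f (inverse fls_X)) (- k)
    = fls_nth (fls_const c1 * inverse fls_X + fls_const c0) (- k)"
    using assms by (simp add: clears_def distrib_right mult.assoc)
  then show ?thesis by (simp add: WZ fls_inverse_X fls_X_inv_times_conv_shift(1))
qed

text \<open>As \<open>p1\<close> and \<open>p0\<close> are nonzero, the fraction has no pole at 0 or
  at infinity. A Laurent series vanishes below some degree, and the recursion carries these zeros up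
  to degree 0.\<close>

lemma excoeff_regular:
  assumes c: "clears p1 p0 c1 c0 f" and p: "p1 \<noteq> 0" "p0 \<noteq> 0" and k: "dsg d * k < 0"
  shows "excoeff d f k = 0"
proof -
  obtain K where K: "\<And>k. dsg d * k < K \<Longrightarrow> excoeff d f k = 0"
  proof (cases d)
    case ZW then show ?thesis using that[of "fls_subdegree (f fls_X)"] by simp
  next
    case WZ then show ?thesis using that[of "fls_subdegree (f (inverse fls_X))"] by simp
  qed
  have "excoeff d f k = 0" if "dsg d * k < 0" "nat (dsg d * k - K) \<le> m" for k m
    using that
  proof (induction m arbitrary: k)
    case 0 then show ?case
    proof (cases "dsg d * k < K")
      case False
      then have e: "excoeff d f (k - dsg d) = 0" using 0 by (intro K) (cases d; simp)
      show ?thesis using excoeff_rec[OF c, of d k] excoeff_rec[OF c, of d "k + 1"] 0 e p by (cases d) auto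
    qed (use K in auto)
  next
    case (Suc m)
    have e: "excoeff d f (k - dsg d) = 0" using Suc.prems by (intro Suc.IH) (cases d; simp)+
    show ?case using excoeff_rec[OF c, of d k] excoeff_rec[OF c, of d "k + 1"] Suc.prems e p by (cases d) auto
  qed
  then show ?thesis using k by blast
qed

locale central_powers =
  fixes C :: "int \<Rightarrow> 'a::cqalg"
  assumes C_zero: "C 0 = 1" and C_add: "C (a + b) = C a * C b" and C_cen: "cen (C a)"
begin

lemma C_inv: "C a * C (- a) = 1" "C (- a) * C a = 1" "C a * (C (- a) * y) = y" "C (- a) * (C a * y) = y"
proof -
  show "C a * C (- a) = 1" "C (- a) * C a = 1" using C_add[of a "- a"] C_add[of "- a" a] C_zero by simp_all
  then show "C a * (C (- a) * y) = y" "C (- a) * (C a * y) = y" by (simp_all flip: mult.assoc)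
qed

lemma C_mult_eq_iff: "C a * y = C a * z \<longleftrightarrow> y = z"
  by (metis C_inv(4))

lemma rm_finite:
  assumes "clears p1 p0 c1 c0 f" "p1 \<noteq> 0" "p0 \<noteq> 0" "bd d S"
  shows "finite {k. sc (excoeff d f k) * g k * S (a - k) (b + k) \<noteq> 0}"
proof -
  obtain K where K: "\<And>k. k \<ge> K \<Longrightarrow> S (a - dsg d * k) (b + dsg d * k) = 0"
    using assms(4) unfolding bd_def by blast
  have "k \<in> {-\<bar>K\<bar>..\<bar>K\<bar>}" if "sc (excoeff d f k) * g k * S (a - k) (b + k) \<noteq> 0" for k
  proof -
    have "\<not> dsg d * k < 0" using excoeff_regular[OF assms(1-3), of d k] that by auto
    moreover have "\<not> dsg d * k \<ge> K" using K[of "dsg d * k"] that by (cases d) auto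
    ultimately show ?thesis by (cases d) auto
  qed
  then have "{k. sc (excoeff d f k) * g k * S (a - k) (b + k) \<noteq> 0} \<subseteq> {-\<bar>K\<bar>..\<bar>K\<bar>}" by blast
  then show ?thesis using finite_subset by blast
qed

lemma lin_rm:
  assumes c: "clears p1 p0 c1 c0 f" "p1 \<noteq> 0" "p0 \<noteq> 0" "bd d S"
  shows "lin p1 p0 (C j) (rm C d j f S) = lin c1 c0 (C j) S"
proof (intro ext)
  fix a b
  define u where "u k = sc (excoeff d f k) * C (j * k) * S (a - k) (b + k)" for k
  define v where "v k = sc (excoeff d f (k - 1)) * C (j * (k - 1)) * S (a - k) (b + k)" for k
  have fin: "finite {k. u k \<noteq> 0}" unfolding u_def by (rule rm_finite[OF c])
  have shift: "sc (excoeff d f k) * C (j * k) * S (a - 1 - k) (b + 1 + k) = v (k + 1)" for k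
    by (simp add: v_def algebra_simps)
  have bij: "bij (\<lambda>k::int. k + 1)" by (rule bij_betw_byWitness[of _ "\<lambda>k. k - 1"]) auto
  have fin1: "finite {k. sc (excoeff d f k) * C (j * k) * S (a - 1 - k) (b + 1 + k) \<noteq> 0}"
    by (rule rm_finite[OF c])
  have "{k. v k \<noteq> 0} \<subseteq> (\<lambda>k. k + 1) ` {k. v (k + 1) \<noteq> 0}"
  proof
    fix k assume "k \<in> {k. v k \<noteq> 0}"
    then show "k \<in> (\<lambda>k. k + 1) ` {k. v (k + 1) \<noteq> 0}" by (intro image_eqI[of _ _ "k - 1"]) auto
  qed
  then have finv: "finite {k. v k \<noteq> 0}" using fin1 unfolding shift by (meson finite_imageI finite_subset)
  have 1: "rm C d j f S (a - 1) (b + 1) = Sum_any v"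
    unfolding rm_def shift using Sum_any.reindex_cong[OF bij, of v "\<lambda>k. v (k + 1)"] by (simp add: comp_def)
  have A: "finite ({k. u k \<noteq> 0} \<union> {k. v k \<noteq> 0} \<union> {0, 1})" (is "finite ?A") using fin finv by simp
  have "lin p1 p0 (C j) (rm C d j f S) a b = (\<Sum>k\<in>?A. sc p1 * C j * v k + sc p0 * u k)"
    unfolding lin_def 1 sum.distrib sum_distrib_left[symmetric]
    by (subst (1 2) Sum_any.expand_superset[OF A, symmetric]) (auto simp: rm_def u_def)
  also have "\<dots> = (\<Sum>k\<in>?A. (if k = 1 then sc c1 * C j * S (a - 1) (b + 1) else 0) + (if k = 0 then sc c0 * S a b else 0))"
  proof (intro sum.cong refl)
    fix k
    have j: "C j * C (j * (k - 1)) = C (j * k)" by (simp add: algebra_simps flip: C_add)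
    have "sc p1 * C j * v k + sc p0 * u k = sc (p1 * excoeff d f (k - 1) + p0 * excoeff d f k) * C (j * k) * S (a - k) (b + k)"
      unfolding u_def v_def j[symmetric] sc_add sc_mult by (simp add: algebra_simps cen_ac C_cen cen_sc)
    then show "sc p1 * C j * v k + sc p0 * u k = (if k = 1 then sc c1 * C j * S (a - 1) (b + 1) else 0) + (if k = 0 then sc c0 * S a b else 0)"
      unfolding excoeff_rec[OF c(1)] by (auto simp: C_zero)
  qed
  also have "\<dots> = lin c1 c0 (C j) S a b"
    unfolding sum.distrib using A by (simp add: lin_def)
  finally show "lin p1 p0 (C j) (rm C d j f S) a b = lin c1 c0 (C j) S a b" .
qed

text \<open>For the quadratic relations, whose series are infinite in both directions but whose
  coefficients are polynomials.\<close>

lemma rm_poly: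
  assumes "\<And>x. x \<in> {fls_X, inverse fls_X} \<Longrightarrow> f x = fls_const c1 * x + fls_const c0"
  shows "rm C d j f S = lin c1 c0 (C j) S"
proof (intro ext)
  fix a b
  have e: "excoeff d f k = (if k = 1 then c1 else 0) + (if k = 0 then c0 else 0)" for k
    using excoeff_rec[of 0 1 c1 c0 f d k] assms by (simp add: clears_def)
  have "rm C d j f S a b = (\<Sum>k\<in>{0, 1}. sc (excoeff d f k) * C (j * k) * S (a - k) (b + k))"
    unfolding rm_def by (rule Sum_any.expand_superset) (auto simp: e)
  then show "rm C d j f S a b = lin c1 c0 (C j) S a b" by (simp add: e lin_def C_zero add.commute)
qed

lemma bd_rm:
  assumes c: "clears p1 p0 c1 c0 f" "p1 \<noteq> 0" "p0 \<noteq> 0" and "bd d S"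
  shows "bd d (rm C d j f S)"
  unfolding bd_def
proof (intro allI)
  fix a b
  obtain K where K: "K \<ge> 0" "\<And>k. k \<ge> K \<Longrightarrow> S (a - dsg d * k) (b + dsg d * k) = 0"
    using assms(4) unfolding bd_def by blast
  have "rm C d j f S (a - dsg d * k) (b + dsg d * k) = 0" if "k \<ge> K" for k
  proof -
    have "sc (excoeff d f m) * C (j * m) * S (a - dsg d * k - m) (b + dsg d * k + m) = 0" for m
    proof (cases "dsg d * m < 0")
      case False
      then have "S (a - dsg d * (k + dsg d * m)) (b + dsg d * (k + dsg d * m)) = 0" using that by (intro K(2)) simp
      moreover have "a - dsg d * (k + dsg d * m) = a - dsg d * k - m" "b + dsg d * (k + dsg d * m) = b + dsg d * k + m"
        by (cases d; simp)+
      ultimately show ?thesis by simp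
    qed (simp add: excoeff_regular[OF c])
    then show ?thesis unfolding rm_def by simp
  qed
  then show "\<exists>K\<ge>0. \<forall>k\<ge>K. rm C d j f S (a - dsg d * k) (b + dsg d * k) = 0" using K(1) by blast
qed

lemma bd_add: "bd d S \<Longrightarrow> bd d T \<Longrightarrow> bd d (\<lambda>a b. S a b + T a b :: 'a)"
  unfolding bd_def
proof (intro allI)
  fix a b assume S: "\<forall>a b. \<exists>K\<ge>0. \<forall>k\<ge>K. S (a - dsg d * k) (b + dsg d * k) = 0"
    and T: "\<forall>a b. \<exists>K\<ge>0. \<forall>k\<ge>K. T (a - dsg d * k) (b + dsg d * k) = 0"
  obtain K1 K2 where "K1 \<ge> 0" "\<And>k. k \<ge> K1 \<Longrightarrow> S (a - dsg d * k) (b + dsg d * k) = 0"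
     "\<And>k. k \<ge> K2 \<Longrightarrow> T (a - dsg d * k) (b + dsg d * k) = 0" using S T by metis
  then show "\<exists>K\<ge>0. \<forall>k\<ge>K. S (a - dsg d * k) (b + dsg d * k) + T (a - dsg d * k) (b + dsg d * k) = 0"
    by (intro exI[of _ "max K1 K2"]) auto
qed
lemma bd_uminus: "bd d S \<Longrightarrow> bd d (\<lambda>a b. - S a b :: 'a)" by (simp add: bd_def)
lemma bd_diff: "bd d S \<Longrightarrow> bd d T \<Longrightarrow> bd d (\<lambda>a b. S a b - T a b :: 'a)"
  using bd_add[OF _ bd_uminus] by simp
lemma bd_zero: "bd d (\<lambda>a b. 0 :: 'a)" by (auto simp: bd_def)
lemma bd_sum: "(\<And>i. i \<in> A \<Longrightarrow> bd d (S i)) \<Longrightarrow> bd d (\<lambda>a b. \<Sum>i\<in>A. S i a b :: 'a)"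
  by (induction A rule: infinite_finite_induct) (auto intro: bd_add bd_zero)

lemma bd_shift: "bd d S \<Longrightarrow> bd d (\<lambda>a b. S (a - 1) (b + 1))"
  unfolding bd_def
proof (intro allI)
  fix a b assume S: "\<forall>a b. \<exists>K\<ge>0. \<forall>k\<ge>K. S (a - dsg d * k) (b + dsg d * k) = 0"
  have eq: "a - dsg d * k - 1 = a - 1 - dsg d * k" "b + dsg d * k + 1 = b + 1 + dsg d * k" for k by simp_all
  show "\<exists>K\<ge>0. \<forall>k\<ge>K. S (a - dsg d * k - 1) (b + dsg d * k + 1) = 0"
    using S[rule_format, of "a - 1" "b + 1"] by (simp only: eq)
qed

lemma bd_lin:
  assumes S: "bd d (S :: int \<Rightarrow> int \<Rightarrow> 'a)" shows "bd d (lin c1 c0 \<kappa> S)"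
proof -
  have "bd d (\<lambda>a b. y * S a b)" if "bd d S" for y and S :: "int \<Rightarrow> int \<Rightarrow> 'a"
    using that unfolding bd_def by (metis mult_zero_right)
  from bd_add[OF this[OF bd_shift[OF S]] this[OF S]] show ?thesis unfolding lin_def[abs_def] .
qed

text \<open>Solved for one coefficient, the equation makes it a multiple of the next one on its line
  of constant degree, in the direction in which \<open>bd\<close> forces the coefficients to vanish
  eventually.\<close>

lemma lin_cancel:
  assumes "bd d D" and p: "p1 \<noteq> 0" "p0 \<noteq> 0" and z: "\<And>a b. lin p1 p0 (C j) D a b = 0"
  shows "D a b = 0"
proof -
  have step: "\<exists>y. D a b = y * D (a - dsg d) (b + dsg d)" for a b
  proof (cases d)
    case ZW
    have "sc (inverse p0) * lin p1 p0 (C j) D a b = sc (inverse p0 * p1) * C j * D (a - 1) (b + 1) + D a b"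
      using p by (simp add: lin_def distrib_left sc_one flip: sc_mult mult.assoc)
    then show ?thesis unfolding z
      by (intro exI[of _ "- (sc (inverse p0 * p1) * C j)"]) (simp add: ZW eq_neg_iff_add_eq_0 add.commute)
  next
    case WZ
    have "sc (inverse p1) * C (- j) * lin p1 p0 (C j) D (a + 1) (b - 1) = D a b + sc (inverse p1) * C (- j) * sc p0 * D (a + 1) (b - 1)"
      using p by (simp add: lin_def distrib_left sc_one mult.assoc cen_left_commute[OF cen_sc, of p1] C_inv)
        (simp add: sc_one flip: sc_mult mult.assoc)
    then show ?thesis unfolding z
      by (intro exI[of _ "- (sc (inverse p1) * C (- j) * sc p0)"]) (simp add: WZ eq_neg_iff_add_eq_0)
  qed
  have many: "\<exists>y. D a b = y * D (a - dsg d * int m) (b + dsg d * int m)" for m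
  proof (induction m)
    case (Suc m)
    then obtain y where y: "D a b = y * D (a - dsg d * int m) (b + dsg d * int m)" by blast
    obtain y' where "D (a - dsg d * int m) (b + dsg d * int m) = y' * D (a - dsg d * int m - dsg d) (b + dsg d * int m + dsg d)"
      using step by blast
    then have "D a b = (y * y') * D (a - dsg d * int (Suc m)) (b + dsg d * int (Suc m))"
      using y by (simp add: algebra_simps)
    then show ?case by blast
  qed (auto intro: exI[of _ 1])
  obtain K where "K \<ge> 0" "\<And>k. k \<ge> K \<Longrightarrow> D (a - dsg d * k) (b + dsg d * k) = 0"
    using assms(1) unfolding bd_def by blast
  then show ?thesis using many[of "nat K"] by auto
qed

lemma lin_diff: "lin c1 c0 \<kappa> (\<lambda>a b. S a b - T a b) = (\<lambda>a b. lin c1 c0 \<kappa> S a b - lin c1 c0 \<kappa> T a b)"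
  by (simp add: lin_def fun_eq_iff algebra_simps)
lemma lin_add: "lin c1 c0 \<kappa> (\<lambda>a b. S a b + T a b) = (\<lambda>a b. lin c1 c0 \<kappa> S a b + lin c1 c0 \<kappa> T a b)"
  by (simp add: lin_def fun_eq_iff algebra_simps)
lemma lin_sum: "lin c1 c0 \<kappa> (\<lambda>a b. \<Sum>i\<in>A. S i a b) = (\<lambda>a b. \<Sum>i\<in>A. lin c1 c0 \<kappa> (S i) a b)"
  by (simp add: lin_def fun_eq_iff sum_distrib_left sum.distrib)

lemma eq_iff_lin_eq:
  assumes "bd d S" "bd d T" "p1 \<noteq> 0" "p0 \<noteq> 0"
  shows "(\<forall>a b. S a b = T a b) \<longleftrightarrow> (\<forall>a b. lin p1 p0 (C j) S a b = lin p1 p0 (C j) T a b)"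
proof
  assume "\<forall>a b. lin p1 p0 (C j) S a b = lin p1 p0 (C j) T a b"
  then have "S a b - T a b = 0" for a b
    by (intro lin_cancel[OF bd_diff[OF assms(1,2)] assms(3,4), where j = j]) (simp add: lin_diff)
  then show "\<forall>a b. S a b = T a b" by simp
qed (simp add: lin_def)

lemma lin_lin: "cen \<kappa> \<Longrightarrow> cen \<kappa>' \<Longrightarrow> lin c1 c0 \<kappa> (lin p1 p0 \<kappa>' S) = lin p1 p0 \<kappa>' (lin c1 c0 \<kappa> S)"
  by (simp add: lin_def fun_eq_iff algebra_simps cen_ac cen_sc)

end

text \<open>Numerators of the entries of \<open>R\<close> over the common denominator
  \<open>q^-1 x - q\<close>: \<open>r1 x + r0\<close> for the entries on the diagonal and
  \<open>o1 x + o0\<close> for the others.\<close>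

definition r1 :: "nat \<Rightarrow> nat \<Rightarrow> Cq" where "r1 i j = (if i = j then qi else 1)"
definition r0 :: "nat \<Rightarrow> nat \<Rightarrow> Cq" where "r0 i j = (if i = j then - qv else - 1)"
definition o1 :: "nat \<Rightarrow> nat \<Rightarrow> Cq" where "o1 i j = (if i < j then dq else 0)"
definition o0 :: "nat \<Rightarrow> nat \<Rightarrow> Cq" where "o0 i j = (if j < i then dq else 0)"

definition Rc :: "nat \<Rightarrow> nat \<Rightarrow> Cq fls \<Rightarrow> Cq fls" where
  "Rc i k x = (if i = k then 1 else (x - 1) / (inverse qL * x - qL))"
definition Ro :: "nat \<Rightarrow> nat \<Rightarrow> Cq fls \<Rightarrow> Cq fls" where
  "Ro i k x = (if i = k then 0 else if i > k then (inverse qL - qL) / (x * inverse qL - qL)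
    else x * (inverse qL - qL) / (x * inverse qL - qL))"

lemma linear_nonzero:
  assumes "p1 \<noteq> 0" "x \<in> {fls_X, inverse fls_X}" shows "fls_const p1 * x + fls_const p0 \<noteq> (0 :: Cq fls)"
proof
  assume z: "fls_const p1 * x + fls_const p0 = 0"
  have "fls_nth (fls_const p1 * x + fls_const p0) 1 = p1 \<or> fls_nth (fls_const p1 * x + fls_const p0) (- 1) = p1"
    using assms(2) by (auto simp: fls_inverse_X)
  then show False using z assms(1) by simp
qed

lemma clears_divide:
  assumes "p1 \<noteq> 0" "\<And>x. x \<in> {fls_X, inverse fls_X} \<Longrightarrow> f x = (fls_const c1 * x + fls_const c0) / (fls_const p1 * x + fls_const p0)"
  shows "clears p1 p0 c1 c0 f"
  unfolding clears_def using assms linear_nonzero[OF assms(1)] by simp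

lemma inverse_qL: "inverse qL = fls_const qi" by (rule fls_inverse_const)
lemma fls_const_dq: "fls_const dq = fls_const qi - fls_const qv" by (rule fls_eqI) auto
lemma fls_const_neg: "fls_const (- c) = - fls_const (c :: Cq)" by (rule fls_eqI) auto
lemmas fc = inverse_qL fls_const_dq fls_const_neg

lemma qi_nonzero: "qi \<noteq> 0" using qv_nonzero by simp

lemma clears_Rc: "clears qi (- qv) (r1 i k) (r0 i k) (Rc i k)"
  by (rule clears_divide[OF qi_nonzero], frule linear_nonzero[OF qi_nonzero, of _ "- qv"])
     (auto simp: Rc_def r1_def r0_def fc)

lemma clears_Ro: "clears qi (- qv) (o1 i k) (o0 i k) (Ro i k)"
  by (rule clears_divide[OF qi_nonzero]) (auto simp: Ro_def o1_def o0_def fc mult.commute)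

lemma clears_fractions:
  "clears 1 (- 1) qi (- qv) (\<lambda>x. (x * inverse qL - qL) / (x - 1))"
  "clears 1 (- 1) qv (- qi) (\<lambda>x. (x * qL - inverse qL) / (x - 1))"
  "clears qv (- qi) 1 (- 1) (\<lambda>x. (x - 1) / (x * qL - inverse qL))"
  "clears qi (- qv) 1 (- 1) (\<lambda>x. (x - 1) / (x * inverse qL - qL))"
  by (rule clears_divide; simp add: qv_nonzero fc mult.commute)+

lemma clears_mult:
  assumes "clears p1 p0 c1 c0 f" "clears c1 c0 d1 d0 g"
  shows "clears p1 p0 d1 d0 (\<lambda>x. f x * g x)"
  unfolding clears_def
proof
  fix x assume x: "x \<in> {fls_X, inverse fls_X :: Cq fls}"
  have f: "(fls_const p1 * x + fls_const p0) * f x = fls_const c1 * x + fls_const c0"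
    using assms(1) x unfolding clears_def by (rule bspec)
  have g: "(fls_const c1 * x + fls_const c0) * g x = fls_const d1 * x + fls_const d0"
    using assms(2) x unfolding clears_def by (rule bspec)
  show "(fls_const p1 * x + fls_const p0) * (f x * g x) = fls_const d1 * x + fls_const d0"
    by (simp only: mult.assoc[symmetric] f g)
qed

text \<open>The factor in the quadratic relations is a multiple of the denominator of
  \<open>R\<close>; this is what makes their coefficients polynomials.\<close>

lemma q_factor: "x - qL ^ 2 = qL * (fls_const qi * x + fls_const (- qv))"
proof -
  have "qL * (fls_const qi * x) = x" using qv_nonzero by (simp flip: mult.assoc)
  then show ?thesis by (simp add: fls_const_neg power2_eq_square right_diff_distrib)
qed

lemma EE_poly:
  assumes "x \<in> {fls_X, inverse fls_X}"
  shows "(x - qL ^ 2) * Rc i k x = fls_const (qv * r1 i k) * x + fls_const (qv * r0 i k)"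
    and "(x - qL ^ 2) * Ro i k x = fls_const (qv * o1 i k) * x + fls_const (qv * o0 i k)"
proof -
  have c: "(fls_const qi * x + fls_const (- qv)) * Rc i k x = fls_const (r1 i k) * x + fls_const (r0 i k)"
    "(fls_const qi * x + fls_const (- qv)) * Ro i k x = fls_const (o1 i k) * x + fls_const (o0 i k)"
    using bspec[OF clears_Rc[unfolded clears_def] assms] bspec[OF clears_Ro[unfolded clears_def] assms] .
  show "(x - qL ^ 2) * Rc i k x = fls_const (qv * r1 i k) * x + fls_const (qv * r0 i k)"
    "(x - qL ^ 2) * Ro i k x = fls_const (qv * o1 i k) * x + fls_const (qv * o0 i k)"
    unfolding q_factor mult.assoc c by (simp_all only: distrib_left mult.assoc flip: fls_const_mult_const)
qed

lemma FF_poly: "x * qL ^ 2 - 1 = fls_const (qv * qv) * x + fls_const (qv * (- qi))"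
  using qv_nonzero by (simp add: power2_eq_square mult.commute fls_const_neg)

text \<open>Arbitrary values replace the matrix entries, so that only equalities between indices
  have to be analysed.\<close>

lemma Rmat_cases:
  fixes a b d i j k l :: nat
  shows "(if i = a \<and> k = b then (if i = k then I else U) else if i = b \<and> a = k then (if i > a then B else D) else Z)
      = (if a = i \<and> b = k then (if i = k then I else U) else if b = i \<and> a = k then (if i = k then Z else if i > k then B else D) else Z)"
    and "(if a = j \<and> b = l then (if a = b then I else U) else if a = l \<and> j = b then (if a > j then B else D) else Z)
      = (if a = j \<and> b = l then (if j = l then I else U) else if a = l \<and> b = j then (if l = j then Z else if l > j then B else D) else Z)"
    and "(if a = j \<and> k = d then (if a = k then I else U) else if a = d \<and> j = k then (if a > j then B else D) else Z)
      = (if a = j \<and> d = k then (if j = k then I else U) else if a = d \<and> j = k then (if a = j then Z else if a > j then B else D) else Z)"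
    and "(if i = a \<and> d = b then (if i = d then I else U) else if i = b \<and> a = d then (if i > a then B else D) else Z)
      = (if a = i \<and> d = b then (if i = b then I else U) else if a = d \<and> i = b then (if i = a then Z else if i > a then B else D) else Z)"
  by auto

lemma Rmat_row: "Rmat qL i a k b x = (if a = i \<and> b = k then Rc i k x else if b = i \<and> a = k then Ro i k x else 0)"
  unfolding Rmat_def Rc_def Ro_def by (rule Rmat_cases(1))
lemma Rmat_col: "Rmat qL a j b l x = (if a = j \<and> b = l then Rc j l x else if a = l \<and> b = j then Ro l j x else 0)"
  unfolding Rmat_def Rc_def Ro_def by (rule Rmat_cases(2))
lemma Rmat_KF: "Rmat qL a j k d x = (if a = j \<and> d = k then Rc j k x else if a = d \<and> j = k then Ro a j x else 0)"
  unfolding Rmat_def Rc_def Ro_def by (rule Rmat_cases(3))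
lemma Rmat_KE: "Rmat qL i a d b x = (if a = i \<and> d = b then Rc i b x else if a = d \<and> i = b then Ro i a x else 0)"
  unfolding Rmat_def Rc_def Ro_def by (rule Rmat_cases(4))

lemma sum_two_points:
  fixes U V :: "'b::comm_monoid_add"
  assumes "i \<in> A" "k \<in> B" "i' \<in> A" "k' \<in> B" "finite A" "finite B" "i = i' \<Longrightarrow> k = k' \<Longrightarrow> V = 0"
  shows "(\<Sum>a\<in>A. \<Sum>b\<in>B. if a = i \<and> b = k then U else if a = i' \<and> b = k' then V else 0) = U + V"
proof -
  have "(if a = i \<and> b = k then U else if a = i' \<and> b = k' then V else 0)
    = (if a = i then if b = k then U else 0 else 0) + (if a = i' then if b = k' then V else 0 else 0)" for a b
    using assms(7) by auto
  then have "(\<Sum>a\<in>A. \<Sum>b\<in>B. if a = i \<and> b = k then U else if a = i' \<and> b = k' then V else 0)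
    = (\<Sum>a\<in>A. \<Sum>b\<in>B. if a = i then if b = k then U else 0 else 0) + (\<Sum>a\<in>A. \<Sum>b\<in>B. if a = i' then if b = k' then V else 0 else 0)"
    by (simp add: sum.distrib)
  moreover have "(\<Sum>a\<in>A. \<Sum>b\<in>B. if a = i then if b = k then U else 0 else 0) = U" if "i \<in> A" "k \<in> B" for i k and U :: 'b
  proof -
    have "(\<Sum>b\<in>B. if a = i then if b = k then U else 0 else 0) = (if a = i then U else 0)" for a
      using that assms(6) by auto
    then show ?thesis using that assms(5) by simp
  qed
  ultimately show ?thesis using assms(1-4) by simp
qed

section \<open>Sums against the R-matrix and cleared forms of the relations\<close>

context central_powers begin

lemma rm_zero: "rm C d j (\<lambda>x. 0) S = (\<lambda>a b. 0)" by (cases d) (simp_all add: rm_def fun_eq_iff)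

text \<open>For equal indices the two positions in a row of \<open>R\<close> coincide; then the
  off-diagonal contribution must be 0, as the next sums demand.\<close>

lemma Ro_same: "rm C d j (\<lambda>x. g x * Ro i i x) S a b = 0" by (simp add: Ro_def rm_zero)

lemma sum_Rmat_row:
  assumes "i \<in> {1..M}" "k \<in> {1..M}"
  shows "(\<Sum>a=1..M. \<Sum>b=1..M. rm C d h (\<lambda>x. g x * Rmat qL i a k b x) (S a b) r t)
    = rm C d h (\<lambda>x. g x * Rc i k x) (S i k) r t + rm C d h (\<lambda>x. g x * Ro i k x) (S k i) r t"
proof -
  have e: "rm C d h (\<lambda>x. g x * Rmat qL i a k b x) (S a b) r t =
    (if a = i \<and> b = k then rm C d h (\<lambda>x. g x * Rc i k x) (S i k) r t else
     if a = k \<and> b = i then rm C d h (\<lambda>x. g x * Ro i k x) (S k i) r t else 0)" for a b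
    by (auto simp: Rmat_row rm_zero)
  show ?thesis unfolding e by (rule sum_two_points) (use assms Ro_same in simp_all)
qed

lemma sum_Rmat_col:
  assumes "j \<in> {1..M}" "l \<in> {1..M}"
  shows "(\<Sum>a=1..M. \<Sum>b=1..M. rm C d h (\<lambda>x. g x * Rmat qL a j b l x) (S a b) r t)
    = rm C d h (\<lambda>x. g x * Rc j l x) (S j l) r t + rm C d h (\<lambda>x. g x * Ro l j x) (S l j) r t"
proof -
  have e: "rm C d h (\<lambda>x. g x * Rmat qL a j b l x) (S a b) r t =
    (if a = j \<and> b = l then rm C d h (\<lambda>x. g x * Rc j l x) (S j l) r t else
     if a = l \<and> b = j then rm C d h (\<lambda>x. g x * Ro l j x) (S l j) r t else 0)" for a b
    by (auto simp: Rmat_col rm_zero)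
  show ?thesis unfolding e by (rule sum_two_points) (use assms Ro_same in simp_all)
qed

lemma sum_diag_point:
  fixes U :: "'b::comm_monoid_add" and i k M :: nat
  assumes "i \<in> {1..M}" "k \<in> {1..M}" "i = k \<Longrightarrow> V i = 0"
  shows "(\<Sum>a=1..M. \<Sum>b=1..M. if a = i \<and> b = k then U else if a = b \<and> i = k then V a else 0)
    = U + (if i = k then \<Sum>a=1..M. V a else 0)"
proof -
  have e: "(if a = i \<and> b = k then U else if a = b \<and> i = k then V a else 0)
    = (if a = i then if b = k then U else 0 else 0) + (if b = a then if i = k then V a else 0 else 0)" for a b
    using assms(3) by auto
  have "(\<Sum>b=1..M. if a = i then if b = k then U else 0 else 0) = (if a = i then U else 0)"
    "(\<Sum>b=1..M. if b = a then if i = k then V a else 0 else 0) = (if i = k then V a else 0)" if "a \<in> {1..M}" for a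
    using assms(2) that by auto
  then have "(\<Sum>a=1..M. \<Sum>b=1..M. if a = i \<and> b = k then U else if a = b \<and> i = k then V a else 0)
    = (\<Sum>a=1..M. (if a = i then U else 0) + (if i = k then V a else 0))"
    unfolding e sum.distrib by (intro arg_cong2[where f = "(+)"] sum.cong refl) auto
  then show ?thesis using assms(1) by (simp add: sum.distrib)
qed

text \<open>The sum runs over a row index of one tensor factor and a column index of the other, as
  in a partial transpose of \<open>R\<close>. For \<open>j = k\<close> it meets a whole diagonal of
  off-diagonal entries.\<close>

lemma sum_Rmat_KF:
  assumes "j \<in> {1..M}" "k \<in> {1..M}"
  shows "(\<Sum>a=1..M. \<Sum>b=1..M. rm C d h (\<lambda>x. g x * Rmat qL a j k b x) (S a b) r t)
    = rm C d h (\<lambda>x. g x * Rc j k x) (S j k) r t + (if j = k then \<Sum>a=1..M. rm C d h (\<lambda>x. g x * Ro a j x) (S a a) r t else 0)"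
proof -
  have e: "rm C d h (\<lambda>x. g x * Rmat qL a j k b x) (S a b) r t =
    (if a = j \<and> b = k then rm C d h (\<lambda>x. g x * Rc j k x) (S j k) r t else
     if a = b \<and> j = k then rm C d h (\<lambda>x. g x * Ro a j x) (S a a) r t else 0)" for a b
    by (auto simp: Rmat_KF rm_zero)
  show ?thesis unfolding e by (rule sum_diag_point) (use assms Ro_same in simp_all)
qed

lemma sum_Rmat_KE:
  assumes "i \<in> {1..M}" "b \<in> {1..M}"
  shows "(\<Sum>a=1..M. \<Sum>c=1..M. rm C d h (\<lambda>x. g x * Rmat qL i a c b x) (S a c) r t)
    = rm C d h (\<lambda>x. g x * Rc i b x) (S i b) r t + (if i = b then \<Sum>a=1..M. rm C d h (\<lambda>x. g x * Ro i a x) (S a a) r t else 0)"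
proof -
  have e: "rm C d h (\<lambda>x. g x * Rmat qL i a c b x) (S a c) r t =
    (if a = i \<and> c = b then rm C d h (\<lambda>x. g x * Rc i b x) (S i b) r t else
     if a = c \<and> i = b then rm C d h (\<lambda>x. g x * Ro i a x) (S a a) r t else 0)" for a c
    by (auto simp: Rmat_KE rm_zero)
  show ?thesis unfolding e by (rule sum_diag_point) (use assms Ro_same in simp_all)
qed

text \<open>\<open>U\<close> is the expansion in the direction \<open>d\<close> of \<open>V / (p1 \<kappa> x + p0)\<close>.\<close>

definition frac :: "expansion \<Rightarrow> Cq \<Rightarrow> Cq \<Rightarrow> int \<Rightarrow> (int \<Rightarrow> int \<Rightarrow> 'a) \<Rightarrow> (int \<Rightarrow> int \<Rightarrow> 'a) \<Rightarrow> bool" where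
  "frac d p1 p0 j U V \<longleftrightarrow> bd d U \<and> lin p1 p0 (C j) U = V"

lemma frac_rm: "clears p1 p0 c1 c0 f \<Longrightarrow> p1 \<noteq> 0 \<Longrightarrow> p0 \<noteq> 0 \<Longrightarrow> bd d S \<Longrightarrow> frac d p1 p0 j (rm C d j f S) (lin c1 c0 (C j) S)"
  unfolding frac_def using lin_rm bd_rm by blast
lemma frac_self: "bd d S \<Longrightarrow> frac d p1 p0 j S (lin p1 p0 (C j) S)"
  by (simp add: frac_def)
lemma frac_add: "frac d p1 p0 j U V \<Longrightarrow> frac d p1 p0 j U' V' \<Longrightarrow> frac d p1 p0 j (\<lambda>a b. U a b + U' a b) (\<lambda>a b. V a b + V' a b)"
  unfolding frac_def using bd_add lin_add by auto
lemma frac_sum: "(\<And>i. i \<in> A \<Longrightarrow> frac d p1 p0 j (U i) (V i)) \<Longrightarrow> frac d p1 p0 j (\<lambda>a b. \<Sum>i\<in>A. U i a b) (\<lambda>a b. \<Sum>i\<in>A. V i a b)"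
  unfolding frac_def using bd_sum[of A d U] lin_sum[of p1 p0 "C j" U A] by (auto simp: fun_eq_iff)
lemma frac_if: "(P \<Longrightarrow> frac d p1 p0 j U V) \<Longrightarrow> frac d p1 p0 j (\<lambda>a b. if P then U a b else 0) (\<lambda>a b. if P then V a b else 0)"
  by (cases P) (auto simp: frac_def bd_zero lin_def fun_eq_iff)

lemma frac_eq_iff:
  assumes "frac d p1 p0 j U V" "frac d p1 p0 j U' V'" "p1 \<noteq> 0" "p0 \<noteq> 0"
  shows "(\<forall>a b. U a b = U' a b) \<longleftrightarrow> (\<forall>a b. V a b = V' a b)"
  using assms eq_iff_lin_eq[of d U U' p1 p0 j] unfolding frac_def by simp

text \<open>Cross multiplication for two denominators that may contain different central elements
  \<open>C j\<close> and \<open>C j'\<close>.\<close>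

lemma frac_eq_iff2:
  assumes U: "frac d p1 p0 j U V" and U': "frac d p1' p0' j' U' V'" and p: "p1 \<noteq> 0" "p0 \<noteq> 0" "p1' \<noteq> 0" "p0' \<noteq> 0"
  shows "(\<forall>a b. U a b = U' a b) \<longleftrightarrow> (\<forall>a b. lin p1' p0' (C j') V a b = lin p1 p0 (C j) V' a b)"
proof -
  have "(\<forall>a b. U a b = U' a b) \<longleftrightarrow> (\<forall>a b. lin p1 p0 (C j) U a b = lin p1 p0 (C j) U' a b)"
    by (rule eq_iff_lin_eq[of d U U' p1 p0 j]) (use assms in \<open>auto simp: frac_def\<close>)
  also have "\<dots> \<longleftrightarrow> (\<forall>a b. lin p1' p0' (C j') (lin p1 p0 (C j) U) a b = lin p1' p0' (C j') (lin p1 p0 (C j) U') a b)"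
    by (rule eq_iff_lin_eq[of d _ _ p1' p0' j']) (use assms bd_lin in \<open>auto simp: frac_def\<close>)
  also have "lin p1' p0' (C j') (lin p1 p0 (C j) U') = lin p1 p0 (C j) V'"
    using U' unfolding frac_def by (simp add: lin_lin C_cen)
  finally show ?thesis using U unfolding frac_def by simp
qed

lemma neg_nonzero: "- qv \<noteq> 0" "- qi \<noteq> 0" "(- 1 :: Cq) \<noteq> 0" "(1 :: Cq) \<noteq> 0" using qv_nonzero by simp_all

lemma RLL_form:
  assumes S: "\<And>a b. bd d (S a b)" "\<And>a b. bd d (T a b)" and ij: "i \<in> {1..M}" "j \<in> {1..M}" "k \<in> {1..M}" "l \<in> {1..M}"
  shows "(\<forall>r t. (\<Sum>a=1..M. \<Sum>b=1..M. rm C d h (Rmat qL i a k b) (S a b) r t) = (\<Sum>a=1..M. \<Sum>b=1..M. rm C d h' (Rmat qL a j b l) (T a b) r t))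
   \<longleftrightarrow> (\<forall>r t. lin qi (- qv) (C h') (\<lambda>r t. lin (r1 i k) (r0 i k) (C h) (S i k) r t + lin (o1 i k) (o0 i k) (C h) (S k i) r t) r t
     = lin qi (- qv) (C h) (\<lambda>r t. lin (r1 j l) (r0 j l) (C h') (T j l) r t + lin (o1 l j) (o0 l j) (C h') (T l j) r t) r t)"
  unfolding sum_Rmat_row[OF ij(1,3), of d h "\<lambda>x. 1", simplified mult_1_left] sum_Rmat_col[OF ij(2,4), of d h' "\<lambda>x. 1", simplified mult_1_left]
  by (rule frac_eq_iff2[of d qi "- qv" h _ _ qi "- qv" h']; (intro frac_add frac_rm clears_Rc clears_Ro S qi_nonzero neg_nonzero)?)

lemma KF_form:
  assumes S: "\<And>a b. bd d (S a b)" "bd d T" and ij: "j \<in> {1..M}" "k \<in> {1..M}"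
  shows "(\<forall>r t. (\<Sum>a=1..M. \<Sum>b=1..M. rm C d h (Rmat qL a j k b) (S a b) r t) = rm C d h (\<lambda>x. (x - 1) / (x * inverse qL - qL)) T r t)
   \<longleftrightarrow> (\<forall>r t. lin (r1 j k) (r0 j k) (C h) (S j k) r t + (if j = k then \<Sum>a=1..M. lin (o1 a j) (o0 a j) (C h) (S a a) r t else 0) 
     = lin 1 (- 1) (C h) T r t)"
  unfolding sum_Rmat_KF[OF ij, of d h "\<lambda>x. 1", simplified mult_1_left]
  by (rule frac_eq_iff[of d qi "- qv" h]; (intro frac_add frac_sum frac_if frac_rm clears_Rc clears_Ro clears_fractions S qi_nonzero neg_nonzero)?)

lemma KE_form:
  assumes S: "bd d S" "\<And>a b. bd d (T a b)" and ij: "i \<in> {1..M}" "b \<in> {1..M}"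
  shows "(\<forall>r t. S r t = (\<Sum>a=1..M. \<Sum>c=1..M. rm C d h (\<lambda>x. (x * inverse qL - qL) / (x - 1) * Rmat qL i a c b x) (T a c) r t))
   \<longleftrightarrow> (\<forall>r t. lin 1 (- 1) (C h) S r t =
     lin (r1 i b) (r0 i b) (C h) (T i b) r t + (if i = b then \<Sum>a=1..M. lin (o1 i a) (o0 i a) (C h) (T a a) r t else 0))"
  unfolding sum_Rmat_KE[OF ij, of d h "\<lambda>x. (x * inverse qL - qL) / (x - 1)"]
  by (rule frac_eq_iff[of d 1 "- 1" h]; (intro frac_self frac_add frac_sum frac_if frac_rm clears_mult[OF clears_fractions(1)] clears_Rc clears_Ro S qi_nonzero neg_nonzero)?)

lemma kE_form:
  assumes "bd d S" "bd d T"
  shows "(\<forall>r t. S r t = rm C d h (\<lambda>x. (x * qL - inverse qL) / (x - 1)) T r t) \<longleftrightarrow>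
    (\<forall>r t. lin 1 (- 1) (C h) S r t = lin qv (- qi) (C h) T r t)"
  by (rule frac_eq_iff[of d 1 "- 1" h]; (intro frac_self frac_rm clears_fractions assms neg_nonzero)?)

lemma kF_form:
  assumes "bd d S" "bd d T"
  shows "(\<forall>r t. S r t = rm C d h (\<lambda>x. (x - 1) / (x * qL - inverse qL)) T r t) \<longleftrightarrow>
    (\<forall>r t. lin qv (- qi) (C h) S r t = lin 1 (- 1) (C h) T r t)"
  by (rule frac_eq_iff[of d qv "- qi" h]; (intro frac_self frac_rm clears_fractions assms qv_nonzero neg_nonzero)?)

lemma Kk_form:
  assumes "bd d S" "bd d T"
  shows "(\<forall>r t. rm C d h (\<lambda>x. (x * inverse qL - qL) / (x - 1)) S r t = rm C d h' (\<lambda>x. (x * inverse qL - qL) / (x - 1)) T r t) \<longleftrightarrow>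
    (\<forall>r t. lin 1 (- 1) (C h') (lin qi (- qv) (C h) S) r t = lin 1 (- 1) (C h) (lin qi (- qv) (C h') T) r t)"
  by (rule frac_eq_iff2[of d 1 "- 1" h _ _ 1 "- 1" h']; (intro frac_rm clears_fractions assms neg_nonzero)?)

lemma lin_scale: "lin (c * c1) (c * c0) \<kappa> S a b = sc c * lin c1 c0 \<kappa> S a b"
  by (simp add: lin_def sc_mult algebra_simps)

lemma sc_eq_iff: "c \<noteq> 0 \<Longrightarrow> sc c * y = sc c * z \<longleftrightarrow> y = z"
  using sc_cancel[of c "y - z"] by (auto simp: right_diff_distrib)

lemma EE_form:
  assumes ij: "a \<in> {1..M}" "b \<in> {1..M}"
  shows "(\<forall>r t. (\<Sum>c=1..M. \<Sum>d=1..M. rm C ZW 0 (\<lambda>x. (x - qL ^ 2) * Rmat qL c a d b x) (S c d) r t) = rm C ZW 0 (\<lambda>x. x * qL ^ 2 - 1) T r t)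
   \<longleftrightarrow> (\<forall>r t. lin (r1 a b) (r0 a b) 1 (S a b) r t + lin (o1 b a) (o0 b a) 1 (S b a) r t = lin qv (- qi) 1 T r t)"
  unfolding sum_Rmat_col[OF ij, of ZW 0 "\<lambda>x. x - qL ^ 2"]
  by (simp only: rm_poly[OF EE_poly(1)] rm_poly[OF EE_poly(2)] rm_poly[OF FF_poly] lin_scale C_zero flip: distrib_left)
    (simp only: sc_eq_iff[OF qv_nonzero])

lemma FF_form:
  assumes ij: "a \<in> {1..M}" "b \<in> {1..M}"
  shows "(\<forall>r t. rm C ZW 0 (\<lambda>x. x * qL ^ 2 - 1) S r t = (\<Sum>c=1..M. \<Sum>d=1..M. rm C ZW 0 (\<lambda>x. (x - qL ^ 2) * Rmat qL a c b d x) (T c d) r t))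
   \<longleftrightarrow> (\<forall>r t. lin qv (- qi) 1 S r t = lin (r1 a b) (r0 a b) 1 (T a b) r t + lin (o1 a b) (o0 a b) 1 (T b a) r t)"
  unfolding sum_Rmat_row[OF ij, of ZW 0 "\<lambda>x. x - qL ^ 2"]
  by (simp only: rm_poly[OF EE_poly(1)] rm_poly[OF EE_poly(2)] rm_poly[OF FF_poly] lin_scale C_zero flip: distrib_left)
    (simp only: sc_eq_iff[OF qv_nonzero])

end

section \<open>Cutting two-sided series into halves\<close>

primrec sy :: "pmsign \<Rightarrow> 'a::ab_group_add \<Rightarrow> 'a" where "sy Plus y = y" | "sy Minus y = - y"

lemma sy_sy [simp]: "sy s (sy s y) = y" "sy s 0 = 0" by (cases s; simp)+
lemma sy_mult: "sy s y * z = sy s (y * z)" "y * sy s z = sy s (y * (z :: 'a::ring))" by (cases s; simp)+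
lemma sy_sum: "sy s (sum g A) = (\<Sum>i\<in>A. sy s (g i))" by (cases s) (simp_all add: sum_negf)

text \<open>The exponents belonging to the half currents of sign \<open>s\<close>, when those of the positive half start at \<open>\<tau>\<close>.\<close>

primrec inh :: "pmsign \<Rightarrow> int \<Rightarrow> int \<Rightarrow> bool" where
  "inh Plus \<tau> p \<longleftrightarrow> \<tau> \<le> p" | "inh Minus \<tau> p \<longleftrightarrow> p < \<tau>"

text \<open>A finite window that contains every exponent contributing to degree \<open>N\<close> of
  a product of two series of the same sign, whichever the sign is.\<close>

definition cvl :: "int \<Rightarrow> int set" where "cvl N = {-\<bar>N\<bar>..\<bar>N\<bar>}"

lemma sc_two: "sc 2 * y = y + (y :: 'a::cqalg)"
proof -
  have "sc 2 = (1 + 1 :: 'a)" unfolding one_add_one[symmetric] sc_add sc_one ..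
  then show ?thesis by (simp add: distrib_right del: one_add_one)
qed

lemma sum_telescope_int:
  fixes h :: "int \<Rightarrow> 'a::ab_group_add"
  assumes "m \<le> k + 1" shows "(\<Sum>p=m..k. h p - h (p + 1)) = h m - h (k + 1)"
proof -
  have "(\<Sum>p=m..m + int r - 1. h p - h (p + 1)) = h m - h (m + int r)" for r
  proof (induction r)
    case (Suc r)
    have "{m..m + int (Suc r) - 1} = insert (m + int r) {m..m + int r - 1}" by auto
    then show ?case using Suc by (simp add: algebra_simps)
  qed simp
  from this[of "nat (k + 1 - m)"] show ?thesis using assms by simp
qed

text \<open>By \<open>full\<close> the summand is \<open>h1 p - h1 (p + 1)\<close>. Over one half
  the sum telescopes, and only the value at the boundary of the half survives because of
  \<open>van\<close>.\<close>

lemma half_boundary: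
  fixes h1 h2 :: "int \<Rightarrow> 'a::ab_group_add"
  assumes full: "\<And>p. h1 (p + 1) + h2 p = 0" and van: "\<And>p. sg s * (N - p) < 0 \<Longrightarrow> h1 p = 0 \<and> h2 p = 0"
    and t: "\<tau> = 0 \<or> \<tau> = 1"
  shows "h1 \<tau> = sy s (\<Sum>p\<in>cvl N. if inh s \<tau> p then h1 p + h2 p else 0)"
proof -
  have h2: "h2 p = - h1 (p + 1)" for p using full[of p] by (simp add: eq_neg_iff_add_eq_0 add.commute)
  show ?thesis
  proof (cases s)
    case Plus
    have "(\<Sum>p\<in>cvl N. if inh s \<tau> p then h1 p + h2 p else 0) = (\<Sum>p=\<tau>..N. h1 p - h1 (p + 1))"
      using t van by (intro sum.mono_neutral_cong) (auto simp: cvl_def Plus h2)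
    also have "\<dots> = h1 \<tau>"
    proof (cases "\<tau> \<le> N + 1")
      case True then show ?thesis using van[of "N + 1"] by (simp add: sum_telescope_int Plus)
    next
      case False then show ?thesis using van[of \<tau>] by (simp add: Plus)
    qed
    finally show ?thesis by (simp add: Plus)
  next
    case Minus
    have "(\<Sum>p\<in>cvl N. if inh s \<tau> p then h1 p + h2 p else 0) = (\<Sum>p=N..\<tau> - 1. h1 p - h1 (p + 1))"
      using t van by (intro sum.mono_neutral_cong) (auto simp: cvl_def Minus h2)
    also have "\<dots> = - h1 \<tau>"
    proof (cases "N \<le> \<tau>")
      case True
      have "h1 N = 0" using van[of "N - 1"] h2[of "N - 1"] by (simp add: Minus)
      then show ?thesis using True by (simp add: sum_telescope_int)
    next
      case False then show ?thesis using van[of \<tau>] by (simp add: Minus)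
    qed
    finally show ?thesis by (simp add: Minus)
  qed
qed

text \<open>The shift by \<open>x\<close> crosses the boundary of the halves on the line
  \<open>b = \<tau> - 1\<close> only: there the positive half contains \<open>Hx\<close> and the
  negative half \<open>H0\<close>, elsewhere a half contains both terms or neither. The value on
  that line is the telescoping sum of \<open>half_boundary\<close>, taken on the half of sign
  \<open>s\<close>. For the converse the two halves are added.\<close>

lemma split_iff:
  fixes Hx H0 :: "int \<Rightarrow> int \<Rightarrow> 'a::ab_group_add"
  assumes van: "\<And>a p. sg s * a < 0 \<Longrightarrow> Hx a p = 0 \<and> H0 a p = 0" and t: "\<tau> = 0 \<or> \<tau> = 1"
    and Y: "\<And>N. Y N = sy s (\<Sum>p\<in>cvl N. if inh s \<tau> p then Hx (N - p) p + H0 (N - p) p else 0)"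
  shows "(\<forall>a b. Hx (a - 1) (b + 1) + H0 a b = 0) \<longleftrightarrow>
    (\<forall>s' a b. sy s' ((if inh s' \<tau> (b + 1) then Hx (a - 1) (b + 1) else 0) + (if inh s' \<tau> b then H0 a b else 0))
      = (if b = \<tau> - 1 then Y (a + b) else 0))" (is "?L = ?R")
proof
  assume L: ?L
  show ?R
  proof (intro allI)
    fix s' and a b :: int
    define N where "N = a + b"
    have full: "Hx (N - (p + 1)) (p + 1) + H0 (N - p) p = 0" for p
      using L[rule_format, of "N - p" p] by (simp add: algebra_simps)
    have y: "Hx (N - \<tau>) \<tau> = Y N" unfolding Y
      by (rule half_boundary[where ?h1.0 = "\<lambda>p. Hx (N - p) p" and ?h2.0 = "\<lambda>p. H0 (N - p) p"]) (use full van t in auto)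
    have H: "Hx (a - 1) (b + 1) = - H0 a b" using L by (simp add: eq_neg_iff_add_eq_0)
    show "sy s' ((if inh s' \<tau> (b + 1) then Hx (a - 1) (b + 1) else 0) + (if inh s' \<tau> b then H0 a b else 0))
      = (if b = \<tau> - 1 then Y (a + b) else 0)"
    proof (cases "b = \<tau> - 1")
      case True
      have "Hx (a - 1) (b + 1) = Y N" using y by (simp add: N_def True algebra_simps)
      then have "H0 a b = - Y N" using H by (metis minus_minus)
      then show ?thesis using \<open>Hx (a - 1) (b + 1) = Y N\<close> True by (cases s') (simp_all add: N_def)
    qed (use H in \<open>cases s'; auto\<close>)
  qed
next
  assume R: ?R
  show ?L
  proof (intro allI)
    fix a b
    define Z where "Z = (if b = \<tau> - 1 then Y (a + b) else 0)"
    define M where "M s' = (if inh s' \<tau> (b + 1) then Hx (a - 1) (b + 1) else 0) + (if inh s' \<tau> b then H0 a b else 0)" for s'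
    have "sy s' (M s') = Z" for s' using R by (auto simp: M_def Z_def)
    then have "M Plus = Z" "- M Minus = Z" by (metis sy.simps)+
    moreover have "Hx (a - 1) (b + 1) + H0 a b = M Plus + M Minus" by (auto simp: M_def)
    ultimately show "Hx (a - 1) (b + 1) + H0 a b = 0" by (metis minus_minus add.right_inverse)
  qed
qed

subsection \<open>Quadratic relations\<close>

context
  fixes A :: "nat set" and prec :: "nat \<Rightarrow> nat \<Rightarrow> bool" and G :: "nat \<Rightarrow> int \<Rightarrow> nat \<Rightarrow> int \<Rightarrow> 'a::cqalg" and \<tau> :: int
begin

text \<open>The coefficients of \<open>x\<close> and of 1 in a quadratic relation,
  \<open>G c a l p\<close> being the coefficients of a product of two currents. The relation of
  \<open>F\<close> is the case \<open>prec = (<)\<close>, \<open>\<tau> = 1\<close>; that of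
  \<open>E\<close> is the case \<open>prec = (>)\<close>, \<open>\<tau> = 0\<close>, with the order
  of the factors reversed.\<close>

definition qHx :: "nat \<Rightarrow> nat \<Rightarrow> int \<Rightarrow> int \<Rightarrow> 'a" where
  "qHx c l a p = sc (if c = l then qi else 1) * G l p c a + sc (if prec c l then dq else 0) * G c p l a - sc qv * G c a l p"
definition qH0 :: "nat \<Rightarrow> nat \<Rightarrow> int \<Rightarrow> int \<Rightarrow> 'a" where
  "qH0 c l a p = sc (if c = l then - qv else - 1) * G l p c a + sc (if prec l c then dq else 0) * G c p l a + sc qi * G c a l p"
text \<open>The exponents \<open>p\<close> for which \<open>p\<close> and \<open>N - p\<close> both
  lie in the half of sign \<open>s\<close>.\<close>

primrec qrange :: "pmsign \<Rightarrow> int \<Rightarrow> int set" where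
  "qrange Plus N = {\<tau>..N - \<tau>}" | "qrange Minus N = {N + 1 - \<tau>..\<tau> - 1}"
text \<open>A coefficient of the product of two half currents of the same sign; see
  \<open>qB_F\<close> and \<open>qB_E\<close>.\<close>

definition qB :: "pmsign \<Rightarrow> nat \<Rightarrow> nat \<Rightarrow> int \<Rightarrow> 'a" where
  "qB s c l N = (\<Sum>p\<in>qrange s N. G c (N - p) l p)"

definition "qfull \<longleftrightarrow> (\<forall>c\<in>A. \<forall>l\<in>A. \<forall>a b. qHx c l (a - 1) (b + 1) + qH0 c l a b = 0)"

context
  assumes prec: "\<And>c l. c \<noteq> l \<Longrightarrow> prec c l \<longleftrightarrow> \<not> prec l c" "\<And>c. \<not> prec c c"
begin

lemma sc_q: "sc qv * (sc qi * y) = (y :: 'a)" "sc qi * (sc qv * y) = y"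
  using qv_nonzero by (simp_all add: sc_one flip: mult.assoc sc_mult)

lemma qHx_add_qH0: "qHx c l a p + qH0 c l a p = sc dq * (G c p l a + G c a l p)"
proof -
  consider "c = l" | "c \<noteq> l" "prec c l" "\<not> prec l c" | "c \<noteq> l" "\<not> prec c l" "prec l c" using prec by blast
  then show ?thesis
    by cases (simp_all add: qHx_def qH0_def prec(2) sc_diff sc_uminus sc_one algebra_simps)
qed

text \<open>The relations for \<open>(c, l)\<close> and for \<open>(l, c)\<close> are linear in
  \<open>D\<close> and in the symmetric expression \<open>G c b l a + G c a l b\<close>. Eliminating
  the latter leaves \<open>dq\<close> times the antisymmetry of \<open>D\<close>.\<close>

lemma anti_prec:
  assumes qfull "c \<in> A" "l \<in> A" "prec c l"
  defines "D \<equiv> (\<lambda>a p. G l p c a - sc qi * G c a l p)"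
  shows "D (b + 1) (a - 1) = - D a b" and "qH0 c l a b = - D a b" and "qHx l c a b = - (sc qv * D b a)"
proof -
  have cl: "c \<noteq> l" "\<not> prec l c" using prec assms(4) by metis+
  show H0: "qH0 c l a b = - D a b" for a b
    using cl by (simp add: qH0_def D_def sc_uminus sc_one)
  show Hx': "qHx l c a b = - (sc qv * D b a)" for a b
    using cl by (simp add: qHx_def D_def sc_one algebra_simps sc_q)
  have Hx: "qHx c l a b = D a b + sc dq * (G c b l a + G c a l b)" for a b
    using cl assms(4) by (simp add: qHx_def D_def sc_one sc_diff algebra_simps)
  have H0': "qH0 l c a b = sc qi * D b a + sc dq * D a b + sc qi * (sc dq * (G c b l a + G c a l b))" for a b
    using cl assms(4) by (simp add: qH0_def D_def sc_one sc_uminus sc_diff algebra_simps sc_q)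
  have 1: "D b a + sc dq * (G c a l b + G c b l a) = D (b + 1) (a - 1)"
    using assms(1-3) Hx[of b a] H0[of "b + 1" "a - 1"] unfolding qfull_def
    by (metis (no_types, lifting) add_diff_cancel_right' diff_add_cancel eq_neg_iff_add_eq_0 add.inverse_inverse)
  have 2: "- (sc qv * D (b + 1) (a - 1)) + (sc qi * D b a + sc dq * D a b + sc qi * (sc dq * (G c b l a + G c a l b))) = 0"
    using assms(1-3) Hx'[of "a - 1" "b + 1"] H0'[of a b] unfolding qfull_def by metis
  have "sc qi * D b a + sc qi * (sc dq * (G c b l a + G c a l b)) = sc qi * D (b + 1) (a - 1)"
    unfolding 1[symmetric] by (simp add: algebra_simps)
  then have "sc dq * (D (b + 1) (a - 1) + D a b) = 0"
    using 2 by (simp add: sc_diff algebra_simps)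
  from sc_cancel[OF this dq_nonzero] show "D (b + 1) (a - 1) = - D a b"
    by (simp add: eq_neg_iff_add_eq_0)
qed

text \<open>For \<open>c = l\<close> interchanging the exponents interchanges the coefficients of
  \<open>x\<close> and of 1; for \<open>c \<noteq> l\<close> the antisymmetry is the one of
  \<open>D\<close> in \<open>anti_prec\<close>.\<close>

lemma qHx_anti:
  assumes q: qfull and cl: "c \<in> A" "l \<in> A"
  shows "qHx c l (p - 1) (N + 1 - p) = - qHx c l (N - p) p"
proof -
  have f: "qHx c l (a - 1) (b + 1) = - qH0 c l a b" for a b
    using assms by (simp add: qfull_def eq_neg_iff_add_eq_0)
  consider "c = l" | "prec c l" | "prec l c" using prec by blast
  then show ?thesis
  proof cases
    case 1
    have "qH0 c c a b = qHx c c b a" for a b by (simp add: qH0_def qHx_def prec(2) sc_uminus)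
    then show ?thesis using f[of p "N - p"] by (simp add: 1 algebra_simps)
  next
    case 2
    note D = anti_prec[OF q cl 2]
    have "qHx c l (p - 1) (N + 1 - p) = - qH0 c l p (N - p)" using f[of p "N - p"] by (simp add: algebra_simps)
    moreover have "qHx c l (N - p) p = - qH0 c l (N - p + 1) (p - 1)" using f[of "N - p + 1" "p - 1"] by simp
    ultimately show ?thesis using D(1)[where a = p and b = "N - p"] unfolding D(2) by simp
  next
    case 3
    note D = anti_prec[OF q cl(2,1) 3]
    show ?thesis unfolding D(3) using arg_cong[OF D(1)[where a = p and b = "N - p"], of "\<lambda>y. sc qv * y"]
      by (simp add: algebra_simps)
  qed
qed

text \<open>Symmetrized under \<open>p \<mapsto> N - p\<close>, the sum over a half telescopes by
  \<open>qHx_add_qH0\<close>. Its two end values are opposite by \<open>qHx_anti\<close>, so twice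
  the sum is twice the boundary value.\<close>

lemma qB_eq:
  assumes q: qfull and cl: "c \<in> A" "l \<in> A"
  shows "sc dq * qB s c l N = (if inh s \<tau> (N - \<tau> + 1) then sy s (qHx c l (N - \<tau>) \<tau>) else 0)"
proof -
  define h where "h p = qHx c l (N - p) p" for p
  have h0: "qH0 c l (N - p) p = - h (p + 1)" for p
  proof -
    have "qHx c l (N - p - 1) (p + 1) + qH0 c l (N - p) p = 0" using assms unfolding qfull_def by blast
    then show ?thesis by (simp add: h_def algebra_simps eq_neg_iff_add_eq_0)
  qed
  have anti: "h (N + 1 - \<tau>) = - h \<tau>" using qHx_anti[OF assms, of \<tau> N] by (simp add: h_def)
  have rflct: "(\<Sum>p\<in>qrange s N. G c p l (N - p)) = qB s c l N"
    unfolding qB_def by (rule sum.reindex_bij_witness[of _ "\<lambda>p. N - p" "\<lambda>p. N - p"]) (cases s; auto)+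
  have "sc 2 * (sc dq * qB s c l N) = (\<Sum>p\<in>qrange s N. sc dq * (G c p l (N - p) + G c (N - p) l p))"
    unfolding distrib_left sum.distrib sum_distrib_left[symmetric] rflct
    by (simp only: qB_def sc_two)
  also have "\<dots> = (\<Sum>p\<in>qrange s N. h p - h (p + 1))"
  proof (intro sum.cong refl)
    fix p show "sc dq * (G c p l (N - p) + G c (N - p) l p) = h p - h (p + 1)"
      unfolding qHx_add_qH0[of c l "N - p" p, symmetric] h0 by (simp add: h_def)
  qed
  also have "\<dots> = (if inh s \<tau> (N - \<tau> + 1) then sy s (h \<tau> + h \<tau>) else 0)"
  proof (cases s)
    case Plus
    then show ?thesis using sum_telescope_int[of \<tau> "N - \<tau>" h] anti by (auto simp: algebra_simps)
  next
    case Minus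
    then show ?thesis using sum_telescope_int[of "N + 1 - \<tau>" "\<tau> - 1" h] anti
      by (auto simp: algebra_simps)
  qed
  also have "\<dots> = sc 2 * (if inh s \<tau> (N - \<tau> + 1) then sy s (h \<tau>) else 0)"
    by (cases s) (simp_all add: sc_two)
  finally have "sc 2 * (sc dq * qB s c l N - (if inh s \<tau> (N - \<tau> + 1) then sy s (h \<tau>) else 0)) = 0"
    by (simp add: right_diff_distrib)
  from sc_cancel[OF this two_nonzero] show ?thesis unfolding h_def by simp
qed

text \<open>The q-commutation of half currents, seen from the full currents: the boundary values for
  \<open>(c, l)\<close> and \<open>(l, c)\<close> differ by a factor \<open>q\<close>, and
  \<open>qB_eq\<close> turns this into a statement about products.\<close>

lemma qB_prec:
  assumes "qfull" "c \<in> A" "l \<in> A" "prec c l"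
  shows "qB s l c N = sc qv * qB s c l N"
proof -
  note D = anti_prec[OF assms]
  have "qHx c l (N - \<tau> + 1 - 1) (\<tau> - 1 + 1) + qH0 c l (N - \<tau> + 1) (\<tau> - 1) = 0"
    using assms unfolding qfull_def by blast
  then have "qHx c l (N - \<tau>) \<tau> = - qH0 c l (N - \<tau> + 1) (\<tau> - 1)"
    by (simp add: eq_neg_iff_add_eq_0)
  then have v: "qHx c l (N - \<tau>) \<tau> = - (G l (N - \<tau>) c \<tau> - sc qi * G c \<tau> l (N - \<tau>))"
    unfolding D(2) using D(1)[where a = \<tau> and b = "N - \<tau>"] by simp
  have "qHx l c (N - \<tau>) \<tau> = sc qv * qHx c l (N - \<tau>) \<tau>"
    unfolding D(3) v by (simp add: algebra_simps)
  then have "sc dq * qB s l c N = sc qv * (sc dq * qB s c l N)"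
    unfolding qB_eq[OF assms(1,3,2)] qB_eq[OF assms(1,2,3)] by (cases s) auto
  then have "sc dq * (qB s l c N - sc qv * qB s c l N) = 0"
    by (simp add: right_diff_distrib cen_left_commute[OF cen_sc, of dq "sc qv"])
  from sc_cancel[OF this dq_nonzero] show ?thesis by simp
qed

text \<open>Cut down to a quadrant, the relation can fail only on the two lines where the shift by
  \<open>x\<close> crosses the boundary in the first or in the second variable. \<open>qB_eq\<close>
  gives the values on both lines.\<close>

lemma qfull_iff:
  "qfull \<longleftrightarrow> (\<forall>s s'. \<forall>c\<in>A. \<forall>l\<in>A. \<forall>a b. sy s (sy s' ((if inh s \<tau> (a - 1) \<and> inh s' \<tau> (b + 1) then qHx c l (a - 1) (b + 1) else 0)
      + (if inh s \<tau> a \<and> inh s' \<tau> b then qH0 c l a b else 0)))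
      = (if b = \<tau> - 1 then sc dq * qB s c l (a + b) else 0) + (if a = \<tau> then sc dq * qB s' c l (a + b) else 0))"
   (is "_ \<longleftrightarrow> ?R")
proof
  assume q: qfull
  show ?R
  proof (intro allI ballI)
    fix s s' c l a b assume cl: "c \<in> A" "l \<in> A"
    define v where "v = qHx c l (a - 1) (b + 1)"
    have "v + qH0 c l a b = 0" using q cl unfolding qfull_def v_def by blast
    then have H0: "qH0 c l a b = - v" by (simp add: eq_neg_iff_add_eq_0 add.commute)
    have b: "sc dq * qB s c l (a + b) = (if inh s \<tau> (a + b - \<tau> + 1) then sy s (qHx c l (a + b - \<tau>) \<tau>) else 0)" for s
      by (rule qB_eq[OF q cl])
    have anti: "qHx c l (\<tau> - 1) (a + b + 1 - \<tau>) = - qHx c l (a + b - \<tau>) \<tau>" by (rule qHx_anti[OF q cl])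
    show "sy s (sy s' ((if inh s \<tau> (a - 1) \<and> inh s' \<tau> (b + 1) then qHx c l (a - 1) (b + 1) else 0)
      + (if inh s \<tau> a \<and> inh s' \<tau> b then qH0 c l a b else 0)))
      = (if b = \<tau> - 1 then sc dq * qB s c l (a + b) else 0) + (if a = \<tau> then sc dq * qB s' c l (a + b) else 0)"
      unfolding H0 v_def[symmetric]
    proof (cases "b = \<tau> - 1"; cases "a = \<tau>")
      \<comment> \<open>The point where the two lines meet; the value there is its own
        negative.\<close>
      assume ab: "b = \<tau> - 1" "a = \<tau>"
      have "v = - v" using anti by (simp add: v_def ab)
      then have "sc 2 * v = 0" unfolding sc_two by (metis add.right_inverse)
      then have v: "v = 0" using sc_cancel two_nonzero by blast
      moreover have "qHx c l (a + b - \<tau>) \<tau> = 0" using v by (simp add: v_def ab)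
      ultimately show "sy s (sy s' ((if inh s \<tau> (a - 1) \<and> inh s' \<tau> (b + 1) then v else 0) + (if inh s \<tau> a \<and> inh s' \<tau> b then - v else 0)))
      = (if b = \<tau> - 1 then sc dq * qB s c l (a + b) else 0) + (if a = \<tau> then sc dq * qB s' c l (a + b) else 0)"
        unfolding b using ab by simp
    next
      assume ab: "b = \<tau> - 1" "a \<noteq> \<tau>"
      have "qHx c l (a + b - \<tau>) \<tau> = v" by (simp add: v_def ab)
      then show "sy s (sy s' ((if inh s \<tau> (a - 1) \<and> inh s' \<tau> (b + 1) then v else 0) + (if inh s \<tau> a \<and> inh s' \<tau> b then - v else 0)))
      = (if b = \<tau> - 1 then sc dq * qB s c l (a + b) else 0) + (if a = \<tau> then sc dq * qB s' c l (a + b) else 0)"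
        unfolding b using ab by (cases s; cases s') auto
    next
      assume ab: "b \<noteq> \<tau> - 1" "a = \<tau>"
      have "qHx c l (a + b - \<tau>) \<tau> = - v" using anti by (simp add: v_def ab add.commute)
      then show "sy s (sy s' ((if inh s \<tau> (a - 1) \<and> inh s' \<tau> (b + 1) then v else 0) + (if inh s \<tau> a \<and> inh s' \<tau> b then - v else 0)))
      = (if b = \<tau> - 1 then sc dq * qB s c l (a + b) else 0) + (if a = \<tau> then sc dq * qB s' c l (a + b) else 0)"
        unfolding b using ab by (cases s; cases s') auto
    next
      assume ab: "b \<noteq> \<tau> - 1" "a \<noteq> \<tau>"
      then have "inh s \<tau> (a - 1) = inh s \<tau> a" "inh s' \<tau> (b + 1) = inh s' \<tau> b" by (cases s; cases s'; auto)+
      then show "sy s (sy s' ((if inh s \<tau> (a - 1) \<and> inh s' \<tau> (b + 1) then v else 0) + (if inh s \<tau> a \<and> inh s' \<tau> b then - v else 0)))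
      = (if b = \<tau> - 1 then sc dq * qB s c l (a + b) else 0) + (if a = \<tau> then sc dq * qB s' c l (a + b) else 0)"
        using ab by simp
    qed
  qed
next
  assume R: ?R
  show qfull unfolding qfull_def
  proof (intro ballI allI)
    fix c l a b assume cl: "c \<in> A" "l \<in> A"
    define u v where "u = qHx c l (a - 1) (b + 1)" and "v = qH0 c l a b"
    define X where "X s s' = (if inh s \<tau> (a - 1) \<and> inh s' \<tau> (b + 1) then u else 0) + (if inh s \<tau> a \<and> inh s' \<tau> b then v else 0)" for s s'
    define Y where "Y s = (if b = \<tau> - 1 then sc dq * qB s c l (a + b) else 0)" for s
    define Z where "Z s = (if a = \<tau> then sc dq * qB s c l (a + b) else 0)" for s
    have r: "sy s (sy s' (X s s')) = Y s + Z s'" for s s'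
      using R cl unfolding X_def Y_def Z_def u_def v_def by blast
    have x: "X s s' = sy s (sy s' (Y s + Z s'))" for s s'
      unfolding r[symmetric] by (cases s; cases s') simp_all
    \<comment> \<open>Each inhomogeneous term \<open>Y\<close> or \<open>Z\<close> depends on one of
      the two signs only, so it cancels in the sum over all four quadrants.\<close>
    have "u + v = X Plus Plus + X Plus Minus + X Minus Plus + X Minus Minus" by (auto simp: X_def)
    also have "\<dots> = 0" unfolding x by simp
    finally show "qHx c l (a - 1) (b + 1) + qH0 c l a b = 0" by (simp add: u_def v_def)
  qed
qed

end

end

text \<open>A series supported on finitely many terms of each total degree is divisible by \<open>q\<^sup>-\<^sup>1 x - q\<close> only if it
  vanishes at \<open>x = q\<^sup>2\<close>.\<close>

lemma root_of_divisible:
  fixes D R :: "int \<Rightarrow> 'a::cqalg"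
  assumes D: "\<And>a. sc qi * D (a - 1) - sc qv * D a = R a" and fin: "\<And>a. \<bar>a\<bar> > K \<Longrightarrow> D a = 0"
    and R: "\<And>a. a \<noteq> m \<Longrightarrow> a \<noteq> m + 1 \<Longrightarrow> R a = 0"
  shows "R m + sc (qv * qv) * R (m + 1) = 0"
proof -
  have q: "sc qv * (sc qi * y) = (y :: 'a)" "sc qi * (sc qv * y) = (y :: 'a)" for y
    using qv_nonzero by (simp_all add: sc_one flip: mult.assoc sc_mult)
  have up: "D a = sc qi * (sc qi * D (a - 1))" if "a < m" for a
  proof -
    have "sc qi * D (a - 1) = sc qv * D a" using D[of a] R[of a] that by simp
    then show ?thesis using q(2)[of "D a"] by simp
  qed
  have down: "D a = sc qv * (sc qv * D (a + 1))" if "a > m" for a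
  proof -
    have "sc qi * D a = sc qv * D (a + 1)" using D[of "a + 1"] R[of "a + 1"] that by simp
    then show ?thesis using q(1)[of "D a"] by simp
  qed
  have "D a = 0" if "a < m" "nat (a + \<bar>K\<bar> + 1) \<le> r" for a r
    using that
  proof (induction r arbitrary: a)
    case (Suc r) then show ?case using up[of a] Suc.IH[of "a - 1"] by simp
  qed (use fin in auto)
  from this[OF _ order_refl] have low: "D (m - 1) = 0" by simp
  have "D a = 0" if "a > m" "nat (\<bar>K\<bar> + 1 - a) \<le> r" for a r
    using that
  proof (induction r arbitrary: a)
    case (Suc r) then show ?case using down[of a] Suc.IH[of "a + 1"] by simp
  qed (use fin in auto)
  from this[OF _ order_refl] have high: "D (m + 1) = 0" by simp
  have "R m = - (sc qv * D m)" "R (m + 1) = sc qi * D m" using D[of m] D[of "m + 1"] low high by simp_all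
  then show ?thesis by (simp add: sc_mult mult.assoc q)
qed

section \<open>The relation between E and F on the four quadrants\<close>

context central_powers begin

text \<open>The right-hand side consists of two delta functions. Cut down to a quadrant, they become
  geometric series along lines of constant degree, and one linear factor for each sign reduces them
  to terms supported on the axes.\<close>

lemma EF_iff:
  fixes com :: "int \<Rightarrow> int \<Rightarrow> 'a" and h :: "pmsign \<Rightarrow> int \<Rightarrow> 'a"
  assumes h: "\<And>s N. sg s * N < 0 \<Longrightarrow> h s N = 0"
    and c: "\<And>s s' a b. c s s' a b = sy s (sy s' (if inh s 0 a \<and> inh s' 1 b then com a b else 0))"
  shows "(\<forall>a b. com a b = sc dq * (C (a - b) * h Plus (a + b) - C (b - a) * h Minus (a + b))) \<longleftrightarrow>
    (\<forall>s s' a b. lin 1 (- 1) (C (2 * sg s')) (lin 1 (- 1) (C (2 * sg s)) (c s s')) a b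
      = sc dq * (lin 1 (- 1) (C (2 * sg s')) (\<lambda>a b. if b = 0 then C (sg s * a) * h s a else 0) a b
        - lin 1 (- 1) (C (2 * sg s)) (\<lambda>a b. if a = 0 then C (- sg s' * b) * h s' b else 0) a b))"
   (is "?L \<longleftrightarrow> ?R")
proof -
  define g where "g a b = sc dq * (C (a - b) * h Plus (a + b) - C (b - a) * h Minus (a + b))" for a b
  define c0 where "c0 s s' a b = sy s (sy s' (if inh s 0 a \<and> inh s' 1 b then g a b else 0))" for s s' a b
  have lin1: "lin 1 (- 1) (C j) S a b = C j * S (a - 1) (b + 1) - S a b" for j S a b
    by (simp add: lin_def sc_one sc_uminus)
  have key: "lin 1 (- 1) (C (2 * sg s')) (lin 1 (- 1) (C (2 * sg s)) (c0 s s')) a b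
      = sc dq * (lin 1 (- 1) (C (2 * sg s')) (\<lambda>a b. if b = 0 then C (sg s * a) * h s a else 0) a b
        - lin 1 (- 1) (C (2 * sg s)) (\<lambda>a b. if a = 0 then C (- sg s' * b) * h s' b else 0) a b)" for s s' a b
  proof -
    \<comment> \<open>As \<open>h s N\<close> is 0 on one side of \<open>N = 0\<close>, the
      restriction to the quadrant is a difference of two series that are each restricted in one
      coordinate only. A single linear factor clears each of them up to a term on an axis.\<close>
    define tz where "tz a b = sy s' (if inh s' 1 b then sc dq * (C (sg s * (a - b)) * h s (a + b)) else 0)" for a b
    define tw where "tw a b = (if s = s' then sy s (if \<not> inh s 0 a then sc dq * (C (sg s' * (a - b)) * h s' (a + b)) else 0)
      else - sy s (if inh s 0 a then sc dq * (C (sg s' * (a - b)) * h s' (a + b)) else 0))" for a b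
    have c0: "c0 s s' a b = tz a b - tw a b" for a b
      using h[of Plus "a + b"] h[of Minus "a + b"]
      by (cases s; cases s') (auto simp: c0_def tz_def tw_def g_def right_diff_distrib)
    have CC: "C j * (sc y * (C i * z)) = sc y * (C (j + i) * z)" for j i y z
      by (simp add: C_add mult.assoc cen_left_commute[OF C_cen, of j "sc y"])
    have tz: "lin 1 (- 1) (C (2 * sg s)) tz = (\<lambda>a b. sc dq * (if b = 0 then C (sg s * a) * h s a else 0))"
    proof (intro ext)
      fix a b show "lin 1 (- 1) (C (2 * sg s)) tz a b = sc dq * (if b = 0 then C (sg s * a) * h s a else 0)"
        by (cases s; cases s'; cases "b = 0"; cases "b \<ge> 1") (auto simp: lin1 tz_def CC algebra_simps)
    qed
    have tw: "lin 1 (- 1) (C (2 * sg s')) tw = (\<lambda>a b. sc dq * (if a = 0 then C (- sg s' * b) * h s' b else 0))"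
    proof (intro ext)
      fix a b show "lin 1 (- 1) (C (2 * sg s')) tw a b = sc dq * (if a = 0 then C (- sg s' * b) * h s' b else 0)"
        by (cases s; cases s'; cases "a = 0"; cases "a \<ge> 1") (auto simp: lin1 tw_def CC algebra_simps)
    qed
    have c0': "c0 s s' = (\<lambda>a b. tz a b - tw a b)" using c0 by blast
    have "lin 1 (- 1) (C (2 * sg s')) (lin 1 (- 1) (C (2 * sg s)) (c0 s s'))
      = (\<lambda>a b. lin 1 (- 1) (C (2 * sg s')) (lin 1 (- 1) (C (2 * sg s)) tz) a b
        - lin 1 (- 1) (C (2 * sg s)) (lin 1 (- 1) (C (2 * sg s')) tw) a b)"
      unfolding c0' lin_diff lin_lin[OF C_cen C_cen, of 1 "- 1" "2 * sg s" 1 "- 1" "2 * sg s'"] ..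
    moreover have "lin 1 (- 1) (C j) (\<lambda>a b. sc dq * S a b) a b = sc dq * lin 1 (- 1) (C j) S a b" for j S a b
      by (simp add: lin1 right_diff_distrib cen_left_commute[OF C_cen, of j "sc dq"])
    ultimately show ?thesis unfolding tz tw by (simp add: right_diff_distrib)
  qed
  have "?L \<longleftrightarrow> (\<forall>a b. com a b = g a b)" by (simp add: g_def)
  also have "\<dots> \<longleftrightarrow> (\<forall>s s' a b. c s s' a b = c0 s s' a b)"
  proof
    assume R: "\<forall>s s' a b. c s s' a b = c0 s s' a b"
    show "\<forall>a b. com a b = g a b"
    proof (intro allI)
      fix a b
      obtain s s' where "inh s 0 a" "inh s' 1 b" by (metis inh.simps not_less)
      then show "com a b = g a b" using R[rule_format, of s s' a b] unfolding c c0_def by (metis sy_sy(1))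
    qed
  qed (simp add: c c0_def)
  also have "\<dots> \<longleftrightarrow> (\<forall>s s' a b. lin 1 (- 1) (C (2 * sg s')) (lin 1 (- 1) (C (2 * sg s)) (c s s')) a b
     = lin 1 (- 1) (C (2 * sg s')) (lin 1 (- 1) (C (2 * sg s)) (c0 s s')) a b)"
  proof (rule all_cong1, rule all_cong1)
    fix s s'
    have b: "bd (dir s) (\<lambda>a b. sy s (sy s' (if inh s 0 a \<and> inh s' 1 b then y a b else (0::'a))))" for y
      unfolding bd_def
    proof (intro allI)
      fix a b show "\<exists>K\<ge>0. \<forall>k\<ge>K. sy s (sy s' (if inh s 0 (a - dsg (dir s) * k) \<and> inh s' 1 (b + dsg (dir s) * k)
         then y (a - dsg (dir s) * k) (b + dsg (dir s) * k) else 0)) = 0"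
        by (cases s) (auto intro!: exI[of _ "\<bar>a\<bar> + 1"])
    qed
    have bc: "bd (dir s) (c s s')" "bd (dir s) (c0 s s')"
      using b[of com] b[of g] unfolding c[symmetric] c0_def[symmetric] by simp_all
    have "(\<forall>a b. c s s' a b = c0 s s' a b) \<longleftrightarrow> (\<forall>a b. lin 1 (- 1) (C (2 * sg s)) (c s s') a b = lin 1 (- 1) (C (2 * sg s)) (c0 s s') a b)"
      by (rule eq_iff_lin_eq[OF bc]) auto
    also have "\<dots> \<longleftrightarrow> (\<forall>a b. lin 1 (- 1) (C (2 * sg s')) (lin 1 (- 1) (C (2 * sg s)) (c s s')) a b
     = lin 1 (- 1) (C (2 * sg s')) (lin 1 (- 1) (C (2 * sg s)) (c0 s s')) a b)"
      by (rule eq_iff_lin_eq[OF bd_lin[OF bc(1)] bd_lin[OF bc(2)]]) auto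
    finally show "(\<forall>a b. c s s' a b = c0 s s' a b) \<longleftrightarrow> (\<forall>a b. lin 1 (- 1) (C (2 * sg s')) (lin 1 (- 1) (C (2 * sg s)) (c s s')) a b
     = lin 1 (- 1) (C (2 * sg s')) (lin 1 (- 1) (C (2 * sg s)) (c0 s s')) a b)" .
  qed
  finally show ?thesis unfolding key .
qed

end

text \<open>Both factors vanish on the same side of 0, so all contributing exponents lie between 0
  and \<open>N\<close>.\<close>

lemma hs_mult:
  fixes A B :: "'a::ring_1 fps"
  shows "hs s (A * B) N = (\<Sum>p\<in>cvl N. hs s A (N - p) * hs s B p)"
proof (cases "sg s * N < 0")
  case True
  have "hs s A (N - p) * hs s B p = 0" for p
  proof (cases "sg s * p < 0")
    case False
    then have "sg s * (N - p) < 0" using True by (simp add: right_diff_distrib)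
    then show ?thesis by (simp add: hs_neg)
  qed (simp add: hs_neg)
  then show ?thesis using True by (simp add: hs_neg)
next
  case False
  define n where "n = nat (sg s * N)"
  have inj: "inj_on (\<lambda>i. sg s * int (n - i)) {0..n}" by (cases s) (auto simp: inj_on_def)
  have N: "N = sg s * int n" using False by (cases s) (auto simp: n_def)
  have "(\<Sum>p\<in>cvl N. hs s A (N - p) * hs s B p) = (\<Sum>p\<in>(\<lambda>i. sg s * int (n - i)) ` {0..n}. hs s A (N - p) * hs s B p)"
  proof (rule sum.mono_neutral_right)
    show "(\<lambda>i. sg s * int (n - i)) ` {0..n} \<subseteq> cvl N" by (cases s) (auto simp: cvl_def N)
    show "\<forall>p\<in>cvl N - (\<lambda>i. sg s * int (n - i)) ` {0..n}. hs s A (N - p) * hs s B p = 0"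
    proof
      fix p assume p: "p \<in> cvl N - (\<lambda>i. sg s * int (n - i)) ` {0..n}"
      have "sg s * p < 0 \<or> sg s * (N - p) < 0"
      proof (rule ccontr)
        assume "\<not> (sg s * p < 0 \<or> sg s * (N - p) < 0)"
        then have "p = sg s * int (n - nat (int n - sg s * p))" "nat (int n - sg s * p) \<in> {0..n}"
          by (cases s; auto simp: N)+
        then show False using p by blast
      qed
      then show "hs s A (N - p) * hs s B p = 0" by (auto simp: hs_neg)
    qed
  qed (simp add: cvl_def)
  also have "\<dots> = (\<Sum>i=0..n. hs s A (N - sg s * int (n - i)) * hs s B (sg s * int (n - i)))"
    by (simp only: sum.reindex[OF inj] comp_def)
  also have "\<dots> = (\<Sum>i=0..n. A $ i * B $ (n - i))"
    by (intro sum.cong refl) (cases s; auto simp: hs_def half_series_def N nat_diff_distrib)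
  also have "\<dots> = hs s (A * B) N"
    using False by (simp add: hs_def half_series_def fps_mult_nth n_def)
  finally show ?thesis by simp
qed

lemma eq_iff_diff_zero:
  fixes x y z :: "'a::ab_group_add"
  shows "x - y = z \<Longrightarrow> x = y \<longleftrightarrow> z = 0" and "y - x = z \<Longrightarrow> x = y \<longleftrightarrow> z = 0"
  by auto

section \<open>Currents\<close>

text \<open>\<open>e0\<close> and \<open>f0\<close> reflect the triangular zero modes: the last row
  of \<open>L\<^sup>-\<close> and the last column of \<open>L\<^sup>+\<close> have no constant term.
  They make the exponents in the two halves of a current disjoint.\<close>

locale gauss = central_powers C for C :: "int \<Rightarrow> 'a::cqalg" +
  fixes N :: nat and K Ki :: "pmsign \<Rightarrow> nat \<Rightarrow> nat \<Rightarrow> 'a fps" and k :: "pmsign \<Rightarrow> 'a fps"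
    and e f :: "pmsign \<Rightarrow> nat \<Rightarrow> 'a fps"
  assumes KKi: "i \<in> {1..N} \<Longrightarrow> j \<in> {1..N} \<Longrightarrow> (\<Sum>a=1..N. K s i a * Ki s a j) = (if i = j then 1 else 0)"
    and KiK: "i \<in> {1..N} \<Longrightarrow> j \<in> {1..N} \<Longrightarrow> (\<Sum>a=1..N. Ki s i a * K s a j) = (if i = j then 1 else 0)"
    and e0: "e Minus a $ 0 = 0" and f0: "f Plus a $ 0 = 0"
begin

abbreviation Ks where "Ks s i j \<equiv> hs s (K s i j)"
abbreviation ks where "ks s \<equiv> hs s (k s)"

text \<open>The currents \<open>E(z) = e\<^sup>+(z q\<^sup>c\<^sup>/\<^sup>2) - e\<^sup>-(z q\<^sup>-\<^sup>c\<^sup>/\<^sup>2)\<close> and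
  \<open>F(z) = f\<^sup>+(z q\<^sup>-\<^sup>c\<^sup>/\<^sup>2) - f\<^sup>-(z q\<^sup>c\<^sup>/\<^sup>2)\<close>; no power of \<open>z\<close> occurs in both halves.\<close>

definition Ec :: "nat \<Rightarrow> int \<Rightarrow> 'a" where
  "Ec a p = (if 0 \<le> p then C p * hs Plus (e Plus a) p else - (C (- p) * hs Minus (e Minus a) p))"
definition Fc :: "nat \<Rightarrow> int \<Rightarrow> 'a" where
  "Fc a p = (if 1 \<le> p then C (- p) * hs Plus (f Plus a) p else - (C p * hs Minus (f Minus a) p))"

text \<open>The coefficients of \<open>A\<close> after its argument is multiplied by
  \<open>q^(- \<epsilon> sg s c/2)\<close>. The value \<open>\<epsilon> = -1\<close> is the
  rescaling of \<open>e\<close> in the current \<open>E\<close>, the value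
  \<open>\<epsilon> = 1\<close> that of \<open>f\<close> in \<open>F\<close>.\<close>

definition hat :: "int \<Rightarrow> pmsign \<Rightarrow> 'a fps \<Rightarrow> int \<Rightarrow> 'a" where "hat \<epsilon> s A a = C (- \<epsilon> * sg s * a) * hs s A a"

lemma hat_e: "hat (- 1) s (e s a) p = sy s (if inh s 0 p then Ec a p else 0)"
  using e0[of a] by (cases s) (auto simp: hat_def Ec_def hs_def half_series_def)
lemma hat_f: "hat 1 s (f s a) p = sy s (if inh s 1 p then Fc a p else 0)"
  using f0[of a] by (cases s) (auto simp: hat_def Fc_def hs_def half_series_def not_le)

lemma hat_neg: "sg s * a < 0 \<Longrightarrow> hat \<epsilon> s A a = 0" by (simp add: hat_def hs_neg)

lemma hat_mult: "hat \<epsilon> s (A * B) n = (\<Sum>p\<in>cvl n. hat \<epsilon> s A (n - p) * hat \<epsilon> s B p)"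
  unfolding hat_def hs_mult sum_distrib_left
proof (intro sum.cong refl)
  fix p
  have "C (- \<epsilon> * sg s * n) = C (- \<epsilon> * sg s * (n - p)) * C (- \<epsilon> * sg s * p)"
    unfolding C_add[symmetric] by (simp add: algebra_simps)
  then show "C (- \<epsilon> * sg s * n) * (hs s A (n - p) * hs s B p) = C (- \<epsilon> * sg s * (n - p)) * hs s A (n - p) * (C (- \<epsilon> * sg s * p) * hs s B p)"
    by (simp add: cen_ac C_cen)
qed

lemma cvl_sym: "(\<Sum>p\<in>cvl n. g (n - p) p) = (\<Sum>p\<in>cvl n. g p (n - p))"
  if "\<And>p. p \<notin> cvl n \<Longrightarrow> g p (n - p) = 0" "\<And>p. n - p \<notin> cvl n \<Longrightarrow> g (n - p) p = 0" "\<And>p. p \<notin> cvl n \<Longrightarrow> g (n - p) p = (0::'b::comm_monoid_add)"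
proof -
  have "(\<Sum>p\<in>cvl n. g (n - p) p) = (\<Sum>p\<in>{p\<in>cvl n. n - p \<in> cvl n}. g (n - p) p)"
    by (rule sum.mono_neutral_right) (use that(2) in \<open>auto simp: cvl_def\<close>)
  also have "\<dots> = (\<Sum>p\<in>{p\<in>cvl n. n - p \<in> cvl n}. g p (n - p))"
    by (rule sum.reindex_bij_witness[of _ "\<lambda>p. n - p" "\<lambda>p. n - p"]) auto
  also have "\<dots> = (\<Sum>p\<in>cvl n. g p (n - p))"
    by (rule sum.mono_neutral_left) (use that(3)[of "n - i" for i] in \<open>auto simp: cvl_def\<close>)
  finally show ?thesis .
qed

lemma hat_mult': "hat \<epsilon> s (B * A) n = (\<Sum>p\<in>cvl n. hat \<epsilon> s B p * hat \<epsilon> s A (n - p))"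
proof -
  have z: "hat \<epsilon> s B u * hat \<epsilon> s A v = 0" if "u + v = n" "u \<notin> cvl n \<or> v \<notin> cvl n" for u v
  proof -
    have "sg s * u < 0 \<or> sg s * v < 0" using that by (cases s) (auto simp: cvl_def)
    then show ?thesis using hat_neg by auto
  qed
  show ?thesis unfolding hat_mult
    by (rule cvl_sym[of n "\<lambda>a b. hat \<epsilon> s B a * hat \<epsilon> s A b"]) (rule z; simp)+
qed

lemma hat_conv:
  assumes g: "\<And>p. hat \<epsilon> s g p = sy s (if inh s \<tau> p then Gc p else 0)"
  shows "hat \<epsilon> s (A * g) n = sy s (\<Sum>p\<in>cvl n. if inh s \<tau> p then hat \<epsilon> s A (n - p) * Gc p else 0)"
    and "hat \<epsilon> s (g * A) n = sy s (\<Sum>p\<in>cvl n. if inh s \<tau> p then Gc p * hat \<epsilon> s A (n - p) else 0)"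
  unfolding hat_mult[of \<epsilon> s A g] hat_mult'[of \<epsilon> s g A] g sy_sum sy_mult
  by (intro sum.cong refl; simp)+

lemma hat_sum: "hat \<epsilon> s (sum g A) n = (\<Sum>i\<in>A. hat \<epsilon> s (g i) n)"
  by (simp add: hat_def hs_sum sum_distrib_left)

text \<open>The central element in the argument of the rational function is the rescaling built into
  \<open>hat\<close>; after multiplication by \<open>C\<close> only scalars remain as
  coefficients.\<close>

lemma lin_hat:
  "C (- \<epsilon> * sg s * a) * lin c1 c0 (C (\<epsilon> * sg s)) (prod_zw (hs s A) G) a b = sc c1 * (hat \<epsilon> s A (a - 1) * G (b + 1)) + sc c0 * (hat \<epsilon> s A a * G b)"
  "C (- \<epsilon> * sg s * a) * lin c1 c0 (C (\<epsilon> * sg s)) (prod_wz G (hs s A)) a b = sc c1 * (G (b + 1) * hat \<epsilon> s A (a - 1)) + sc c0 * (G b * hat \<epsilon> s A a)"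
proof -
  have c: "C (- \<epsilon> * sg s * (a - 1)) = C (- \<epsilon> * sg s * a) * C (\<epsilon> * sg s)"
    unfolding C_add[symmetric] by (simp add: algebra_simps)
  show "C (- \<epsilon> * sg s * a) * lin c1 c0 (C (\<epsilon> * sg s)) (prod_zw (hs s A) G) a b = sc c1 * (hat \<epsilon> s A (a - 1) * G (b + 1)) + sc c0 * (hat \<epsilon> s A a * G b)"
    "C (- \<epsilon> * sg s * a) * lin c1 c0 (C (\<epsilon> * sg s)) (prod_wz G (hs s A)) a b = sc c1 * (G (b + 1) * hat \<epsilon> s A (a - 1)) + sc c0 * (G b * hat \<epsilon> s A a)"
    unfolding hat_def c lin_def prod_zw_def prod_wz_def by (simp_all add: distrib_left cen_ac C_cen cen_sc)
qed

lemma C_mult_all: "(\<forall>a b. u a b = v a b) \<longleftrightarrow> (\<forall>a b. C (g a b) * u a b = C (g a b) * (v a b :: 'a))"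
  by (simp add: C_mult_eq_iff)

subsection \<open>Full currents and half currents\<close>

text \<open>Prefix \<open>c\<close>: a relation between full currents, cleared of denominators; prefix \<open>h\<close>: the corresponding
  relations between half currents of given signs; prefix \<open>d\<close>: the relation as in the definition of the algebra.\<close>

definition "c_KF s \<longleftrightarrow> (\<forall>i\<in>{1..N}. \<forall>j\<in>{1..N}. \<forall>l\<in>{1..N}. \<forall>a b.
  lin (r1 j l) (r0 j l) (C (sg s)) (prod_zw (Ks s i j) (Fc l)) a b
    + (if j = l then \<Sum>c=1..N. lin (o1 c j) (o0 c j) (C (sg s)) (prod_zw (Ks s i c) (Fc c)) a b else 0)
  = lin 1 (- 1) (C (sg s)) (prod_wz (Fc l) (Ks s i j)) a b)"
definition "KFx s i j l a p =
   sc (r1 j l) * (hat 1 s (K s i j) a * Fc l p)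
   + (if j = l then \<Sum>c=1..N. sc (o1 c j) * (hat 1 s (K s i c) a * Fc c p) else 0) - Fc l p * hat 1 s (K s i j) a"
definition "KF0 s i j l a p = sc (r0 j l) * (hat 1 s (K s i j) a * Fc l p)
   + (if j = l then \<Sum>c=1..N. sc (o0 c j) * (hat 1 s (K s i c) a * Fc c p) else 0) + Fc l p * hat 1 s (K s i j) a"
definition "h_KF s s' \<longleftrightarrow> (\<forall>i\<in>{1..N}. \<forall>j\<in>{1..N}. \<forall>l\<in>{1..N}. \<forall>a b.
  sy s' ((if inh s' 1 (b + 1) then KFx s i j l (a - 1) (b + 1) else 0) + (if inh s' 1 b then KF0 s i j l a b else 0))
   = (if b = 0 then if j = l then sc dq * (\<Sum>c=1..N. hat 1 s (K s i c * f s c) (a + b)) else 0 else 0))"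

text \<open>Numerators at \<open>x = 1\<close>, where the denominator is \<open>dq\<close> and
  \<open>R\<close> is the permutation matrix. This is why the boundary terms are products at a
  single spectral parameter.\<close>

lemma r_sums: "r1 j l + r0 j l = (if j = l then dq else 0)" "i \<noteq> j \<Longrightarrow> o1 i j + o0 i j = dq" "o1 i i + o0 i i = 0"
  by (auto simp: r1_def r0_def o1_def o0_def)

lemma sum_o:
  fixes v :: "nat \<Rightarrow> 'a"
  assumes "j \<in> {1..N}"
  shows "sc dq * v j + (\<Sum>c=1..N. (sc (o1 c j) + sc (o0 c j)) * v c) = sc dq * (\<Sum>c=1..N. v c)"
    and "sc dq * v j + (\<Sum>c=1..N. (sc (o1 j c) + sc (o0 j c)) * v c) = sc dq * (\<Sum>c=1..N. v c)"
proof -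
  have *: "(\<Sum>c=1..N. (if c = j then 0 else sc dq * v c)) = sc dq * (\<Sum>c=1..N. v c) - sc dq * v j"
  proof -
    have "(\<Sum>c=1..N. (if c = j then 0 else sc dq * v c)) = (\<Sum>c=1..N. sc dq * v c - (if c = j then sc dq * v j else 0))"
      by (intro sum.cong refl) simp
    then show ?thesis using assms by (simp add: sum_subtractf sum_distrib_left)
  qed
  have o: "(sc (o1 c j) + sc (o0 c j)) * v c = (if c = j then 0 else sc dq * v c)"
    "(sc (o1 j c) + sc (o0 j c)) * v c = (if c = j then 0 else sc dq * v c)" for c
    using r_sums(2)[of c j] r_sums(2)[of j c] r_sums(3)[of j] by (auto simp flip: sc_add)
  show "sc dq * v j + (\<Sum>c=1..N. (sc (o1 c j) + sc (o0 c j)) * v c) = sc dq * (\<Sum>c=1..N. v c)"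
    "sc dq * v j + (\<Sum>c=1..N. (sc (o1 j c) + sc (o0 j c)) * v c) = sc dq * (\<Sum>c=1..N. v c)"
    unfolding o * by simp_all
qed

lemma sum_half: "(\<Sum>p\<in>A. if Q p then \<Sum>c\<in>B. u c p else 0) = (\<Sum>c\<in>B. \<Sum>p\<in>A. if Q p then u c p else (0::'a))"
  by (subst sum.swap) (intro sum.cong refl, simp)

lemma sum_half_scale: "(\<Sum>p\<in>A. if Q p then y * u p else 0) = y * (\<Sum>p\<in>A. if Q p then u p else (0::'a))"
  by (simp add: sum_distrib_left if_distrib cong: if_cong)

text \<open>\<open>split_iff\<close> with \<open>K\<close> as the one-sided factor. Its boundary sum
  sees the numerators only through their values at \<open>x = 1\<close>, so it is \<open>dq\<close>
  times a coefficient of \<open>K f\<close> with both factors at the same argument.\<close>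

lemma c_KF_iff: "c_KF s \<longleftrightarrow> (\<forall>s'. h_KF s s')"
proof -
  have "(\<forall>a b. lin (r1 j l) (r0 j l) (C (sg s)) (prod_zw (Ks s i j) (Fc l)) a b
      + (if j = l then \<Sum>c=1..N. lin (o1 c j) (o0 c j) (C (sg s)) (prod_zw (Ks s i c) (Fc c)) a b else 0)
      = lin 1 (- 1) (C (sg s)) (prod_wz (Fc l) (Ks s i j)) a b) \<longleftrightarrow>
    (\<forall>s' a b. sy s' ((if inh s' 1 (b + 1) then KFx s i j l (a - 1) (b + 1) else 0) + (if inh s' 1 b then KF0 s i j l a b else 0))
   = (if b = 0 then if j = l then sc dq * (\<Sum>c=1..N. hat 1 s (K s i c * f s c) (a + b)) else 0 else 0))"
    (is "?L \<longleftrightarrow> ?R") if "j \<in> {1..N}" for i j l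
  proof -
    have "?L \<longleftrightarrow> (\<forall>a b. KFx s i j l (a - 1) (b + 1) + KF0 s i j l a b = 0)"
    proof (rule trans[OF C_mult_all[where g = "\<lambda>a b. - 1 * sg s * a"]], rule all_cong1, rule all_cong1)
      fix a b
      have "C (- 1 * sg s * a) * (lin (r1 j l) (r0 j l) (C (sg s)) (prod_zw (Ks s i j) (Fc l)) a b
        + (if j = l then \<Sum>c=1..N. lin (o1 c j) (o0 c j) (C (sg s)) (prod_zw (Ks s i c) (Fc c)) a b else 0))
        - C (- 1 * sg s * a) * lin 1 (- 1) (C (sg s)) (prod_wz (Fc l) (Ks s i j)) a b
        = KFx s i j l (a - 1) (b + 1) + KF0 s i j l a b"
        using lin_hat[of 1 s a] 
        by (simp add: distrib_left sum_distrib_left KFx_def KF0_def sum.distrib sc_one sc_uminus)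
      from this show "C (- 1 * sg s * a) * (lin (r1 j l) (r0 j l) (C (sg s)) (prod_zw (Ks s i j) (Fc l)) a b
        + (if j = l then \<Sum>c=1..N. lin (o1 c j) (o0 c j) (C (sg s)) (prod_zw (Ks s i c) (Fc c)) a b else 0))
        = C (- 1 * sg s * a) * lin 1 (- 1) (C (sg s)) (prod_wz (Fc l) (Ks s i j)) a b \<longleftrightarrow> KFx s i j l (a - 1) (b + 1) + KF0 s i j l a b = 0"
        by (rule eq_iff_diff_zero(1))
    qed
    also have "\<dots> \<longleftrightarrow> (\<forall>s' a b. sy s' ((if inh s' 1 (b + 1) then KFx s i j l (a - 1) (b + 1) else 0) + (if inh s' 1 b then KF0 s i j l a b else 0))
   = (if b = 1 - 1 then (if j = l then sc dq * (\<Sum>c=1..N. hat 1 s (K s i c * f s c) (a + b)) else 0) else 0))"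
    proof (rule split_iff[where s = s])
      show "KFx s i j l a p = 0 \<and> KF0 s i j l a p = 0" if "sg s * a < 0" for a p
        using that by (simp add: KFx_def KF0_def hat_neg)
      fix n
      have *: "KFx s i j l (n - p) p + KF0 s i j l (n - p) p = (if j = l then sc dq * (\<Sum>c=1..N. hat 1 s (K s i c) (n - p) * Fc c p) else 0)" for p
      proof -
        have "KFx s i j l (n - p) p + KF0 s i j l (n - p) p = sc (r1 j l + r0 j l) * (hat 1 s (K s i j) (n - p) * Fc l p)
          + (if j = l then \<Sum>c=1..N. (sc (o1 c j) + sc (o0 c j)) * (hat 1 s (K s i c) (n - p) * Fc c p) else 0)"
          by (simp add: KFx_def KF0_def sc_add algebra_simps sum.distrib)
        then show ?thesis using sum_o(1)[OF that, of "\<lambda>c. hat 1 s (K s i c) (n - p) * Fc c p"] by (cases "j = l") (simp_all add: r_sums)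
      qed
      show "(if j = l then sc dq * (\<Sum>c=1..N. hat 1 s (K s i c * f s c) n) else 0)
        = sy s (\<Sum>p\<in>cvl n. if inh s 1 p then KFx s i j l (n - p) p + KF0 s i j l (n - p) p else 0)"
        unfolding * by (cases "j = l") (simp_all add: hat_conv(1)[OF hat_f] sum_half_scale sum_half sy_mult cong: if_cong flip: sy_sum)
    qed simp
    finally show ?thesis by simp
  qed
  then show ?thesis unfolding c_KF_def h_KF_def by blast
qed

definition "c_KE s \<longleftrightarrow> (\<forall>i\<in>{1..N}. \<forall>j\<in>{1..N}. \<forall>l\<in>{1..N}. \<forall>a b.
  lin 1 (- 1) (C (- sg s)) (prod_zw (Ks s i j) (Ec l)) a b = 
  lin (r1 i l) (r0 i l) (C (- sg s)) (prod_wz (Ec l) (Ks s i j)) a b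
    + (if i = l then \<Sum>c=1..N. lin (o1 i c) (o0 i c) (C (- sg s)) (prod_wz (Ec c) (Ks s c j)) a b else 0))"
definition "KEx s i j l a p = sc (r1 i l) * (Ec l p * hat (- 1) s (K s i j) a)
   + (if i = l then \<Sum>c=1..N. sc (o1 i c) * (Ec c p * hat (- 1) s (K s c j) a) else 0) - hat (- 1) s (K s i j) a * Ec l p"
definition "KE0 s i j l a p = sc (r0 i l) * (Ec l p * hat (- 1) s (K s i j) a)
   + (if i = l then \<Sum>c=1..N. sc (o0 i c) * (Ec c p * hat (- 1) s (K s c j) a) else 0) + hat (- 1) s (K s i j) a * Ec l p"
definition "h_KE s s' \<longleftrightarrow> (\<forall>i\<in>{1..N}. \<forall>j\<in>{1..N}. \<forall>l\<in>{1..N}. \<forall>a b.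
  sy s' ((if inh s' 0 (b + 1) then KEx s i j l (a - 1) (b + 1) else 0) + (if inh s' 0 b then KE0 s i j l a b else 0))
   = (if b = - 1 then if i = l then sc dq * (\<Sum>c=1..N. hat (- 1) s (e s c * K s c j) (a + b)) else 0 else 0))"

lemma c_KE_iff: "c_KE s \<longleftrightarrow> (\<forall>s'. h_KE s s')"
proof -
  have "(\<forall>a b. lin 1 (- 1) (C (- sg s)) (prod_zw (Ks s i j) (Ec l)) a b = 
      lin (r1 i l) (r0 i l) (C (- sg s)) (prod_wz (Ec l) (Ks s i j)) a b
      + (if i = l then \<Sum>c=1..N. lin (o1 i c) (o0 i c) (C (- sg s)) (prod_wz (Ec c) (Ks s c j)) a b else 0)) \<longleftrightarrow>
    (\<forall>s' a b. sy s' ((if inh s' 0 (b + 1) then KEx s i j l (a - 1) (b + 1) else 0) + (if inh s' 0 b then KE0 s i j l a b else 0))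
   = (if b = - 1 then if i = l then sc dq * (\<Sum>c=1..N. hat (- 1) s (e s c * K s c j) (a + b)) else 0 else 0))"
    (is "?L \<longleftrightarrow> ?R") if "i \<in> {1..N}" for i j l
  proof -
    have "?L \<longleftrightarrow> (\<forall>a b. KEx s i j l (a - 1) (b + 1) + KE0 s i j l a b = 0)"
    proof (rule trans[OF C_mult_all[where g = "\<lambda>a b. - (- 1) * sg s * a"]], rule all_cong1, rule all_cong1)
      fix a b
      have "C (- (- 1) * sg s * a) * (lin (r1 i l) (r0 i l) (C (- sg s)) (prod_wz (Ec l) (Ks s i j)) a b
        + (if i = l then \<Sum>c=1..N. lin (o1 i c) (o0 i c) (C (- sg s)) (prod_wz (Ec c) (Ks s c j)) a b else 0))
        - C (- (- 1) * sg s * a) * lin 1 (- 1) (C (- sg s)) (prod_zw (Ks s i j) (Ec l)) a b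
        = KEx s i j l (a - 1) (b + 1) + KE0 s i j l a b"
        using lin_hat[of "- 1" s a]
        by (simp add: distrib_left sum_distrib_left KEx_def KE0_def sum.distrib sc_one sc_uminus)
      from this show "C (- (- 1) * sg s * a) * lin 1 (- 1) (C (- sg s)) (prod_zw (Ks s i j) (Ec l)) a b
        = C (- (- 1) * sg s * a) * (lin (r1 i l) (r0 i l) (C (- sg s)) (prod_wz (Ec l) (Ks s i j)) a b
        + (if i = l then \<Sum>c=1..N. lin (o1 i c) (o0 i c) (C (- sg s)) (prod_wz (Ec c) (Ks s c j)) a b else 0)) \<longleftrightarrow> KEx s i j l (a - 1) (b + 1) + KE0 s i j l a b = 0"
        by (rule eq_iff_diff_zero(2))
    qed
    also have "\<dots> \<longleftrightarrow> (\<forall>s' a b. sy s' ((if inh s' 0 (b + 1) then KEx s i j l (a - 1) (b + 1) else 0) + (if inh s' 0 b then KE0 s i j l a b else 0))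
   = (if b = 0 - 1 then (if i = l then sc dq * (\<Sum>c=1..N. hat (- 1) s (e s c * K s c j) (a + b)) else 0) else 0))"
    proof (rule split_iff[where s = s])
      show "KEx s i j l a p = 0 \<and> KE0 s i j l a p = 0" if "sg s * a < 0" for a p
        using that by (simp add: KEx_def KE0_def hat_neg)
      fix n
      have *: "KEx s i j l (n - p) p + KE0 s i j l (n - p) p = (if i = l then sc dq * (\<Sum>c=1..N. Ec c p * hat (- 1) s (K s c j) (n - p)) else 0)" for p
      proof -
        have "KEx s i j l (n - p) p + KE0 s i j l (n - p) p = sc (r1 i l + r0 i l) * (Ec l p * hat (- 1) s (K s i j) (n - p))
          + (if i = l then \<Sum>c=1..N. (sc (o1 i c) + sc (o0 i c)) * (Ec c p * hat (- 1) s (K s c j) (n - p)) else 0)"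
          by (simp add: KEx_def KE0_def sc_add algebra_simps sum.distrib)
        then show ?thesis using sum_o(2)[OF that, of "\<lambda>c. Ec c p * hat (- 1) s (K s c j) (n - p)"] by (cases "i = l") (simp_all add: r_sums)
      qed
      show "(if i = l then sc dq * (\<Sum>c=1..N. hat (- 1) s (e s c * K s c j) n) else 0)
        = sy s (\<Sum>p\<in>cvl n. if inh s 0 p then KEx s i j l (n - p) p + KE0 s i j l (n - p) p else 0)"
        unfolding * by (cases "i = l") (simp_all add: hat_conv(2)[OF hat_e] sum_half_scale sum_half sy_mult cong: if_cong flip: sy_sum)
    qed simp
    finally show ?thesis by simp
  qed
  then show ?thesis unfolding c_KE_def h_KE_def by blast
qed

definition "c_kF s \<longleftrightarrow> (\<forall>l\<in>{1..N}. \<forall>a b.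
  lin qv (- qi) (C (sg s)) (prod_zw (ks s) (Fc l)) a b = lin 1 (- 1) (C (sg s)) (prod_wz (Fc l) (ks s)) a b)"
definition "kFx s l a p = sc qv * (hat 1 s (k s) a * Fc l p) - Fc l p * hat 1 s (k s) a"
definition "kF0 s l a p = - (sc qi * (hat 1 s (k s) a * Fc l p)) + Fc l p * hat 1 s (k s) a"
definition "h_kF s s' \<longleftrightarrow> (\<forall>l\<in>{1..N}. \<forall>a b.
  sy s' ((if inh s' 1 (b + 1) then kFx s l (a - 1) (b + 1) else 0) + (if inh s' 1 b then kF0 s l a b else 0))
   = (if b = 0 then - (sc dq * hat 1 s (k s * f s l) (a + b)) else 0))"

lemma c_kF_iff: "c_kF s \<longleftrightarrow> (\<forall>s'. h_kF s s')"
proof -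
  have "(\<forall>a b. lin qv (- qi) (C (sg s)) (prod_zw (ks s) (Fc l)) a b = lin 1 (- 1) (C (sg s)) (prod_wz (Fc l) (ks s)) a b) \<longleftrightarrow>
    (\<forall>s' a b. sy s' ((if inh s' 1 (b + 1) then kFx s l (a - 1) (b + 1) else 0) + (if inh s' 1 b then kF0 s l a b else 0))
   = (if b = 0 then - (sc dq * hat 1 s (k s * f s l) (a + b)) else 0))" (is "?L \<longleftrightarrow> ?R") for l
  proof -
    have "?L \<longleftrightarrow> (\<forall>a b. kFx s l (a - 1) (b + 1) + kF0 s l a b = 0)"
    proof (rule trans[OF C_mult_all[where g = "\<lambda>a b. - 1 * sg s * a"]], rule all_cong1, rule all_cong1)
      fix a b
      have "C (- 1 * sg s * a) * lin qv (- qi) (C (sg s)) (prod_zw (ks s) (Fc l)) a b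
        - C (- 1 * sg s * a) * lin 1 (- 1) (C (sg s)) (prod_wz (Fc l) (ks s)) a b = kFx s l (a - 1) (b + 1) + kF0 s l a b"
        using lin_hat[of 1 s a] by (simp add: kFx_def kF0_def sc_one sc_uminus)
      from this show "C (- 1 * sg s * a) * lin qv (- qi) (C (sg s)) (prod_zw (ks s) (Fc l)) a b
        = C (- 1 * sg s * a) * lin 1 (- 1) (C (sg s)) (prod_wz (Fc l) (ks s)) a b \<longleftrightarrow> kFx s l (a - 1) (b + 1) + kF0 s l a b = 0"
        by (rule eq_iff_diff_zero(1))
    qed
    also have "\<dots> \<longleftrightarrow> (\<forall>s' a b. sy s' ((if inh s' 1 (b + 1) then kFx s l (a - 1) (b + 1) else 0) + (if inh s' 1 b then kF0 s l a b else 0))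
   = (if b = 1 - 1 then - (sc dq * hat 1 s (k s * f s l) (a + b)) else 0))"
    proof (rule split_iff[where s = s])
      show "kFx s l a p = 0 \<and> kF0 s l a p = 0" if "sg s * a < 0" for a p
        using that by (simp add: kFx_def kF0_def hat_neg)
      fix n
      have *: "kFx s l (n - p) p + kF0 s l (n - p) p = - sc dq * (hat 1 s (k s) (n - p) * Fc l p)" for p
        by (simp add: kFx_def kF0_def sc_diff algebra_simps)
      show "- (sc dq * hat 1 s (k s * f s l) n) = sy s (\<Sum>p\<in>cvl n. if inh s 1 p then kFx s l (n - p) p + kF0 s l (n - p) p else 0)"
        unfolding * hat_conv(1)[OF hat_f] sum_half_scale by (simp only: sy_mult(2)[symmetric] mult_minus_left[symmetric])
    qed simp
    finally show ?thesis by simp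
  qed
  then show ?thesis unfolding c_kF_def h_kF_def by blast
qed

definition "c_kE s \<longleftrightarrow> (\<forall>l\<in>{1..N}. \<forall>a b.
  lin 1 (- 1) (C (- sg s)) (prod_zw (ks s) (Ec l)) a b = lin qv (- qi) (C (- sg s)) (prod_wz (Ec l) (ks s)) a b)"
definition "kEx s l a p = sc qv * (Ec l p * hat (- 1) s (k s) a) - hat (- 1) s (k s) a * Ec l p"
definition "kE0 s l a p = - (sc qi * (Ec l p * hat (- 1) s (k s) a)) + hat (- 1) s (k s) a * Ec l p"
definition "h_kE s s' \<longleftrightarrow> (\<forall>l\<in>{1..N}. \<forall>a b.
  sy s' ((if inh s' 0 (b + 1) then kEx s l (a - 1) (b + 1) else 0) + (if inh s' 0 b then kE0 s l a b else 0))
   = (if b = - 1 then - (sc dq * hat (- 1) s (e s l * k s) (a + b)) else 0))"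

lemma c_kE_iff: "c_kE s \<longleftrightarrow> (\<forall>s'. h_kE s s')"
proof -
  have "(\<forall>a b. lin 1 (- 1) (C (- sg s)) (prod_zw (ks s) (Ec l)) a b = lin qv (- qi) (C (- sg s)) (prod_wz (Ec l) (ks s)) a b) \<longleftrightarrow>
    (\<forall>s' a b. sy s' ((if inh s' 0 (b + 1) then kEx s l (a - 1) (b + 1) else 0) + (if inh s' 0 b then kE0 s l a b else 0))
   = (if b = - 1 then - (sc dq * hat (- 1) s (e s l * k s) (a + b)) else 0))" (is "?L \<longleftrightarrow> ?R") for l
  proof -
    have "?L \<longleftrightarrow> (\<forall>a b. kEx s l (a - 1) (b + 1) + kE0 s l a b = 0)"
    proof (rule trans[OF C_mult_all[where g = "\<lambda>a b. - (- 1) * sg s * a"]], rule all_cong1, rule all_cong1)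
      fix a b
      have "C (- (- 1) * sg s * a) * lin qv (- qi) (C (- sg s)) (prod_wz (Ec l) (ks s)) a b
        - C (- (- 1) * sg s * a) * lin 1 (- 1) (C (- sg s)) (prod_zw (ks s) (Ec l)) a b = kEx s l (a - 1) (b + 1) + kE0 s l a b"
        using lin_hat[of "- 1" s a] by (simp add: kEx_def kE0_def sc_one sc_uminus)
      from this show "C (- (- 1) * sg s * a) * lin 1 (- 1) (C (- sg s)) (prod_zw (ks s) (Ec l)) a b
        = C (- (- 1) * sg s * a) * lin qv (- qi) (C (- sg s)) (prod_wz (Ec l) (ks s)) a b \<longleftrightarrow> kEx s l (a - 1) (b + 1) + kE0 s l a b = 0"
        by (rule eq_iff_diff_zero(2))
    qed
    also have "\<dots> \<longleftrightarrow> (\<forall>s' a b. sy s' ((if inh s' 0 (b + 1) then kEx s l (a - 1) (b + 1) else 0) + (if inh s' 0 b then kE0 s l a b else 0))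
   = (if b = 0 - 1 then - (sc dq * hat (- 1) s (e s l * k s) (a + b)) else 0))"
    proof (rule split_iff[where s = s])
      show "kEx s l a p = 0 \<and> kE0 s l a p = 0" if "sg s * a < 0" for a p
        using that by (simp add: kEx_def kE0_def hat_neg)
      fix n
      have *: "kEx s l (n - p) p + kE0 s l (n - p) p = - sc dq * (Ec l p * hat (- 1) s (k s) (n - p))" for p
        by (simp add: kEx_def kE0_def sc_diff algebra_simps)
      show "- (sc dq * hat (- 1) s (e s l * k s) n) = sy s (\<Sum>p\<in>cvl n. if inh s 0 p then kEx s l (n - p) p + kE0 s l (n - p) p else 0)"
        unfolding * hat_conv(2)[OF hat_e] sum_half_scale by (simp only: sy_mult(2)[symmetric] mult_minus_left[symmetric])
    qed simp
    finally show ?thesis by simp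
  qed
  then show ?thesis unfolding c_kE_def h_kE_def by blast
qed

end

section \<open>Quadratic relations and the relation between E and F for half currents\<close>

context gauss begin

lemma hat_ext: "(\<And>n. hat \<epsilon> s A n = hat \<epsilon> s B n) \<Longrightarrow> A = B"
  by (rule hs_ext[of s]) (simp add: hat_def C_mult_eq_iff)

lemma qrange_cvl:
  fixes g :: "int \<Rightarrow> 'b::comm_monoid_add"
  assumes "\<tau> = 0 \<or> \<tau> = 1"
  shows "(\<Sum>p\<in>cvl n. if inh s \<tau> (n - p) \<and> inh s \<tau> p then g p else 0) = (\<Sum>p\<in>qrange \<tau> s n. g p)"
proof (cases s)
  case Plus
  show ?thesis by (rule sum.mono_neutral_cong_right) (use assms in \<open>auto simp: Plus cvl_def\<close>)
next
  case Minus
  show ?thesis by (rule sum.mono_neutral_cong_right) (use assms in \<open>auto simp: Minus cvl_def\<close>)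
qed

abbreviation GF where "GF c a l p \<equiv> Fc c a * Fc l p"
abbreviation GE where "GE c a l p \<equiv> Ec l p * Ec c a"

lemma qB_F: "qB GF 1 s c l n = hat 1 s (f s c * f s l) n"
  unfolding hat_mult hat_f sy_mult sy_sy qB_def
  by (subst qrange_cvl[symmetric, of 1]) (auto intro!: sum.cong)

lemma qB_E: "qB GE 0 s c l n = hat (- 1) s (e s l * e s c) n"
  unfolding hat_mult'[of "- 1" s "e s l"] hat_e sy_mult sy_sy qB_def
  by (subst qrange_cvl[symmetric, of 0]) (auto intro!: sum.cong)

definition "c_FF \<longleftrightarrow> (\<forall>c\<in>{1..N}. \<forall>l\<in>{1..N}. \<forall>a b. lin qv (- qi) 1 (prod_zw (Fc c) (Fc l)) a b
  = lin (r1 c l) (r0 c l) 1 (prod_wz (Fc l) (Fc c)) a b + lin (o1 c l) (o0 c l) 1 (prod_wz (Fc c) (Fc l)) a b)"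
definition "c_EE \<longleftrightarrow> (\<forall>c\<in>{1..N}. \<forall>l\<in>{1..N}. \<forall>a b. lin (r1 c l) (r0 c l) 1 (prod_zw (Ec c) (Ec l)) a b
  + lin (o1 l c) (o0 l c) 1 (prod_zw (Ec l) (Ec c)) a b = lin qv (- qi) 1 (prod_wz (Ec l) (Ec c)) a b)"

definition "h_FF s s' \<longleftrightarrow> (\<forall>c\<in>{1..N}. \<forall>l\<in>{1..N}. \<forall>a b.
  sy s (sy s' ((if inh s 1 (a - 1) \<and> inh s' 1 (b + 1) then qHx (<) GF c l (a - 1) (b + 1) else 0)
      + (if inh s 1 a \<and> inh s' 1 b then qH0 (<) GF c l a b else 0)))
      = (if b = 0 then sc dq * hat 1 s (f s c * f s l) (a + b) else 0) + (if a = 1 then sc dq * hat 1 s' (f s' c * f s' l) (a + b) else 0))"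
definition "h_EE s s' \<longleftrightarrow> (\<forall>c\<in>{1..N}. \<forall>l\<in>{1..N}. \<forall>a b.
  sy s (sy s' ((if inh s 0 (a - 1) \<and> inh s' 0 (b + 1) then qHx (>) GE c l (a - 1) (b + 1) else 0)
      + (if inh s 0 a \<and> inh s' 0 b then qH0 (>) GE c l a b else 0)))
      = (if b = - 1 then sc dq * hat (- 1) s (e s l * e s c) (a + b) else 0) + (if a = 0 then sc dq * hat (- 1) s' (e s' l * e s' c) (a + b) else 0))"
definition "q_FF s \<longleftrightarrow> (\<forall>c\<in>{1..N}. \<forall>l\<in>{1..N}. c < l \<longrightarrow> f s l * f s c = fps_const (sc qv) * (f s c * f s l))"
definition "q_EE s \<longleftrightarrow> (\<forall>c\<in>{1..N}. \<forall>l\<in>{1..N}. c > l \<longrightarrow> e s c * e s l = fps_const (sc qv) * (e s l * e s c))"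

lemma hat_const: "hat \<epsilon> s (fps_const (sc c) * A) n = sc c * hat \<epsilon> s A n"
  by (simp add: hat_def hs_def half_series_def cen_left_commute[OF C_cen, of _ "sc c"])

lemma qfull_F: "c_FF \<longleftrightarrow> qfull {1..N} (<) GF"
  unfolding c_FF_def qfull_def
proof (intro ball_cong refl iff_allI)
  fix c l a b
  have "lin (r1 c l) (r0 c l) 1 (prod_wz (Fc l) (Fc c)) a b + lin (o1 c l) (o0 c l) 1 (prod_wz (Fc c) (Fc l)) a b
    - lin qv (- qi) 1 (prod_zw (Fc c) (Fc l)) a b = qHx (<) GF c l (a - 1) (b + 1) + qH0 (<) GF c l a b"
    by (simp add: lin_def prod_zw_def prod_wz_def qHx_def qH0_def r1_def r0_def o1_def o0_def sc_uminus algebra_simps)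
  then show "(lin qv (- qi) 1 (prod_zw (Fc c) (Fc l)) a b
    = lin (r1 c l) (r0 c l) 1 (prod_wz (Fc l) (Fc c)) a b + lin (o1 c l) (o0 c l) 1 (prod_wz (Fc c) (Fc l)) a b)
    \<longleftrightarrow> (qHx (<) GF c l (a - 1) (b + 1) + qH0 (<) GF c l a b = 0)"
    by (rule eq_iff_diff_zero(2))
qed

lemma qfull_E: "c_EE \<longleftrightarrow> qfull {1..N} (>) GE"
  unfolding c_EE_def qfull_def
proof (intro ball_cong refl iff_allI)
  fix c l a b
  have "lin (r1 c l) (r0 c l) 1 (prod_zw (Ec c) (Ec l)) a b + lin (o1 l c) (o0 l c) 1 (prod_zw (Ec l) (Ec c)) a b
    - lin qv (- qi) 1 (prod_wz (Ec l) (Ec c)) a b = qHx (>) GE c l (a - 1) (b + 1) + qH0 (>) GE c l a b"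
    by (simp add: lin_def prod_zw_def prod_wz_def qHx_def qH0_def r1_def r0_def o1_def o0_def sc_uminus algebra_simps)
  then show "(lin (r1 c l) (r0 c l) 1 (prod_zw (Ec c) (Ec l)) a b + lin (o1 l c) (o0 l c) 1 (prod_zw (Ec l) (Ec c)) a b
    = lin qv (- qi) 1 (prod_wz (Ec l) (Ec c)) a b) \<longleftrightarrow> (qHx (>) GE c l (a - 1) (b + 1) + qH0 (>) GE c l a b = 0)"
    by (rule eq_iff_diff_zero(1))
qed

lemma prec_less: "c \<noteq> l \<Longrightarrow> (c < l) = (\<not> l < (c::nat))" "\<not> c < (c::nat)" by auto
lemma prec_greater: "c \<noteq> l \<Longrightarrow> (c > l) = (\<not> l > (c::nat))" "\<not> c > (c::nat)" by auto

lemma c_FF_iff: "c_FF \<longleftrightarrow> (\<forall>s s'. h_FF s s')"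
  using qfull_iff[where prec = "(<)" and A = "{1..N}" and G = GF and \<tau> = 1, OF prec_less]
  unfolding qfull_F qB_F h_FF_def diff_self .
lemma c_EE_iff: "c_EE \<longleftrightarrow> (\<forall>s s'. h_EE s s')"
  using qfull_iff[where prec = "(>)" and A = "{1..N}" and G = GE and \<tau> = 0, OF prec_greater]
  unfolding qfull_E qB_E h_EE_def diff_0 .

lemma c_FF_q: "c_FF \<Longrightarrow> q_FF s"
  unfolding q_FF_def
proof (intro ballI impI)
  fix c l assume "c_FF" "c \<in> {1..N}" "l \<in> {1..N}" "c < l"
  then have "qB GF 1 s l c n = sc qv * qB GF 1 s c l n" for n
    using qB_prec[where prec = "(<)" and A = "{1..N}" and G = GF and \<tau> = 1, OF prec_less] qfull_F by blast
  then show "f s l * f s c = fps_const (sc qv) * (f s c * f s l)"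
    by (intro hat_ext[of 1 s]) (simp add: qB_F hat_const)
qed

lemma c_EE_q: "c_EE \<Longrightarrow> q_EE s"
  unfolding q_EE_def
proof (intro ballI impI)
  fix c l assume "c_EE" "c \<in> {1..N}" "l \<in> {1..N}" "c > l"
  then have "qB GE 0 s l c n = sc qv * qB GE 0 s c l n" for n
    using qB_prec[where prec = "(>)" and A = "{1..N}" and G = GE and \<tau> = 0, OF prec_greater] qfull_E by blast
  then show "e s c * e s l = fps_const (sc qv) * (e s l * e s c)"
    by (intro hat_ext[of "- 1" s]) (simp add: qB_E hat_const)
qed

abbreviation "kKi s l i \<equiv> k s * Ki s l i"

definition "c_EF \<longleftrightarrow> (\<forall>i\<in>{1..N}. \<forall>l\<in>{1..N}. \<forall>a b. prod_zw (Ec i) (Fc l) a b - prod_wz (Fc l) (Ec i) a b =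
  sc dq * (C (a - b) * hs Plus (kKi Plus l i) (a + b) - C (b - a) * hs Minus (kKi Minus l i) (a + b)))"
definition "EFc i l s s' a b = sy s (sy s' (if inh s 0 a \<and> inh s' 1 b then Ec i a * Fc l b - Fc l b * Ec i a else 0))"
definition "h_EF s s' \<longleftrightarrow> (\<forall>i\<in>{1..N}. \<forall>l\<in>{1..N}. \<forall>a b.
  lin 1 (- 1) (C (2 * sg s')) (lin 1 (- 1) (C (2 * sg s)) (EFc i l s s')) a b
      = sc dq * (lin 1 (- 1) (C (2 * sg s')) (\<lambda>a b. if b = 0 then C (sg s * a) * hs s (kKi s l i) a else 0) a b
        - lin 1 (- 1) (C (2 * sg s)) (\<lambda>a b. if a = 0 then C (- sg s' * b) * hs s' (kKi s' l i) b else 0) a b))"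

lemma c_EF_iff: "c_EF \<longleftrightarrow> (\<forall>s s'. h_EF s s')"
proof -
  have "(\<forall>a b. prod_zw (Ec i) (Fc l) a b - prod_wz (Fc l) (Ec i) a b =
  sc dq * (C (a - b) * hs Plus (kKi Plus l i) (a + b) - C (b - a) * hs Minus (kKi Minus l i) (a + b))) \<longleftrightarrow> (\<forall>s s' a b.
  lin 1 (- 1) (C (2 * sg s')) (lin 1 (- 1) (C (2 * sg s)) (EFc i l s s')) a b
      = sc dq * (lin 1 (- 1) (C (2 * sg s')) (\<lambda>a b. if b = 0 then C (sg s * a) * hs s (kKi s l i) a else 0) a b
        - lin 1 (- 1) (C (2 * sg s)) (\<lambda>a b. if a = 0 then C (- sg s' * b) * hs s' (kKi s' l i) b else 0) a b))" for i l
    by (rule EF_iff) (simp_all add: hs_neg EFc_def prod_zw_def prod_wz_def)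
  then show ?thesis unfolding c_EF_def h_EF_def by blast
qed

definition L :: "pmsign \<Rightarrow> nat \<Rightarrow> nat \<Rightarrow> 'a fps" where
  "L s i j = (if i \<le> N then if j \<le> N then K s i j else (\<Sum>a=1..N. K s i a * f s a)
     else if j \<le> N then (\<Sum>a=1..N. e s a * K s a j) else k s + (\<Sum>a=1..N. \<Sum>b=1..N. e s a * K s a b * f s b))"

text \<open>One formula for all pairs of signs: the argument of the left R-matrix is
  \<open>x q^((sg s' - sg s) c/2)\<close>, that of the right one has the opposite shift, and for
  equal signs there is none. Each side is multiplied by the denominator of the other.\<close>

definition "c_RLL M Lf s s' \<longleftrightarrow> (\<forall>i\<in>{1..M::nat}. \<forall>m\<in>{1..M}. \<forall>j\<in>{1..M}. \<forall>l\<in>{1..M}. \<forall>a b.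
  lin qi (- qv) (C (sg s - sg s')) (\<lambda>a b. lin (r1 i m) (r0 i m) (C (sg s' - sg s)) (prod_zw (hs s (Lf s i j)) (hs s' (Lf s' m l))) a b
    + lin (o1 i m) (o0 i m) (C (sg s' - sg s)) (prod_zw (hs s (Lf s m j)) (hs s' (Lf s' i l))) a b) a b
  = lin qi (- qv) (C (sg s' - sg s)) (\<lambda>a b. lin (r1 j l) (r0 j l) (C (sg s - sg s')) (prod_wz (hs s' (Lf s' m l)) (hs s (Lf s i j))) a b
    + lin (o1 l j) (o0 l j) (C (sg s - sg s')) (prod_wz (hs s' (Lf s' m j)) (hs s (Lf s i l))) a b) a b)"

definition "c_Kk s s' \<longleftrightarrow> (\<forall>i\<in>{1..N}. \<forall>j\<in>{1..N}. \<forall>a b.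
  lin 1 (- 1) (C (sg s - sg s')) (lin qi (- qv) (C (sg s' - sg s)) (prod_wz (ks s') (Ks s i j))) a b
  = lin 1 (- 1) (C (sg s' - sg s)) (lin qi (- qv) (C (sg s - sg s')) (prod_zw (Ks s i j) (ks s'))) a b)"
definition "c_kk s s' \<longleftrightarrow> (\<forall>a b. prod_zw (ks s) (ks s') a b = prod_wz (ks s') (ks s) a b)"

end

section \<open>The RLL relation in a ring of series in two variables\<close>

locale gauss_realization = gauss C N K Ki k e f + realization s s' E1 E2 co x xi cf
  for C :: "int \<Rightarrow> 'a::cqalg" and N :: nat and K Ki :: "pmsign \<Rightarrow> nat \<Rightarrow> nat \<Rightarrow> 'a fps" and k :: "pmsign \<Rightarrow> 'a fps"
    and e f :: "pmsign \<Rightarrow> nat \<Rightarrow> 'a fps" and s s' :: pmsign and E1 E2 :: "'a fps \<Rightarrow> 'r::ring_1" and co :: "'a \<Rightarrow> 'r"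
    and x xi :: 'r and cf :: "'r \<Rightarrow> int \<Rightarrow> int \<Rightarrow> 'a"
begin

text \<open>\<open>Y 1\<close> and \<open>Y (- 1)\<close> are the arguments of the right and left R-matrix.\<close>

definition Y :: "int \<Rightarrow> 'r" where "Y \<epsilon> = co (C (\<epsilon> * (sg s - sg s'))) * x"
definition lp :: "int \<Rightarrow> Cq \<Rightarrow> Cq \<Rightarrow> 'r" where "lp \<epsilon> c1 c0 = co (sc c1) * Y \<epsilon> + co (sc c0)"
definition U :: "int \<Rightarrow> 'r" where "U \<epsilon> = uinv (lp \<epsilon> qi (- qv))"
definition Ra :: "int \<Rightarrow> 'r" where "Ra \<epsilon> = U \<epsilon> * (Y \<epsilon> - 1)"
definition Rb :: "int \<Rightarrow> 'r" where "Rb \<epsilon> = U \<epsilon> * (co (sc qi) - co (sc qv))"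
definition Rx :: "int \<Rightarrow> 'r" where "Rx \<epsilon> = U \<epsilon> * (co (sc qi) - co (sc qv)) * Y \<epsilon>"

lemma cen_co: "cen (co (sc c))" "cen (co (C i))" "cen (Y \<epsilon>)" "cen (lp \<epsilon> c1 c0)"
  by (simp_all add: Y_def lp_def co_cen cen_sc C_cen cen_mult cen_intros x_cen)

lemma unit_lp: assumes "c1 \<noteq> 0" "c0 \<noteq> 0" shows "unit (lp \<epsilon> c1 c0)"
proof -
  have "lp \<epsilon> c1 c0 = co (sc c1 * C (\<epsilon> * (sg s - sg s'))) * x + co (sc c0)"
    by (simp add: lp_def Y_def co_mult mult.assoc)
  moreover have "sc c1 * C (\<epsilon> * (sg s - sg s')) * (C (- (\<epsilon> * (sg s - sg s'))) * sc (inverse c1)) = 1" "sc c0 * sc (inverse c0) = (1 :: 'a)"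
    using assms by (simp_all add: mult.assoc C_inv sc_one flip: sc_mult)
  ultimately show ?thesis using unit_lin[OF cen_mult[OF cen_sc C_cen] cen_sc] by metis
qed

lemma unit_P: "unit (lp \<epsilon> qi (- qv))" by (rule unit_lp) (simp_all add: qv_nonzero)
lemma cen_U: "cen (U \<epsilon>)" unfolding U_def by (rule cen_uinv[OF unit_P cen_co(4)])
lemma unit_Y1: "unit (Y \<epsilon> - 1)" using unit_lp[of 1 "- 1" \<epsilon>] by (simp add: lp_def sc_one sc_uminus co_uminus co_one)
lemma lp_minus1: "lp \<epsilon> 1 (- 1) = Y \<epsilon> - 1" by (simp add: lp_def sc_one sc_uminus co_uminus co_one)

lemma P_U: "lp \<epsilon> qi (- qv) * U \<epsilon> = 1" "U \<epsilon> * lp \<epsilon> qi (- qv) = 1" unfolding U_def using uinv unit_P by blast+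
lemma P_U_mult: "lp \<epsilon> qi (- qv) * (U \<epsilon> * y) = y" by (simp add: P_U flip: mult.assoc)

lemma P_R: "lp \<epsilon> qi (- qv) * Ra \<epsilon> = lp \<epsilon> 1 (- 1)" "lp \<epsilon> qi (- qv) * Rb \<epsilon> = lp \<epsilon> 0 dq" "lp \<epsilon> qi (- qv) * Rx \<epsilon> = lp \<epsilon> dq 0"
  by (simp_all add: Ra_def Rb_def Rx_def P_U_mult mult.assoc lp_minus1) (simp_all add: lp_def sc_diff co_diff)

lemma cen_R: "cen (Ra \<epsilon>)" "cen (Rb \<epsilon>)" "cen (Rx \<epsilon>)"
  unfolding Ra_def Rb_def Rx_def by (intro cen_mult cen_intros cen_U cen_co)+

lemma unit_Ra: "unit (Ra \<epsilon>)" unfolding Ra_def U_def by (intro unit_mult unit_uinv unit_P unit_Y1)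

lemma E_if: "E1 (if b then 1 else 0) = (if b then 1 else 0)" "E2 (if b then 1 else 0) = (if b then 1 else 0)"
  by (simp_all add: E1_one E2_one)

sublocale P: rpair N "Ra (- 1)" "Rb (- 1)" "Rx (- 1)" "Ra 1" "Rb 1" "Rx 1"
  "\<lambda>i j. E1 (K s i j)" "\<lambda>i j. E1 (Ki s i j)" "E1 (k s)" "\<lambda>i. E1 (e s i)" "\<lambda>i. E1 (f s i)"
  "\<lambda>i j. E2 (K s' i j)" "\<lambda>i j. E2 (Ki s' i j)" "E2 (k s')" "\<lambda>i. E2 (e s' i)" "\<lambda>i. E2 (f s' i)"
proof
  show "y * c = c * y" if "c \<in> {Ra (- 1), Rb (- 1), Rx (- 1), Ra 1, Rb 1, Rx 1}" for c y
    using that cen_R unfolding cen_def by auto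
  show "y = 0" if "Ra (- 1) * y = 0" for y using unit_cancel[OF unit_Ra that] .
  show "y = 0" if "Ra 1 * y = 0" for y using unit_cancel[OF unit_Ra that] .
qed (simp_all only: E1_sum[symmetric] E2_sum[symmetric] E1_mult[symmetric] E2_mult[symmetric] KKi KiK E_if)

lemma P_L: "P.L i j = E1 (L s i j)" "P.L' i j = E2 (L s' i j)"
  by (simp_all add: P.L_def P.L'_def L_def E1_sum E2_sum E1_mult E2_mult E1_add E2_add)

lemma lp_zero: "lp \<epsilon> 0 0 = 0" by (simp add: lp_def)

lemma P_r: "lp (- 1) qi (- qv) * P.rl i j = lp (- 1) (r1 i j) (r0 i j)" "lp 1 qi (- qv) * P.rr i j = lp 1 (r1 i j) (r0 i j)"
    "lp (- 1) qi (- qv) * P.pl i j = lp (- 1) (o1 i j) (o0 i j)" "lp 1 qi (- qv) * P.pr i j = lp 1 (o1 i j) (o0 i j)"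
  by (auto simp: P.rl_def P.rr_def P.pl_def P.pr_def r1_def r0_def o1_def o0_def P_R lp_zero)

lemma cf_lp: "cf (lp \<epsilon> c1 c0 * S) a b = lin c1 c0 (C (\<epsilon> * (sg s - sg s'))) (cf S) a b"
  by (simp add: lp_def Y_def lin_def distrib_right cf_add cf_co cf_x mult.assoc)

text \<open>Coefficients after a simultaneous rescaling of both arguments, chosen so that
  multiplication by \<open>lp \<epsilon>\<close> involves scalars only (\<open>cft_lp\<close>) and
  products become products of \<open>hat\<close> (\<open>cft_prod\<close>).\<close>

definition cft :: "int \<Rightarrow> 'r \<Rightarrow> int \<Rightarrow> int \<Rightarrow> 'a" where "cft \<epsilon> S a b = C (- \<epsilon> * sg s * a + - \<epsilon> * sg s' * b) * cf S a b"

lemma cft_eq_iff: "S = T \<longleftrightarrow> (\<forall>a b. cft \<epsilon> S a b = cft \<epsilon> T a b)"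
  unfolding cft_def C_mult_eq_iff by (rule cf_eq_iff)
lemma cft_simps: "cft \<epsilon> (S + T) a b = cft \<epsilon> S a b + cft \<epsilon> T a b" "cft \<epsilon> (S - T) a b = cft \<epsilon> S a b - cft \<epsilon> T a b"
   "cft \<epsilon> (- S) a b = - cft \<epsilon> S a b" "cft \<epsilon> 0 a b = 0" "cft \<epsilon> (\<Sum>i\<in>A. g i) a b = (\<Sum>i\<in>A. cft \<epsilon> (g i) a b)"
  by (simp_all add: cft_def cf_add cf_diff cf_uminus cf_sum distrib_left right_diff_distrib sum_distrib_left)
lemma cft_lp: "cft \<epsilon> (lp \<epsilon> c1 c0 * S) a b = sc c1 * cft \<epsilon> S (a - 1) (b + 1) + sc c0 * cft \<epsilon> S a b"
proof -
  have c: "C (- \<epsilon> * sg s * (a - 1) + - \<epsilon> * sg s' * (b + 1)) = C (- \<epsilon> * sg s * a + - \<epsilon> * sg s' * b) * C (\<epsilon> * (sg s - sg s'))"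
    unfolding C_add[symmetric] by (simp add: algebra_simps)
  show ?thesis unfolding cft_def cf_lp lin_def c by (simp add: distrib_left cen_ac C_cen cen_sc)
qed
lemma cft_prod: "cft \<epsilon> (E1 A * E2 g) a b = hat \<epsilon> s A a * hat \<epsilon> s' g b" "cft \<epsilon> (E2 g * E1 A) a b = hat \<epsilon> s' g b * hat \<epsilon> s A a"
  unfolding cft_def hat_def cf_E1E2 cf_E2E1 C_add by (simp_all add: cen_ac C_cen)
lemma cft_E: "cft \<epsilon> (E1 A) a b = (if b = 0 then hat \<epsilon> s A a else 0)" "cft \<epsilon> (E2 A) a b = (if a = 0 then hat \<epsilon> s' A b else 0)"
  by (simp_all add: cft_def hat_def cf_E1 cf_E2)

text \<open>Both denominators are units of the ring, so the equation may be multiplied by them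
  before coefficients are taken.\<close>

lemma X_iff:
  "P.X i m j l = 0 \<longleftrightarrow> (\<forall>a b.
  lin qi (- qv) (C (sg s - sg s')) (\<lambda>a b. lin (r1 i m) (r0 i m) (C (sg s' - sg s)) (prod_zw (hs s (L s i j)) (hs s' (L s' m l))) a b
    + lin (o1 i m) (o0 i m) (C (sg s' - sg s)) (prod_zw (hs s (L s m j)) (hs s' (L s' i l))) a b) a b
  = lin qi (- qv) (C (sg s' - sg s)) (\<lambda>a b. lin (r1 j l) (r0 j l) (C (sg s - sg s')) (prod_wz (hs s' (L s' m l)) (hs s (L s i j))) a b
    + lin (o1 l j) (o0 l j) (C (sg s - sg s')) (prod_wz (hs s' (L s' m j)) (hs s (L s i l))) a b) a b)"
proof -
  define A where "A = P.rl i m * (E1 (L s i j) * E2 (L s' m l)) + P.pl i m * (E1 (L s m j) * E2 (L s' i l))"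
  define B where "B = P.rr j l * (E2 (L s' m l) * E1 (L s i j)) + P.pr l j * (E2 (L s' m j) * E1 (L s i l))"
  have cf: "cf (E1 c * E2 d) = prod_zw (hs s c) (hs s' d)" "cf (E2 d * E1 c) = prod_wz (hs s' d) (hs s c)" for c d
    by (simp_all add: fun_eq_iff cf_E1E2 cf_E2E1 prod_zw_def prod_wz_def)
  have e: "- 1 * (sg s - sg s') = sg s' - sg s" "1 * (sg s - sg s') = sg s - sg s'" by simp_all
  have A: "cf (lp (- 1) qi (- qv) * A) = (\<lambda>a b. lin (r1 i m) (r0 i m) (C (sg s' - sg s)) (prod_zw (hs s (L s i j)) (hs s' (L s' m l))) a b
    + lin (o1 i m) (o0 i m) (C (sg s' - sg s)) (prod_zw (hs s (L s m j)) (hs s' (L s' i l))) a b)"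
    unfolding A_def distrib_left mult.assoc[symmetric] P_r unfolding mult.assoc by (simp add: fun_eq_iff cf_add cf_lp cf e)
  have B: "cf (lp 1 qi (- qv) * B) = (\<lambda>a b. lin (r1 j l) (r0 j l) (C (sg s - sg s')) (prod_wz (hs s' (L s' m l)) (hs s (L s i j))) a b
    + lin (o1 l j) (o0 l j) (C (sg s - sg s')) (prod_wz (hs s' (L s' m j)) (hs s (L s i l))) a b)"
    unfolding B_def distrib_left mult.assoc[symmetric] P_r unfolding mult.assoc by (simp add: fun_eq_iff cf_add cf_lp cf)
  have "P.X i m j l = 0 \<longleftrightarrow> A = B" by (simp add: P.X_def P_L A_def B_def algebra_simps)
  also have "\<dots> \<longleftrightarrow> lp 1 qi (- qv) * (lp (- 1) qi (- qv) * A) = lp (- 1) qi (- qv) * (lp 1 qi (- qv) * B)"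
  proof -
    have "A = B \<longleftrightarrow> (lp 1 qi (- qv) * lp (- 1) qi (- qv)) * A = (lp 1 qi (- qv) * lp (- 1) qi (- qv)) * B"
      by (rule unit_eq_iff[OF unit_mult[OF unit_P unit_P]])
    also have "(lp 1 qi (- qv) * lp (- 1) qi (- qv)) * B = lp (- 1) qi (- qv) * (lp 1 qi (- qv) * B)"
      by (simp add: cen_left_commute[OF cen_co(4), of 1 qi "- qv" "lp (- 1) qi (- qv)"] mult.assoc)
    finally show ?thesis by (simp add: mult.assoc)
  qed
  also have "\<dots> \<longleftrightarrow> (\<forall>a b. cf (lp 1 qi (- qv) * (lp (- 1) qi (- qv) * A)) a b = cf (lp (- 1) qi (- qv) * (lp 1 qi (- qv) * B)) a b)"
    by (rule cf_eq_iff)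
  finally show ?thesis unfolding cf_lp A B e .
qed

lemma c_RLL_iff: "(\<forall>i\<in>{1..Suc N}. \<forall>m\<in>{1..Suc N}. \<forall>j\<in>{1..Suc N}. \<forall>l\<in>{1..Suc N}. P.X i m j l = 0) \<longleftrightarrow> c_RLL (Suc N) L s s'"
  unfolding c_RLL_def X_iff ..

lemma rel_KK_iff: "P.rel_KK \<longleftrightarrow> c_RLL N K s s'"
  unfolding P.rel_KK_def c_RLL_def X_iff by (intro ball_cong refl) (simp add: L_def)

lemma rel_Kk_iff: "P.rel_Kk \<longleftrightarrow> c_Kk s s'"
  unfolding P.rel_Kk_def c_Kk_def
proof (intro ball_cong refl)
  fix i j
  have cf: "cf (E1 c * E2 d) = prod_zw (hs s c) (hs s' d)" "cf (E2 d * E1 c) = prod_wz (hs s' d) (hs s c)" for c d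
    by (simp_all add: fun_eq_iff cf_E1E2 cf_E2E1 prod_zw_def prod_wz_def)
  let ?l = "lp (- 1) qi (- qv)" and ?r = "lp 1 qi (- qv)"
  have e: "- 1 * (sg s - sg s') = sg s' - sg s" "1 * (sg s - sg s') = sg s - sg s'" by simp_all
  have "(Ra (- 1) * (E1 (K s i j) * E2 (k s')) = Ra 1 * (E2 (k s') * E1 (K s i j))) \<longleftrightarrow>
    (?l * ?r) * (Ra (- 1) * (E1 (K s i j) * E2 (k s'))) = (?l * ?r) * (Ra 1 * (E2 (k s') * E1 (K s i j)))"
    by (rule unit_eq_iff[OF unit_mult[OF unit_P unit_P]])
  also have "(?l * ?r) * (Ra (- 1) * (E1 (K s i j) * E2 (k s'))) = lp (- 1) 1 (- 1) * (?r * (E1 (K s i j) * E2 (k s')))"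
    unfolding P_R[symmetric] by (simp add: mult.assoc cen_left_commute[OF cen_co(4), of 1 qi "- qv" "Ra (- 1)"])
  also have "(?l * ?r) * (Ra 1 * (E2 (k s') * E1 (K s i j))) = lp 1 1 (- 1) * (?l * (E2 (k s') * E1 (K s i j)))"
    unfolding P_R[symmetric] by (simp add: mult.assoc cen_left_commute[OF cen_co(4), of "- 1" qi "- qv" "?r"]
      cen_left_commute[OF cen_co(4), of "- 1" qi "- qv" "Ra 1"])
  also have "lp (- 1) 1 (- 1) * (?r * (E1 (K s i j) * E2 (k s'))) = lp 1 1 (- 1) * (?l * (E2 (k s') * E1 (K s i j))) \<longleftrightarrow>
     lp 1 1 (- 1) * (?l * (E2 (k s') * E1 (K s i j))) = lp (- 1) 1 (- 1) * (?r * (E1 (K s i j) * E2 (k s')))" by (rule eq_commute)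
  finally show "(Ra (- 1) * (E1 (K s i j) * E2 (k s')) = Ra 1 * (E2 (k s') * E1 (K s i j))) \<longleftrightarrow> (\<forall>a b.
    lin 1 (- 1) (C (sg s - sg s')) (lin qi (- qv) (C (sg s' - sg s)) (prod_wz (ks s') (Ks s i j))) a b
    = lin 1 (- 1) (C (sg s' - sg s)) (lin qi (- qv) (C (sg s - sg s')) (prod_zw (Ks s i j) (ks s'))) a b)"
    unfolding cf_eq_iff[of "lp 1 1 (- 1) * _"] cf_lp[abs_def] cf e .
qed

lemma rel_kk_iff: "P.rel_kk \<longleftrightarrow> c_kk s s'"
  unfolding P.rel_kk_def c_kk_def cf_eq_iff by (simp add: cf_E1E2 cf_E2E1 prod_zw_def prod_wz_def)

end

context gauss begin

lemma bd_prod: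
  fixes A :: "'a fps"
  shows "bd (dir s) (prod_zw (hs s A) G)" "bd (dir s) (prod_wz G (hs s A))"
proof -
  have h: "hs s A (a - dsg (dir s) * k) = 0" if "k \<ge> \<bar>a\<bar> + 1" for a k
    using that by (intro hs_neg) (cases s; simp)
  show "bd (dir s) (prod_zw (hs s A) G)"
    unfolding bd_def
  proof (intro allI)
    show "\<exists>K\<ge>0. \<forall>k\<ge>K. prod_zw (hs s A) G (a - dsg (dir s) * k) (b + dsg (dir s) * k) = 0" for a b
      by (rule exI[of _ "\<bar>a\<bar> + 1"]) (auto simp: prod_zw_def h)
  qed
  show "bd (dir s) (prod_wz G (hs s A))"
    unfolding bd_def
  proof (intro allI)
    show "\<exists>K\<ge>0. \<forall>k\<ge>K. prod_wz G (hs s A) (a - dsg (dir s) * k) (b + dsg (dir s) * k) = 0" for a b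
      by (rule exI[of _ "\<bar>a\<bar> + 1"]) (auto simp: prod_wz_def h)
  qed
qed

text \<open>For equal signs the rational factors on the two sides have the same argument and
  cancel.\<close>

lemma c_Kk_same: "c_Kk s s \<longleftrightarrow> (\<forall>i\<in>{1..N}. \<forall>j\<in>{1..N}. \<forall>a b. prod_zw (Ks s i j) (ks s) a b = prod_wz (ks s) (Ks s i j) a b)"
  unfolding c_Kk_def
proof (intro ball_cong refl)
  fix i j
  have "(\<forall>a b. prod_zw (Ks s i j) (ks s) a b = prod_wz (ks s) (Ks s i j) a b) \<longleftrightarrow>
    (\<forall>a b. prod_wz (ks s) (Ks s i j) a b = prod_zw (Ks s i j) (ks s) a b)" by (simp add: eq_commute)
  also have "\<dots> \<longleftrightarrow> (\<forall>a b. lin qi (- qv) (C 0) (prod_wz (ks s) (Ks s i j)) a b = lin qi (- qv) (C 0) (prod_zw (Ks s i j) (ks s)) a b)"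
    by (rule eq_iff_lin_eq[OF bd_prod(2,1)]) (simp_all add: qv_nonzero)
  also have "\<dots> \<longleftrightarrow> (\<forall>a b. lin 1 (- 1) (C 0) (lin qi (- qv) (C 0) (prod_wz (ks s) (Ks s i j))) a b
    = lin 1 (- 1) (C 0) (lin qi (- qv) (C 0) (prod_zw (Ks s i j) (ks s))) a b)"
    by (rule eq_iff_lin_eq[OF bd_lin[OF bd_prod(2)] bd_lin[OF bd_prod(1)]]) simp_all
  finally show "(\<forall>a b. lin 1 (- 1) (C (sg s - sg s)) (lin qi (- qv) (C (sg s - sg s)) (prod_wz (ks s) (Ks s i j))) a b
    = lin 1 (- 1) (C (sg s - sg s)) (lin qi (- qv) (C (sg s - sg s)) (prod_zw (Ks s i j) (ks s))) a b) \<longleftrightarrow>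
    (\<forall>a b. prod_zw (Ks s i j) (ks s) a b = prod_wz (ks s) (Ks s i j) a b)"
    by simp
qed

text \<open>\<open>Ki k = Ki k (K Ki) = Ki (K k) Ki = k Ki\<close>, since \<open>k\<close> commutes
  with the entries of \<open>K\<close>.\<close>

lemma k_Ki_commute:
  assumes "c_Kk s s" "i \<in> {1..N}" "l \<in> {1..N}"
  shows "Ki s l i * k s = k s * Ki s l i"
proof -
  have K: "K s a b * k s = k s * K s a b" if "a \<in> {1..N}" "b \<in> {1..N}" for a b
  proof (rule hs_ext)
    fix n
    have h: "hs s (K s a b) u * hs s (k s) v = hs s (k s) v * hs s (K s a b) u" for u v
      using assms(1) that unfolding c_Kk_same prod_zw_def prod_wz_def by blast
    show "hs s (K s a b * k s) n = hs s (k s * K s a b) n"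
      using hat_mult[of 0 s "K s a b" "k s" n] hat_mult'[of 0 s "k s" "K s a b" n] by (simp add: hat_def C_zero h)
  qed
  have d: "(if b then 1 else 0) * y = (if b then y else 0)" "y * (if b then 1 else 0) = (if b then y else 0)" for b and y :: "'a fps"
    by auto
  have "Ki s l i * k s = (\<Sum>b=1..N. Ki s l b * k s * (\<Sum>a=1..N. K s b a * Ki s a i))"
  proof (rule sym[OF trans[OF sum.cong[OF refl]]])
    fix b assume "b \<in> {1..N}"
    then show "Ki s l b * k s * (\<Sum>a=1..N. K s b a * Ki s a i) = (if b = i then Ki s l i * k s else 0)"
      using assms(2) by (simp only: KKi d) simp
  qed (use assms(2) in simp)
  also have "\<dots> = (\<Sum>b=1..N. \<Sum>a=1..N. Ki s l b * K s b a * k s * Ki s a i)"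
    by (intro sum.cong refl) (simp add: sum_distrib_left mult.assoc[symmetric], simp add: mult.assoc K)
  also have "\<dots> = (\<Sum>a=1..N. (\<Sum>b=1..N. Ki s l b * K s b a) * (k s * Ki s a i))"
    unfolding sum_distrib_right mult.assoc by (rule sum.swap)
  also have "\<dots> = k s * Ki s l i"
  proof (rule trans[OF sum.cong[OF refl]])
    fix a assume "a \<in> {1..N}"
    then show "(\<Sum>b=1..N. Ki s l b * K s b a) * (k s * Ki s a i) = (if l = a then k s * Ki s l i else 0)"
      using assms(3) by (simp only: KiK d) simp
  qed (use assms(3) in simp)
  finally show ?thesis .
qed

end

section \<open>Relations of half currents with K and k\<close>

context gauss_realization begin

lemma zero_iff_P: "y = 0 \<longleftrightarrow> lp \<epsilon> qi (- qv) * y = 0"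
  using unit_cancel[OF unit_P] by auto

text \<open>Only the right R-matrix occurs in \<open>Q\<close>, so one denominator suffices;
  \<open>cft 1\<close> is the rescaling that turns both \<open>K\<close> and \<open>f\<close> into
  \<open>hat 1\<close>.\<close>

lemma rel_KF_iff: "P.rel_KF \<longleftrightarrow> h_KF s s'"
proof -
  have "P.Q l i j = 0 \<longleftrightarrow> (\<forall>a b. sy s' ((if inh s' 1 (b + 1) then KFx s i j l (a - 1) (b + 1) else 0) + (if inh s' 1 b then KF0 s i j l a b else 0))
   = (if b = 0 then if j = l then sc dq * (\<Sum>c=1..N. hat 1 s (K s i c * f s c) (a + b)) else 0 else 0))"
    if "i \<in> {1..N}" "j \<in> {1..N}" "l \<in> {1..N}" for i j l
  proof -
    define W where "W = lp 1 (r1 j l) (r0 j l) * (E1 (K s i j) * E2 (f s' l))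
      + (if j = l then (\<Sum>c=1..N. lp 1 (o1 c j) (o0 c j) * (E1 (K s i c) * E2 (f s' c))) - lp 1 0 dq * E1 (\<Sum>c=1..N. K s i c * f s c) else 0)
      - lp 1 1 (- 1) * (E2 (f s' l) * E1 (K s i j))"
    have "lp 1 qi (- qv) * P.Q l i j = - W"
      using that unfolding P.Q_def W_def P_L
      by (simp add: right_diff_distrib distrib_left sum_distrib_left P_r P_R L_def mult.assoc[symmetric])
    then have "P.Q l i j = 0 \<longleftrightarrow> W = 0" using zero_iff_P[of "P.Q l i j" 1] by simp
    also have "\<dots> \<longleftrightarrow> (\<forall>a b. cft 1 W a b = 0)" unfolding cft_eq_iff[of W 0 1] cft_simps ..
    finally have Z: "P.Q l i j = 0 \<longleftrightarrow> (\<forall>a b. cft 1 W a b = 0)" .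
  have eq: "cft 1 W a b = sy s' ((if inh s' 1 (b + 1) then KFx s i j l (a - 1) (b + 1) else 0) + (if inh s' 1 b then KF0 s i j l a b else 0))
       - (if b = 0 then if j = l then sc dq * (\<Sum>c=1..N. hat 1 s (K s i c * f s c) (a + b)) else 0 else 0)" for a b
      by (cases "inh s' 1 (b + 1)"; cases "inh s' 1 b"; cases "j = l";
        simp add: W_def cft_simps cft_lp cft_prod cft_E hat_f hat_sum KFx_def KF0_def sc_one sc_uminus sc_zero sum.distrib;
        cases s'; simp add: sum_negf algebra_simps)
    show ?thesis unfolding Z eq by (simp only: right_minus_eq)
  qed
  then show ?thesis unfolding P.rel_KF_def h_KF_def by blast
qed

lemma rel_KE_iff: "P.rel_KE \<longleftrightarrow> h_KE s s'"
proof -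
  have "P.Qm l i j = 0 \<longleftrightarrow> (\<forall>a b. sy s' ((if inh s' 0 (b + 1) then KEx s i j l (a - 1) (b + 1) else 0) + (if inh s' 0 b then KE0 s i j l a b else 0))
   = (if b = - 1 then if i = l then sc dq * (\<Sum>c=1..N. hat (- 1) s (e s c * K s c j) (a + b)) else 0 else 0))"
    if "i \<in> {1..N}" "j \<in> {1..N}" "l \<in> {1..N}" for i j l
  proof -
    define W where "W = lp (- 1) (r1 i l) (r0 i l) * (E2 (e s' l) * E1 (K s i j))
      + (if i = l then (\<Sum>c=1..N. lp (- 1) (o1 i c) (o0 i c) * (E2 (e s' c) * E1 (K s c j))) - lp (- 1) dq 0 * E1 (\<Sum>c=1..N. e s c * K s c j) else 0)
      - lp (- 1) 1 (- 1) * (E1 (K s i j) * E2 (e s' l))"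
    have "lp (- 1) qi (- qv) * P.Qm l i j = - W"
      using that unfolding P.Qm_def W_def P_L
      by (simp add: right_diff_distrib distrib_left sum_distrib_left P_r P_R L_def mult.assoc[symmetric])
    then have "P.Qm l i j = 0 \<longleftrightarrow> W = 0" using zero_iff_P[of "P.Qm l i j" "- 1"] by simp
    also have "\<dots> \<longleftrightarrow> (\<forall>a b. cft (- 1) W a b = 0)" unfolding cft_eq_iff[of W 0 "- 1"] cft_simps ..
    finally have Z: "P.Qm l i j = 0 \<longleftrightarrow> (\<forall>a b. cft (- 1) W a b = 0)" .
  have eq: "cft (- 1) W a b = sy s' ((if inh s' 0 (b + 1) then KEx s i j l (a - 1) (b + 1) else 0) + (if inh s' 0 b then KE0 s i j l a b else 0))
       - (if b = - 1 then if i = l then sc dq * (\<Sum>c=1..N. hat (- 1) s (e s c * K s c j) (a + b)) else 0 else 0)" for a b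
    proof -
      have b: "(if b + 1 = 0 then hat (- 1) s A (a - 1) else 0) = (if b = - 1 then hat (- 1) s A (a + b) else 0)" for A by auto
      show ?thesis
        by (cases "inh s' 0 (b + 1)"; cases "inh s' 0 b"; cases "i = l";
          simp add: W_def cft_simps cft_lp cft_prod cft_E[of _ _ a "b + 1", unfolded b] cft_E[of _ _ "a - 1" "b + 1", unfolded b] cft_E hat_e hat_sum KEx_def KE0_def sc_one sc_uminus sc_zero sum.distrib;
          cases s'; simp add: sum_negf algebra_simps)
    qed
    show ?thesis unfolding Z eq by (simp only: right_minus_eq)
  qed
  then show ?thesis unfolding P.rel_KE_def h_KE_def by blast
qed

text \<open>Used where \<open>k\<close> belongs to the second variable. Exchanging \<open>z\<close>
  and \<open>w\<close> turns \<open>x\<close> into its inverse, and the cleared relations then agree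
  after a shift of the exponents by one.\<close>

lemma shift_all: "(\<forall>a b. \<Phi> (b + 1) (a - 1)) \<longleftrightarrow> (\<forall>a b. \<Phi> a (b :: int) :: bool)" for \<Phi> :: "int \<Rightarrow> int \<Rightarrow> bool"
  by (metis add_diff_cancel diff_add_cancel)

lemma rel_kF_iff: "P.rel_kF \<longleftrightarrow> h_kF s' s"
proof -
  have "Ra 1 * (E1 (f s l) * E2 (k s')) + Rx 1 * (E2 (k s') * E2 (f s' l)) = E2 (k s') * E1 (f s l) \<longleftrightarrow>
   (\<forall>a b. sy s ((if inh s 1 (b + 1) then kFx s' l (a - 1) (b + 1) else 0) + (if inh s 1 b then kF0 s' l a b else 0))
   = (if b = 0 then - (sc dq * hat 1 s' (k s' * f s' l) (a + b)) else 0))" (is "?L \<longleftrightarrow> _") for l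
  proof -
    define W where "W = lp 1 1 (- 1) * (E1 (f s l) * E2 (k s')) + lp 1 dq 0 * E2 (k s' * f s' l) - lp 1 qi (- qv) * (E2 (k s') * E1 (f s l))"
    have "lp 1 qi (- qv) * (Ra 1 * (E1 (f s l) * E2 (k s')) + Rx 1 * (E2 (k s') * E2 (f s' l)) - E2 (k s') * E1 (f s l)) = W"
      unfolding W_def E2_mult by (simp add: right_diff_distrib distrib_left P_R mult.assoc[symmetric])
    then have "?L \<longleftrightarrow> W = 0" using zero_iff_P[of "Ra 1 * (E1 (f s l) * E2 (k s')) + Rx 1 * (E2 (k s') * E2 (f s' l)) - E2 (k s') * E1 (f s l)" 1] by simp
    also have "\<dots> \<longleftrightarrow> (\<forall>a b. cft 1 W a b = 0)" unfolding cft_eq_iff[of W 0 1] cft_simps ..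
    finally have Z: "?L \<longleftrightarrow> (\<forall>a b. cft 1 W a b = 0)" .
  have eq: "cft 1 W a b = sy s ((if inh s 1 (a - 1 + 1) then kFx s' l (b + 1 - 1) (a - 1 + 1) else 0) + (if inh s 1 (a - 1) then kF0 s' l (b + 1) (a - 1) else 0))
       - (if a - 1 = 0 then - (sc dq * hat 1 s' (k s' * f s' l) (b + 1 + (a - 1))) else 0)" for a b
      by (cases "inh s 1 a"; cases "inh s 1 (a - 1)";
         simp add: W_def cft_simps cft_lp cft_prod cft_E hat_f kFx_def kF0_def sc_one sc_uminus sc_zero; cases s; simp add: algebra_simps)
    have "(\<forall>a b. sy s ((if inh s 1 (a - 1 + 1) then kFx s' l (b + 1 - 1) (a - 1 + 1) else 0) + (if inh s 1 (a - 1) then kF0 s' l (b + 1) (a - 1) else 0))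
       - (if a - 1 = 0 then - (sc dq * hat 1 s' (k s' * f s' l) (b + 1 + (a - 1))) else 0) = 0) \<longleftrightarrow>
      (\<forall>a b. sy s ((if inh s 1 (b + 1) then kFx s' l (a - 1) (b + 1) else 0) + (if inh s 1 b then kF0 s' l a b else 0))
       - (if b = 0 then - (sc dq * hat 1 s' (k s' * f s' l) (a + b)) else 0) = 0)" by (rule shift_all)
    then show ?thesis unfolding Z eq by (simp only: right_minus_eq)
  qed
  then show ?thesis unfolding P.rel_kF_def h_kF_def by simp
qed

lemma rel_kE_iff: "P.rel_kE \<longleftrightarrow> h_kE s' s"
proof -
  have "E1 (e s l) * E2 (k s') = Ra (- 1) * (E2 (k s') * E1 (e s l)) + Rb (- 1) * (E2 (e s' l) * E2 (k s')) \<longleftrightarrow>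
   (\<forall>a b. sy s ((if inh s 0 (b + 1) then kEx s' l (a - 1) (b + 1) else 0) + (if inh s 0 b then kE0 s' l a b else 0))
   = (if b = - 1 then - (sc dq * hat (- 1) s' (e s' l * k s') (a + b)) else 0))" (is "?L \<longleftrightarrow> _") for l
  proof -
    define W where "W = lp (- 1) 1 (- 1) * (E2 (k s') * E1 (e s l)) + lp (- 1) 0 dq * E2 (e s' l * k s') - lp (- 1) qi (- qv) * (E1 (e s l) * E2 (k s'))"
    have "lp (- 1) qi (- qv) * (Ra (- 1) * (E2 (k s') * E1 (e s l)) + Rb (- 1) * (E2 (e s' l) * E2 (k s')) - E1 (e s l) * E2 (k s')) = W"
      unfolding W_def E2_mult by (simp add: right_diff_distrib distrib_left P_R mult.assoc[symmetric])
    then have "?L \<longleftrightarrow> W = 0" using zero_iff_P[of "Ra (- 1) * (E2 (k s') * E1 (e s l)) + Rb (- 1) * (E2 (e s' l) * E2 (k s')) - E1 (e s l) * E2 (k s')" "- 1"] by auto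
    also have "\<dots> \<longleftrightarrow> (\<forall>a b. cft (- 1) W a b = 0)" unfolding cft_eq_iff[of W 0 "- 1"] cft_simps ..
    finally have Z: "?L \<longleftrightarrow> (\<forall>a b. cft (- 1) W a b = 0)" .
  have eq: "cft (- 1) W a b = sy s ((if inh s 0 (a - 1 + 1) then kEx s' l (b + 1 - 1) (a - 1 + 1) else 0) + (if inh s 0 (a - 1) then kE0 s' l (b + 1) (a - 1) else 0))
       - (if a - 1 = - 1 then - (sc dq * hat (- 1) s' (e s' l * k s') (b + 1 + (a - 1))) else 0)" for a b
      by (cases "inh s 0 a"; cases "inh s 0 (a - 1)";
         simp add: W_def cft_simps cft_lp cft_prod cft_E hat_e kEx_def kE0_def sc_one sc_uminus sc_zero; cases s; simp add: algebra_simps)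
    have "(\<forall>a b. sy s ((if inh s 0 (a - 1 + 1) then kEx s' l (b + 1 - 1) (a - 1 + 1) else 0) + (if inh s 0 (a - 1) then kE0 s' l (b + 1) (a - 1) else 0))
       - (if a - 1 = - 1 then - (sc dq * hat (- 1) s' (e s' l * k s') (b + 1 + (a - 1))) else 0) = 0) \<longleftrightarrow>
      (\<forall>a b. sy s ((if inh s 0 (b + 1) then kEx s' l (a - 1) (b + 1) else 0) + (if inh s 0 b then kE0 s' l a b else 0))
       - (if b = - 1 then - (sc dq * hat (- 1) s' (e s' l * k s') (a + b)) else 0) = 0)" by (rule shift_all)
    then show ?thesis unfolding Z eq by (simp only: right_minus_eq)
  qed
  then show ?thesis unfolding P.rel_kE_def h_kE_def by simp
qed

subsection \<open>Relations between half currents of the same kind\<close>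

text \<open>Because \<open>(x - 1)^2 - (q^-1 - q)^2 x = (q^-1 x - q)(q x - q^-1)\<close>. The second
  factor is the coefficient in the quadratic relations of the currents.\<close>

lemma Rb_Rx: "lp \<epsilon> qi (- qv) * (Ra \<epsilon> * Ra \<epsilon> - Rb \<epsilon> * Rx \<epsilon>) = lp \<epsilon> qv (- qi)"
proof -
  define p q where "p = co (sc qi)" and "q = co (sc qv)"
  have pq: "p * q = 1" "p * (q * y) = y" for y
    using qv_nonzero by (simp_all add: p_def q_def sc_one co_one flip: co_mult sc_mult mult.assoc)
  have c: "cen p" "cen q" "cen (U \<epsilon>)" "cen (Y \<epsilon>)" by (simp_all add: p_def q_def cen_co cen_U)
  have P: "lp \<epsilon> qi (- qv) = p * Y \<epsilon> - q" "lp \<epsilon> qv (- qi) = q * Y \<epsilon> - p" by (simp_all add: lp_def p_def q_def sc_uminus co_uminus)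
  have u: "U \<epsilon> * (p * Y \<epsilon> - q) = 1" using P_U(2)[of \<epsilon>] by (simp add: P)
  have "Ra \<epsilon> * Ra \<epsilon> - Rb \<epsilon> * Rx \<epsilon> = U \<epsilon> * (U \<epsilon> * ((p * Y \<epsilon> - q) * (q * Y \<epsilon> - p)))"
    using c by (simp add: pq Ra_def Rb_def Rx_def p_def[symmetric] q_def[symmetric] algebra_simps cen_ac)
  also have "\<dots> = U \<epsilon> * (q * Y \<epsilon> - p)" using u by (simp flip: mult.assoc)
  finally show "lp \<epsilon> qi (- qv) * (Ra \<epsilon> * Ra \<epsilon> - Rb \<epsilon> * Rx \<epsilon>) = lp \<epsilon> qv (- qi)"
    by (simp only: P_U_mult P(2))
qed

definition "FFr c l = P.rr c l * (E2 (f s' l) * P.G c) + P.pr c l * (E2 (f s' c) * P.G l)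
   - Rb 1 * (E1 (f s c) * P.G l) - Ra 1 * (Ra 1 * (E1 (f s c) * E2 (f s' l)))"
text \<open>The part of \<open>FFr\<close> with at most one factor \<open>f'\<close>, cleared of its
  denominator. The products of two \<open>f'\<close> are left out, since they carry a second
  denominator, that of \<open>Rx\<close>.\<close>

definition "FFm c l = lp 1 (r1 c l) (r0 c l) * (E2 (f s' l) * E1 (f s c)) + lp 1 (o1 c l) (o0 c l) * (E2 (f s' c) * E1 (f s l))
   - lp 1 0 dq * E1 (f s c * f s l) - lp 1 qv (- qi) * (E1 (f s c) * E2 (f s' l))"

lemma P_FFr: "lp 1 qi (- qv) * FFr c l = FFm c l - Rx 1 * (lp 1 (r1 c l) (r0 c l) * E2 (f s' l * f s' c) + lp 1 (o1 c l) (o0 c l) * E2 (f s' c * f s' l))"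
proof -
  let ?P = "lp (1) qi (- qv)" and ?M = "Ra (1) * Ra (1) - Rb (1) * Rx (1)"
  have 1: "FFr c l = P.rr c l * (E2 (f s' l) * E1 (f s c)) + P.pr c l * (E2 (f s' c) * E1 (f s l)) - Rb 1 * E1 (f s c * f s l) - ?M * (E1 (f s c) * E2 (f s' l)) - Rx (1) * (P.rr c l * E2 (f s' l * f s' c) + P.pr c l * E2 (f s' c * f s' l))"
    unfolding FFr_def P.G_def P.Gm_def E1_mult E2_mult
    by (simp add: algebra_simps cen_left_commute[OF cen_R(3), symmetric, where z = "E2 w" for w] cen_left_commute[OF cen_R(3), symmetric, where z = "E2 u * w" for u w])
  have 2: "?P * (?M * y) = lp (1) qv (- qi) * y" for y
    using arg_cong[OF Rb_Rx[of "1"], of "\<lambda>z. z * y"] by (simp only: mult.assoc)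
  have 3: "?P * (Rx (1) * y) = Rx (1) * (?P * y)" for y by (rule cen_left_commute[OF cen_R(3), symmetric])
  have 4: "?P * (P.rr c l * y) = lp (1) (r1 c l) (r0 c l) * y" "?P * (P.pr c l * y) = lp (1) (o1 c l) (o0 c l) * y" "?P * (Rb 1 * y) = lp (1) 0 dq * y" for y
    by (simp_all only: mult.assoc[symmetric] P_r P_R)
  show ?thesis by (simp only: 1 FFm_def right_diff_distrib[of ?P] distrib_left[of ?P] 2 4 3)
qed

lemma rel_FF_zero: "P.rel_FF \<longleftrightarrow> (\<forall>c\<in>{1..N}. \<forall>l\<in>{1..N}. FFr c l = 0)"
  unfolding P.rel_FF_def FFr_def ..

lemma quad_scalars: "sc qv * (sc qi * y) = (y :: 'a)" "sc qi * (sc qv * y) = (y :: 'a)"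
  using qv_nonzero by (simp_all add: sc_one flip: mult.assoc sc_mult)

text \<open>On q-commuting products at a single argument, \<open>R\<close> merely exchanges the two
  factors. Hence the numerators combine to the denominator, which cancels the second denominator in
  \<open>P_FFr\<close>.\<close>

lemma lp_FF:
  assumes "q_FF s'" "c \<in> {1..N}" "l \<in> {1..N}"
  shows "lp 1 (r1 c l) (r0 c l) * E2 (f s' l * f s' c) + lp 1 (o1 c l) (o0 c l) * E2 (f s' c * f s' l) = lp 1 qi (- qv) * E2 (f s' c * f s' l)"
proof -
  have h: "hat 1 s' (f s' l * f s' c) n = sc qv * hat 1 s' (f s' c * f s' l) n" if "c < l" for n
    using assms that unfolding q_FF_def by (simp add: hat_const)
  have h': "hat 1 s' (f s' c * f s' l) n = sc qv * hat 1 s' (f s' l * f s' c) n" if "l < c" for n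
    using assms that unfolding q_FF_def by (simp add: hat_const)
  consider "c = l" | "c < l" | "l < c" by linarith
  then show ?thesis unfolding cft_eq_iff[of _ _ 1] cft_simps cft_lp cft_E
    by cases (auto simp: h h' r1_def r0_def o1_def o0_def sc_zero sc_one sc_uminus sc_diff quad_scalars algebra_simps)
qed

text \<open>After \<open>lp_FF\<close> a single denominator is left. The products of two half
  currents of the same matrix sit on the lines \<open>b = 0\<close> and \<open>a = 1\<close>, which
  are the boundary lines of \<open>qfull_iff\<close> for \<open>\<tau> = 1\<close>.\<close>

lemma rel_FF_iff:
  assumes "q_FF s'"
  shows "P.rel_FF \<longleftrightarrow> h_FF s s'"
  unfolding rel_FF_zero h_FF_def
proof (intro ball_cong refl)
  fix c l assume cl: "c \<in> {1..N}" "l \<in> {1..N}"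
  define W where "W = FFm c l - lp 1 dq 0 * E2 (f s' c * f s' l)"
  have "Rx 1 * (lp 1 qi (- qv) * y) = lp 1 dq 0 * y" for y
    unfolding P_R[symmetric] by (simp add: mult.assoc cen_left_commute[OF cen_R(3)])
  then have "lp 1 qi (- qv) * FFr c l = W" unfolding P_FFr lp_FF[OF assms cl] W_def by simp
  then have "FFr c l = 0 \<longleftrightarrow> W = 0" using zero_iff_P[of "FFr c l" 1] by simp
  also have "\<dots> \<longleftrightarrow> (\<forall>a b. cft 1 W a b = 0)" unfolding cft_eq_iff[of W 0 1] cft_simps ..
  finally have Z: "FFr c l = 0 \<longleftrightarrow> (\<forall>a b. cft 1 W a b = 0)" .
  have eq: "cft 1 W a b = sy s (sy s' ((if inh s 1 (a - 1) \<and> inh s' 1 (b + 1) then qHx (<) GF c l (a - 1) (b + 1) else 0)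
      + (if inh s 1 a \<and> inh s' 1 b then qH0 (<) GF c l a b else 0)))
      - ((if b = 0 then sc dq * hat 1 s (f s c * f s l) (a + b) else 0) + (if a = 1 then sc dq * hat 1 s' (f s' c * f s' l) (a + b) else 0))" for a b
  proof -
    define V where "V = lp 1 (r1 c l) (r0 c l) * (E2 (f s' l) * E1 (f s c)) + lp 1 (o1 c l) (o0 c l) * (E2 (f s' c) * E1 (f s l)) - lp 1 qv (- qi) * (E1 (f s c) * E2 (f s' l))"
    have W: "W = V - (lp 1 0 dq * E1 (f s c * f s l) + lp 1 dq 0 * E2 (f s' c * f s' l))" by (simp add: W_def V_def FFm_def)
    have V: "cft 1 V a b = sy s (sy s' ((if inh s 1 (a - 1) \<and> inh s' 1 (b + 1) then qHx (<) GF c l (a - 1) (b + 1) else 0)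
      + (if inh s 1 a \<and> inh s' 1 b then qH0 (<) GF c l a b else 0)))"
      unfolding V_def cft_simps cft_lp cft_E cft_prod hat_f qHx_def qH0_def r1_def r0_def o1_def o0_def sc_uminus
      by (cases "inh s 1 (a - 1)"; cases "inh s' 1 (b + 1)"; cases "inh s 1 a"; cases "inh s' 1 b"; cases s; cases s';
        simp add: algebra_simps)
    have T: "cft 1 (lp 1 0 dq * E1 A) a b = (if b = 0 then sc dq * hat 1 s A (a + b) else 0)"
      "cft 1 (lp 1 dq 0 * E2 A) a b = (if a = 1 then sc dq * hat 1 s' A (a + b) else 0)" for A
      unfolding cft_lp cft_E by (auto simp: sc_zero add.commute)
    show ?thesis unfolding W cft_simps(1,2) V T ..
  qed
  show "FFr c l = 0 \<longleftrightarrow> (\<forall>a b. sy s (sy s' ((if inh s 1 (a - 1) \<and> inh s' 1 (b + 1) then qHx (<) GF c l (a - 1) (b + 1) else 0)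
      + (if inh s 1 a \<and> inh s' 1 b then qH0 (<) GF c l a b else 0)))
      = (if b = 0 then sc dq * hat 1 s (f s c * f s l) (a + b) else 0) + (if a = 1 then sc dq * hat 1 s' (f s' c * f s' l) (a + b) else 0))"
    unfolding Z eq by (simp only: right_minus_eq)
qed

text \<open>The hypothesis is the value at \<open>x = q^2\<close> of the numerators of
  \<open>R\<close> for two different indices, applied to \<open>u\<close> and \<open>v\<close>; up
  to the factor \<open>dq\<close> it says \<open>(q^2 - 1) u = q (q^2 - 1) v\<close>.\<close>

lemma quad_solve:
  fixes u v :: 'a
  assumes "sc dq * (sc (- 1) * u + sc 0 * v) + sc (qv * qv) * (sc dq * (sc 1 * u + sc dq * v)) = 0"
  shows "u = sc qv * v"
proof -
  have "sc (dq * (- 1) + qv * qv * dq) * (u - sc qv * v) = 0"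
  proof -
    have e: "qv * qv * dq * dq = - ((dq * (- 1) + qv * qv * dq) * qv)" using qv_nonzero by (simp add: field_simps)
    have "sc dq * (sc (- 1) * u + sc 0 * v) + sc (qv * qv) * (sc dq * (sc 1 * u + sc dq * v))
      = sc (dq * (- 1) + qv * qv * dq) * u + sc (qv * qv * dq * dq) * v"
      by (simp only: sc_add sc_mult sc_zero sc_one mult_zero_left distrib_left distrib_right mult.assoc add.assoc add_0_right mult_1_left)
    also have "\<dots> = sc (dq * (- 1) + qv * qv * dq) * (u - sc qv * v)"
      unfolding e sc_uminus sc_mult[of "dq * (- 1) + qv * qv * dq" qv] by (simp only: right_diff_distrib mult.assoc mult_minus_left add_uminus_conv_diff)
    finally show ?thesis using assms by simp
  qed
  moreover have "dq * (- 1) + qv * qv * dq = - (qv * dq * dq)" using qv_nonzero by (simp add: field_simps)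
  then have "dq * (- 1) + qv * qv * dq \<noteq> 0" using qv_nonzero dq_nonzero by simp
  ultimately show ?thesis using sc_cancel by (metis eq_iff_diff_eq_0)
qed

text \<open>For equal signs \<open>FFm\<close> has finitely many coefficients of each total degree,
  so its multiple by \<open>q^-1 x - q\<close> vanishes at \<open>x = q^2\<close>. By
  \<open>P_FFr\<close> this multiple is the R-matrix applied to products of two half
  currents.\<close>

lemma q_FF:
  assumes "P.rel_FF" and ss: "s' = s"
  shows "q_FF s"
  unfolding q_FF_def
proof (intro ballI impI)
  fix c l assume cl: "c \<in> {1..N}" "l \<in> {1..N}" "c < l"
  let ?R = "lp 1 (r1 c l) (r0 c l) * E2 (f s l * f s c) + lp 1 (o1 c l) (o0 c l) * E2 (f s c * f s l)"
  have "FFr c l = 0" using assms cl unfolding rel_FF_zero by blast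
  then have "FFm c l = Rx 1 * ?R" using P_FFr[of c l] unfolding ss by simp
  then have P: "lp 1 qi (- qv) * FFm c l = lp 1 dq 0 * ?R" by (simp only: P_R[symmetric] mult.assoc)
  have "hat 1 s (f s l * f s c) n = sc qv * hat 1 s (f s c * f s l) n" for n
  proof (rule quad_solve)
    \<comment> \<open>The numerator \<open>dq x\<close> of \<open>Rx\<close> shifts the exponent by
      one; the right-hand side therefore lives on the exponents 1 and 2.\<close>
    define R where "R a = sc dq * cft 1 ?R (a - 1) (n - a + 1)" for a
    have "R 1 + sc (qv * qv) * R (1 + 1) = 0"
    proof (rule root_of_divisible[where D = "\<lambda>a. cft 1 (FFm c l) a (n - a)" and K = "\<bar>n\<bar> + 2"])
      show "sc qi * cft 1 (FFm c l) (a - 1) (n - (a - 1)) - sc qv * cft 1 (FFm c l) a (n - a) = R a" for a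
        using arg_cong[OF P, of "\<lambda>S. cft 1 S a (n - a)"] unfolding cft_lp R_def by (simp add: sc_zero sc_uminus algebra_simps)
      show "cft 1 (FFm c l) a (n - a) = 0" if "\<bar>a\<bar> > \<bar>n\<bar> + 2" for a
        using that unfolding FFm_def cft_simps cft_lp cft_E cft_prod unfolding ss
        by (cases s) (auto simp: hat_neg abs_if split: if_splits)
      show "R a = 0" if "a \<noteq> 1" "a \<noteq> 1 + 1" for a
        using that unfolding R_def cft_simps cft_lp cft_E unfolding ss by auto
    qed
    then show "sc dq * (sc (- 1) * hat 1 s (f s l * f s c) n + sc 0 * hat 1 s (f s c * f s l) n)
      + sc (qv * qv) * (sc dq * (sc 1 * hat 1 s (f s l * f s c) n + sc dq * hat 1 s (f s c * f s l) n)) = 0"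
      unfolding R_def cft_simps cft_lp cft_E unfolding ss using cl(3) by (simp add: r1_def r0_def o1_def o0_def)
  qed
  then show "f s l * f s c = fps_const (sc qv) * (f s c * f s l)" by (intro hat_ext[of 1 s]) (simp add: hat_const)
qed

definition "EEr c l = P.rl c l * (P.Gm c * E2 (e s' l)) + P.pl l c * (P.Gm l * E2 (e s' c))
   - Rx (- 1) * (P.Gm l * E1 (e s c)) - Ra (- 1) * (Ra (- 1) * (E2 (e s' l) * E1 (e s c)))"
definition "EEm c l = lp (- 1) (r1 c l) (r0 c l) * (E1 (e s c) * E2 (e s' l)) + lp (- 1) (o1 l c) (o0 l c) * (E1 (e s l) * E2 (e s' c))
   - lp (- 1) dq 0 * E1 (e s l * e s c) - lp (- 1) qv (- qi) * (E2 (e s' l) * E1 (e s c))"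

text \<open>The mirror image of \<open>P_FFr\<close>: the left R-matrix replaces the right one, and
  the second denominator comes from \<open>Rb\<close>.\<close>

lemma P_EEr: "lp (- 1) qi (- qv) * EEr c l = EEm c l - Rb (- 1) * (lp (- 1) (r1 c l) (r0 c l) * E2 (e s' c * e s' l) + lp (- 1) (o1 l c) (o0 l c) * E2 (e s' l * e s' c))"
proof -
  let ?P = "lp (- 1) qi (- qv)" and ?M = "Ra (- 1) * Ra (- 1) - Rb (- 1) * Rx (- 1)"
  have 1: "EEr c l = P.rl c l * (E1 (e s c) * E2 (e s' l)) + P.pl l c * (E1 (e s l) * E2 (e s' c)) - Rx (- 1) * E1 (e s l * e s c) - ?M * (E2 (e s' l) * E1 (e s c)) - Rb (- 1) * (P.rl c l * E2 (e s' c * e s' l) + P.pl l c * E2 (e s' l * e s' c))"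
    unfolding EEr_def P.G_def P.Gm_def E1_mult E2_mult
    by (simp add: algebra_simps cen_left_commute[OF cen_R(2), symmetric, where z = "E2 w" for w] cen_left_commute[OF cen_R(2), symmetric, where z = "E2 u * w" for u w])
  have 2: "?P * (?M * y) = lp (- 1) qv (- qi) * y" for y
    using arg_cong[OF Rb_Rx[of "- 1"], of "\<lambda>z. z * y"] by (simp only: mult.assoc)
  have 3: "?P * (Rb (- 1) * y) = Rb (- 1) * (?P * y)" for y by (rule cen_left_commute[OF cen_R(2), symmetric])
  have 4: "?P * (P.rl c l * y) = lp (- 1) (r1 c l) (r0 c l) * y" "?P * (P.pl l c * y) = lp (- 1) (o1 l c) (o0 l c) * y" "?P * (Rx (- 1) * y) = lp (- 1) dq 0 * y" for y
    by (simp_all only: mult.assoc[symmetric] P_r P_R)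
  show ?thesis by (simp only: 1 EEm_def right_diff_distrib[of ?P] distrib_left[of ?P] 2 4 3)
qed

lemma rel_EE_zero: "P.rel_EE \<longleftrightarrow> (\<forall>c\<in>{1..N}. \<forall>l\<in>{1..N}. EEr c l = 0)"
  unfolding P.rel_EE_def EEr_def ..

lemma lp_EE:
  assumes "q_EE s'" "c \<in> {1..N}" "l \<in> {1..N}"
  shows "lp (- 1) (r1 c l) (r0 c l) * E2 (e s' c * e s' l) + lp (- 1) (o1 l c) (o0 l c) * E2 (e s' l * e s' c) = lp (- 1) qi (- qv) * E2 (e s' l * e s' c)"
proof -
  have h: "hat (- 1) s' (e s' c * e s' l) n = sc qv * hat (- 1) s' (e s' l * e s' c) n" if "l < c" for n
    using assms that unfolding q_EE_def by (simp add: hat_const)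
  have h': "hat (- 1) s' (e s' l * e s' c) n = sc qv * hat (- 1) s' (e s' c * e s' l) n" if "c < l" for n
    using assms that unfolding q_EE_def by (simp add: hat_const)
  consider "c = l" | "c < l" | "l < c" by linarith
  then show ?thesis unfolding cft_eq_iff[of _ _ "- 1"] cft_simps cft_lp cft_E
    by cases (auto simp: h h' r1_def r0_def o1_def o0_def sc_zero sc_one sc_uminus sc_diff quad_scalars algebra_simps)
qed

lemma rel_EE_iff:
  assumes "q_EE s'"
  shows "P.rel_EE \<longleftrightarrow> h_EE s s'"
  unfolding rel_EE_zero h_EE_def
proof (intro ball_cong refl)
  fix c l assume cl: "c \<in> {1..N}" "l \<in> {1..N}"
  define W where "W = EEm c l - lp (- 1) 0 dq * E2 (e s' l * e s' c)"
  have "Rb (- 1) * (lp (- 1) qi (- qv) * y) = lp (- 1) 0 dq * y" for y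
    unfolding P_R[symmetric] by (simp add: mult.assoc cen_left_commute[OF cen_R(2)])
  then have "lp (- 1) qi (- qv) * EEr c l = W" unfolding P_EEr lp_EE[OF assms cl] W_def by simp
  then have "EEr c l = 0 \<longleftrightarrow> W = 0" using zero_iff_P[of "EEr c l" "- 1"] by simp
  also have "\<dots> \<longleftrightarrow> (\<forall>a b. cft (- 1) W a b = 0)" unfolding cft_eq_iff[of W 0 "- 1"] cft_simps ..
  finally have Z: "EEr c l = 0 \<longleftrightarrow> (\<forall>a b. cft (- 1) W a b = 0)" .
  have eq: "cft (- 1) W a b = sy s (sy s' ((if inh s 0 (a - 1) \<and> inh s' 0 (b + 1) then qHx (>) GE c l (a - 1) (b + 1) else 0)
      + (if inh s 0 a \<and> inh s' 0 b then qH0 (>) GE c l a b else 0)))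
      - ((if b = - 1 then sc dq * hat (- 1) s (e s l * e s c) (a + b) else 0) + (if a = 0 then sc dq * hat (- 1) s' (e s' l * e s' c) (a + b) else 0))" for a b
  proof -
    define V where "V = lp (- 1) (r1 c l) (r0 c l) * (E1 (e s c) * E2 (e s' l)) + lp (- 1) (o1 l c) (o0 l c) * (E1 (e s l) * E2 (e s' c)) - lp (- 1) qv (- qi) * (E2 (e s' l) * E1 (e s c))"
    have W: "W = V - (lp (- 1) dq 0 * E1 (e s l * e s c) + lp (- 1) 0 dq * E2 (e s' l * e s' c))" by (simp add: W_def V_def EEm_def)
    have V: "cft (- 1) V a b = sy s (sy s' ((if inh s 0 (a - 1) \<and> inh s' 0 (b + 1) then qHx (>) GE c l (a - 1) (b + 1) else 0)
      + (if inh s 0 a \<and> inh s' 0 b then qH0 (>) GE c l a b else 0)))"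
      unfolding V_def cft_simps cft_lp cft_E cft_prod hat_e qHx_def qH0_def r1_def r0_def o1_def o0_def sc_uminus
      by (cases "inh s 0 (a - 1)"; cases "inh s' 0 (b + 1)"; cases "inh s 0 a"; cases "inh s' 0 b"; cases s; cases s';
        simp add: algebra_simps)
    have T: "cft (- 1) (lp (- 1) dq 0 * E1 A) a b = (if b = - 1 then sc dq * hat (- 1) s A (a + b) else 0)"
      "cft (- 1) (lp (- 1) 0 dq * E2 A) a b = (if a = 0 then sc dq * hat (- 1) s' A (a + b) else 0)" for A
    proof -
      have "b + 1 = 0 \<longleftrightarrow> b = - 1" by auto
      then show "cft (- 1) (lp (- 1) dq 0 * E1 A) a b = (if b = - 1 then sc dq * hat (- 1) s A (a + b) else 0)"
        "cft (- 1) (lp (- 1) 0 dq * E2 A) a b = (if a = 0 then sc dq * hat (- 1) s' A (a + b) else 0)"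
        unfolding cft_lp cft_E by (auto simp: sc_zero)
    qed
    show ?thesis unfolding W cft_simps(1,2) V T ..
  qed
  show "EEr c l = 0 \<longleftrightarrow> (\<forall>a b. sy s (sy s' ((if inh s 0 (a - 1) \<and> inh s' 0 (b + 1) then qHx (>) GE c l (a - 1) (b + 1) else 0)
      + (if inh s 0 a \<and> inh s' 0 b then qH0 (>) GE c l a b else 0)))
      = (if b = - 1 then sc dq * hat (- 1) s (e s l * e s c) (a + b) else 0) + (if a = 0 then sc dq * hat (- 1) s' (e s' l * e s' c) (a + b) else 0))"
    unfolding Z eq by (simp only: right_minus_eq)
qed

lemma q_EE:
  assumes "P.rel_EE" and ss: "s' = s"
  shows "q_EE s"
  unfolding q_EE_def
proof (intro ballI impI)
  fix c l assume cl: "c \<in> {1..N}" "l \<in> {1..N}" "c > l"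
  let ?R = "lp (- 1) (r1 c l) (r0 c l) * E2 (e s c * e s l) + lp (- 1) (o1 l c) (o0 l c) * E2 (e s l * e s c)"
  have "EEr c l = 0" using assms cl unfolding rel_EE_zero by blast
  then have "EEm c l = Rb (- 1) * ?R" using P_EEr[of c l] unfolding ss by simp
  then have P: "lp (- 1) qi (- qv) * EEm c l = lp (- 1) 0 dq * ?R" by (simp only: P_R[symmetric] mult.assoc)
  have "hat (- 1) s (e s c * e s l) n = sc qv * hat (- 1) s (e s l * e s c) n" for n
  proof (rule quad_solve)
    \<comment> \<open>The numerator of \<open>Rb\<close> is the constant \<open>dq\<close>, so
      nothing is shifted and the exponents are 0 and 1.\<close>
    define R where "R a = sc dq * cft (- 1) ?R a (n - a)" for a
    have "R 0 + sc (qv * qv) * R (0 + 1) = 0"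
    proof (rule root_of_divisible[where D = "\<lambda>a. cft (- 1) (EEm c l) a (n - a)" and K = "\<bar>n\<bar> + 2"])
      show "sc qi * cft (- 1) (EEm c l) (a - 1) (n - (a - 1)) - sc qv * cft (- 1) (EEm c l) a (n - a) = R a" for a
        using arg_cong[OF P, of "\<lambda>S. cft (- 1) S a (n - a)"] unfolding cft_lp R_def by (simp add: sc_zero sc_uminus algebra_simps)
      show "cft (- 1) (EEm c l) a (n - a) = 0" if "\<bar>a\<bar> > \<bar>n\<bar> + 2" for a
        using that unfolding EEm_def cft_simps cft_lp cft_E cft_prod unfolding ss
        by (cases s) (auto simp: hat_neg abs_if split: if_splits)
      show "R a = 0" if "a \<noteq> 0" "a \<noteq> 0 + 1" for a
        using that unfolding R_def cft_simps cft_lp cft_E unfolding ss by auto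
    qed
    then show "sc dq * (sc (- 1) * hat (- 1) s (e s c * e s l) n + sc 0 * hat (- 1) s (e s l * e s c) n)
      + sc (qv * qv) * (sc dq * (sc 1 * hat (- 1) s (e s c * e s l) n + sc dq * hat (- 1) s (e s l * e s c) n)) = 0"
      unfolding R_def cft_simps cft_lp cft_E unfolding ss using cl(3) by (simp add: r1_def r0_def o1_def o0_def)
  qed
  then show "e s c * e s l = fps_const (sc qv) * (e s l * e s c)" by (intro hat_ext[of "- 1" s]) (simp add: hat_const)
qed

text \<open>Unlike in \<open>cft\<close>, the two variables are rescaled as \<open>e\<close> in
  \<open>z\<close> and \<open>f\<close> in \<open>w\<close>, that is, with opposite
  \<open>\<epsilon>\<close>. The linear factors then keep the central elements
  \<open>C (2 * sg s)\<close> and \<open>C (2 * sg s')\<close>.\<close>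

definition cfe :: "'r \<Rightarrow> int \<Rightarrow> int \<Rightarrow> 'a" where "cfe S a b = C (sg s * a - sg s' * b) * cf S a b"

lemma cfe_lp:
  "cfe (lp 1 c1 c0 * S) = lin c1 c0 (C (2 * sg s)) (cfe S)"
  "cfe (lp (- 1) c1 c0 * S) = lin c1 c0 (C (2 * sg s')) (cfe S)"
proof -
  have c: "C (sg s * a - sg s' * b) * (C (\<epsilon> * (sg s - sg s')) * y) = C (sg s + sg s' + \<epsilon> * (sg s - sg s')) * (C (sg s * (a - 1) - sg s' * (b + 1)) * y)" for a b \<epsilon> y
    unfolding mult.assoc[symmetric] C_add[symmetric] by (simp add: algebra_simps)
  have "cfe (lp \<epsilon> c1 c0 * S) a b = lin c1 c0 (C (sg s + sg s' + \<epsilon> * (sg s - sg s'))) (cfe S) a b" for \<epsilon> a b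
    unfolding cfe_def cf_lp lin_def
    by (simp add: distrib_left mult.assoc cen_left_commute[OF C_cen, of _ "sc c1"] cen_left_commute[OF C_cen, of _ "sc c0"] c)
  from this[of 1] this[of "- 1"]
  show "cfe (lp 1 c1 c0 * S) = lin c1 c0 (C (2 * sg s)) (cfe S)"
    "cfe (lp (- 1) c1 c0 * S) = lin c1 c0 (C (2 * sg s')) (cfe S)" by (simp_all add: fun_eq_iff)
qed

lemma cfe_E: "cfe (E1 A) = (\<lambda>a b. if b = 0 then C (sg s * a) * hs s A a else 0)" "cfe (E2 A) = (\<lambda>a b. if a = 0 then C (- sg s' * b) * hs s' A b else 0)"
  by (simp_all add: cfe_def cf_E1 cf_E2 fun_eq_iff)

lemma cfe_com: "cfe (E1 (e s i) * E2 (f s' l) - E2 (f s' l) * E1 (e s i)) = EFc i l s s'"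
proof (intro ext)
  fix a b
  have "cfe (E1 (e s i) * E2 (f s' l) - E2 (f s' l) * E1 (e s i)) a b
    = hat (- 1) s (e s i) a * hat 1 s' (f s' l) b - hat 1 s' (f s' l) b * hat (- 1) s (e s i) a"
  proof -
    have "C (sg s * a - sg s' * b) = C (sg s * a) * C (- (sg s' * b))" by (simp flip: C_add)
    then show ?thesis unfolding cfe_def cf_diff cf_E1E2 cf_E2E1 hat_def by (simp add: right_diff_distrib mult.assoc
      cen_left_commute[OF C_cen, of "- (sg s' * b)" "hs s (e s i) a", symmetric] cen_left_commute[OF C_cen, of "sg s * a" "hs s' (f s' l) b", symmetric]
      cen_left_commute[OF C_cen, of "- (sg s' * b)" "C (sg s * a)"])
  qed
  then show "cfe (E1 (e s i) * E2 (f s' l) - E2 (f s' l) * E1 (e s i)) a b = EFc i l s s' a b"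
    unfolding hat_e hat_f EFc_def by (cases s; cases s') simp_all
qed

lemma cfe_eq_iff: "S = T \<longleftrightarrow> (\<forall>a b. cfe S a b = cfe T a b)"
  unfolding cfe_def C_mult_eq_iff by (rule cf_eq_iff)

lemma rel_EF_iff:
  assumes "c_Kk s' s'"
  shows "P.rel_EF \<longleftrightarrow> h_EF s s'"
  unfolding P.rel_EF_def h_EF_def
proof (intro ball_cong refl)
  fix i l assume il: "i \<in> {1..N}" "l \<in> {1..N}"
  let ?l = "lp (- 1) qi (- qv)" and ?r = "lp 1 qi (- qv)"
  let ?com = "E1 (e s i) * E2 (f s' l) - E2 (f s' l) * E1 (e s i)"
  have k: "E2 (Ki s' l i) * E2 (k s') = E2 (kKi s' l i)" using k_Ki_commute[OF assms il] by (simp flip: E2_mult)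
  have c: "?l * ?r * (Ra (- 1) * (z * y)) = lp (- 1) 1 (- 1) * (?r * z * y)" "?l * ?r * (Ra 1 * (z * y)) = lp 1 1 (- 1) * (?l * z * y)" for z y
    unfolding P_R[symmetric]
    by (simp_all add: mult.assoc cen_left_commute[OF cen_co(4), of 1 qi "- qv" "Ra (- 1)"] cen_left_commute[OF cen_co(4), of "- 1" qi "- qv" "?r"]
      cen_left_commute[OF cen_co(4), of "- 1" qi "- qv" "Ra 1"])
  have "Ra (- 1) * (Ra 1 * ?com) = Ra (- 1) * (Rb 1 * (E1 (k s) * E1 (Ki s l i))) - Ra 1 * (Rb (- 1) * (E2 (Ki s' l i) * E2 (k s')))
    \<longleftrightarrow> ?l * ?r * (Ra (- 1) * (Ra 1 * ?com)) = ?l * ?r * (Ra (- 1) * (Rb 1 * (E1 (k s) * E1 (Ki s l i))) - Ra 1 * (Rb (- 1) * (E2 (Ki s' l i) * E2 (k s'))))"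
    by (rule unit_eq_iff[OF unit_mult[OF unit_P unit_P]])
  also have "\<dots> \<longleftrightarrow> lp (- 1) 1 (- 1) * (lp 1 1 (- 1) * ?com) = lp (- 1) 1 (- 1) * (lp 1 0 dq * E1 (kKi s l i)) - lp 1 1 (- 1) * (lp (- 1) 0 dq * E2 (kKi s' l i))"
    unfolding right_diff_distrib[of "?l * ?r"] c P_R k E1_mult[symmetric] ..
  also have "\<dots> \<longleftrightarrow> (\<forall>a b. lin 1 (- 1) (C (2 * sg s')) (lin 1 (- 1) (C (2 * sg s)) (EFc i l s s')) a b
      = sc dq * (lin 1 (- 1) (C (2 * sg s')) (\<lambda>a b. if b = 0 then C (sg s * a) * hs s (kKi s l i) a else 0) a b
        - lin 1 (- 1) (C (2 * sg s)) (\<lambda>a b. if a = 0 then C (- sg s' * b) * hs s' (kKi s' l i) b else 0) a b))"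
  proof -
    have z: "lin 0 dq \<kappa> S = (\<lambda>a b. sc dq * S a b)" for \<kappa> :: 'a and S by (simp add: lin_def sc_zero fun_eq_iff)
    have lc: "lin 1 (- 1) (C j) (\<lambda>a b. sc dq * S a b) a b = sc dq * lin 1 (- 1) (C j) S a b" for j S a b
      by (simp add: lin_def sc_one sc_uminus right_diff_distrib cen_left_commute[OF C_cen, of j "sc dq"])
    have d: "cfe (S - T) a b = cfe S a b - cfe T a b" for S T a b by (simp add: cfe_def cf_diff right_diff_distrib)
    show ?thesis unfolding cfe_eq_iff[of "lp (- 1) 1 (- 1) * (lp 1 1 (- 1) * ?com)"] d cfe_lp cfe_E cfe_com z lc right_diff_distrib[of "sc dq"] ..
  qed
  finally show "Ra (- 1) * (Ra 1 * ?com) = Ra (- 1) * (Rb 1 * (E1 (k s) * E1 (Ki s l i))) - Ra 1 * (Rb (- 1) * (E2 (Ki s' l i) * E2 (k s')))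
    \<longleftrightarrow> (\<forall>a b. lin 1 (- 1) (C (2 * sg s')) (lin 1 (- 1) (C (2 * sg s)) (EFc i l s s')) a b
      = sc dq * (lin 1 (- 1) (C (2 * sg s')) (\<lambda>a b. if b = 0 then C (sg s * a) * hs s (kKi s l i) a else 0) a b
        - lin 1 (- 1) (C (2 * sg s)) (\<lambda>a b. if a = 0 then C (- sg s' * b) * hs s' (kKi s' l i) b else 0) a b))" .
qed

end

section \<open>Equivalence for all pairs of signs\<close>

context gauss_realization begin

lemma rels_iff:
  assumes "q_FF s'" "q_EE s'" "c_Kk s' s'"
  shows "P.rels \<longleftrightarrow> c_RLL N K s s' \<and> h_KF s s' \<and> h_KE s s' \<and> h_FF s s' \<and> h_EE s s' \<and> c_Kk s s' \<and> h_kF s' s \<and> h_kE s' s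
    \<and> c_kk s s' \<and> h_EF s s'"
  unfolding P.rels_def rel_KK_iff rel_KF_iff rel_KE_iff rel_FF_iff[OF assms(1)] rel_EE_iff[OF assms(2)] rel_Kk_iff rel_kF_iff rel_kE_iff
    rel_kk_iff rel_EF_iff[OF assms(3)] ..

lemma swapped_realization: "gauss_realization C N K Ki e f s' s E2 E1 co xi x (\<lambda>S i j. cf S j i)"
  by (intro gauss_realization.intro gauss_axioms swapped)

end

locale gauss_realization2 = Z: gauss_realization C N K Ki k e f s s' E1 E2 co x xi cf
  + W: gauss_realization C N K Ki k e f s' s E2 E1 co xi x "\<lambda>S i j. cf S j i"
  for C :: "int \<Rightarrow> 'a::cqalg" and N :: nat and K Ki :: "pmsign \<Rightarrow> nat \<Rightarrow> nat \<Rightarrow> 'a fps" and k :: "pmsign \<Rightarrow> 'a fps"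
    and e f :: "pmsign \<Rightarrow> nat \<Rightarrow> 'a fps" and s s' :: pmsign and E1 E2 :: "'a fps \<Rightarrow> 'r::ring_1" and co :: "'a \<Rightarrow> 'r"
    and x xi :: 'r and cf :: "'r \<Rightarrow> int \<Rightarrow> int \<Rightarrow> 'a"
begin

lemma unitary:
  "W.Ra \<epsilon> * Z.Ra \<epsilon> + W.Rx \<epsilon> * Z.Rx \<epsilon> = 1" "W.Ra \<epsilon> * Z.Ra \<epsilon> + W.Rb \<epsilon> * Z.Rb \<epsilon> = 1"
  "W.Ra \<epsilon> * Z.Rb \<epsilon> + W.Rx \<epsilon> * Z.Ra \<epsilon> = 0" "W.Ra \<epsilon> * Z.Rx \<epsilon> + W.Rb \<epsilon> * Z.Ra \<epsilon> = 0"
proof -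
  have "Z.Y \<epsilon> * W.Y \<epsilon> = co (C (\<epsilon> * (sg s - sg s')) * C (\<epsilon> * (sg s' - sg s))) * (x * xi)"
    by (simp add: Z.Y_def W.Y_def Z.co_mult mult.assoc cen_left_commute[OF Z.x_cen])
  also have "\<dots> = 1" by (simp add: Z.C_add[symmetric] Z.C_zero Z.co_one Z.x_xi flip: distrib_left)
  finally have y: "Z.Y \<epsilon> * W.Y \<epsilon> = 1" .
  have pq: "co (sc qi) * co (sc qv) = 1" using qv_nonzero by (simp add: sc_one Z.co_one flip: Z.co_mult sc_mult)
  have u: "Z.U \<epsilon> * (co (sc qi) * Z.Y \<epsilon> - co (sc qv)) = 1" "W.U \<epsilon> * (co (sc qi) * W.Y \<epsilon> - co (sc qv)) = 1"
    using Z.P_U(2)[of \<epsilon>] W.P_U(2)[of \<epsilon>] by (simp_all add: Z.lp_def W.lp_def sc_uminus Z.co_uminus)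
  show "W.Ra \<epsilon> * Z.Ra \<epsilon> + W.Rx \<epsilon> * Z.Rx \<epsilon> = 1" "W.Ra \<epsilon> * Z.Ra \<epsilon> + W.Rb \<epsilon> * Z.Rb \<epsilon> = 1"
    "W.Ra \<epsilon> * Z.Rb \<epsilon> + W.Rx \<epsilon> * Z.Ra \<epsilon> = 0" "W.Ra \<epsilon> * Z.Rx \<epsilon> + W.Rb \<epsilon> * Z.Ra \<epsilon> = 0"
    unfolding Z.Ra_def Z.Rb_def Z.Rx_def W.Ra_def W.Rb_def W.Rx_def
    by (rule R_unitary[OF Z.cen_co(3) W.cen_co(3) Z.cen_co(1) Z.cen_co(1) Z.cen_U W.cen_U y pq u])+
qed

sublocale R: rpair2 N "Z.Ra (- 1)" "Z.Rb (- 1)" "Z.Rx (- 1)" "Z.Ra 1" "Z.Rb 1" "Z.Rx 1"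
  "W.Ra (- 1)" "W.Rb (- 1)" "W.Rx (- 1)" "W.Ra 1" "W.Rb 1" "W.Rx 1"
  "\<lambda>i j. E1 (K s i j)" "\<lambda>i j. E1 (Ki s i j)" "E1 (k s)" "\<lambda>i. E1 (e s i)" "\<lambda>i. E1 (f s i)"
  "\<lambda>i j. E2 (K s' i j)" "\<lambda>i j. E2 (Ki s' i j)" "E2 (k s')" "\<lambda>i. E2 (e s' i)" "\<lambda>i. E2 (f s' i)"
  by (intro rpair2.intro Z.P.rpair_axioms W.P.rpair_axioms rpair2_axioms.intro unitary)

lemma c_RLL_rels: "Z.c_RLL (Suc N) Z.L s s' \<longleftrightarrow> Z.P.rels \<and> W.P.rels"
  using R.X_iff_rels unfolding Z.c_RLL_iff .

lemma c_RLL_swap: "Z.c_RLL N K s s' \<Longrightarrow> Z.c_RLL N K s' s"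
  unfolding Z.rel_KK_iff[symmetric] W.rel_KK_iff[symmetric] Z.P.rel_KK_def W.P.rel_KK_def
  by (simp add: R.X_swap)

end

context central_powers begin

definition "d_RLL M Lf s s' \<longleftrightarrow> (\<forall>i\<in>{1..M}. \<forall>j\<in>{1..M}. \<forall>k\<in>{1..M}. \<forall>l\<in>{1..M::nat}. \<forall>r t.
  (\<Sum>a=1..M. \<Sum>b=1..M. rm C ZW (sg s' - sg s) (Rmat qL i a k b) (prod_zw (hs s (Lf s a j)) (hs s' (Lf s' b l))) r t)
  = (\<Sum>a=1..M. \<Sum>b=1..M. rm C ZW (sg s - sg s') (Rmat qL a j b l) (prod_wz (hs s' (Lf s' k b)) (hs s (Lf s i a))) r t))"

end

context gauss begin

lemma realization2:
  "gauss_realization2 C N K Ki e f s s' zser wser (\<lambda>a. fls_const (fls_const a)) (xser s s' 1) (xser s s' (- 1))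
    (\<lambda>S i j. fls_nth (fls_nth S (sg s' * j)) (sg s * i))"
proof -
  have "gauss_realization C N K Ki e f s s' zser wser (\<lambda>a. fls_const (fls_const a)) (xser s s' 1) (xser s s' (- 1))
    (\<lambda>S i j. fls_nth (fls_nth S (sg s' * j)) (sg s * i))"
    by (intro gauss_realization.intro gauss_axioms realization_fls)
  from this gauss_realization.swapped_realization[OF this] show ?thesis by (rule gauss_realization2.intro)
qed

text \<open>In the relations of \<open>k\<close> with half currents the signs appear exchanged: for
  the pair \<open>(s, s')\<close> the factor \<open>k\<close> comes from the second matrix and the
  half current from the first.\<close>

definition "h_rels s s' \<longleftrightarrow> c_RLL N K s s' \<and> h_KF s s' \<and> h_KE s s' \<and> h_FF s s' \<and> h_EE s s' \<and> c_Kk s s' \<and> h_kF s' s \<and> h_kE s' s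
    \<and> c_kk s s' \<and> h_EF s s'"

lemma c_RLL_h_rels:
  assumes "\<And>s. q_FF s \<and> q_EE s \<and> c_Kk s s"
  shows "c_RLL (Suc N) L s s' \<longleftrightarrow> h_rels s s' \<and> h_rels s' s"
proof -
  interpret G: gauss_realization2 C N K Ki k e f s s' zser wser "\<lambda>a. fls_const (fls_const a)" "xser s s' 1" "xser s s' (- 1)"
    "\<lambda>S i j. fls_nth (fls_nth S (sg s' * j)) (sg s * i)" by (rule realization2)
  show ?thesis unfolding G.c_RLL_rels h_rels_def using assms by (simp only: G.Z.rels_iff G.W.rels_iff)
qed

lemma c_RLL_diagonal:
  assumes "c_RLL (Suc N) L s s"
  shows "q_FF s \<and> q_EE s \<and> c_Kk s s"
proof -
  interpret G: gauss_realization2 C N K Ki k e f s s zser wser "\<lambda>a. fls_const (fls_const a)" "xser s s 1" "xser s s (- 1)"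
    "\<lambda>S i j. fls_nth (fls_nth S (sg s * j)) (sg s * i)" by (rule realization2)
  have "G.Z.P.rels" using assms unfolding G.c_RLL_rels by blast
  then show ?thesis unfolding G.Z.P.rels_def using G.Z.q_FF G.Z.q_EE G.Z.rel_Kk_iff by blast
qed

lemma c_RLL_swap: "c_RLL N K s s' \<Longrightarrow> c_RLL N K s' s"
proof -
  interpret G: gauss_realization2 C N K Ki k e f s s' zser wser "\<lambda>a. fls_const (fls_const a)" "xser s s' 1" "xser s s' (- 1)"
    "\<lambda>S i j. fls_nth (fls_nth S (sg s' * j)) (sg s * i)" by (rule realization2)
  show "c_RLL N K s s' \<Longrightarrow> c_RLL N K s' s" by (rule G.c_RLL_swap)
qed

lemma c_kk_swap: "c_kk s s' \<Longrightarrow> c_kk s' s"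
  by (simp add: c_kk_def prod_zw_def prod_wz_def)

lemma all_signs: "(\<forall>s. \<Phi> s) \<longleftrightarrow> \<Phi> Plus \<and> \<Phi> Minus" by (metis pmsign.exhaust)

text \<open>\<open>c_RLL_h_rels\<close> presupposes q-commutation and the commutation of
  \<open>K\<close> with \<open>k\<close>. From the left these come from
  \<open>c_RLL_diagonal\<close>; from the right, q-commutation comes from \<open>c_FF_q\<close> and
  \<open>c_EE_q\<close>. The relation for \<open>Plus Minus\<close> accounts for both mixed orders,
  as \<open>c_RLL_h_rels\<close> contains \<open>h_rels\<close> in both.\<close>

theorem c_RLL_gauss:
  "(\<forall>s. c_RLL (Suc N) L s s) \<and> c_RLL (Suc N) L Plus Minus \<longleftrightarrow>
   ((\<forall>s. c_RLL N K s s) \<and> c_RLL N K Plus Minus) \<and> (\<forall>s. c_kk s s) \<and> c_kk Plus Minus \<and> (\<forall>s s'. c_Kk s s')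
   \<and> (\<forall>s. c_KE s \<and> c_KF s \<and> c_kE s \<and> c_kF s) \<and> c_EE \<and> c_FF \<and> c_EF" (is "?L \<longleftrightarrow> ?R")
proof
  assume L: ?L
  then have q: "q_FF s \<and> q_EE s \<and> c_Kk s s" for s using c_RLL_diagonal by blast
  have "h_rels s s'" for s s'
  proof -
    have "h_rels s s" "h_rels s' s'" "h_rels Plus Minus" "h_rels Minus Plus" using L unfolding c_RLL_h_rels[OF q] by blast+
    then show ?thesis by (cases s; cases s') simp_all
  qed
  then show ?R unfolding h_rels_def c_KE_iff c_KF_iff c_kE_iff c_kF_iff c_EE_iff c_FF_iff c_EF_iff by blast
next
  assume R: ?R
  then have q: "q_FF s \<and> q_EE s \<and> c_Kk s s" for s using c_FF_q c_EE_q by blast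
  have "c_RLL N K s s' \<and> c_kk s s'" for s s'
    by (cases s; cases s') (use R c_RLL_swap c_kk_swap in blast)+
  then have "h_rels s s'" for s s'
    using R unfolding h_rels_def c_KE_iff c_KF_iff c_kE_iff c_kF_iff c_EE_iff c_FF_iff c_EF_iff by blast
  then show ?L unfolding c_RLL_h_rels[OF q] by blast
qed

text \<open>Multiplication by an expansion in \<open>z/w\<close> takes terms with ever lower powers
  of \<open>z\<close> and higher powers of \<open>w\<close>. They vanish eventually if the first
  series has sign \<open>Plus\<close> or the second has sign \<open>Minus\<close>.\<close>

lemma c_RLL_form:
  assumes "s = Plus \<or> s' = Minus"
  shows "c_RLL M Lf s s' \<longleftrightarrow> d_RLL M Lf s s'"
proof -
  have b: "bd ZW (prod_zw (hs s A) (hs s' B)) \<and> bd ZW (prod_wz (hs s' B) (hs s A))" for A B :: "'a fps"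
    using assms
  proof
    assume "s = Plus" then show ?thesis using bd_prod[of Plus] by simp
  next
    assume s': "s' = Minus"
    have h: "hs s' B (b + k) = 0" if "k \<ge> \<bar>b\<bar> + 1" for b k using that by (intro hs_neg) (simp add: s')
    have "\<exists>K\<ge>0. \<forall>k\<ge>K. prod_zw (hs s A) (hs s' B) (a - k) (b + k) = 0" "\<exists>K\<ge>0. \<forall>k\<ge>K. prod_wz (hs s' B) (hs s A) (a - k) (b + k) = 0" for a b
      by (rule exI[of _ "\<bar>b\<bar> + 1"], auto simp: prod_zw_def prod_wz_def h)+
    then show ?thesis unfolding bd_def by simp
  qed
  have "c_RLL M Lf s s' \<longleftrightarrow> (\<forall>i\<in>{1..M}. \<forall>m\<in>{1..M}. \<forall>j\<in>{1..M}. \<forall>l\<in>{1..M::nat}. \<forall>r t.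
    (\<Sum>a=1..M. \<Sum>b=1..M. rm C ZW (sg s' - sg s) (Rmat qL i a m b) (prod_zw (hs s (Lf s a j)) (hs s' (Lf s' b l))) r t)
    = (\<Sum>a=1..M. \<Sum>b=1..M. rm C ZW (sg s - sg s') (Rmat qL a j b l) (prod_wz (hs s' (Lf s' m b)) (hs s (Lf s i a))) r t))"
    unfolding c_RLL_def
  proof (intro ball_cong refl)
    fix i m j l assume "i \<in> {1..M}" "m \<in> {1..M}" "j \<in> {1..M}" "l \<in> {1..M}"
    from RLL_form[OF _ _ this(1,3,2,4), of ZW "\<lambda>a b. prod_zw (hs s (Lf s a j)) (hs s' (Lf s' b l))"
        "\<lambda>a b. prod_wz (hs s' (Lf s' m b)) (hs s (Lf s i a))" "sg s' - sg s" "sg s - sg s'"] b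
    show "(\<forall>a b. lin qi (- qv) (C (sg s - sg s')) (\<lambda>a b. lin (r1 i m) (r0 i m) (C (sg s' - sg s)) (prod_zw (hs s (Lf s i j)) (hs s' (Lf s' m l))) a b
    + lin (o1 i m) (o0 i m) (C (sg s' - sg s)) (prod_zw (hs s (Lf s m j)) (hs s' (Lf s' i l))) a b) a b
  = lin qi (- qv) (C (sg s' - sg s)) (\<lambda>a b. lin (r1 j l) (r0 j l) (C (sg s - sg s')) (prod_wz (hs s' (Lf s' m l)) (hs s (Lf s i j))) a b
    + lin (o1 l j) (o0 l j) (C (sg s - sg s')) (prod_wz (hs s' (Lf s' m j)) (hs s (Lf s i l))) a b) a b) \<longleftrightarrow>
      (\<forall>r t. (\<Sum>a=1..M. \<Sum>b=1..M. rm C ZW (sg s' - sg s) (Rmat qL i a m b) (prod_zw (hs s (Lf s a j)) (hs s' (Lf s' b l))) r t)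
    = (\<Sum>a=1..M. \<Sum>b=1..M. rm C ZW (sg s - sg s') (Rmat qL a j b l) (prod_wz (hs s' (Lf s' m b)) (hs s (Lf s i a))) r t))"
      by simp
  qed
  also have "\<dots> \<longleftrightarrow> d_RLL M Lf s s'" unfolding d_RLL_def by blast
  finally show ?thesis .
qed

section \<open>The relations in the form in which the presentation states them\<close>

definition "d_KE s \<longleftrightarrow> (\<forall>i\<in>{1..N}. \<forall>j\<in>{1..N}. \<forall>b\<in>{1..N}. \<forall>r t. prod_zw (Ks s i j) (Ec b) r t =
  (\<Sum>a=1..N. \<Sum>d=1..N. rm C (dir s) (- sg s) (\<lambda>x. (x * inverse qL - qL) / (x - 1) * Rmat qL i a d b x) (prod_wz (Ec d) (Ks s a j)) r t))"
definition "d_KF s \<longleftrightarrow> (\<forall>i\<in>{1..N}. \<forall>j\<in>{1..N}. \<forall>k\<in>{1..N}. \<forall>r t.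
  (\<Sum>a=1..N. \<Sum>d=1..N. rm C (dir s) (sg s) (Rmat qL a j k d) (prod_zw (Ks s i a) (Fc d)) r t)
  = rm C (dir s) (sg s) (\<lambda>x. (x - 1) / (x * inverse qL - qL)) (prod_wz (Fc k) (Ks s i j)) r t)"
definition "d_kE s \<longleftrightarrow> (\<forall>a\<in>{1..N}. \<forall>r t. prod_zw (ks s) (Ec a) r t =
  rm C (dir s) (- sg s) (\<lambda>x. (x * qL - inverse qL) / (x - 1)) (prod_wz (Ec a) (ks s)) r t)"
definition "d_kF s \<longleftrightarrow> (\<forall>a\<in>{1..N}. \<forall>r t. prod_zw (ks s) (Fc a) r t =
  rm C (dir s) (sg s) (\<lambda>x. (x - 1) / (x * qL - inverse qL)) (prod_wz (Fc a) (ks s)) r t)"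
definition "d_Kk s \<longleftrightarrow> (\<forall>i\<in>{1..N}. \<forall>j\<in>{1..N}. \<forall>r t. prod_zw (Ks s i j) (ks s) r t = prod_wz (ks s) (Ks s i j) r t)"
definition "d_Kk' s \<longleftrightarrow> (\<forall>i\<in>{1..N}. \<forall>j\<in>{1..N}. \<forall>r t.
  rm C (dir s) (- 2 * sg s) (\<lambda>x. (x * inverse qL - qL) / (x - 1)) (prod_wz (ks (opp s)) (Ks s i j)) r t =
  rm C (dir s) (2 * sg s) (\<lambda>x. (x * inverse qL - qL) / (x - 1)) (prod_zw (Ks s i j) (ks (opp s))) r t)"
definition "d_EE \<longleftrightarrow> (\<forall>a\<in>{1..N}. \<forall>b\<in>{1..N}. \<forall>r t.
  (\<Sum>c=1..N. \<Sum>d=1..N. rm C ZW 0 (\<lambda>x. (x - qL ^ 2) * Rmat qL c a d b x) (prod_zw (Ec c) (Ec d)) r t)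
  = rm C ZW 0 (\<lambda>x. x * qL ^ 2 - 1) (prod_wz (Ec b) (Ec a)) r t)"
definition "d_FF \<longleftrightarrow> (\<forall>a\<in>{1..N}. \<forall>b\<in>{1..N}. \<forall>r t.
  rm C ZW 0 (\<lambda>x. x * qL ^ 2 - 1) (prod_zw (Fc a) (Fc b)) r t
  = (\<Sum>c=1..N. \<Sum>d=1..N. rm C ZW 0 (\<lambda>x. (x - qL ^ 2) * Rmat qL a c b d x) (prod_wz (Fc d) (Fc c)) r t))"
definition "d_EF \<longleftrightarrow> (\<forall>a\<in>{1..N}. \<forall>b\<in>{1..N}. \<forall>r t. prod_zw (Ec b) (Fc a) r t - prod_wz (Fc a) (Ec b) r t =
  sc (qv - inverse qv) * (C (2 * 1 * (- r)) * C (1 * (r + t)) * hs Minus (kKi Minus a b) (r + t)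
    - C (2 * (- 1) * (- r)) * C (- 1 * (r + t)) * hs Plus (kKi Plus a b) (r + t)))"

lemma d_KE_form: "c_KE s \<longleftrightarrow> d_KE s"
  unfolding c_KE_def d_KE_def
proof (intro ball_cong refl)
  fix i j b assume "i \<in> {1..N}" "j \<in> {1..N}" "b \<in> {1..N}"
  then show "(\<forall>r t. lin 1 (- 1) (C (- sg s)) (prod_zw (Ks s i j) (Ec b)) r t = lin (r1 i b) (r0 i b) (C (- sg s)) (prod_wz (Ec b) (Ks s i j)) r t
    + (if i = b then \<Sum>c=1..N. lin (o1 i c) (o0 i c) (C (- sg s)) (prod_wz (Ec c) (Ks s c j)) r t else 0)) \<longleftrightarrow>
    (\<forall>r t. prod_zw (Ks s i j) (Ec b) r t =
    (\<Sum>a=1..N. \<Sum>d=1..N. rm C (dir s) (- sg s) (\<lambda>x. (x * inverse qL - qL) / (x - 1) * Rmat qL i a d b x) (prod_wz (Ec d) (Ks s a j)) r t))"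
    by (intro KE_form[where T = "\<lambda>a d. prod_wz (Ec d) (Ks s a j)", symmetric] bd_prod)
qed

lemma d_KF_form: "c_KF s \<longleftrightarrow> d_KF s"
  unfolding c_KF_def d_KF_def
proof (intro ball_cong refl)
  fix i j l assume "i \<in> {1..N}" "j \<in> {1..N}" "l \<in> {1..N}"
  then show "(\<forall>r t. lin (r1 j l) (r0 j l) (C (sg s)) (prod_zw (Ks s i j) (Fc l)) r t
    + (if j = l then \<Sum>c=1..N. lin (o1 c j) (o0 c j) (C (sg s)) (prod_zw (Ks s i c) (Fc c)) r t else 0)
  = lin 1 (- 1) (C (sg s)) (prod_wz (Fc l) (Ks s i j)) r t) \<longleftrightarrow> (\<forall>r t.
  (\<Sum>a=1..N. \<Sum>d=1..N. rm C (dir s) (sg s) (Rmat qL a j l d) (prod_zw (Ks s i a) (Fc d)) r t)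
  = rm C (dir s) (sg s) (\<lambda>x. (x - 1) / (x * inverse qL - qL)) (prod_wz (Fc l) (Ks s i j)) r t)"
    by (intro KF_form[where S = "\<lambda>a d. prod_zw (Ks s i a) (Fc d)", symmetric] bd_prod)
qed

lemma d_kE_form: "c_kE s \<longleftrightarrow> d_kE s"
  unfolding c_kE_def d_kE_def by (intro ball_cong refl kE_form[symmetric] bd_prod)
lemma d_kF_form: "c_kF s \<longleftrightarrow> d_kF s"
  unfolding c_kF_def d_kF_def by (intro ball_cong refl kF_form[symmetric] bd_prod)

lemma d_Kk'_form: "c_Kk s (opp s) \<longleftrightarrow> d_Kk' s"
proof -
  have s: "sg s - sg (opp s) = 2 * sg s" "sg (opp s) - sg s = - 2 * sg s" by (cases s; simp)+
  show ?thesis unfolding c_Kk_def d_Kk'_def s by (intro ball_cong refl Kk_form[symmetric] bd_prod)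
qed

lemma d_Kk_form: "(\<forall>s s'. c_Kk s s') \<longleftrightarrow> (\<forall>s. d_Kk s) \<and> (\<forall>s. d_Kk' s)"
  unfolding d_Kk_def c_Kk_same[symmetric] d_Kk'_form[symmetric] by (auto simp: all_signs)

lemma d_EE_form: "c_EE \<longleftrightarrow> d_EE"
  unfolding c_EE_def d_EE_def by (intro ball_cong refl EE_form[where S = "\<lambda>c d. prod_zw (Ec c) (Ec d)", symmetric])
lemma d_FF_form: "c_FF \<longleftrightarrow> d_FF"
  unfolding c_FF_def d_FF_def by (intro ball_cong refl FF_form[where T = "\<lambda>c d. prod_wz (Fc d) (Fc c)", symmetric])

lemma d_EF_form: "c_EF \<longleftrightarrow> d_EF"
proof -
  have "sc (qv - inverse qv) * (C (2 * 1 * (- r)) * C (1 * (r + t)) * u - C (2 * (- 1) * (- r)) * C (- 1 * (r + t)) * v)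
    = sc dq * (C (r - t) * v - C (t - r) * u)" for r t and u v :: 'a
  proof -
    have "C (2 * 1 * (- r)) * C (1 * (r + t)) = C (t - r)" "C (2 * (- 1) * (- r)) * C (- 1 * (r + t)) = C (r - t)"
      by (simp_all flip: C_add)
    moreover have "sc (qv - inverse qv) = - (sc dq :: 'a)" by (simp flip: sc_uminus)
    ultimately show ?thesis by (simp add: right_diff_distrib)
  qed
  then show ?thesis unfolding c_EF_def d_EF_def by auto
qed

definition "d_kk s s' \<longleftrightarrow> (\<forall>r t. prod_zw (ks s) (ks s') r t = prod_wz (ks s') (ks s) r t)"

theorem gauss_relations:
  "(\<forall>s. d_RLL (Suc N) L s s) \<and> d_RLL (Suc N) L Plus Minus \<longleftrightarrow>
   (\<forall>s. d_RLL N K s s) \<and> d_RLL N K Plus Minus \<and> (\<forall>s. d_kk s s) \<and> d_kk Plus Minus \<and> (\<forall>s. d_Kk s) \<and> (\<forall>s. d_Kk' s)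
   \<and> (\<forall>s. d_KE s) \<and> (\<forall>s. d_KF s) \<and> (\<forall>s. d_kE s) \<and> (\<forall>s. d_kF s) \<and> d_EE \<and> d_FF \<and> d_EF"
proof -
  have d: "c_RLL M Lf s s \<longleftrightarrow> d_RLL M Lf s s" "c_RLL M Lf Plus Minus \<longleftrightarrow> d_RLL M Lf Plus Minus" for M Lf s
    by (cases s; simp add: c_RLL_form)+
  show ?thesis
    using c_RLL_gauss unfolding d d_Kk_form d_KE_form d_KF_form d_kE_form d_kF_form d_EE_form d_FF_form d_EF_form d_kk_def[folded c_kk_def]
    by (simp add: conj_assoc all_conj_distrib)
qed

end

section \<open>Presented algebras as types\<close>

text \<open>The homomorphism from the free algebra that extends \<open>\<phi>\<close>.\<close>

definition ev :: "('g \<Rightarrow> 'b::cqalg) \<Rightarrow> 'g falg \<Rightarrow> 'b" where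
  "ev \<phi> p = (\<Sum>w\<in>Poly_Mapping.keys p. sc (Poly_Mapping.lookup p w) * prod_list (map \<phi> (letters w)))"

lemma ev_superset:
  assumes "finite A" "Poly_Mapping.keys p \<subseteq> A"
  shows "ev \<phi> p = (\<Sum>w\<in>A. sc (Poly_Mapping.lookup p w) * prod_list (map \<phi> (letters w)))"
  unfolding ev_def by (rule sum.mono_neutral_left) (use assms in \<open>auto simp: in_keys_iff\<close>)

lemma ev_add: "ev \<phi> (p + q) = ev \<phi> p + ev \<phi> q"
proof -
  let ?A = "Poly_Mapping.keys p \<union> Poly_Mapping.keys q"
  have "ev \<phi> (p + q) = (\<Sum>w\<in>?A. sc (Poly_Mapping.lookup (p + q) w) * prod_list (map \<phi> (letters w)))"
    by (rule ev_superset) (simp_all add: Poly_Mapping.keys_add)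
  also have "\<dots> = ev \<phi> p + ev \<phi> q"
    using ev_superset[of ?A p \<phi>] ev_superset[of ?A q \<phi>] by (simp add: lookup_add sc_add distrib_right sum.distrib)
  finally show ?thesis .
qed

lemma ev_zero [simp]: "ev \<phi> 0 = 0" by (simp add: ev_def)
lemma ev_uminus: "ev \<phi> (- p) = - ev \<phi> p"
  using ev_add[of \<phi> p "- p"] by (simp add: eq_neg_iff_add_eq_0 add.commute)
lemma ev_diff: "ev \<phi> (p - q) = ev \<phi> p - ev \<phi> q"
  using ev_add[of \<phi> p "- q"] by (simp add: ev_uminus)
lemma ev_sum: "ev \<phi> (sum g A) = (\<Sum>i\<in>A. ev \<phi> (g i))"
  by (induction A rule: infinite_finite_induct) (simp_all add: ev_add)

lemma ev_single: "ev \<phi> (Poly_Mapping.single w c) = sc c * prod_list (map \<phi> (letters w))"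
  by (cases "c = 0") (simp_all add: ev_def)

lemma falg_expand: "p = (\<Sum>w\<in>Poly_Mapping.keys p. Poly_Mapping.single w (Poly_Mapping.lookup p w))"
proof (rule poly_mapping_eqI)
  fix v
  have "(\<Sum>w\<in>Poly_Mapping.keys p. Poly_Mapping.lookup (Poly_Mapping.single w (Poly_Mapping.lookup p w)) v)
    = (\<Sum>w\<in>Poly_Mapping.keys p. if w = v then Poly_Mapping.lookup p v else 0)"
    by (intro sum.cong refl) (simp add: lookup_single when_def)
  then show "Poly_Mapping.lookup p v = Poly_Mapping.lookup (\<Sum>w\<in>Poly_Mapping.keys p. Poly_Mapping.single w (Poly_Mapping.lookup p w)) v"
    by (simp add: lookup_sum in_keys_iff)
qed

lemma ev_mult: "ev \<phi> (p * q) = ev \<phi> p * ev \<phi> q"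
proof -
  have s: "ev \<phi> (Poly_Mapping.single u a * Poly_Mapping.single v b) = ev \<phi> (Poly_Mapping.single u a) * ev \<phi> (Poly_Mapping.single v b)" for u v a b
    by (simp add: mult_single ev_single plus_fword_def sc_mult cen_ac cen_sc)
      (metis mult.assoc sc_central)
  have e: "ev \<phi> r = (\<Sum>w\<in>Poly_Mapping.keys r. ev \<phi> (Poly_Mapping.single w (Poly_Mapping.lookup r w)))" for r
    unfolding ev_single by (simp only: ev_def)
  have "p * q = (\<Sum>u\<in>Poly_Mapping.keys p. Poly_Mapping.single u (Poly_Mapping.lookup p u)) * (\<Sum>v\<in>Poly_Mapping.keys q. Poly_Mapping.single v (Poly_Mapping.lookup q v))"
    by (rule arg_cong2[where f = "(*)", OF falg_expand falg_expand])
  then have "ev \<phi> (p * q) = (\<Sum>u\<in>Poly_Mapping.keys p. \<Sum>v\<in>Poly_Mapping.keys q.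
    ev \<phi> (Poly_Mapping.single u (Poly_Mapping.lookup p u)) * ev \<phi> (Poly_Mapping.single v (Poly_Mapping.lookup q v)))"
    by (simp only: sum_product ev_sum s)
  also have "\<dots> = ev \<phi> p * ev \<phi> q" unfolding e[of p] e[of q] sum_product ..
  finally show ?thesis .
qed

lemma ev_one: "ev \<phi> 1 = 1"
  using ev_single[of \<phi> 0 1] by (simp add: sc_one zero_fword_def del: single_one) (simp add: zero_fword_def[symmetric])
lemma ev_scal: "ev \<phi> (scal c) = sc c" by (simp add: scal_def ev_single zero_fword_def)
lemma ev_gen: "ev \<phi> (gen g) = \<phi> g" by (simp add: gen_def ev_single sc_one)
lemma scal_add: "scal (x + y) = scal x + scal y" by (simp add: scal_def single_add)
lemma scal_mult: "scal (x * y) = scal x * scal y" by (simp add: scal_def mult_single)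
lemma ev_power: "ev \<phi> (p ^ m) = ev \<phi> p ^ m" by (induction m) (simp_all add: ev_one ev_mult)

lemma ev_cong: "Poly_Mapping.keys p \<subseteq> FWord ` lists X \<Longrightarrow> (\<And>g. g \<in> X \<Longrightarrow> \<phi> g = \<psi> g) \<Longrightarrow> ev \<phi> p = ev \<psi> p"
  unfolding ev_def by (intro sum.cong refl arg_cong2[where f = "(*)"] arg_cong[where f = prod_list] map_cong) (auto dest!: subsetD)

definition ahom :: "('a::cqalg \<Rightarrow> 'b::cqalg) \<Rightarrow> bool" where
  "ahom H \<longleftrightarrow> (\<forall>x y. H (x + y) = H x + H y) \<and> (\<forall>x y. H (x * y) = H x * H y) \<and> (\<forall>c. H (sc c) = sc c)"

lemma ahom_simps:
  assumes "ahom H"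
  shows "H (x + y) = H x + H y" "H (x * y) = H x * H y" "H (sc c) = sc c" "H 1 = 1" "H 0 = 0" "H (- x) = - H x" "H (x - y) = H x - H y"
    "H (sum g A) = (\<Sum>i\<in>A. H (g i))" "H (prod_list xs) = prod_list (map H xs)"
proof -
  show a: "H (x + y) = H x + H y" "H (x * y) = H x * H y" and c: "H (sc c) = sc c" for x y c using assms by (auto simp: ahom_def)
  show o: "H 1 = 1" "H 0 = 0" using c[of 1] c[of 0] by (simp_all add: sc_one)
  show m: "H (- x) = - H x" for x using a(1)[of x "- x"] by (simp add: o eq_neg_iff_add_eq_0 add.commute)
  show "H (x - y) = H x - H y" using a(1)[of x "- y"] by (simp add: m)
  show "H (sum g A) = (\<Sum>i\<in>A. H (g i))" by (induction A rule: infinite_finite_induct) (simp_all add: a o)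
  show "H (prod_list xs) = prod_list (map H xs)" by (induction xs) (simp_all add: a o)
qed

lemma ahom_ev: "ahom H \<Longrightarrow> H (ev \<phi> p) = ev (\<lambda>g. H (\<phi> g)) p"
  by (simp add: ev_def ahom_simps comp_def)

section \<open>Ideals of relations in free algebras\<close>

abbreviation fcar :: "'g set \<Rightarrow> 'g falg set" where "fcar X \<equiv> carrier (free_algebra X)"

lemma fcar_closed:
  "p \<in> fcar X \<Longrightarrow> q \<in> fcar X \<Longrightarrow> p + q \<in> fcar X" "p \<in> fcar X \<Longrightarrow> q \<in> fcar X \<Longrightarrow> p * q \<in> fcar X"
  "p \<in> fcar X \<Longrightarrow> - p \<in> fcar X" "p \<in> fcar X \<Longrightarrow> q \<in> fcar X \<Longrightarrow> p - q \<in> fcar X" "0 \<in> fcar X" "1 \<in> fcar X" "scal c \<in> fcar X"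
  "(\<And>i. i \<in> A \<Longrightarrow> h i \<in> fcar X) \<Longrightarrow> sum h A \<in> fcar X"
proof -
  show a: "p + q \<in> fcar X" if "p \<in> fcar X" "q \<in> fcar X" for p q
    using that Poly_Mapping.keys_add[of p q] by (auto simp: free_algebra_def)
  show "p * q \<in> fcar X" if pq: "p \<in> fcar X" "q \<in> fcar X"
  proof -
    have "w \<in> FWord ` lists X" if w: "w \<in> Poly_Mapping.keys (p * q)" for w
    proof -
      obtain u v where "w = u + v" "u \<in> Poly_Mapping.keys p" "v \<in> Poly_Mapping.keys q" using w keys_mult[of p q] by blast
      then obtain us vs where "us \<in> lists X" "vs \<in> lists X" "w = FWord us + FWord vs"
        using pq by (fastforce simp: free_algebra_def)
      then show ?thesis by (intro image_eqI[of _ _ "us @ vs"]) (simp_all add: plus_fword_def)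
    qed
    then show ?thesis by (auto simp: free_algebra_def)
  qed
  show m: "- p \<in> fcar X" if "p \<in> fcar X" for p using that by (simp add: free_algebra_def)
  show "p - q \<in> fcar X" if "p \<in> fcar X" "q \<in> fcar X" using a[OF that(1) m[OF that(2)]] by simp
  show z: "0 \<in> fcar X" by (simp add: free_algebra_def)
  show c: "scal c \<in> fcar X" for c by (auto simp: free_algebra_def scal_def zero_fword_def)
  show "1 \<in> fcar X" using c[of 1] by (simp add: scal_def)
  show "sum h A \<in> fcar X" if "\<And>i. i \<in> A \<Longrightarrow> h i \<in> fcar X"
    using that by (induction A rule: infinite_finite_induct) (simp_all add: a z)
qed

lemma gen_fcar: "g \<in> X \<Longrightarrow> gen g \<in> fcar X" by (simp add: free_algebra_def gen_def)

lemma free_algebra_simps: "x \<oplus>\<^bsub>free_algebra X\<^esub> y = x + y" "x \<otimes>\<^bsub>free_algebra X\<^esub> y = x * y" "\<zero>\<^bsub>free_algebra X\<^esub> = 0" "\<one>\<^bsub>free_algebra X\<^esub> = 1"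
  by (simp_all add: free_algebra_def)

lemma ring_free_algebra: "ring (free_algebra X)"
proof (intro ringI abelian_groupI monoid.intro)
  show "\<exists>y\<in>fcar X. y \<oplus>\<^bsub>free_algebra X\<^esub> x = \<zero>\<^bsub>free_algebra X\<^esub>" if "x \<in> fcar X" for x
    using fcar_closed(3)[OF that] by (intro bexI[of _ "- x"]) (simp_all add: free_algebra_simps)
qed (simp_all add: free_algebra_simps fcar_closed algebra_simps)

lemma ideal_kernel:
  fixes \<phi> :: "'g \<Rightarrow> 'b::cqalg"
  shows "ideal {p \<in> fcar X. ev \<phi> p = 0} (free_algebra X)"
proof (intro idealI ring_free_algebra)
  interpret ring "free_algebra X" by (rule ring_free_algebra)
  have "inv\<^bsub>add_monoid (free_algebra X)\<^esub> p = - p" if "p \<in> fcar X" for p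
    using minus_equality[of "- p" p] that by (simp add: a_inv_def free_algebra_simps fcar_closed)
  then show "subgroup {p \<in> fcar X. ev \<phi> p = 0} (add_monoid (free_algebra X))"
    by (intro group.subgroupI a_group) (auto simp: free_algebra_simps fcar_closed ev_add ev_uminus intro!: exI[of _ 0])
qed (auto simp: free_algebra_simps fcar_closed ev_mult)

definition rel_ideal :: "'g set \<Rightarrow> ('g falg \<times> 'g falg) set \<Rightarrow> 'g falg set" where
  "rel_ideal X E = Idl\<^bsub>free_algebra X\<^esub> {u - v |u v. (u, v) \<in> E}"

definition sat :: "('g \<Rightarrow> 'b::cqalg) \<Rightarrow> ('g falg \<times> 'g falg) set \<Rightarrow> bool" where
  "sat \<phi> E \<longleftrightarrow> (\<forall>u v. (u, v) \<in> E \<longrightarrow> ev \<phi> u = ev \<phi> v)"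

lemma ev_rel_ideal:
  assumes "sat \<phi> E" "E \<subseteq> fcar X \<times> fcar X" "p \<in> rel_ideal X E"
  shows "ev \<phi> p = 0"
proof -
  have "rel_ideal X E \<subseteq> {p \<in> fcar X. ev \<phi> p = 0}"
    unfolding rel_ideal_def
    by (rule ring.genideal_minimal[OF ring_free_algebra ideal_kernel]) (use assms in \<open>auto simp: sat_def ev_diff intro!: fcar_closed\<close>)
  then show ?thesis using assms(3) by blast
qed

context
  fixes X :: "'g set" and E :: "('g falg \<times> 'g falg) set"
  assumes E: "E \<subseteq> fcar X \<times> fcar X"
begin

lemma ideal_rel_ideal: "ideal (rel_ideal X E) (free_algebra X)"
  unfolding rel_ideal_def by (rule ring.genideal_ideal[OF ring_free_algebra]) (use E in \<open>auto intro!: fcar_closed\<close>)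

lemma rel_ideal_closed:
  "p \<in> rel_ideal X E \<Longrightarrow> p \<in> fcar X" "0 \<in> rel_ideal X E" "p \<in> rel_ideal X E \<Longrightarrow> q \<in> rel_ideal X E \<Longrightarrow> p + q \<in> rel_ideal X E"
  "p \<in> rel_ideal X E \<Longrightarrow> - p \<in> rel_ideal X E" "p \<in> rel_ideal X E \<Longrightarrow> q \<in> fcar X \<Longrightarrow> p * q \<in> rel_ideal X E"
  "p \<in> rel_ideal X E \<Longrightarrow> q \<in> fcar X \<Longrightarrow> q * p \<in> rel_ideal X E"
proof -
  interpret ideal "rel_ideal X E" "free_algebra X" by (rule ideal_rel_ideal)
  show c: "p \<in> rel_ideal X E \<Longrightarrow> p \<in> fcar X" for p by (rule a_Hcarr)
  show "0 \<in> rel_ideal X E" using additive_subgroup.zero_closed[OF is_additive_subgroup] by (simp add: free_algebra_simps)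
  show "p \<in> rel_ideal X E \<Longrightarrow> q \<in> rel_ideal X E \<Longrightarrow> p + q \<in> rel_ideal X E"
    using additive_subgroup.a_closed[OF is_additive_subgroup] by (simp add: free_algebra_simps)
  show m: "p \<in> rel_ideal X E \<Longrightarrow> q \<in> fcar X \<Longrightarrow> p * q \<in> rel_ideal X E" for q using I_r_closed by (simp add: free_algebra_simps)
  show "p \<in> rel_ideal X E \<Longrightarrow> q \<in> fcar X \<Longrightarrow> q * p \<in> rel_ideal X E" using I_l_closed by (simp add: free_algebra_simps)
  show "p \<in> rel_ideal X E \<Longrightarrow> - p \<in> rel_ideal X E" using m[OF _ fcar_closed(3)[OF fcar_closed(6)]] by simp
qed

lemma rel_ideal_rel: "(u, v) \<in> E \<Longrightarrow> u - v \<in> rel_ideal X E"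
  unfolding rel_ideal_def by (rule subsetD[OF ring.genideal_self[OF ring_free_algebra]]) (use E in \<open>auto intro!: fcar_closed\<close>)

lemma coset_rel_ideal:
  assumes "p \<in> fcar X"
  shows "rel_ideal X E +>\<^bsub>free_algebra X\<^esub> p = {q \<in> fcar X. q - p \<in> rel_ideal X E}"
proof -
  have "q \<in> fcar X \<and> q - p \<in> rel_ideal X E \<longleftrightarrow> (\<exists>h\<in>rel_ideal X E. q = h + p)" for q
    using rel_ideal_closed(1) fcar_closed(1)[OF _ assms] by (auto simp: eq_diff_eq[symmetric] intro: fcar_closed)
      (metis diff_add_cancel)
  then show ?thesis by (auto simp: a_r_coset_def' free_algebra_simps)
qed

end

text \<open>Attaches one presentation to the type of its generators, so that the quotient can be a
  type. \<open>ring_1\<close> contains \<open>0 \<noteq> 1\<close>; this is the reason for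
  \<open>one_notin\<close>.\<close>

class pres =
  fixes gens :: "'a set" and prels :: "('a falg \<times> 'a falg) set"
  assumes prels_carrier: "prels \<subseteq> fcar gens \<times> fcar gens" and one_notin: "1 \<notin> rel_ideal gens prels"

text \<open>A partial equivalence, since only elements of the free algebra on \<open>gens\<close>
  represent classes.\<close>

definition peq :: "'g::pres falg \<Rightarrow> 'g falg \<Rightarrow> bool" where
  "peq p q \<longleftrightarrow> p \<in> fcar gens \<and> q \<in> fcar gens \<and> p - q \<in> rel_ideal gens prels"

lemmas pI_closed = rel_ideal_closed[OF prels_carrier]

lemma part_equivp_peq: "part_equivp (peq :: 'g::pres falg \<Rightarrow> _)"
proof (rule part_equivpI)
  show "\<exists>x. peq x (x :: 'g falg)" by (rule exI[of _ 0]) (simp add: peq_def fcar_closed pI_closed)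
  show "symp (peq :: 'g falg \<Rightarrow> _)"
  proof (rule sympI)
    fix p q :: "'g falg" assume "peq p q" then show "peq q p" using pI_closed(4)[of "p - q"] by (simp add: peq_def)
  qed
  show "transp (peq :: 'g falg \<Rightarrow> _)"
  proof (rule transpI)
    fix p q r :: "'g falg" assume "peq p q" "peq q r" then show "peq p r" using pI_closed(3)[of "p - q" "q - r"] by (simp add: peq_def)
  qed
qed

quotient_type (overloaded) 'g palg = "'g::pres falg" / partial: peq
  by (rule part_equivp_peq)

instantiation palg :: (pres) cqalg
begin

lift_definition zero_palg :: "'a palg" is 0 by (simp add: peq_def fcar_closed pI_closed)
lift_definition one_palg :: "'a palg" is 1 by (simp add: peq_def fcar_closed pI_closed)
lift_definition sc_palg :: "Cq \<Rightarrow> 'a palg" is scal by (simp add: peq_def fcar_closed pI_closed)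
lift_definition plus_palg :: "'a palg \<Rightarrow> 'a palg \<Rightarrow> 'a palg" is "(+)"
  using pI_closed(3) by (auto simp: peq_def fcar_closed add_diff_add)
lift_definition uminus_palg :: "'a palg \<Rightarrow> 'a palg" is uminus
  using pI_closed(4) by (fastforce simp: peq_def fcar_closed)
lift_definition minus_palg :: "'a palg \<Rightarrow> 'a palg \<Rightarrow> 'a palg" is "(-)"
proof -
  fix p p' q q' :: "'a falg" assume "peq p p'" "peq q q'"
  then show "peq (p - q) (p' - q')" using pI_closed(3)[OF _ pI_closed(4), of "p - p'" "q - q'"] by (simp add: peq_def fcar_closed algebra_simps)
qed
lift_definition times_palg :: "'a palg \<Rightarrow> 'a palg \<Rightarrow> 'a palg" is "(*)"
proof -
  fix p p' q q' :: "'a falg" assume a: "peq p p'" "peq q q'"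
  have "p * q - p' * q' = (p - p') * q + p' * (q - q')" by (simp add: algebra_simps)
  then show "peq (p * q) (p' * q')" using a unfolding peq_def by (simp add: fcar_closed pI_closed(3)[OF pI_closed(5) pI_closed(6)])
qed

instance
proof
  fix a b c :: "'a palg" and x y :: Cq
  have r: "peq (p :: 'a falg) p" if "p \<in> fcar gens" for p using that by (simp add: peq_def pI_closed)
  note rr = r fcar_closed peq_def
  show "a + b + c = a + (b + c)" by transfer (simp add: rr add.assoc pI_closed)
  show "a + b = b + a" by transfer (simp add: rr add.commute pI_closed)
  show "0 + a = a" by transfer (simp add: rr pI_closed)
  show "- a + a = 0" by transfer (simp add: rr pI_closed)
  show "a - b = a + - b" by transfer (simp add: rr pI_closed)
  show "a * b * c = a * (b * c)" by transfer (simp add: rr mult.assoc pI_closed)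
  show "1 * a = a" by transfer (simp add: rr pI_closed)
  show "a * 1 = a" by transfer (simp add: rr pI_closed)
  show "(a + b) * c = a * c + b * c" by transfer (simp add: rr distrib_right pI_closed)
  show "a * (b + c) = a * b + a * c" by transfer (simp add: rr distrib_left pI_closed)
  show "0 \<noteq> (1 :: 'a palg)"
  proof
    assume "0 = (1 :: 'a palg)"
    then have "1 = (0 :: 'a palg)" by simp
    then show False by transfer (simp add: peq_def one_notin)
  qed
  show "sc (x + y) = (sc x + sc y :: 'a palg)" by transfer (simp add: rr scal_add pI_closed)
  show "sc (x * y) = (sc x * sc y :: 'a palg)" by transfer (simp add: rr scal_mult pI_closed)
  show "sc 1 = (1 :: 'a palg)" by transfer (simp add: rr scal_def pI_closed)
  show "sc x * a = a * sc x"
  proof transfer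
    fix x and p :: "'a falg" assume "peq p p"
    have "scal x * p = p * scal x"
    proof -
      have "scal x * Poly_Mapping.single w d = Poly_Mapping.single w d * scal x" for w :: "'a fword" and d
        by (simp add: scal_def mult_single mult.commute)
      then show ?thesis by (subst (1 2) falg_expand[of p]) (simp add: sum_distrib_left sum_distrib_right)
    qed
    then show "peq (scal x * p) (p * scal x)" using \<open>peq p p\<close> by (simp add: peq_def fcar_closed pI_closed)
  qed
qed

end

definition cls :: "'g::pres falg \<Rightarrow> 'g palg" where "cls = abs_palg"

lemma cls_eq_iff: "p \<in> fcar gens \<Longrightarrow> q \<in> fcar gens \<Longrightarrow> cls p = cls q \<longleftrightarrow> p - q \<in> rel_ideal gens prels"
  using Quotient_rel_abs2[OF Quotient_palg] Quotient_rel[OF Quotient_palg, of p q] by (auto simp: cls_def peq_def pI_closed)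

lemma cls_surj: obtains p where "p \<in> fcar gens" "x = cls p"
  using Quotient_abs_rep[OF Quotient_palg, of x] Quotient_rep_reflp[OF Quotient_palg, of x] unfolding cls_def peq_def by metis

lemma cls_simps:
  assumes "p \<in> fcar gens" "q \<in> fcar gens"
  shows "cls (p + q) = cls p + cls q" "cls (p * q) = cls p * cls q"
  using plus_palg.abs_eq[of p q] times_palg.abs_eq[of p q] assms by (simp_all add: cls_def peq_def pI_closed)
lemma cls_scal: "cls (scal c) = sc c" "cls 1 = 1" "cls 0 = 0"
  by (simp_all add: cls_def sc_palg_def one_palg_def zero_palg_def map_fun_def)

definition cl :: "'g::pres \<Rightarrow> 'g palg" where "cl g = cls (gen g)"

text \<open>Turns membership of a relation in the ideal into an equation between values at
  \<open>cl\<close>; in this way the defining relations become available in the quotient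
  (\<open>sat_cl\<close>). It is proved on words first.\<close>

lemma ev_cl:
  assumes "p \<in> fcar gens"
  shows "ev cl p = cls p"
proof -
  have w: "cls (Poly_Mapping.single (FWord ws) 1) = prod_list (map cl ws)" if "ws \<in> lists gens" for ws :: "'a list"
    using that
  proof (induction ws)
    case Nil then show ?case using cls_scal(2) by (simp add: zero_fword_def[symmetric])
  next
    case (Cons g ws)
    have "Poly_Mapping.single (FWord (g # ws)) 1 = gen g * Poly_Mapping.single (FWord ws) 1"
      by (simp add: gen_def mult_single plus_fword_def)
    moreover have "Poly_Mapping.single (FWord ws) 1 \<in> fcar gens" using Cons by (simp add: free_algebra_def)
    ultimately show ?case using Cons by (simp add: cls_simps gen_fcar cl_def)
  qed
  have s: "cls (Poly_Mapping.single w c) = ev cl (Poly_Mapping.single w c)" "Poly_Mapping.single w c \<in> fcar gens" if wX: "w \<in> FWord ` lists (gens :: 'a set)" for w c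
  proof -
    obtain ws where ws: "w = FWord ws" "ws \<in> lists gens" using wX by blast
    have "Poly_Mapping.single w c = scal c * Poly_Mapping.single w 1" by (simp add: scal_def mult_single)
    moreover show "Poly_Mapping.single w c \<in> fcar gens" for c using wX by (simp add: free_algebra_def)
    ultimately show "cls (Poly_Mapping.single w c) = ev cl (Poly_Mapping.single w c)"
      using w[OF ws(2)] by (simp add: cls_simps fcar_closed cls_scal ev_mult ev_scal ev_single ws sc_one)
  qed
  have k: "Poly_Mapping.keys p \<subseteq> FWord ` lists gens" using assms by (simp add: free_algebra_def)
  have "cls (\<Sum>w\<in>A. Poly_Mapping.single w (c w)) = (\<Sum>w\<in>A. ev cl (Poly_Mapping.single w (c w)))"
    if "finite A" "A \<subseteq> FWord ` lists (gens :: 'a set)" for A c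
    using that
  proof (induction A)
    case (insert x F)
    have m: "Poly_Mapping.single w (c w) \<in> fcar gens" if "w \<in> insert x F" for w
      using insert.prems s(2) that by blast
    have "Poly_Mapping.single x (c x) \<in> fcar gens" "(\<Sum>w\<in>F. Poly_Mapping.single w (c w)) \<in> fcar gens"
      using m fcar_closed(8)[of F "\<lambda>w. Poly_Mapping.single w (c w)"] by blast+
    then show ?case using insert by (simp add: cls_simps s)
  qed (simp add: cls_scal)
  from this[OF _ k, of "Poly_Mapping.lookup p"] show ?thesis
    by (simp flip: ev_sum falg_expand)
qed

lemma sat_cl: "sat (cl :: 'g::pres \<Rightarrow> _) prels"
  unfolding sat_def
proof (intro allI impI)
  fix u v :: "'g falg" assume uv: "(u, v) \<in> prels"
  then have "u \<in> fcar gens" "v \<in> fcar gens" using prels_carrier by auto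
  then show "ev cl u = ev cl v" using rel_ideal_rel[OF prels_carrier uv] by (simp add: ev_cl cls_eq_iff)
qed

text \<open>Independent of the chosen representative as soon as \<open>\<phi>\<close> satisfies the
  relations (\<open>induced_cls\<close>).\<close>

definition induced :: "('g::pres \<Rightarrow> 'b::cqalg) \<Rightarrow> 'g palg \<Rightarrow> 'b" where
  "induced \<phi> x = ev \<phi> (SOME p. p \<in> fcar gens \<and> cls p = x)"

lemma induced_cls:
  assumes "sat \<phi> prels" "p \<in> fcar gens"
  shows "induced \<phi> (cls p) = ev \<phi> p"
proof -
  define q where "q = (SOME q. q \<in> fcar gens \<and> cls q = cls p)"
  have q: "q \<in> fcar gens" "cls q = cls p" using someI[of "\<lambda>q. q \<in> fcar gens \<and> cls q = cls p" p] assms(2) unfolding q_def by auto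
  then have "q - p \<in> rel_ideal gens prels" using assms(2) by (simp add: cls_eq_iff)
  then have "ev \<phi> (q - p) = 0" by (rule ev_rel_ideal[OF assms(1) prels_carrier])
  then show ?thesis by (simp add: induced_def q_def ev_diff)
qed

lemma ahom_induced:
  assumes "sat \<phi> prels"
  shows "ahom (induced \<phi>)"
  unfolding ahom_def
proof (intro conjI allI)
  fix x y :: "'a palg" and c
  obtain p q where p: "p \<in> fcar gens" "x = cls p" "q \<in> fcar gens" "y = cls q" using cls_surj by metis
  show "induced \<phi> (x + y) = induced \<phi> x + induced \<phi> y" "induced \<phi> (x * y) = induced \<phi> x * induced \<phi> y"
    using p by (simp_all add: cls_simps[symmetric] induced_cls[OF assms] fcar_closed ev_add ev_mult)
  show "induced \<phi> (sc c) = sc c" by (simp add: cls_scal[symmetric] induced_cls[OF assms] fcar_closed ev_scal)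
qed

lemma induced_cl: "sat \<phi> prels \<Longrightarrow> g \<in> gens \<Longrightarrow> induced \<phi> (cl g) = \<phi> g"
  by (simp add: cl_def induced_cls gen_fcar ev_gen)

lemma palg_hom_eqI:
  assumes "ahom G" "ahom H" "\<And>g. g \<in> gens \<Longrightarrow> G (cl g) = H (cl g)"
  shows "G x = H x"
proof -
  obtain p where p: "p \<in> fcar gens" "x = cls p" by (rule cls_surj)
  then have "x = ev cl p" by (simp add: ev_cl)
  then have "G x = ev (\<lambda>g. G (cl g)) p" "H x = ev (\<lambda>g. H (cl g)) p" using assms by (simp_all add: ahom_ev)
  then show ?thesis using ev_cong[of p gens "\<lambda>g. G (cl g)" "\<lambda>g. H (cl g)"] assms(3) p(1) by (simp add: free_algebra_def)
qed

lemma palg_centralI: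
  fixes z :: "'g::pres palg"
  assumes "\<And>g. g \<in> gens \<Longrightarrow> z * cl g = cl g * z"
  shows "cen z"
  unfolding cen_def
proof
  fix y :: "'g palg"
  obtain p where p: "p \<in> fcar gens" "y = cls p" by (rule cls_surj)
  have w: "z * prod_list (map cl ws) = prod_list (map cl ws) * z" if "ws \<in> lists gens" for ws
    using that
  proof (induction ws)
    case (Cons g ws)
    have "z * (cl g * prod_list (map cl ws)) = cl g * (z * prod_list (map cl ws))"
      using assms[of g] Cons.hyps by (simp flip: mult.assoc)
    then show ?case using Cons by (simp add: mult.assoc)
  qed simp
  have "z * ev cl p = ev cl p * z"
    unfolding ev_def sum_distrib_left sum_distrib_right
  proof (intro sum.cong refl)
    fix v assume "v \<in> Poly_Mapping.keys p"
    then have "letters v \<in> lists gens" using p(1) by (auto simp: free_algebra_def dest!: subsetD)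
    then show "z * (sc (Poly_Mapping.lookup p v) * prod_list (map cl (letters v))) = sc (Poly_Mapping.lookup p v) * prod_list (map cl (letters v)) * z"
      using w by (metis mult.assoc sc_central)
  qed
  then show "z * y = y * z" using p by (simp add: ev_cl)
qed

subsection \<open>Comparison with the carrier of a presented algebra\<close>

abbreviation (input) PA where "PA \<equiv> presented_algebra gens prels"

text \<open>The coset of the ideal that corresponds to \<open>x\<close>, the form in which elements
  of \<open>presented_algebra\<close> are given.\<close>

definition fib :: "'g::pres palg \<Rightarrow> 'g falg set" where "fib x = {p \<in> fcar gens. cls p = x}"

lemma fib_cls: "p \<in> fcar gens \<Longrightarrow> fib (cls p) = rel_ideal gens prels +>\<^bsub>free_algebra gens\<^esub> p"
  unfolding coset_rel_ideal[OF prels_carrier] fib_def by (auto simp: cls_eq_iff)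

lemma inj_fib: "inj fib"
proof (rule injI)
  fix x y :: "'a palg" assume a: "fib x = fib y"
  obtain p where "p \<in> fcar gens" "x = cls p" by (rule cls_surj)
  then have "p \<in> fib x" by (simp add: fib_def)
  then show "x = y" unfolding a by (simp add: fib_def \<open>x = cls p\<close>)
qed

lemma presented_algebra_fib:
  fixes x y :: "'g::pres palg"
  shows "carrier (PA :: (Cq, 'g falg set) module) = range fib"
    and "fib x \<oplus>\<^bsub>PA\<^esub> fib y = fib (x + y)" and "fib x \<otimes>\<^bsub>PA\<^esub> fib y = fib (x * y)"
    and "\<one>\<^bsub>PA\<^esub> = fib (1 :: 'g palg)" and "c \<odot>\<^bsub>PA\<^esub> fib x = fib (sc c * x)"
proof -
  interpret I: ideal "rel_ideal gens prels" "free_algebra (gens :: 'g set)" by (rule ideal_rel_ideal[OF prels_carrier])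
  have PA: "carrier PA = carrier (free_algebra (gens :: 'g set) Quot rel_ideal gens prels)"
    "S \<oplus>\<^bsub>PA\<^esub> T = S \<oplus>\<^bsub>free_algebra (gens :: 'g set) Quot rel_ideal gens prels\<^esub> T"
    "S \<otimes>\<^bsub>PA\<^esub> T = S \<otimes>\<^bsub>free_algebra (gens :: 'g set) Quot rel_ideal gens prels\<^esub> T"
    "\<one>\<^bsub>PA\<^esub> = \<one>\<^bsub>free_algebra (gens :: 'g set) Quot rel_ideal gens prels\<^esub>"
    "c \<odot>\<^bsub>PA\<^esub> S = (rel_ideal gens prels +>\<^bsub>free_algebra (gens :: 'g set)\<^esub> scal c) \<otimes>\<^bsub>free_algebra (gens :: 'g set) Quot rel_ideal gens prels\<^esub> S" for S T c
    by (simp_all add: presented_algebra_def rel_ideal_def Let_def)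
  show "carrier (PA :: (Cq, 'g falg set) module) = range fib"
    unfolding PA by (auto simp: FactRing_def A_RCOSETS_def' fib_cls[symmetric] intro: cls_surj)
      (metis cls_surj)
  obtain p q where p: "p \<in> fcar gens" "x = cls p" "q \<in> fcar gens" "y = cls q" using cls_surj by metis
  have m: "(rel_ideal gens prels +>\<^bsub>free_algebra (gens :: 'g set)\<^esub> u) \<otimes>\<^bsub>free_algebra gens Quot rel_ideal gens prels\<^esub> (rel_ideal gens prels +>\<^bsub>free_algebra gens\<^esub> v)
      = fib (cls u * cls v)" if "u \<in> fcar gens" "v \<in> fcar gens" for u v
    using I.rcoset_mult_add[OF that] that by (simp add: FactRing_def free_algebra_simps cls_simps[symmetric] fib_cls fcar_closed)
  show "fib x \<otimes>\<^bsub>PA\<^esub> fib y = fib (x * y)" unfolding PA using p by (simp add: fib_cls m)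
  show "c \<odot>\<^bsub>PA\<^esub> fib x = fib (sc c * x)" unfolding PA using p by (simp add: fib_cls m fcar_closed cls_scal)
  show "fib x \<oplus>\<^bsub>PA\<^esub> fib y = fib (x + y)"
    unfolding PA using I.a_rcos_sum[OF p(1) p(3)] p by (simp add: FactRing_def free_algebra_simps cls_simps[symmetric] fib_cls fcar_closed)
  have "\<one>\<^bsub>free_algebra (gens :: 'g set) Quot rel_ideal gens prels\<^esub> = rel_ideal gens prels +>\<^bsub>free_algebra (gens :: 'g set)\<^esub> 1"
    by (simp add: FactRing_def free_algebra_simps)
  then show "\<one>\<^bsub>PA\<^esub> = fib (1 :: 'g palg)" unfolding PA using fib_cls[of "1 :: 'g falg"] by (simp add: cls_scal fcar_closed)
qed

lemma presented_isomorphic: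
  fixes H :: "'g::pres palg \<Rightarrow> 'h::pres palg" and G :: "'h palg \<Rightarrow> 'g palg"
  assumes H: "ahom H" and GH: "\<And>x. G (H x) = x" "\<And>y. H (G y) = y"
  shows "algebra_isomorphic (presented_algebra (gens :: 'g set) prels) (presented_algebra (gens :: 'h set) prels)"
proof -
  define h where "h S = fib (H (inv_into UNIV fib S))" for S
  have h: "h (fib x) = fib (H x)" for x by (simp add: h_def inv_f_f[OF inj_fib])
  have "h \<in> ring_iso (presented_algebra (gens :: 'g set) prels) (presented_algebra (gens :: 'h set) prels)"
    unfolding ring_iso_def
  proof (intro CollectI conjI ring_hom_memI)
    have "range H = UNIV" using GH(2) by (metis surjI)
    have "h ` range fib = (\<lambda>x. fib (H x)) ` UNIV" by (simp add: image_image h)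
    also have "\<dots> = fib ` range H" by (simp add: image_image)
    also have "\<dots> = range fib" using \<open>range H = UNIV\<close> by simp
    finally have "h ` range fib = range fib" .
    moreover have "inj_on h (range fib)"
    proof (rule inj_onI)
      fix S T assume a: "S \<in> range fib" "T \<in> range fib" "h S = h T"
      obtain x y where xy: "S = fib x" "T = fib y" using a(1,2) by blast
      then have "H x = H y" using a(3) injD[OF inj_fib, of "H x" "H y"] by (simp add: h)
      then have "x = y" by (metis GH(1))
      then show "S = T" using xy by simp
    qed
    ultimately show "bij_betw h (carrier (presented_algebra (gens :: 'g set) prels)) (carrier (presented_algebra (gens :: 'h set) prels))"
      unfolding presented_algebra_fib bij_betw_def by blast
  qed (auto simp: presented_algebra_fib h ahom_simps[OF H])
  moreover have "h (c \<odot>\<^bsub>presented_algebra (gens :: 'g set) prels\<^esub> x) = c \<odot>\<^bsub>presented_algebra (gens :: 'h set) prels\<^esub> h x"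
    if "x \<in> carrier (presented_algebra (gens :: 'g set) prels)" for c x
    using that by (auto simp: presented_algebra_fib h ahom_simps[OF H])
  ultimately show ?thesis unfolding algebra_isomorphic_def by blast
qed

subsection \<open>Inverses of matrix series\<close>

text \<open>\<open>ser_inv\<close> is built from ring operations and thus commutes with
  homomorphisms; this carries the inverse of \<open>K\<close> in the EF relation from the free
  algebra to its values.\<close>

locale rhom =
  fixes h :: "'a::ring_1 \<Rightarrow> 'b::ring_1"
  assumes h_add: "h (x + y) = h x + h y" and h_mult: "h (x * y) = h x * h y" and h_one: "h 1 = 1"
begin

lemma h_zero: "h 0 = 0" using h_add[of 0 0] by simp
lemma h_uminus: "h (- x) = - h x" using h_add[of x "- x"] by (simp add: h_zero eq_neg_iff_add_eq_0 add.commute)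
lemma h_sum: "h (sum g A) = (\<Sum>i\<in>A. h (g i))"
  by (induction A rule: infinite_finite_induct) (simp_all add: h_zero h_add)

lemma h_mat_mult: "h (mat_mult N A B i j) = mat_mult N (\<lambda>i j. h (A i j)) (\<lambda>i j. h (B i j)) i j"
  by (simp add: mat_mult_def h_sum h_mult)
lemma h_mat_pow: "h (mat_pow N A r i j) = mat_pow N (\<lambda>i j. h (A i j)) r i j"
  by (induction r arbitrary: i j) (simp_all add: mat_id_def h_one h_zero h_mat_mult)
lemma h_tri_inv: "h (tri_inv N D T i j) = tri_inv N (\<lambda>i. h (D i)) (\<lambda>i j. h (T i j)) i j"
proof -
  have "(\<lambda>a b. h (if a = b then 0 else - (D a * T a b))) = (\<lambda>a b. if a = b then 0 else - (h (D a) * h (T a b)))"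
    by (auto simp: fun_eq_iff h_zero h_uminus h_mult)
  then show ?thesis by (simp add: tri_inv_def h_mult h_sum h_mat_pow)
qed
lemma h_ser_inv: "h (ser_inv N D T m i j) = ser_inv N (\<lambda>i. h (D i)) (\<lambda>m i j. h (T m i j)) m i j"
proof (induction m arbitrary: i j rule: less_induct)
  case (less m)
  show ?case
  proof (cases m)
    case 0 then show ?thesis by (simp add: h_tri_inv)
  next
    case (Suc k)
    have "(\<lambda>a b. h (\<Sum>r\<le>k. mat_mult N (T (Suc r)) (ser_inv N D T (k - r)) a b))
      = (\<lambda>a b. \<Sum>r\<le>k. mat_mult N (\<lambda>i j. h (T (Suc r) i j)) (ser_inv N (\<lambda>i. h (D i)) (\<lambda>m i j. h (T m i j)) (k - r)) a b)"
      unfolding h_sum h_mat_mult by (simp add: less.IH Suc)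
    then show ?thesis by (simp add: Suc h_uminus h_mat_mult h_tri_inv)
  qed
qed

end

lemma rhom_ev: "rhom (ev \<phi>)" by (intro rhom.intro ev_add ev_mult ev_one)

text \<open>The positive powers of the strictly triangular matrix in \<open>tri_inv\<close> vanish
  on the diagonal and on the far side of it, so only the identity matrix contributes there.\<close>

lemma tri_inv_triangular:
  fixes T :: "nat \<Rightarrow> nat \<Rightarrow> 'a::ring_1"
  assumes ij: "i \<in> {1..N}" "j \<in> {1..N}"
  shows "(\<And>i j. i \<in> {1..N} \<Longrightarrow> j \<in> {1..N} \<Longrightarrow> i < j \<Longrightarrow> T i j = 0) \<Longrightarrow> i \<le> j \<Longrightarrow> tri_inv N D T i j = (if i = j then D j else 0)"
    and "(\<And>i j. i \<in> {1..N} \<Longrightarrow> j \<in> {1..N} \<Longrightarrow> j < i \<Longrightarrow> T i j = 0) \<Longrightarrow> j \<le> i \<Longrightarrow> tri_inv N D T i j = (if i = j then D j else 0)"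
proof -
  define M where "M = (\<lambda>a b. if a = b then 0 else - (D a * T a b))"
  have s: "(\<Sum>r<N. mat_pow N M r i j) = (if i = j then 1 else 0)" if z: "\<And>r. mat_pow N M (Suc r) i j = 0"
  proof -
    obtain N' where N': "N = Suc N'" using ij by (cases N) auto
    show ?thesis unfolding N' by (subst sum.lessThan_Suc_shift) (simp add: z[unfolded N'] mat_id_def del: mat_pow.simps(2))
  qed
  have t: "tri_inv N D T i j = (if i = j then D j else 0)" if "\<And>r. mat_pow N M (Suc r) i j = 0"
    unfolding tri_inv_def M_def[symmetric] s[OF that] by simp
  show "(\<And>i j. i \<in> {1..N} \<Longrightarrow> j \<in> {1..N} \<Longrightarrow> i < j \<Longrightarrow> T i j = 0) \<Longrightarrow> i \<le> j \<Longrightarrow> tri_inv N D T i j = (if i = j then D j else 0)"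
    by (intro t mat_pow_lower) (use ij in \<open>auto simp: M_def\<close>)
  show "(\<And>i j. i \<in> {1..N} \<Longrightarrow> j \<in> {1..N} \<Longrightarrow> j < i \<Longrightarrow> T i j = 0) \<Longrightarrow> j \<le> i \<Longrightarrow> tri_inv N D T i j = (if i = j then D j else 0)"
    by (intro t mat_pow_upper) (use ij in \<open>auto simp: M_def\<close>)
qed

lemma fps_matrix_right:
  fixes T S :: "nat \<Rightarrow> nat \<Rightarrow> nat \<Rightarrow> 'a::ring_1"
  assumes "\<And>m. (\<Sum>r\<le>m. mat_mult N (T r) (S (m - r)) i j) = (if m = 0 then mat_id i j else 0)"
  shows "(\<Sum>a=1..N. Abs_fps (\<lambda>m. T m i a) * Abs_fps (\<lambda>m. S m a j)) = (if i = j then 1 else 0)"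
proof (rule fps_ext)
  fix m
  have "(\<Sum>a=1..N. Abs_fps (\<lambda>m. T m i a) * Abs_fps (\<lambda>m. S m a j)) $ m = (\<Sum>r\<le>m. mat_mult N (T r) (S (m - r)) i j)"
    unfolding mat_mult_def by (subst sum.swap) (simp add: fps_sum_nth fps_mult_nth atMost_atLeast0)
  then show "(\<Sum>a=1..N. Abs_fps (\<lambda>m. T m i a) * Abs_fps (\<lambda>m. S m a j)) $ m = (if i = j then 1 else 0) $ m"
    unfolding assms by (simp add: mat_id_def)
qed

text \<open>\<open>ser_inv_right\<close> provides right inverses only. But the constant term of the
  inverse \<open>Ki\<close> is again triangular, with diagonal \<open>D\<close>, so
  \<open>Ki\<close> has a right inverse \<open>M\<close> of its own; then
  \<open>M = (K Ki) M = K\<close>, and \<open>Ki\<close> is a left inverse of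
  \<open>K\<close>.\<close>

lemma ser_inv_fps:
  fixes T :: "nat \<Rightarrow> nat \<Rightarrow> nat \<Rightarrow> 'a::ring_1"
  assumes D: "\<And>i. i \<in> {1..N} \<Longrightarrow> T 0 i i * D i = 1 \<and> D i * T 0 i i = 1"
    and tri: "(\<forall>i\<in>{1..N}. \<forall>j\<in>{1..N}. i < j \<longrightarrow> T 0 i j = 0) \<or> (\<forall>i\<in>{1..N}. \<forall>j\<in>{1..N}. j < i \<longrightarrow> T 0 i j = 0)"
    and ij: "i \<in> {1..N}" "j \<in> {1..N}"
  shows "(\<Sum>a=1..N. Abs_fps (\<lambda>m. T m i a) * Abs_fps (\<lambda>m. ser_inv N D T m a j)) = (if i = j then 1 else 0)" (is ?R)
    and "(\<Sum>a=1..N. Abs_fps (\<lambda>m. ser_inv N D T m i a) * Abs_fps (\<lambda>m. T m a j)) = (if i = j then 1 else 0)"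
proof -
  define S where "S = ser_inv N D T"
  define D' where "D' i = T 0 i i" for i
  define K Ki where "K i j = Abs_fps (\<lambda>m. T m i j)" and "Ki i j = Abs_fps (\<lambda>m. S m i j)" for i j
  define M where "M i j = Abs_fps (\<lambda>m. ser_inv N D' S m i j)" for i j
  have R: "(\<Sum>a=1..N. K i a * Ki a j) = (if i = j then 1 else 0)" if "i \<in> {1..N}" "j \<in> {1..N}" for i j
    unfolding K_def Ki_def S_def by (rule fps_matrix_right, rule ser_inv_right[where T = T and D = D and N = N, OF D tri that])
  then show ?R using ij unfolding K_def Ki_def S_def .
  have S0: "S 0 i j = tri_inv N D (T 0) i j" for i j by (simp add: S_def)
  have S0ii: "S 0 i i = D i" if "i \<in> {1..N}" for i
    using tri tri_inv_triangular[OF that that, of "T 0" D] unfolding S0 by auto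
  have S0tri: "(\<forall>i\<in>{1..N}. \<forall>j\<in>{1..N}. i < j \<longrightarrow> S 0 i j = 0) \<or> (\<forall>i\<in>{1..N}. \<forall>j\<in>{1..N}. j < i \<longrightarrow> S 0 i j = 0)"
    using tri
  proof
    assume l: "\<forall>i\<in>{1..N}. \<forall>j\<in>{1..N}. i < j \<longrightarrow> T 0 i j = 0"
    have "S 0 i j = 0" if "i \<in> {1..N}" "j \<in> {1..N}" "i < j" for i j
      unfolding S0 using tri_inv_triangular(1)[OF that(1,2), of "T 0" D] l that(3) by simp
    then show ?thesis by blast
  next
    assume l: "\<forall>i\<in>{1..N}. \<forall>j\<in>{1..N}. j < i \<longrightarrow> T 0 i j = 0"
    have "S 0 i j = 0" if "i \<in> {1..N}" "j \<in> {1..N}" "j < i" for i j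
      unfolding S0 using tri_inv_triangular(2)[OF that(1,2), of "T 0" D] l that(3) by simp
    then show ?thesis by blast
  qed
  have L: "(\<Sum>a=1..N. Ki i a * M a j) = (if i = j then 1 else 0)" if "i \<in> {1..N}" "j \<in> {1..N}" for i j
    unfolding M_def Ki_def by (rule fps_matrix_right, rule ser_inv_right[where T = S and D = D' and N = N, OF _ S0tri that]) (use D S0ii in \<open>simp add: D'_def\<close>)
  have KM: "M i j = K i j" if "i \<in> {1..N}" "j \<in> {1..N}" for i j
  proof -
    have "M i j = (\<Sum>a=1..N. (\<Sum>b=1..N. K i b * Ki b a) * M a j)"
      using that by (simp only: R sum_delta_mult[of "{1..N}"] finite_atLeastAtMost cong: sum.cong)
    also have "\<dots> = (\<Sum>b=1..N. K i b * (\<Sum>a=1..N. Ki b a * M a j))"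
      unfolding sum_distrib_left sum_distrib_right mult.assoc by (rule sum.swap)
    also have "\<dots> = K i j" using that by (simp only: L sum_delta_mult[of "{1..N}"] finite_atLeastAtMost cong: sum.cong)
    finally show ?thesis .
  qed
  have "(\<Sum>a=1..N. Ki i a * K a j) = (\<Sum>a=1..N. Ki i a * M a j)" using ij by (intro sum.cong refl) (simp add: KM)
  then show "(\<Sum>a=1..N. Abs_fps (\<lambda>m. ser_inv N D T m i a) * Abs_fps (\<lambda>m. T m a j)) = (if i = j then 1 else 0)"
    using L[OF ij] unfolding Ki_def K_def S_def by simp
qed

text \<open>The diagonal zero modes of the opposite sign serve as the inverses of those of sign
  \<open>s\<close>.\<close>

definition kinv :: "nat \<Rightarrow> (pmsign \<Rightarrow> nat \<Rightarrow> nat \<Rightarrow> 'a::ring_1 fps) \<Rightarrow> pmsign \<Rightarrow> nat \<Rightarrow> nat \<Rightarrow> 'a fps" where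
  "kinv N K s i j = Abs_fps (\<lambda>m. ser_inv N (\<lambda>i. K (opp s) i i $ 0) (\<lambda>m i j. K s i j $ m) m i j)"

lemma gauss_kinv:
  fixes C :: "int \<Rightarrow> 'a::cqalg"
  assumes "central_powers C"
    and d: "\<And>s i. i \<in> {1..N} \<Longrightarrow> K s i i $ 0 * K (opp s) i i $ 0 = 1"
    and t: "\<And>s i j. \<not> mode_ok s i j 0 \<Longrightarrow> K s i j $ 0 = 0"
    and "\<And>a. e Minus a $ 0 = 0" "\<And>a. f Plus a $ 0 = 0"
  shows "gauss C N K (kinv N K) e f"
proof -
  have D: "K s i i $ 0 * K (opp s) i i $ 0 = 1 \<and> K (opp s) i i $ 0 * K s i i $ 0 = 1" if "i \<in> {1..N}" for s i
    using d[OF that, of s] d[OF that, of "opp s"] by (cases s) simp_all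
  have T: "(\<forall>i\<in>{1..N}. \<forall>j\<in>{1..N}. i < j \<longrightarrow> K s i j $ 0 = 0) \<or> (\<forall>i\<in>{1..N}. \<forall>j\<in>{1..N}. j < i \<longrightarrow> K s i j $ 0 = 0)" for s
    by (cases s) (auto intro!: t simp: mode_ok_def)
  have f: "Abs_fps (\<lambda>m. K s i j $ m) = K s i j" for s i j by (rule fps_ext) simp
  show ?thesis
    using assms(1,4,5) ser_inv_fps[where T = "\<lambda>m i j. K s i j $ m" and D = "\<lambda>i. K (opp s) i i $ 0" for s, OF D T]
    unfolding gauss_def gauss_axioms_def by (simp add: kinv_def f)
qed

subsection \<open>Evaluation of the defining relations\<close>

lemma excoeff_bound: "\<exists>K. \<forall>k. dsg d * k < K \<longrightarrow> excoeff d f k = 0"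
proof (cases d)
  case ZW then show ?thesis by (intro exI[of _ "fls_subdegree (f fls_X)"]) simp
next
  case WZ then show ?thesis by (intro exI[of _ "fls_subdegree (f (inverse fls_X))"]) simp
qed

lemma finite_bd:
  assumes "bd d S"
  shows "finite {k. excoeff d f k \<noteq> 0 \<and> S (a - k) (b + k) \<noteq> 0}"
proof -
  obtain L where L: "\<And>k. dsg d * k < L \<Longrightarrow> excoeff d f k = 0" using excoeff_bound by blast
  obtain K where K: "\<And>k. k \<ge> K \<Longrightarrow> S (a - dsg d * k) (b + dsg d * k) = 0" using assms unfolding bd_def by blast
  have dd: "dsg d * (dsg d * k) = k" for k by (cases d) simp_all
  have "k \<in> {- \<bar>K\<bar> - \<bar>L\<bar>..\<bar>K\<bar> + \<bar>L\<bar>}" if "excoeff d f k \<noteq> 0 \<and> S (a - k) (b + k) \<noteq> 0" for k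
  proof -
    have "\<not> dsg d * k < L" using L[of k] that by auto
    moreover have "\<not> dsg d * k \<ge> K" using K[of "dsg d * k"] that unfolding dd by auto
    ultimately show ?thesis by (cases d) auto
  qed
  then show ?thesis by (intro finite_subset[OF _ finite_atLeastAtMost_int]) blast
qed

text \<open>Finiteness is required in the free algebra, before evaluation: \<open>Sum_any\<close> is
  0 by default when infinitely many terms are nonzero.\<close>

lemma ev_rmul:
  assumes C: "\<And>k. ev \<phi> (Cf k) = C k" and fin: "finite {k. excoeff d f k \<noteq> 0 \<and> S (a - k) (b + k) \<noteq> 0}"
  shows "ev \<phi> (rmul Cf d j f S a b) = rm C d j f (\<lambda>a b. ev \<phi> (S a b)) a b"
proof -
  let ?A = "{k. excoeff d f k \<noteq> 0 \<and> S (a - k) (b + k) \<noteq> 0}"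
  have "rmul Cf d j f S a b = (\<Sum>k\<in>?A. scal (excoeff d f k) * Cf (j * k) * S (a - k) (b + k))"
    unfolding rmul_def by (rule Sum_any.expand_superset[OF fin]) (auto simp: scal_def)
  moreover have "rm C d j f (\<lambda>a b. ev \<phi> (S a b)) a b = (\<Sum>k\<in>?A. sc (excoeff d f k) * C (j * k) * ev \<phi> (S (a - k) (b + k)))"
    unfolding rm_def by (rule Sum_any.expand_superset[OF fin]) auto
  ultimately show ?thesis by (simp add: ev_sum ev_mult ev_scal C)
qed

lemma half_series_zero: "sg s * t < 0 \<Longrightarrow> half_series s c t = 0" by (simp add: half_series_def)

lemma bd_half:
  fixes c :: "nat \<Rightarrow> 'a::mult_zero"
  shows "bd (dir s) (prod_zw (half_series s c) G)" "bd (dir s) (prod_wz G (half_series s c))"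
    "bd ZW (prod_zw G (half_series Minus c))" "bd ZW (prod_wz (half_series Minus c) G)"
proof -
  have h: "half_series s c (a - dsg (dir s) * k) = 0" if "k \<ge> \<bar>a\<bar> + 1" for a k
    using that by (intro half_series_zero) (cases s; simp)
  have h': "half_series Minus c (b + k) = 0" if "k \<ge> \<bar>b\<bar> + 1" for b k
    using that by (intro half_series_zero) simp
  have 1: "\<exists>K\<ge>0. \<forall>k\<ge>K. prod_zw (half_series s c) G (a - dsg (dir s) * k) (b + dsg (dir s) * k) = 0"
    "\<exists>K\<ge>0. \<forall>k\<ge>K. prod_wz G (half_series s c) (a - dsg (dir s) * k) (b + dsg (dir s) * k) = 0" for a b
    by (rule exI[of _ "\<bar>a\<bar> + 1"], auto simp: prod_zw_def prod_wz_def h)+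
  have 2: "\<exists>K\<ge>0. \<forall>k\<ge>K. prod_zw G (half_series Minus c) (a - k) (b + k) = 0"
    "\<exists>K\<ge>0. \<forall>k\<ge>K. prod_wz (half_series Minus c) G (a - k) (b + k) = 0" for a b
    by (rule exI[of _ "\<bar>b\<bar> + 1"], auto simp: prod_zw_def prod_wz_def h')+
  show "bd (dir s) (prod_zw (half_series s c) G)" "bd (dir s) (prod_wz G (half_series s c))"
    "bd ZW (prod_zw G (half_series Minus c))" "bd ZW (prod_wz (half_series Minus c) G)"
    unfolding bd_def using 1 2 by simp_all
qed

text \<open>For the quadratic relations: \<open>E\<close> and \<open>F\<close> are infinite in both
  directions, so the finiteness of the sums must come from the polynomial coefficient.\<close>

lemma excoeff_poly_finite:
  assumes "\<And>x. x \<in> {fls_X, inverse fls_X} \<Longrightarrow> f x = fls_const c1 * x + fls_const c0"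
  shows "finite {k. excoeff d f k \<noteq> 0 \<and> Q k}"
proof -
  have "excoeff d f k = (if k = 1 then c1 else 0) + (if k = 0 then c0 else 0)" for k
    using excoeff_rec[of 0 1 c1 c0 f d k] assms by (simp add: clears_def)
  then have "{k. excoeff d f k \<noteq> 0 \<and> Q k} \<subseteq> {0, 1}" by auto
  then show ?thesis by (rule finite_subset) simp
qed

lemma EE_finite: "finite {k. excoeff d (\<lambda>x. (x - qL ^ 2) * Rmat qL a i b k' x) k \<noteq> 0 \<and> Q k}"
proof -
  consider "i = a \<and> k' = b" | "\<not> (i = a \<and> k' = b)" "k' = a \<and> i = b" | "\<not> (i = a \<and> k' = b)" "\<not> (k' = a \<and> i = b)" by blast
  then show ?thesis
  proof cases
    case 1
    then show ?thesis unfolding Rmat_row by (intro excoeff_poly_finite[of _ "qv * r1 a b" "qv * r0 a b"]) (simp add: EE_poly(1))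
  next
    case 2
    then have "(if i = a \<and> k' = b then A else if k' = a \<and> i = b then B else Z) = B" for A B Z :: "Cq fls" by auto
    then show ?thesis unfolding Rmat_row by (intro excoeff_poly_finite[of _ "qv * o1 a b" "qv * o0 a b"]) (simp only: EE_poly(2))
  next
    case 3
    then have "(if i = a \<and> k' = b then A else if k' = a \<and> i = b then B else Z) = Z" for A B Z :: "Cq fls" by auto
    then show ?thesis unfolding Rmat_row by (intro excoeff_poly_finite[of _ 0 0]) simp
  qed
qed

lemma ev_prod: "ev \<phi> (prod_zw A B r t) = prod_zw (\<lambda>a. ev \<phi> (A a)) (\<lambda>b. ev \<phi> (B b)) r t"
    "ev \<phi> (prod_wz B A r t) = prod_wz (\<lambda>b. ev \<phi> (B b)) (\<lambda>a. ev \<phi> (A a)) r t"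
  by (simp_all add: prod_zw_def prod_wz_def ev_mult)

lemma ev_half: "(\<lambda>t. ev \<phi> (half_series s c t)) = hs s (Abs_fps (\<lambda>m. ev \<phi> (c m)))"
  by (simp add: fun_eq_iff hs_def half_series_def)

lemma ev_rmul_prod:
  assumes C: "\<And>k. ev \<phi> (Cf k) = C k"
  shows "bd d (prod_zw A B) \<Longrightarrow> ev \<phi> (rmul Cf d j f (prod_zw A B) r t) = rm C d j f (prod_zw (\<lambda>a. ev \<phi> (A a)) (\<lambda>b. ev \<phi> (B b))) r t"
    and "bd d (prod_wz B A) \<Longrightarrow> ev \<phi> (rmul Cf d j f (prod_wz B A) r t) = rm C d j f (prod_wz (\<lambda>b. ev \<phi> (B b)) (\<lambda>a. ev \<phi> (A a))) r t"
proof -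
  show "ev \<phi> (rmul Cf d j f (prod_zw A B) r t) = rm C d j f (prod_zw (\<lambda>a. ev \<phi> (A a)) (\<lambda>b. ev \<phi> (B b))) r t" if "bd d (prod_zw A B)"
    using ev_rmul[where S = "prod_zw A B", OF C finite_bd[OF that]] by (simp only: ev_prod)
  show "ev \<phi> (rmul Cf d j f (prod_wz B A) r t) = rm C d j f (prod_wz (\<lambda>b. ev \<phi> (B b)) (\<lambda>a. ev \<phi> (A a))) r t" if "bd d (prod_wz B A)"
    using ev_rmul[where S = "prod_wz B A", OF C finite_bd[OF that]] by (simp only: ev_prod)
qed

context central_powers begin

lemma ev_ipow:
  assumes "ev \<phi> u = C 1" "ev \<phi> v = C (- 1)"
  shows "ev \<phi> (ipow u v k) = C k"
proof -
  have "C c ^ m = C (c * int m)" for c m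
    by (induction m) (simp_all add: C_zero C_add distrib_left)
  then show ?thesis using assms by (simp add: ipow_def ev_power)
qed

lemma sat_U_rels:
  assumes \<phi>: "\<phi> UC = C 1" "\<phi> UCinv = C (- 1)"
    and Lf: "\<And>s i j. Lf s i j = Abs_fps (\<lambda>m. if mode_ok s i j m then \<phi> (UL s i j m) else 0)"
  shows "sat \<phi> (U_rels n) \<longleftrightarrow> (\<forall>s. \<forall>i\<in>{1..n}. Lf s i i $ 0 * Lf (opp s) i i $ 0 = 1) \<and> (\<forall>s. d_RLL n Lf s s) \<and> d_RLL n Lf Plus Minus"
proof -
  have C: "ev \<phi> (uC k) = C k" for k unfolding uC_def by (rule ev_ipow) (simp_all add: ev_gen \<phi>)
  have l: "ev \<phi> (lcoef s i j m) = Lf s i j $ m" for s i j m by (simp add: lcoef_def Lf ev_gen)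
  have lf: "(\<lambda>t. ev \<phi> (lser s i j t)) = hs s (Lf s i j)" for s i j
    unfolding lser_def ev_half l by (simp add: fps_nth_inverse)
  have b: "bd ZW (prod_zw (lser s a j) (lser s' b l))" "bd ZW (prod_wz (lser s' b l) (lser s a j))" if "s = Plus \<or> s' = Minus" for s s' a j b l
    using that bd_half(1,2)[of Plus] bd_half(3,4) unfolding lser_def by auto
  have R: "ev \<phi> (\<Sum>a=1..n. \<Sum>b=1..n. rmul uC ZW h (F a b) (prod_zw (lser s a j) (lser s' b l)) r t)
      = (\<Sum>a=1..n. \<Sum>b=1..n. rm C ZW h (F a b) (prod_zw (hs s (Lf s a j)) (hs s' (Lf s' b l))) r t)"
    "ev \<phi> (\<Sum>a=1..n. \<Sum>b=1..n. rmul uC ZW h (F a b) (prod_wz (lser s' k b) (lser s i a)) r t)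
      = (\<Sum>a=1..n. \<Sum>b=1..n. rm C ZW h (F a b) (prod_wz (hs s' (Lf s' k b)) (hs s (Lf s i a))) r t)"
    if "s = Plus \<or> s' = Minus" for s s' h F i j k l r t
    by (simp_all only: ev_sum ev_rmul_prod[OF C] b[OF that] lf)
  have ss: "s = Plus \<or> s = Minus" for s by (cases s) auto
  have pm: "Plus = Plus \<or> Minus = Minus" by simp
  show ?thesis
  proof
    assume S: "sat \<phi> (U_rels n)"
    have e: "(u, v) \<in> U_rels n \<Longrightarrow> ev \<phi> u = ev \<phi> v" for u v using S unfolding sat_def by blast
    have "Lf s i i $ 0 * Lf (opp s) i i $ 0 = 1" if "i \<in> {1..n}" for s i
      using e[OF U_rels.diag[OF that]] by (simp add: ev_mult l ev_one)
    moreover have "d_RLL n Lf s s" for s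
      unfolding d_RLL_def diff_self using e[OF U_rels.RLL] unfolding R[OF ss] by blast
    moreover have "d_RLL n Lf Plus Minus"
    proof -
      have "sg Minus - sg Plus = - 2" "sg Plus - sg Minus = 2" by simp_all
      then show ?thesis unfolding d_RLL_def using e[OF U_rels.RLL'] unfolding R[OF pm] by (simp only:) blast
    qed
    ultimately show "(\<forall>s. \<forall>i\<in>{1..n}. Lf s i i $ 0 * Lf (opp s) i i $ 0 = 1) \<and> (\<forall>s. d_RLL n Lf s s) \<and> d_RLL n Lf Plus Minus" by blast
  next
    assume A: "(\<forall>s. \<forall>i\<in>{1..n}. Lf s i i $ 0 * Lf (opp s) i i $ 0 = 1) \<and> (\<forall>s. d_RLL n Lf s s) \<and> d_RLL n Lf Plus Minus"
    have "ev \<phi> u = ev \<phi> v" if "(u, v) \<in> U_rels n" for u v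
      using that
    proof cases
      case (central g)
      then show ?thesis by (simp add: ev_mult ev_gen \<phi> cen_commute[OF C_cen])
    next
      case (diag i s)
      then show ?thesis using A by (simp add: ev_mult l ev_one)
    next
      case (RLL i j k l s r t)
      then show ?thesis using A unfolding RLL(1,2) R[OF ss] d_RLL_def by simp
    next
      case (RLL' i j k l r t)
      then show ?thesis using A unfolding RLL'(1,2) R[OF pm] d_RLL_def by simp
    qed (simp_all add: ev_mult ev_gen \<phi> C_inv ev_one)
    then show "sat \<phi> (U_rels n)" unfolding sat_def by blast
  qed
qed

end

context gauss begin

definition "Z_conditions \<longleftrightarrow> (\<forall>s. d_RLL N K s s) \<and> d_RLL N K Plus Minus \<and> (\<forall>s. d_kk s s) \<and> d_kk Plus Minus \<and> (\<forall>s. d_Kk s) \<and> (\<forall>s. d_Kk' s)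
   \<and> (\<forall>s. d_KE s) \<and> (\<forall>s. d_KF s) \<and> (\<forall>s. d_kE s) \<and> (\<forall>s. d_kF s) \<and> d_EE \<and> d_FF \<and> d_EF"

lemma sat_Z_rels:
  assumes \<phi>: "\<phi> ZC = C 1" "\<phi> ZCinv = C (- 1)" "\<And>a m. \<phi> (ZE a m) = Ec a m" "\<And>a m. \<phi> (ZF a m) = Fc a m"
    and K: "\<And>s i j. K s i j = Abs_fps (\<lambda>m. if mode_ok s i j m then \<phi> (ZK s i j m) else 0)"
    and k: "\<And>s. k s = Abs_fps (\<lambda>m. \<phi> (Zk s m))" and Ki: "Ki = kinv N K" and n: "n - 1 = N"
  shows "sat \<phi> (Z_rels n) \<longleftrightarrow> (\<forall>s. \<forall>i\<in>{1..N}. K s i i $ 0 * K (opp s) i i $ 0 = 1) \<and> (\<forall>s. k s $ 0 * k (opp s) $ 0 = 1) \<and> Z_conditions"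
    (is "_ \<longleftrightarrow> ?A")
proof -
  interpret h: rhom "ev \<phi>" by (rule rhom_ev)
  have C: "ev \<phi> (zC k) = C k" for k unfolding zC_def by (rule ev_ipow) (simp_all add: ev_gen \<phi>)
  have c: "ev \<phi> (Kcoef s i j m) = K s i j $ m" "ev \<phi> (kcoef s m) = k s $ m" for s i j m by (simp_all add: Kcoef_def kcoef_def K k ev_gen)
  have lf: "(\<lambda>t. ev \<phi> (Kser s i j t)) = Ks s i j" "(\<lambda>t. ev \<phi> (kser s t)) = ks s" "(\<lambda>t. ev \<phi> (Eser a t)) = Ec a" "(\<lambda>t. ev \<phi> (Fser a t)) = Fc a" for s i j a
    unfolding Kser_def kser_def ev_half c by (simp_all add: Eser_def Fser_def ev_gen \<phi> fps_nth_inverse)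
  have inv: "ev \<phi> (kKinv n s i j t) = hs s (kKi s i j) t" for s i j t
  proof -
    have "ev \<phi> (\<Sum>r\<le>m. kcoef s r * Kinv n s (m - r) i j) = (k s * Ki s i j) $ m" for m
      unfolding h.h_sum h.h_mult Kinv_def h.h_ser_inv c n Ki kinv_def by (simp add: fps_mult_nth atMost_atLeast0)
    then show ?thesis unfolding kKinv_def using fun_cong[OF ev_half[of \<phi> s "\<lambda>m. \<Sum>r\<le>m. kcoef s r * Kinv n s (m - r) i j"], of t] by (simp add: fps_nth_inverse)
  qed
  have b: "bd ZW (prod_zw (Kser s a j) (Kser s' b l))" "bd ZW (prod_wz (Kser s' b l) (Kser s a j))" if "s = Plus \<or> s' = Minus" for s s' a j b l
    using that bd_half(1,2)[of Plus] bd_half(3,4) unfolding Kser_def by auto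
  have bh: "bd (dir s) (prod_zw (Kser s i j) G)" "bd (dir s) (prod_wz G (Kser s i j))"
    "bd (dir s) (prod_zw (kser s) G)" "bd (dir s) (prod_wz G (kser s))" for s i j G
    unfolding Kser_def kser_def by (rule bd_half)+
  note E = ev_sum ev_rmul_prod[OF C] lf
  have R: "ev \<phi> (\<Sum>a=1..N. \<Sum>b=1..N. rmul zC ZW h (F a b) (prod_zw (Kser s a j) (Kser s' b l)) r t)
      = (\<Sum>a=1..N. \<Sum>b=1..N. rm C ZW h (F a b) (prod_zw (Ks s a j) (Ks s' b l)) r t)"
    "ev \<phi> (\<Sum>a=1..N. \<Sum>b=1..N. rmul zC ZW h (F a b) (prod_wz (Kser s' k b) (Kser s i a)) r t)
      = (\<Sum>a=1..N. \<Sum>b=1..N. rm C ZW h (F a b) (prod_wz (Ks s' k b) (Ks s i a)) r t)"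
    if "s = Plus \<or> s' = Minus" for s s' h F i j k l r t
    by (simp_all only: E b[OF that])
  have ss: "s = Plus \<or> s = Minus" for s by (cases s) auto
  have pm: "Plus = Plus \<or> Minus = Minus" by simp
  have sg: "sg Minus - sg Plus = - 2" "sg Plus - sg Minus = 2" by simp_all
  have p: "ev \<phi> (prod_zw A B r t) = prod_zw (\<lambda>a. ev \<phi> (A a)) (\<lambda>b. ev \<phi> (B b)) r t"
    "ev \<phi> (prod_wz B A r t) = prod_wz (\<lambda>b. ev \<phi> (B b)) (\<lambda>a. ev \<phi> (A a)) r t" for A B r t by (rule ev_prod)+
  have EEl: "ev \<phi> (rmul zC ZW 0 (\<lambda>x. (x - qL ^ 2) * Rmat qL a i b k' x) (prod_zw A B) r t)
     = rm C ZW 0 (\<lambda>x. (x - qL ^ 2) * Rmat qL a i b k' x) (prod_zw (\<lambda>a. ev \<phi> (A a)) (\<lambda>b. ev \<phi> (B b))) r t"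
    "ev \<phi> (rmul zC ZW 0 (\<lambda>x. (x - qL ^ 2) * Rmat qL a i b k' x) (prod_wz B A) r t)
     = rm C ZW 0 (\<lambda>x. (x - qL ^ 2) * Rmat qL a i b k' x) (prod_wz (\<lambda>b. ev \<phi> (B b)) (\<lambda>a. ev \<phi> (A a))) r t"
    "ev \<phi> (rmul zC ZW 0 (\<lambda>x. x * qL ^ 2 - 1) (prod_zw A B) r t)
     = rm C ZW 0 (\<lambda>x. x * qL ^ 2 - 1) (prod_zw (\<lambda>a. ev \<phi> (A a)) (\<lambda>b. ev \<phi> (B b))) r t"
    "ev \<phi> (rmul zC ZW 0 (\<lambda>x. x * qL ^ 2 - 1) (prod_wz B A) r t)
     = rm C ZW 0 (\<lambda>x. x * qL ^ 2 - 1) (prod_wz (\<lambda>b. ev \<phi> (B b)) (\<lambda>a. ev \<phi> (A a))) r t" for a i b k' A B r t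
    by (subst ev_rmul[OF C], rule EE_finite excoeff_poly_finite[OF FF_poly], simp only: ev_prod)+
  have EFl: "ev \<phi> (scal (qv - inverse qv) * (delta_term 1 (kKinv n Minus a b) r t - delta_term (- 1) (kKinv n Plus a b) r t))
    = sc (qv - inverse qv) * (C (2 * 1 * (- r)) * C (1 * (r + t)) * hs Minus (kKi Minus a b) (r + t)
    - C (2 * (- 1) * (- r)) * C (- 1 * (r + t)) * hs Plus (kKi Plus a b) (r + t))" for a b r t
    by (simp only: delta_term_def ev_mult ev_scal ev_diff C inv)
  show ?thesis
  proof
    assume S: "sat \<phi> (Z_rels n)"
    have e: "(u, v) \<in> Z_rels n \<Longrightarrow> ev \<phi> u = ev \<phi> v" for u v using S unfolding sat_def by blast
    \<comment> \<open>Numbered in the order of the introduction rules of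
      \<open>Z_rels\<close>.\<close>
    note r = Z_rels.intros[where n = n, unfolded n]
    have "K s i i $ 0 * K (opp s) i i $ 0 = 1" if "i \<in> {1..N}" for s i
      using e[OF r(4)[OF that]] by (simp only: ev_mult c ev_one)
    moreover have "k s $ 0 * k (opp s) $ 0 = 1" for s
      using e[OF r(5)] by (simp only: ev_mult c ev_one)
    moreover have "d_RLL N K s s" for s
      unfolding d_RLL_def diff_self using e[OF r(6)] unfolding R[OF ss] by blast
    moreover have "d_RLL N K Plus Minus"
      unfolding d_RLL_def sg using e[OF r(7)] unfolding R[OF pm] by blast
    moreover have "d_kk s s" for s using e[OF r(8)] unfolding d_kk_def p lf by blast
    moreover have "d_kk Plus Minus" using e[OF r(9)] unfolding d_kk_def p lf by blast
    moreover have "d_Kk s" for s using e[OF r(10)] unfolding d_Kk_def p lf by blast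
    moreover have "d_Kk' s" for s using e[OF r(11)] unfolding d_Kk'_def by (simp only: E bh) blast
    moreover have "d_KE s" for s using e[OF r(12)] unfolding d_KE_def by (simp only: E bh p) blast
    moreover have "d_KF s" for s using e[OF r(13)] unfolding d_KF_def by (simp only: E bh p) blast
    moreover have "d_kE s" for s using e[OF r(14)] unfolding d_kE_def by (simp only: E bh p) blast
    moreover have "d_kF s" for s using e[OF r(15)] unfolding d_kF_def by (simp only: E bh p) blast
    moreover have d_EE using e[OF r(16)] unfolding d_EE_def ev_sum EEl lf by blast
    moreover have d_FF using e[OF r(17)] unfolding d_FF_def ev_sum EEl lf by blast
    moreover have d_EF using e[OF r(18)] unfolding d_EF_def ev_diff[of _ "prod_zw _ _ _ _"] EFl p lf by blast
    ultimately show ?A unfolding Z_conditions_def by blast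
  next
    assume A: ?A
    have B: "d_RLL N K s s" "d_kk s s" "d_Kk s" "d_Kk' s" "d_KE s" "d_KF s" "d_kE s" "d_kF s" for s
      using A unfolding Z_conditions_def by blast+
    have B': "d_RLL N K Plus Minus" "d_kk Plus Minus" d_EE d_FF d_EF using A unfolding Z_conditions_def by blast+
    have "ev \<phi> u = ev \<phi> v" if "(u, v) \<in> Z_rels n" for u v
      using that
    proof cases
      case (central g)
      then show ?thesis by (simp add: ev_mult ev_gen \<phi> cen_commute[OF C_cen])
    next
      case (diagK i s)
      then show ?thesis using A unfolding n by (simp only: ev_mult c ev_one)
    next
      case (diagk s)
      then show ?thesis using A by (simp only: ev_mult c ev_one)
    next
      case (RKK i j k l s r t)
      then show ?thesis using B[of s] unfolding n unfolding RKK(1,2)[unfolded n] R[OF ss] d_RLL_def by simp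
    next
      case (RKK' i j k l r t)
      then show ?thesis using B' unfolding n unfolding RKK'(1,2)[unfolded n] R[OF pm] d_RLL_def by simp
    next
      case (kk s r t) then show ?thesis using B[of s] by (simp only: p lf d_kk_def)
    next
      case (kk' r t) then show ?thesis using B' by (simp only: p lf d_kk_def)
    next
      case (Kk i j s r t) then show ?thesis using B[of s] unfolding n by (simp only: p lf d_Kk_def)
    next
      case (Kk' i j s r t) then show ?thesis using B[of s] unfolding n by (simp only: E bh d_Kk'_def)
    next
      case (KE i j b s r t) then show ?thesis using B[of s] unfolding n by (simp only: p E bh d_KE_def)
    next
      case (KF i j k s r t) then show ?thesis using B[of s] unfolding n by (simp only: p E bh d_KF_def)
    next
      case (kE a s r t) then show ?thesis using B[of s] unfolding n by (simp only: p E bh d_kE_def)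
    next
      case (kF a s r t) then show ?thesis using B[of s] unfolding n by (simp only: p E bh d_kF_def)
    next
      case (EE a b r t) then show ?thesis using B' unfolding n by (simp only: ev_sum EEl lf d_EE_def)
    next
      case (FF a b r t) then show ?thesis using B' unfolding n by (simp only: ev_sum EEl lf d_FF_def)
    next
      case (EF a b r t) then show ?thesis using B' unfolding n by (simp only: ev_diff[of _ "prod_zw _ _ _ _"] EFl p lf d_EF_def)
    qed (simp_all add: ev_mult ev_gen \<phi> C_inv ev_one)
    then show "sat \<phi> (Z_rels n)" unfolding sat_def by blast
  qed
qed

end

subsection \<open>Nontriviality\<close>

text \<open>A copy of the scalars, since the instance below is needed for this particular field only.\<close>

typedef scalar = "UNIV :: Cq set" ..

instantiation scalar :: cqalg
begin
definition "0 = Abs_scalar 0"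
definition "1 = Abs_scalar 1"
definition "x + y = Abs_scalar (Rep_scalar x + Rep_scalar y)"
definition "x - y = Abs_scalar (Rep_scalar x - Rep_scalar y)"
definition "- x = Abs_scalar (- Rep_scalar x)"
definition "x * y = Abs_scalar (Rep_scalar x * Rep_scalar y)"
definition "sc c = Abs_scalar c"
instance
  by standard (simp_all add: zero_scalar_def one_scalar_def plus_scalar_def minus_scalar_def uminus_scalar_def times_scalar_def sc_scalar_def
    Abs_scalar_inverse Abs_scalar_inject Rep_scalar_inverse algebra_simps)
end

definition idm :: "nat \<Rightarrow> nat \<Rightarrow> scalar fps" where "idm i j = (if i = j then 1 else 0)"

lemma central_powers_one: "central_powers (\<lambda>_. 1 :: 'a::cqalg)"
  by standard (simp_all add: cen_intros)

text \<open>With \<open>q^(c/2)\<close> replaced by 1 the two R-matrices have the same argument, and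
  for identity matrices both sides reduce to the same entry of \<open>R\<close>.\<close>

lemma d_RLL_identity: "central_powers.d_RLL (\<lambda>_. 1) M (\<lambda>s. idm) s s'"
proof -
  interpret central_powers "\<lambda>_. 1 :: scalar" by (rule central_powers_one)
  define S :: "int \<Rightarrow> int \<Rightarrow> scalar" where "S r t = (if r = 0 then if t = 0 then 1 else 0 else 0)" for r t
  have P: "prod_zw (hs s (idm a j)) (hs s' (idm b l)) = (if a = j then if b = l then S else (\<lambda>_ _. 0) else (\<lambda>_ _. 0))"
    "prod_wz (hs s' (idm b l)) (hs s (idm a j)) = (if a = j then if b = l then S else (\<lambda>_ _. 0) else (\<lambda>_ _. 0))" for a j b l
    by (auto simp: fun_eq_iff prod_zw_def prod_wz_def idm_def hs_one hs_zero S_def)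
  have z: "rm (\<lambda>_. 1) d h f (\<lambda>_ _. 0) r t = (0 :: scalar)" for d h f r t by (simp add: rm_def)
  have h: "rm (\<lambda>_. 1) ZW h f S r t = rm (\<lambda>_. 1) ZW 0 f S r t" for h f r t by (simp add: rm_def)
  have d: "rm (\<lambda>_. 1) ZW h f (if a = j then if b = l then S else (\<lambda>_ _. 0) else (\<lambda>_ _. 0)) r t
    = (if a = j then if b = l then rm (\<lambda>_. 1) ZW 0 f S r t else 0 else 0)" for h f a j b l r t
    by (cases "a = j"; cases "b = l"; simp add: z h[of h])
  have dd: "(\<Sum>a=1..M. \<Sum>b=1..M. if a = j then if b = l then g a b else 0 else 0) = g j l"
    "(\<Sum>a=1..M. \<Sum>b=1..M. if j = a then if l = b then g a b else 0 else 0) = g j l"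
    if "j \<in> {1..M}" "l \<in> {1..M}" for j l and g :: "nat \<Rightarrow> nat \<Rightarrow> scalar"
  proof -
    have "(\<Sum>b=1..M. if a = j then if b = l then g a b else 0 else 0) = (if a = j then g j l else 0)"
      "(\<Sum>b=1..M. if j = a then if l = b then g a b else 0 else 0) = (if j = a then g j l else 0)" for a
      using that(2) by (cases "a = j"; simp)+
    then show "(\<Sum>a=1..M. \<Sum>b=1..M. if a = j then if b = l then g a b else 0 else 0) = g j l"
      "(\<Sum>a=1..M. \<Sum>b=1..M. if j = a then if l = b then g a b else 0 else 0) = g j l"
      using that(1) by simp_all
  qed
  show ?thesis unfolding d_RLL_def P d by (intro ballI allI) (simp only: dd)
qed

lemma gauss_trivial: "gauss (\<lambda>_. 1) N (\<lambda>s. idm) (kinv N (\<lambda>s. idm)) (\<lambda>_ _. 0) (\<lambda>_ _. 0)"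
proof (rule gauss_kinv[OF central_powers_one])
  show "idm i j $ 0 = 0" if "\<not> mode_ok s i j 0" for s i j using that by (cases s) (auto simp: mode_ok_def idm_def)
qed (simp_all add: idm_def)

lemma idm_coeff: "idm i j = Abs_fps (\<lambda>m. if mode_ok s i j m then idm i j $ m else 0)"
  by (rule fps_ext) (cases s; auto simp: mode_ok_def idm_def)

text \<open>The generators of the RLL presentation go to identity matrices. For the currents one
  takes \<open>E = F = 0\<close>, \<open>K = 1\<close>, \<open>k = 1\<close>; instead of being
  checked one by one, their relations are deduced from \<open>gauss_relations\<close> and the
  identity solution of size \<open>Suc N\<close>.\<close>

lemma sat_trivial:
  shows "\<exists>\<phi> :: ugen \<Rightarrow> scalar. sat \<phi> (U_rels n)" and "n \<ge> 1 \<Longrightarrow> \<exists>\<phi> :: zgen \<Rightarrow> scalar. sat \<phi> (Z_rels n)"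
proof -
  define \<phi> :: "ugen \<Rightarrow> scalar" where "\<phi> g = (case g of UC \<Rightarrow> 1 | UCinv \<Rightarrow> 1 | UL s i j m \<Rightarrow> idm i j $ m)" for g
  have e: "\<phi> (UL s i j m) = idm i j $ m" for s i j m by (simp add: \<phi>_def)
  have "idm i j = Abs_fps (\<lambda>m. if mode_ok s i j m then \<phi> (UL s i j m) else 0)" for s i j
    unfolding e by (rule idm_coeff)
  from central_powers.sat_U_rels[where Lf = "\<lambda>s. idm" and \<phi> = \<phi> and n = n, OF central_powers_one _ _ this]
  have "sat \<phi> (U_rels n)" by (simp add: d_RLL_identity) (simp add: \<phi>_def idm_def)
  then show "\<exists>\<phi> :: ugen \<Rightarrow> scalar. sat \<phi> (U_rels n)" by (rule exI[where x = \<phi>])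
  assume "n \<ge> 1"
  then obtain N where n: "n = Suc N" by (cases n) auto
  interpret gauss "\<lambda>_. 1" N "\<lambda>s. idm" "kinv N (\<lambda>s. idm)" "\<lambda>_. 1" "\<lambda>_ _. 0" "\<lambda>_ _. 0" by (rule gauss_trivial)
  define \<psi> :: "zgen \<Rightarrow> scalar" where "\<psi> g = (case g of ZC \<Rightarrow> 1 | ZCinv \<Rightarrow> 1 | ZE a m \<Rightarrow> 0 | ZF a m \<Rightarrow> 0 | ZK s i j m \<Rightarrow> idm i j $ m | Zk s m \<Rightarrow> (1 :: scalar fps) $ m)" for g
  have L: "L s i j = idm i j" if "i \<in> {1..Suc N}" "j \<in> {1..Suc N}" for s i j
    using that by (auto simp: L_def idm_def le_Suc_eq)
  have "d_RLL (Suc N) L s s' \<longleftrightarrow> d_RLL (Suc N) (\<lambda>s. idm) s s'" for s s'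
    unfolding d_RLL_def by (intro ball_cong refl all_cong1 arg_cong2[where f = "(=)"] sum.cong) (simp_all add: L)
  then have c: Z_conditions using gauss_relations d_RLL_identity unfolding Z_conditions_def by blast
  have e: "\<psi> (ZK s i j m) = idm i j $ m" for s i j m by (simp add: \<psi>_def)
  have K: "idm i j = Abs_fps (\<lambda>m. if mode_ok s i j m then \<psi> (ZK s i j m) else 0)" for s i j
    unfolding e by (rule idm_coeff)
  have p: "\<psi> ZC = 1" "\<psi> ZCinv = 1" "\<psi> (ZE a m) = Ec a m" "\<psi> (ZF a m) = Fc a m" for a m
    by (simp_all add: \<psi>_def Ec_def Fc_def hs_zero)
  have k: "1 = Abs_fps (\<lambda>m. \<psi> (Zk s m))" for s by (rule fps_ext) (simp add: \<psi>_def)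
  have n': "n - 1 = N" by (simp add: n)
  have "sat \<psi> (Z_rels n)"
    unfolding sat_Z_rels[where \<phi> = \<psi> and n = n, OF p(1,2,3,4) K k HOL.refl n'] using c by (simp add: idm_def)
  then show "\<exists>\<phi> :: zgen \<Rightarrow> scalar. sat \<phi> (Z_rels n)" by (rule exI[where x = \<psi>])
qed

lemma one_notin_rel_ideal:
  fixes \<phi> :: "'g \<Rightarrow> 'b::cqalg"
  assumes "sat \<phi> E" "E \<subseteq> fcar X \<times> fcar X"
  shows "1 \<notin> rel_ideal X E"
proof
  assume "1 \<in> rel_ideal X E"
  then have "ev \<phi> 1 = 0" by (rule ev_rel_ideal[OF assms])
  then show False by (simp add: ev_one)
qed

subsection \<open>The defining relations lie in the free algebra\<close>

lemma fcar_power: "p \<in> fcar X \<Longrightarrow> p ^ m \<in> fcar X"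
  by (induction m) (simp_all add: fcar_closed)
lemma fcar_ipow: "u \<in> fcar X \<Longrightarrow> v \<in> fcar X \<Longrightarrow> ipow u v k \<in> fcar X"
  by (simp add: ipow_def fcar_power)
lemma fcar_rmul: "(\<And>k. Cf k \<in> fcar X) \<Longrightarrow> (\<And>a b. S a b \<in> fcar X) \<Longrightarrow> rmul Cf d j f S r t \<in> fcar X"
  by (simp add: rmul_def Sum_any.expand_set fcar_closed)
lemma fcar_prod: "(\<And>a. A a \<in> fcar X) \<Longrightarrow> (\<And>a. B a \<in> fcar X) \<Longrightarrow> prod_zw A B r t \<in> fcar X"
  "(\<And>a. A a \<in> fcar X) \<Longrightarrow> (\<And>a. B a \<in> fcar X) \<Longrightarrow> prod_wz B A r t \<in> fcar X"
  by (simp_all add: prod_zw_def prod_wz_def fcar_closed)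
lemma fcar_half: "(\<And>m. c m \<in> fcar X) \<Longrightarrow> half_series s c t \<in> fcar X"
  by (simp add: half_series_def fcar_closed)

lemma U_rels_fcar: "U_rels n \<subseteq> fcar (U_gens n) \<times> fcar (U_gens n)"
proof -
  let ?X = "U_gens n"
  have g: "gen UC \<in> fcar ?X" "gen UCinv \<in> fcar ?X" by (simp_all add: gen_fcar U_gens_def)
  have C: "uC k \<in> fcar ?X" for k unfolding uC_def by (rule fcar_ipow[OF g])
  have c: "lcoef s i j m \<in> fcar ?X" if "i \<in> {1..n}" "j \<in> {1..n}" for s i j m
    using that by (auto simp: lcoef_def fcar_closed U_gens_def intro!: gen_fcar)
  have l: "lser s i j t \<in> fcar ?X" if "i \<in> {1..n}" "j \<in> {1..n}" for s i j t
    unfolding lser_def using c[OF that] by (rule fcar_half)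
  have "u \<in> fcar ?X \<and> v \<in> fcar ?X" if "(u, v) \<in> U_rels n" for u v
    using that by cases (auto intro!: g C c l fcar_closed gen_fcar fcar_rmul fcar_prod simp del: atLeastAtMost_iff)
  then show ?thesis by auto
qed

lemma Z_rels_fcar: "Z_rels n \<subseteq> fcar (Z_gens n) \<times> fcar (Z_gens n)"
proof -
  let ?X = "Z_gens n" and ?N = "n - 1"
  have g: "gen ZC \<in> fcar ?X" "gen ZCinv \<in> fcar ?X" by (simp_all add: gen_fcar Z_gens_def)
  have C: "zC k \<in> fcar ?X" for k unfolding zC_def by (rule fcar_ipow[OF g])
  have c: "Kcoef s i j m \<in> fcar ?X" if "i \<in> {1..?N}" "j \<in> {1..?N}" for s i j m
    using that by (auto simp: Kcoef_def fcar_closed Z_gens_def intro!: gen_fcar)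
  have c': "kcoef s m \<in> fcar ?X" for s m by (simp add: kcoef_def gen_fcar Z_gens_def)
  have E: "Eser a m \<in> fcar ?X" "Fser a m \<in> fcar ?X" if "a \<in> {1..?N}" for a m
    using that by (simp_all add: Eser_def Fser_def gen_fcar Z_gens_def)
  have l: "Kser s i j t \<in> fcar ?X" if "i \<in> {1..?N}" "j \<in> {1..?N}" for s i j t
    unfolding Kser_def using c[OF that] by (rule fcar_half)
  have l': "kser s t \<in> fcar ?X" for s t unfolding kser_def using c' by (rule fcar_half)
  have mm: "mat_mult ?N A B i j \<in> fcar ?X"
    if "\<And>i j. i \<in> {1..?N} \<Longrightarrow> j \<in> {1..?N} \<Longrightarrow> A i j \<in> fcar ?X" "\<And>i j. i \<in> {1..?N} \<Longrightarrow> j \<in> {1..?N} \<Longrightarrow> B i j \<in> fcar ?X"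
      "i \<in> {1..?N}" "j \<in> {1..?N}" for A B i j
    unfolding mat_mult_def using that by (blast intro: fcar_closed)
  have mp: "mat_pow ?N A r i j \<in> fcar ?X"
    if "\<And>i j. i \<in> {1..?N} \<Longrightarrow> j \<in> {1..?N} \<Longrightarrow> A i j \<in> fcar ?X" "i \<in> {1..?N}" "j \<in> {1..?N}" for A r i j
    using that(2,3)
  proof (induction r arbitrary: i j)
    case (Suc r) then show ?case unfolding mat_pow.simps by (intro mm that(1)) simp_all
  qed (simp add: mat_id_def fcar_closed)
  have ti: "tri_inv ?N (\<lambda>i. Kcoef (opp s) i i 0) (Kcoef' s) i j \<in> fcar ?X"
    if "Kcoef' s = (\<lambda>i j. Kcoef s i j 0)" "i \<in> {1..?N}" "j \<in> {1..?N}" for s i j Kcoef'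
    unfolding tri_inv_def that(1) using that(2,3) by (intro fcar_closed mp) (auto intro!: fcar_closed c)
  have si: "Kinv n s m i j \<in> fcar ?X" if "i \<in> {1..?N}" "j \<in> {1..?N}" for s m i j
    using that
  proof (induction m arbitrary: i j rule: less_induct)
    case (less m)
    show ?case
    proof (cases m)
      case 0 then show ?thesis using ti[of "\<lambda>s i j. Kcoef s i j 0" s] less.prems by (simp add: Kinv_def)
    next
      case (Suc k)
      have "ser_inv ?N (\<lambda>i. Kcoef (opp s) i i 0) (\<lambda>m i j. Kcoef s i j m) (k - r) a b \<in> fcar ?X" if "a \<in> {1..?N}" "b \<in> {1..?N}" for r a b
        using less.IH[of "k - r" a b] that by (simp add: Kinv_def Suc)
      then show ?thesis unfolding Kinv_def Suc ser_inv.simps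
        using less.prems by (intro fcar_closed mm ti[of "\<lambda>s i j. Kcoef s i j 0" s]) (auto intro: c)
    qed
  qed
  have kK: "kKinv n s i j t \<in> fcar ?X" if "i \<in> {1..?N}" "j \<in> {1..?N}" for s i j t
    unfolding kKinv_def using si[OF that] c' by (intro fcar_half fcar_closed)
  have "u \<in> fcar ?X \<and> v \<in> fcar ?X" if "(u, v) \<in> Z_rels n" for u v
    using that by cases (auto simp: delta_term_def intro!: g C c c' l l' E kK fcar_closed gen_fcar fcar_rmul fcar_prod simp del: atLeastAtMost_iff)
  then show ?thesis by auto
qed

subsection \<open>The two presentations\<close>

text \<open>Types cannot depend on \<open>n\<close>; it suffices to treat a value of \<open>n\<close> that is a counterexample to the
  theorem if there is any.\<close>

definition n0 :: nat where
  "n0 = (if \<exists>n\<ge>2. \<not> algebra_isomorphic (ZUR n) (Uq_gl_hat n) then SOME n. n \<ge> 2 \<and> \<not> algebra_isomorphic (ZUR n) (Uq_gl_hat n) else 2)"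

lemma n0_ge_2: "n0 \<ge> 2"
  unfolding n0_def by (auto intro: someI2)

lemma n0_counterexample:
  assumes "algebra_isomorphic (ZUR n0) (Uq_gl_hat n0)" "n \<ge> 2"
  shows "algebra_isomorphic (ZUR n) (Uq_gl_hat n)"
proof (rule ccontr)
  assume n: "\<not> algebra_isomorphic (ZUR n) (Uq_gl_hat n)"
  have "\<not> algebra_isomorphic (ZUR (SOME n. n \<ge> 2 \<and> \<not> algebra_isomorphic (ZUR n) (Uq_gl_hat n)))
    (Uq_gl_hat (SOME n. n \<ge> 2 \<and> \<not> algebra_isomorphic (ZUR n) (Uq_gl_hat n)))"
    by (rule someI2[of _ n]) (use n assms(2) in auto)
  moreover have "n0 = (SOME n. n \<ge> 2 \<and> \<not> algebra_isomorphic (ZUR n) (Uq_gl_hat n))"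
    unfolding n0_def by (rule if_P) (use n assms(2) in blast)
  ultimately show False using assms(1) by simp
qed

definition N0 :: nat where "N0 = n0 - 1"

lemma n0_N0: "n0 = Suc N0" "n0 - 1 = N0" using n0_ge_2 by (simp_all add: N0_def)

instantiation ugen :: pres
begin
definition gens_ugen :: "ugen set" where "gens_ugen = U_gens n0"
definition prels_ugen :: "(ugen falg \<times> ugen falg) set" where "prels_ugen = U_rels n0"
instance
proof
  show "prels \<subseteq> fcar (gens :: ugen set) \<times> fcar gens" unfolding gens_ugen_def prels_ugen_def by (rule U_rels_fcar)
  show "1 \<notin> rel_ideal (gens :: ugen set) prels"
    unfolding gens_ugen_def prels_ugen_def using sat_trivial(1)[of n0] one_notin_rel_ideal U_rels_fcar by blast
qed
end

instantiation zgen :: pres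
begin
definition gens_zgen :: "zgen set" where "gens_zgen = Z_gens n0"
definition prels_zgen :: "(zgen falg \<times> zgen falg) set" where "prels_zgen = Z_rels n0"
instance
proof
  show "prels \<subseteq> fcar (gens :: zgen set) \<times> fcar gens" unfolding gens_zgen_def prels_zgen_def by (rule Z_rels_fcar)
  show "1 \<notin> rel_ideal (gens :: zgen set) prels"
    unfolding gens_zgen_def prels_zgen_def using sat_trivial(2)[of n0] n0_ge_2 one_notin_rel_ideal Z_rels_fcar by (metis One_nat_def Suc_leD numeral_2_eq_2)
qed
end

lemma central_powers_ipow:
  fixes u v :: "'a::cqalg"
  assumes uv: "u * v = 1" "v * u = 1" and u: "cen u"
  shows "central_powers (ipow u v)" "ipow u v 1 = u" "ipow u v (- 1) = v"
proof -
  have v: "cen v" using cen_inverse[OF u uv] .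
  have up: "ipow u v (k + 1) = ipow u v k * u" for k
  proof (cases "0 \<le> k")
    case True then show ?thesis by (simp add: ipow_def nat_add_distrib power_commutes)
  next
    case False
    then have "k = - int (Suc (nat (- k - 1)))" by simp
    then obtain m where "k = - int (Suc m)" by blast
    then show ?thesis by (cases m) (auto simp: ipow_def power_Suc2 mult.assoc uv nat_add_distrib simp del: power_Suc)
  qed
  have down: "ipow u v (k - 1) = ipow u v k * v" for k
    using up[of "k - 1"] uv by (simp add: mult.assoc)
  have z: "ipow u v 0 = 1" by (simp add: ipow_def)
  have "ipow u v (a + b) = ipow u v a * ipow u v b" for a b
  proof (induction b rule: int_induct[where k = 0])
    case (step1 i) then show ?case using up[of "a + i"] up[of i] by (simp add: add.assoc mult.assoc)
  next
    case (step2 i) then show ?case using down[of "a + i"] down[of i] by (simp add: add_diff_eq mult.assoc)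
  qed (simp add: z)
  moreover have "cen (y ^ m)" if "cen y" for y :: 'a and m by (induction m) (simp_all add: cen_intros cen_mult that)
  then have "cen (ipow u v a)" for a using u v by (simp add: ipow_def)
  ultimately show "central_powers (ipow u v)" by (intro central_powers.intro z)
  show "ipow u v 1 = u" "ipow u v (- 1) = v" by (simp_all add: ipow_def)
qed

section \<open>Gauss decompositions under homomorphisms\<close>

definition fmap :: "('a::cqalg \<Rightarrow> 'b::cqalg) \<Rightarrow> 'a fps \<Rightarrow> 'b fps" where "fmap H A = Abs_fps (\<lambda>m. H (A $ m))"

lemma fmap_simps:
  assumes "ahom H"
  shows "fmap H (A + B) = fmap H A + fmap H B" "fmap H (A * B) = fmap H A * fmap H B" "fmap H (sum g S) = (\<Sum>i\<in>S. fmap H (g i))"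
    "hs s (fmap H A) t = H (hs s A t)"
  by (rule fps_ext; simp add: fmap_def ahom_simps[OF assms] fps_mult_nth fps_sum_nth)+
    (simp add: hs_def half_series_def fmap_def ahom_simps[OF assms])

lemma fmap_nth: "fmap H A $ m = H (A $ m)" by (simp add: fmap_def)

lemma ahom_ipow: "ahom H \<Longrightarrow> H (ipow u v k) = ipow (H u) (H v) k"
proof -
  assume H: "ahom H"
  have "H (y ^ m) = H y ^ m" for y m by (induction m) (simp_all add: ahom_simps[OF H])
  then show ?thesis by (simp add: ipow_def)
qed

lemma (in central_powers) d_RLL_cong:
  assumes "\<And>s i j. i \<in> {1..M} \<Longrightarrow> j \<in> {1..M} \<Longrightarrow> Lf s i j = Lg s i j"
  shows "d_RLL M Lf s s' \<longleftrightarrow> d_RLL M Lg s s'"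
  unfolding d_RLL_def by (intro ball_cong refl all_cong1 arg_cong2[where f = "(=)"] sum.cong) (simp_all add: assms)

context gauss begin

text \<open>The two halves of a current have disjoint exponents, so each half is read off from the
  current by undoing the rescaling.\<close>

lemma half_currents:
  "e Plus a $ m = C (- int m) * Ec a (int m)" "e Minus a $ m = (if m = 0 then 0 else - (C (- int m) * Ec a (- int m)))"
  "f Plus a $ m = (if m = 0 then 0 else C (int m) * Fc a (int m))" "f Minus a $ m = - (C (int m) * Fc a (- int m))"
  by (auto simp: Ec_def Fc_def hs_def half_series_def e0 f0 C_inv C_zero)

lemma L_zero_mode:
  assumes K: "\<And>s i j. \<not> mode_ok s i j 0 \<Longrightarrow> K s i j $ 0 = 0" and ij: "i \<in> {1..Suc N}" "j \<in> {1..Suc N}" "\<not> mode_ok s i j m"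
  shows "L s i j $ m = 0"
proof -
  have "m = 0" "(s = Plus \<and> i < j) \<or> (s = Minus \<and> j < i)" using ij(3) by (cases s; auto simp: mode_ok_def)+
  then show ?thesis using ij K[of s i j] by (auto simp: L_def fps_sum_nth fps_mult_nth e0 f0)
qed

text \<open>For either sign one of \<open>e\<close>, \<open>f\<close> has no constant term, so the
  products \<open>e K f\<close> have none.\<close>

lemma L_last_zero: "L s (Suc N) (Suc N) $ 0 = k s $ 0"
  by (cases s) (simp_all add: L_def fps_sum_nth fps_mult_nth e0 f0)

lemma L_columns:
  "i \<in> {1..N} \<Longrightarrow> j \<in> {1..N} \<Longrightarrow> L s i j = K s i j"
  "i \<in> {1..N} \<Longrightarrow> L s i (Suc N) = (\<Sum>a=1..N. K s i a * f s a)"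
  "j \<in> {1..N} \<Longrightarrow> L s (Suc N) j = (\<Sum>a=1..N. e s a * K s a j)"
  "L s (Suc N) (Suc N) = k s + (\<Sum>a=1..N. \<Sum>b=1..N. e s a * K s a b * f s b)"
  by (simp_all add: L_def)

end

context
  fixes H :: "'a::cqalg \<Rightarrow> 'b::cqalg" and C :: "int \<Rightarrow> 'a" and C' :: "int \<Rightarrow> 'b" and N :: nat
    and K Ki :: "pmsign \<Rightarrow> nat \<Rightarrow> nat \<Rightarrow> 'a fps" and k :: "pmsign \<Rightarrow> 'a fps" and e f :: "pmsign \<Rightarrow> nat \<Rightarrow> 'a fps"
    and K' Ki' :: "pmsign \<Rightarrow> nat \<Rightarrow> nat \<Rightarrow> 'b fps" and k' :: "pmsign \<Rightarrow> 'b fps" and e' f' :: "pmsign \<Rightarrow> nat \<Rightarrow> 'b fps"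
  assumes H: "ahom H" and G: "gauss C N K Ki e f" and G': "gauss C' N K' Ki' e' f'" and C: "\<And>i. H (C i) = C' i"
begin

interpretation A: gauss C N K Ki k e f by (rule G)
interpretation B: gauss C' N K' Ki' k' e' f' by (rule G')

text \<open>Uniqueness of the Gauss decomposition: \<open>K\<close> is the corner of
  \<open>L\<close>, the last column determines \<open>f\<close> and the last row determines
  \<open>e\<close> after cancelling \<open>K'\<close>, and then the last diagonal entry determines
  \<open>k\<close>.\<close>

lemma gauss_decomposition_image:
  assumes L: "\<And>s i j. i \<in> {1..Suc N} \<Longrightarrow> j \<in> {1..Suc N} \<Longrightarrow> fmap H (gauss.L N K k e f s i j) = gauss.L N K' k' e' f' s i j"
  shows "\<And>a p. a \<in> {1..N} \<Longrightarrow> H (gauss.Ec C e a p) = gauss.Ec C' e' a p" "\<And>a p. a \<in> {1..N} \<Longrightarrow> H (gauss.Fc C f a p) = gauss.Fc C' f' a p"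
    "\<And>s. fmap H (k s) = k' s"
proof -
  have K: "fmap H (K s i j) = K' s i j" if "i \<in> {1..N}" "j \<in> {1..N}" for s i j
    using L[of i j s] that by (simp add: A.L_columns B.L_columns)
  have f: "fmap H (f s a) = f' s a" if "a \<in> {1..N}" for s a
  proof -
    have "fmap H (f s a) - f' s a = 0"
    proof (rule matrix_cancel_left[where A = "{1..N}" and Ki = "Ki' s" and K = "K' s" and y = "\<lambda>a. fmap H (f s a) - f' s a"])
      fix i assume i: "i \<in> {1..N}"
      have "(\<Sum>a=1..N. K' s i a * fmap H (f s a)) = fmap H (A.L s i (Suc N))"
        unfolding A.L_columns(2)[OF i] fmap_simps[OF H] by (intro sum.cong refl) (simp add: K[OF i])
      also have "\<dots> = (\<Sum>a=1..N. K' s i a * f' s a)" using i by (subst L) (simp_all add: B.L_columns)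
      finally show "(\<Sum>a=1..N. K' s i a * (fmap H (f s a) - f' s a)) = 0" by (simp add: right_diff_distrib sum_subtractf)
    qed (use B.KiK that in auto)
    then show ?thesis by simp
  qed
  have e: "fmap H (e s a) = e' s a" if "a \<in> {1..N}" for s a
  proof -
    have "fmap H (e s a) - e' s a = 0"
    proof (rule matrix_cancel_right[where A = "{1..N}" and Ki = "Ki' s" and K = "K' s" and y = "\<lambda>a. fmap H (e s a) - e' s a"])
      fix j assume j: "j \<in> {1..N}"
      have "(\<Sum>a=1..N. fmap H (e s a) * K' s a j) = fmap H (A.L s (Suc N) j)"
        unfolding A.L_columns(3)[OF j] fmap_simps[OF H] by (intro sum.cong refl) (simp add: K[OF _ j])
      also have "\<dots> = (\<Sum>a=1..N. e' s a * K' s a j)" using j by (subst L) (simp_all add: B.L_columns)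
      finally show "(\<Sum>a=1..N. (fmap H (e s a) - e' s a) * K' s a j) = 0" by (simp add: left_diff_distrib sum_subtractf)
    qed (use B.KKi that in auto)
    then show ?thesis by simp
  qed
  show "fmap H (k s) = k' s" for s
  proof -
    have "fmap H (A.L s (Suc N) (Suc N)) = fmap H (k s) + (\<Sum>a=1..N. \<Sum>b=1..N. e' s a * K' s a b * f' s b)"
      unfolding A.L_columns(4) fmap_simps[OF H] by (intro arg_cong2[where f = "(+)"] refl sum.cong) (simp add: K e f)
    then show ?thesis using L[of "Suc N" "Suc N" s] by (simp add: B.L_columns)
  qed
  show "H (A.Ec a p) = B.Ec a p" if "a \<in> {1..N}" for a p
    using fmap_simps(4)[OF H, of Plus "e Plus a" p] fmap_simps(4)[OF H, of Minus "e Minus a" p]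
    by (simp add: A.Ec_def B.Ec_def ahom_simps[OF H] C e[OF that])
  show "H (A.Fc a p) = B.Fc a p" if "a \<in> {1..N}" for a p
    using fmap_simps(4)[OF H, of Plus "f Plus a" p] fmap_simps(4)[OF H, of Minus "f Minus a" p]
    by (simp add: A.Fc_def B.Fc_def ahom_simps[OF H] C f[OF that])
qed

text \<open>The half currents are coefficients of the currents up to powers of \<open>C\<close>, so
  a homomorphism compatible with the currents is compatible with the half currents, and hence with
  \<open>L\<close>.\<close>

lemma gauss_composition_image:
  assumes K: "\<And>s i j. i \<in> {1..N} \<Longrightarrow> j \<in> {1..N} \<Longrightarrow> fmap H (K s i j) = K' s i j" and k: "\<And>s. fmap H (k s) = k' s"
    and E: "\<And>a p. a \<in> {1..N} \<Longrightarrow> H (gauss.Ec C e a p) = gauss.Ec C' e' a p" "\<And>a p. a \<in> {1..N} \<Longrightarrow> H (gauss.Fc C f a p) = gauss.Fc C' f' a p"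
    and ij: "i \<in> {1..Suc N}" "j \<in> {1..Suc N}"
  shows "fmap H (gauss.L N K k e f s i j) = gauss.L N K' k' e' f' s i j"
proof -
  have e: "fmap H (e s a) = e' s a" and f: "fmap H (f s a) = f' s a" if "a \<in> {1..N}" for a
    by (rule fps_ext, cases s; simp add: fmap_nth A.half_currents B.half_currents ahom_simps[OF H] C E[OF that])+
  consider "i \<in> {1..N}" "j \<in> {1..N}" | "i \<in> {1..N}" "j = Suc N" | "i = Suc N" "j \<in> {1..N}" | "i = Suc N" "j = Suc N"
    using ij by fastforce
  then show ?thesis
  proof cases
    case 1 then show ?thesis by (simp only: A.L_columns(1) B.L_columns(1) K)
  next
    case 2 then show ?thesis unfolding 2(2) A.L_columns(2)[OF 2(1)] B.L_columns(2)[OF 2(1)] fmap_simps[OF H]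
      by (intro sum.cong refl) (simp add: K f)
  next
    case 3 then show ?thesis unfolding 3(1) A.L_columns(3)[OF 3(2)] B.L_columns(3)[OF 3(2)] fmap_simps[OF H]
      by (intro sum.cong refl) (simp add: K e)
  next
    case 4 then show ?thesis unfolding 4 A.L_columns(4) B.L_columns(4) fmap_simps[OF H]
      by (intro arg_cong2[where f = "(+)"] refl sum.cong) (simp_all add: K k e f)
  qed
qed

end

section \<open>Gauss factors in the algebra with the RLL presentation\<close>

definition CU :: "int \<Rightarrow> ugen palg" where "CU = ipow (cl UC) (cl UCinv)"
definition LU :: "pmsign \<Rightarrow> nat \<Rightarrow> nat \<Rightarrow> ugen palg fps" where
  "LU s i j = Abs_fps (\<lambda>m. if mode_ok s i j m then cl (UL s i j m) else 0)"
definition eU :: "pmsign \<Rightarrow> nat \<Rightarrow> ugen palg fps" where "eU s a = (\<Sum>b=1..N0. LU s (Suc N0) b * kinv N0 LU s b a)"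
definition fU :: "pmsign \<Rightarrow> nat \<Rightarrow> ugen palg fps" where "fU s a = (\<Sum>b=1..N0. kinv N0 LU s a b * LU s b (Suc N0))"
text \<open>The Schur complement of the corner, that is, a quasideterminant of the matrix
  \<open>LU\<close>.\<close>

definition kU :: "pmsign \<Rightarrow> ugen palg fps" where
  "kU s = LU s (Suc N0) (Suc N0) - (\<Sum>a=1..N0. \<Sum>b=1..N0. eU s a * LU s a b * fU s b)"

lemma CU: "central_powers CU" "CU 1 = cl UC" "CU (- 1) = cl UCinv"
proof -
  have e: "ev cl u = ev cl v" if "(u, v) \<in> U_rels n0" for u v
    using sat_cl[where 'g = ugen] that unfolding sat_def prels_ugen_def by blast
  have uv: "cl UC * cl UCinv = 1" "cl UCinv * cl UC = 1"
    using e[OF U_rels.inv1] e[OF U_rels.inv2] by (simp_all add: ev_mult ev_gen ev_one)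
  have "cen (cl UC)"
    using e[OF U_rels.central] by (intro palg_centralI) (simp add: ev_mult ev_gen gens_ugen_def)
  from central_powers_ipow[OF uv this] show "central_powers CU" "CU 1 = cl UC" "CU (- 1) = cl UCinv" unfolding CU_def .
qed

lemma LU_relations: "i \<in> {1..Suc N0} \<Longrightarrow> LU s i i $ 0 * LU (opp s) i i $ 0 = 1"
  "central_powers.d_RLL CU (Suc N0) LU s s" "central_powers.d_RLL CU (Suc N0) LU Plus Minus"
  using central_powers.sat_U_rels[OF CU(1), of cl LU n0] sat_cl[where 'g = ugen]
  by (simp_all add: CU LU_def prels_ugen_def n0_N0)

lemma LU_zero: "\<not> mode_ok s i j 0 \<Longrightarrow> LU s i j $ 0 = 0" by (simp add: LU_def)

lemma gauss_U: "gauss CU N0 LU (kinv N0 LU) eU fU"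
  by (rule gauss_kinv[OF CU(1)]) (simp_all add: LU_relations(1) LU_zero eU_def fU_def fps_sum_nth fps_mult_nth mode_ok_def)

interpretation U: gauss CU N0 LU "kinv N0 LU" kU eU fU by (rule gauss_U)

lemma L_U:
  assumes "i \<in> {1..Suc N0}" "j \<in> {1..Suc N0}"
  shows "U.L s i j = LU s i j"
proof -
  have c: "(\<Sum>a=1..N0. LU s i a * fU s a) = LU s i (Suc N0)" if "i \<in> {1..N0}" for i
  proof -
    have "(\<Sum>a=1..N0. LU s i a * fU s a) = (\<Sum>b=1..N0. (\<Sum>a=1..N0. LU s i a * kinv N0 LU s a b) * LU s b (Suc N0))"
      unfolding fU_def sum_distrib_left sum_distrib_right mult.assoc by (rule sum.swap)
    also have "\<dots> = LU s i (Suc N0)"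
      using that by (simp only: U.KKi sum_delta_mult[of "{1..N0}"] finite_atLeastAtMost cong: sum.cong)
    finally show ?thesis .
  qed
  have r: "(\<Sum>a=1..N0. eU s a * LU s a j) = LU s (Suc N0) j" if "j \<in> {1..N0}" for j
  proof -
    have "(\<Sum>a=1..N0. eU s a * LU s a j) = (\<Sum>b=1..N0. LU s (Suc N0) b * (\<Sum>a=1..N0. kinv N0 LU s b a * LU s a j))"
      unfolding eU_def sum_distrib_left sum_distrib_right mult.assoc by (rule sum.swap)
    also have "\<dots> = LU s (Suc N0) j"
      using that by (simp only: U.KiK sum_delta_mult[of "{1..N0}"] finite_atLeastAtMost cong: sum.cong)
    finally show ?thesis .
  qed
  consider "i \<in> {1..N0}" "j \<in> {1..N0}" | "i \<in> {1..N0}" "j = Suc N0" | "i = Suc N0" "j \<in> {1..N0}" | "i = Suc N0" "j = Suc N0"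
    using assms by fastforce
  then show ?thesis
  proof cases
    case 1 then show ?thesis by (rule U.L_columns(1))
  next
    case 2 then show ?thesis by (simp only: U.L_columns(2) c)
  next
    case 3 then show ?thesis by (simp only: U.L_columns(3) r)
  next
    case 4 then show ?thesis by (simp add: U.L_columns(4) kU_def)
  qed
qed

definition \<phi> :: "zgen \<Rightarrow> ugen palg" where
  "\<phi> g = (case g of ZC \<Rightarrow> cl UC | ZCinv \<Rightarrow> cl UCinv | ZE a m \<Rightarrow> U.Ec a m | ZF a m \<Rightarrow> U.Fc a m
    | ZK s i j m \<Rightarrow> cl (UL s i j m) | Zk s m \<Rightarrow> kU s $ m)"

lemma sat_\<phi>: "sat \<phi> (prels :: (zgen falg \<times> zgen falg) set)"
proof -
  have "U.d_RLL (Suc N0) U.L s s' \<longleftrightarrow> U.d_RLL (Suc N0) LU s s'" for s s' by (rule U.d_RLL_cong) (rule L_U)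
  then have Z: U.Z_conditions using U.gauss_relations LU_relations(2,3) unfolding U.Z_conditions_def by blast
  have "kU s $ 0 = LU s (Suc N0) (Suc N0) $ 0" for s
    using U.L_last_zero[of s] L_U[of "Suc N0" "Suc N0" s] by simp
  then have k: "kU s $ 0 * kU (opp s) $ 0 = 1" for s by (simp add: LU_relations(1))
  have "sat \<phi> (Z_rels n0) \<longleftrightarrow> (\<forall>s. \<forall>i\<in>{1..N0}. LU s i i $ 0 * LU (opp s) i i $ 0 = 1) \<and> (\<forall>s. kU s $ 0 * kU (opp s) $ 0 = 1) \<and> U.Z_conditions"
    by (rule U.sat_Z_rels) (simp_all add: \<phi>_def CU LU_def n0_N0 fps_nth_inverse cong: if_cong)
  then show ?thesis unfolding prels_zgen_def using Z k LU_relations(1) by simp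
qed

section \<open>Half currents and the matrix L in the algebra of currents\<close>

definition CZ :: "int \<Rightarrow> zgen palg" where "CZ = ipow (cl ZC) (cl ZCinv)"
definition KZ :: "pmsign \<Rightarrow> nat \<Rightarrow> nat \<Rightarrow> zgen palg fps" where
  "KZ s i j = Abs_fps (\<lambda>m. if mode_ok s i j m then cl (ZK s i j m) else 0)"
definition kZ :: "pmsign \<Rightarrow> zgen palg fps" where "kZ s = Abs_fps (\<lambda>m. cl (Zk s m))"
text \<open>The halves of the generating current, freed of the rescaling. Exponent 0 belongs to the
  positive half of \<open>E\<close> but to the negative half of \<open>F\<close>, as the triangular
  zero modes of \<open>L\<close> require.\<close>

definition eZ :: "pmsign \<Rightarrow> nat \<Rightarrow> zgen palg fps" where
  "eZ s a = Abs_fps (\<lambda>m. case s of Plus \<Rightarrow> CZ (- int m) * cl (ZE a (int m)) | Minus \<Rightarrow> if m = 0 then 0 else - (CZ (- int m) * cl (ZE a (- int m))))"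
definition fZ :: "pmsign \<Rightarrow> nat \<Rightarrow> zgen palg fps" where
  "fZ s a = Abs_fps (\<lambda>m. case s of Plus \<Rightarrow> if m = 0 then 0 else CZ (int m) * cl (ZF a (int m)) | Minus \<Rightarrow> - (CZ (int m) * cl (ZF a (- int m))))"

lemma ev_cl_Z: "(u, v) \<in> Z_rels n0 \<Longrightarrow> ev cl u = ev cl v"
  using sat_cl[where 'g = zgen] unfolding sat_def prels_zgen_def by blast

lemma CZ: "central_powers CZ" "CZ 1 = cl ZC" "CZ (- 1) = cl ZCinv"
proof -
  have uv: "cl ZC * cl ZCinv = 1" "cl ZCinv * cl ZC = 1"
    using ev_cl_Z[OF Z_rels.inv1] ev_cl_Z[OF Z_rels.inv2] by (simp_all add: ev_mult ev_gen ev_one)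
  have "cen (cl ZC)"
    using ev_cl_Z[OF Z_rels.central] by (intro palg_centralI) (simp add: ev_mult ev_gen gens_zgen_def)
  from central_powers_ipow[OF uv this] show "central_powers CZ" "CZ 1 = cl ZC" "CZ (- 1) = cl ZCinv" unfolding CZ_def .
qed

lemma KZ_diagonal: "i \<in> {1..N0} \<Longrightarrow> KZ s i i $ 0 * KZ (opp s) i i $ 0 = 1"
proof -
  assume "i \<in> {1..N0}"
  then have "ev cl (Kcoef s i i 0 * Kcoef (opp s) i i 0) = (ev cl 1 :: zgen palg)"
    by (intro ev_cl_Z Z_rels.diagK) (simp add: n0_N0)
  then show ?thesis by (cases s) (simp_all add: ev_mult ev_one Kcoef_def KZ_def ev_gen mode_ok_def)
qed

lemma KZ_zero: "\<not> mode_ok s i j 0 \<Longrightarrow> KZ s i j $ 0 = 0" by (simp add: KZ_def)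

lemma gauss_Z: "gauss CZ N0 KZ (kinv N0 KZ) eZ fZ"
  by (rule gauss_kinv[where K = KZ and C = CZ and N = N0, OF CZ(1) KZ_diagonal KZ_zero]) (simp_all add: eZ_def fZ_def)

interpretation Z: gauss CZ N0 KZ "kinv N0 KZ" kZ eZ fZ by (rule gauss_Z)

lemma currents_Z: "Z.Ec a p = cl (ZE a p)" "Z.Fc a p = cl (ZF a p)"
  by (auto simp: Z.Ec_def Z.Fc_def hs_def half_series_def eZ_def fZ_def Z.C_inv)

lemma Z_relations: Z.Z_conditions "kZ s $ 0 * kZ (opp s) $ 0 = 1"
proof -
  have "sat cl (Z_rels n0) \<longleftrightarrow> (\<forall>s. \<forall>i\<in>{1..N0}. KZ s i i $ 0 * KZ (opp s) i i $ 0 = 1) \<and> (\<forall>s. kZ s $ 0 * kZ (opp s) $ 0 = 1) \<and> Z.Z_conditions"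
    by (rule Z.sat_Z_rels) (simp_all add: CZ KZ_def kZ_def currents_Z n0_N0)
  then show Z.Z_conditions "kZ s $ 0 * kZ (opp s) $ 0 = 1" using sat_cl[where 'g = zgen] by (auto simp: prels_zgen_def)
qed

definition \<psi> :: "ugen \<Rightarrow> zgen palg" where
  "\<psi> g = (case g of UC \<Rightarrow> cl ZC | UCinv \<Rightarrow> cl ZCinv | UL s i j m \<Rightarrow> Z.L s i j $ m)"

lemma sat_\<psi>: "sat \<psi> (prels :: (ugen falg \<times> ugen falg) set)"
proof -
  \<comment> \<open>Generators exist only for modes with \<open>mode_ok\<close>; by
    \<open>L_zero_mode\<close> the other coefficients of \<open>Z.L\<close> are 0, so the
    restriction loses nothing.\<close>
  define Lf where "Lf s i j = Abs_fps (\<lambda>m. if mode_ok s i j m then \<psi> (UL s i j m) else 0)" for s i j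
  have L: "Lf s i j = Z.L s i j" if "i \<in> {1..Suc N0}" "j \<in> {1..Suc N0}" for s i j
    by (rule fps_ext) (simp add: Lf_def \<psi>_def Z.L_zero_mode[OF KZ_zero that])
  have "Z.d_RLL (Suc N0) Lf s s' \<longleftrightarrow> Z.d_RLL (Suc N0) Z.L s s'" for s s' by (rule Z.d_RLL_cong) (rule L)
  then have d: "Z.d_RLL (Suc N0) Lf s s" "Z.d_RLL (Suc N0) Lf Plus Minus" for s
    using Z.gauss_relations Z_relations(1) unfolding Z.Z_conditions_def by blast+
  have "Lf s i i $ 0 * Lf (opp s) i i $ 0 = 1" if "i \<in> {1..Suc N0}" for s i
  proof (cases "i = Suc N0")
    case True then show ?thesis by (simp add: L Z.L_last_zero Z_relations(2))
  next
    case False then show ?thesis using that by (simp add: L Z.L_columns(1) KZ_diagonal)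
  qed
  then show ?thesis unfolding prels_ugen_def n0_N0(1)
    by (subst Z.sat_U_rels[where Lf = Lf]) (simp_all add: CZ Lf_def[abs_def, symmetric] d, simp_all add: \<psi>_def CZ Lf_def)
qed

section \<open>Mutually inverse homomorphisms\<close>

lemma Z_gens: "ZC \<in> gens" "ZCinv \<in> gens" "a \<in> {1..N0} \<Longrightarrow> ZE a p \<in> gens" "a \<in> {1..N0} \<Longrightarrow> ZF a p \<in> gens"
  "i \<in> {1..N0} \<Longrightarrow> j \<in> {1..N0} \<Longrightarrow> mode_ok s i j m \<Longrightarrow> ZK s i j m \<in> gens" "Zk s m \<in> gens"
  by (simp_all add: gens_zgen_def Z_gens_def n0_N0)
lemma U_gens: "UC \<in> gens" "UCinv \<in> gens"
  "i \<in> {1..Suc N0} \<Longrightarrow> j \<in> {1..Suc N0} \<Longrightarrow> mode_ok s i j m \<Longrightarrow> UL s i j m \<in> gens"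
  by (simp_all add: gens_ugen_def U_gens_def n0_N0)

lemmas hom_\<phi> = ahom_induced[OF sat_\<phi>] and hom_\<psi> = ahom_induced[OF sat_\<psi>]
lemmas on_gens = induced_cl[OF sat_\<phi>] induced_cl[OF sat_\<psi>]

lemma induced_C: "induced \<psi> (CU i) = CZ i" "induced \<phi> (CZ i) = CU i"
  unfolding CU_def CZ_def by (simp_all add: ahom_ipow hom_\<phi> hom_\<psi> on_gens U_gens Z_gens) (simp_all add: \<phi>_def \<psi>_def)

lemma \<psi>_LU:
  assumes "i \<in> {1..Suc N0}" "j \<in> {1..Suc N0}"
  shows "fmap (induced \<psi>) (LU s i j) = Z.L s i j"
proof (rule fps_ext)
  fix m show "fmap (induced \<psi>) (LU s i j) $ m = Z.L s i j $ m"
    using Z.L_zero_mode[OF KZ_zero assms, of s m] U_gens(3)[OF assms, of s m]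
    by (auto simp: fmap_nth LU_def on_gens \<psi>_def ahom_simps[OF hom_\<psi>])
qed

lemma \<phi>_LZ:
  assumes "i \<in> {1..Suc N0}" "j \<in> {1..Suc N0}"
  shows "fmap (induced \<phi>) (Z.L s i j) = LU s i j"
proof -
  have "fmap (induced \<phi>) (Z.L s i j) = U.L s i j"
  proof (rule gauss_composition_image[OF hom_\<phi> gauss_Z gauss_U induced_C(2) _ _ _ _ assms])
    show "fmap (induced \<phi>) (KZ s i j) = LU s i j" if "i \<in> {1..N0}" "j \<in> {1..N0}" for s i j
      by (rule fps_ext) (auto simp: fmap_nth KZ_def LU_def on_gens Z_gens(5)[OF that] ahom_simps[OF hom_\<phi>], simp add: \<phi>_def)
    show "fmap (induced \<phi>) (kZ s) = kU s" for s
      by (rule fps_ext) (simp add: fmap_nth kZ_def on_gens Z_gens, simp add: \<phi>_def)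
    show "induced \<phi> (Z.Ec a p) = U.Ec a p" "induced \<phi> (Z.Fc a p) = U.Fc a p" if "a \<in> {1..N0}" for a p
      unfolding currents_Z on_gens(1)[OF Z_gens(3)[OF that]] on_gens(1)[OF Z_gens(4)[OF that]] by (simp_all add: \<phi>_def)
  qed
  then show ?thesis unfolding L_U[OF assms] .
qed

text \<open>\<open>induced \<psi>\<close> maps the matrix \<open>U.L\<close> to \<open>Z.L\<close>,
  and uniqueness of the Gauss decomposition matches its factors with the generating series.\<close>

lemma \<psi>_\<phi>: "induced \<psi> (induced \<phi> x) = x"
proof (rule palg_hom_eqI[of "\<lambda>x. induced \<psi> (induced \<phi> x)" "\<lambda>x. x"])
  show "ahom (\<lambda>x. induced \<psi> (induced \<phi> x))" "ahom (\<lambda>x :: zgen palg. x)"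
    using hom_\<phi> hom_\<psi> by (simp_all add: ahom_def)
  have L: "fmap (induced \<psi>) (U.L s i j) = Z.L s i j" if "i \<in> {1..Suc N0}" "j \<in> {1..Suc N0}" for s i j
    unfolding L_U[OF that] by (rule \<psi>_LU[OF that])
  note D = gauss_decomposition_image[OF hom_\<psi> gauss_U gauss_Z induced_C(1), where k = kU and k' = kZ, OF L]
  fix g :: zgen assume g: "g \<in> gens"
  show "induced \<psi> (induced \<phi> (cl g)) = cl g"
    unfolding on_gens(1)[OF g]
  proof (cases g)
    case (ZE a m)
    then have "a \<in> {1..N0}" using g by (simp add: gens_zgen_def Z_gens_def n0_N0)
    then show "induced \<psi> (\<phi> g) = cl g" using D(1)[of a m] by (simp add: \<phi>_def ZE currents_Z)
  next
    case (ZF a m)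
    then have "a \<in> {1..N0}" using g by (simp add: gens_zgen_def Z_gens_def n0_N0)
    then show "induced \<psi> (\<phi> g) = cl g" using D(2)[of a m] by (simp add: \<phi>_def ZF currents_Z)
  next
    case (ZK s i j m)
    then have ij: "i \<in> {1..N0}" "j \<in> {1..N0}" and m: "mode_ok s i j m" using g by (simp_all add: gens_zgen_def Z_gens_def n0_N0)
    have "induced \<psi> (\<phi> g) = Z.L s i j $ m" using on_gens(2)[OF U_gens(3), of i j s m] ij m by (simp add: \<phi>_def ZK \<psi>_def)
    then show "induced \<psi> (\<phi> g) = cl g" using m unfolding Z.L_columns(1)[OF ij] ZK by (simp add: KZ_def)
  next
    case (Zk s m)
    then show "induced \<psi> (\<phi> g) = cl g" using arg_cong[OF D(3)[of s], of "\<lambda>A. A $ m"] by (simp add: \<phi>_def fmap_nth kZ_def)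
  qed (use on_gens(2)[OF U_gens(1)] on_gens(2)[OF U_gens(2)] in \<open>simp_all add: \<phi>_def \<psi>_def\<close>)
qed

text \<open>The generators to be compared are coefficients of \<open>L\<close> itself, so it is
  enough to compose the factors, as in \<open>\<phi>_LZ\<close>.\<close>

lemma \<phi>_\<psi>: "induced \<phi> (induced \<psi> y) = y"
proof (rule palg_hom_eqI[of "\<lambda>y. induced \<phi> (induced \<psi> y)" "\<lambda>y. y"])
  show "ahom (\<lambda>y. induced \<phi> (induced \<psi> y))" "ahom (\<lambda>y :: ugen palg. y)"
    using hom_\<phi> hom_\<psi> by (simp_all add: ahom_def)
  fix g :: ugen assume g: "g \<in> gens"
  show "induced \<phi> (induced \<psi> (cl g)) = cl g"
    unfolding on_gens(2)[OF g]
  proof (cases g)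
    case (UL s i j m)
    then have ij: "i \<in> {1..Suc N0}" "j \<in> {1..Suc N0}" and m: "mode_ok s i j m" using g by (simp_all add: gens_ugen_def U_gens_def n0_N0)
    show "induced \<phi> (\<psi> g) = cl g"
      using arg_cong[OF \<phi>_LZ[OF ij, of s], of "\<lambda>A. A $ m"] m by (simp add: UL \<psi>_def fmap_nth LU_def)
  qed (use on_gens(1)[OF Z_gens(1)] on_gens(1)[OF Z_gens(2)] in \<open>simp_all add: \<phi>_def \<psi>_def\<close>)
qed

theorem theorem2p4:
  fixes n :: nat
  assumes "n \<ge> 2"
  shows "algebra_isomorphic (ZUR n) (Uq_gl_hat n)"
proof (rule n0_counterexample[OF _ assms])
  show "algebra_isomorphic (ZUR n0) (Uq_gl_hat n0)"
    using presented_isomorphic[OF hom_\<phi> \<psi>_\<phi> \<phi>_\<psi>]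
    unfolding ZUR_def Uq_gl_hat_def gens_zgen_def prels_zgen_def gens_ugen_def prels_ugen_def .
qed

end
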